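(* Let $(X,\mathcal{S})$ be a conically stratified space and let $\mathcal{U}$ be any complete cover of $X$. Then the universal functor $\mathrm{colim}\,\mathsf{Ent}|_{\mathcal{U}}\to\mathsf{Ent}(X,\mathcal{S})$, induced by the functors $\mathsf{Ent}(U,\mathcal{S}_U)\to\mathsf{Ent}(X,\mathcal{S})$ for $U\in\mathcal{U}$, is an isomorphism in the category $\mathsf{Cat}$ of small categories.
   Context: **Stratified spaces.** An $n$-step filtration of a topological space $X$ is a nested sequence of closed subspaces $\emptyset=X^{-1}\subseteq X^0\subseteq\cdots\subseteq X^n=X$; a filtered space is a space with an $n$-step filtration for some $n$, and its formal dimension is $\sup\{n\mid X^n\setminus X^{n-1}\neq\emptyset\}$ (the empty space has formal dimension $-1$). A filtration-preserving homeomorphism of filtered spaces is a homeomorphism restricting to a homeomorphism in each degree. $\mathbb{R}^d$ is filtered with everything below degree $d$ empty. The product of an $n$-step and an $m$-step filtered space has the $(n+m)$-step filtration $(X\times Y)^k=\bigcup_{i+j=k}X^i\times Y^j$. The cone on a space $L$ is the set $C(L)=(L\times\mathbb{R}_{>0})\cup\{\star\}$, where $U\subseteq C(L)$ is open iff $U\cap(L\times\mathbb{R}_{>0})$ is open and, if $\star\in U$, there is $\epsilon>0$ with $L\times(0,\epsilon)\subseteq U$ (so $C(\emptyset)=\{\star\}$). If $L$ is filtered, $C(L)$ is filtered by $C(L)^0=\{\star\}$, $C(L)^{i+1}=(L^i\times\mathbb{R}_{>0})\cup\{\star\}$. An $n$-dimensional conically stratified space is a Hausdorff space $X$ with an $n$-step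 filtration such that for every $d\ge 0$ and every $x\in X^d-X^{d-1}$ there are an open set $U_x\ni x$, a filtered space $L_x$ of formal dimension $n-d-1$, and a filtration-preserving homeomorphism $h_x:\mathbb{R}^d\times C(L_x)\to U_x$ (with $U_x$ filtered by $U_x\cap X^i$) taking $(0,\star)$ to $x$. Any such open set $U_x$ is called a basic open about $x$. A $d$-dimensional stratum is a connected component of $X^d-X^{d-1}$; $\mathcal{S}$ denotes the set of strata. A stratum-preserving map $(Y,\mathcal{T})\to(X,\mathcal{S})$ is a continuous map sending each $T\in\mathcal{T}$ into some $S\in\mathcal{S}$. An open subset $U\subseteq X$ is itself conically stratified by restricting the filtration, written $(U,\mathcal{S}_U)$; the inclusion $(U,\mathcal{S}_U)\to(X,\mathcal{S})$ is stratum-preserving. **Entrance path category.** Stratify $\mathbb{I}=[0,1]$ by a finite set of $0$-strata containing $0$ and $1$, the $1$-strata being the open intervals in between; write $(\mathbb{I},\{0,\dots,1\})$, listing the $0$-strata. An entrance path is such a stratification $(\mathbb{I},\mathcal{T})$ together with a stratum-preserving map $\alpha:(\mathbb{I},\mathcal{T})\to(X,\mathcal{S})$ such that the dimension of the stratum containing $\alpha(t)$ is non-increasing in $t$. If $\beta(0)=\alpha(1)$, the concatenation $\beta*\alpha$ is $\alpha(2t)$ for $0\le t\le 1/2$ and $\beta(2t-1)$ for $1/2\le t\le 1$, with the concatenated stratification. A reparametrization of $\alpha:(\mathbb{I},\mathcal{T})\to(X,\mathcal{S})$ is $\alpha\circ\phi$ with $\phi:(\mathbb{I},\mathcal{T}')\to(\mathbb{I},\mathcal{T})$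 an isomorphism (stratum-preserving with stratum-preserving inverse), $\phi(0)=0,\phi(1)=1$. Let $\Delta=[v_0v_1v_2]$ be the $2$-simplex stratified by its vertices, edges and face. An elementary homotopy $\alpha\Rightarrow\beta$ from $\alpha:(\mathbb{I},\{0,1/2,1\})\to(X,\mathcal{S})$ to $\beta:(\mathbb{I},\{0,1\})\to(X,\mathcal{S})$ is a stratum-preserving map $h:\Delta\to(X,\mathcal{S})$ together with stratum-preserving parametrizations $\tilde\alpha$ of $[v_0,v_1]\cup[v_1,v_2]$ (with $0,1/2,1\mapsto v_0,v_1,v_2$) and $\tilde\beta$ of $[v_0,v_2]$ (with $0,1\mapsto v_0,v_2$) by $\mathbb{I}$, such that $h\circ\tilde\alpha=\alpha$, $h\circ\tilde\beta=\beta$; $h$ maps $[v_0,v_1,v_2]\setminus[v_1,v_2]$ into a single stratum; and the image of $h$ lies in some basic open about $h(v_2)=\alpha(1)=\beta(1)$. Two entrance paths $\alpha,\beta$ are elementarily related if some reparametrizations of them decompose as concatenations $\alpha_3*\alpha_2*\alpha_1$ and $\beta_3*\beta_2*\beta_1$ (outer pieces possibly absent) with $\alpha_1=\beta_1$, $\alpha_3=\beta_3$, and $\alpha_2\Rightarrow\beta_2$ or $\beta_2\Rightarrow\alpha_2$. Two entrance paths are equivalent if they are connected by a finite chain of elementary relations. $\mathsf{Ent}(X,\mathcal{S})$ is the category whose objects are the points of $X$ and whose morphisms $x\to y$ are equivalence classes of entrance paths from $x$ to $y$, composed by concatenation (identities are classes of constant paths). A stratum-preserving map $f$ induces a functor between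 entrance path categories by composition with $f$, so $\mathsf{Ent}$ is a functor from conically stratified spaces and stratum-preserving maps to $\mathsf{Cat}$. **Covers.** A complete cover of an open set $U$ is a collection $\mathcal{U}$ of open sets with union $U$ such that for all $U_i,U_j\in\mathcal{U}$ some subcollection of $\mathcal{U}$ covers $U_i\cap U_j$ (has union $U_i\cap U_j$). A cover is regarded as a poset under inclusion, and $\mathsf{Ent}|_{\mathcal{U}}:\mathcal{U}\to\mathsf{Cat}$ is the diagram $U\mapsto\mathsf{Ent}(U,\mathcal{S}_U)$ with functors induced by inclusions.
   Formalization: In the elementary relation, a path may be cut at any points, which are added to its 0-strata; read literally, a loop winding once around a one-stratum circle with 0-strata {0,1} is equivalent only to itself, so constant paths are not identities and Ent is not a category. *)

theory Defs
  imports "HOL-Analysis.Analysis"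
begin

section \<open>Small categories and colimits of poset-indexed diagrams\<close>

record ('o, 'm) category =
  Ob :: "'o set"
  Ar :: "'m set"
  Dom :: "'m \<Rightarrow> 'o"
  Cod :: "'m \<Rightarrow> 'o"
  Ident :: "'o \<Rightarrow> 'm"
  Comp :: "'m \<Rightarrow> 'm \<Rightarrow> 'm"

text \<open>\<open>Comp C g f\<close> is the composite \<open>g \<circ> f\<close>, meaningful when \<open>Cod C f = Dom C g\<close>.\<close>

definition is_category :: "('o, 'm) category \<Rightarrow> bool" where
  "is_category C \<longleftrightarrow>
     (\<forall>f\<in>Ar C. Dom C f \<in> Ob C \<and> Cod C f \<in> Ob C) \<and>
     (\<forall>x\<in>Ob C. Ident C x \<in> Ar C \<and> Dom C (Ident C x) = x \<and> Cod C (Ident C x) = x) \<and>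
     (\<forall>f\<in>Ar C. \<forall>g\<in>Ar C. Cod C f = Dom C g \<longrightarrow>
        Comp C g f \<in> Ar C \<and> Dom C (Comp C g f) = Dom C f \<and> Cod C (Comp C g f) = Cod C g) \<and>
     (\<forall>f\<in>Ar C. Comp C f (Ident C (Dom C f)) = f \<and> Comp C (Ident C (Cod C f)) f = f) \<and>
     (\<forall>f\<in>Ar C. \<forall>g\<in>Ar C. \<forall>h\<in>Ar C. Cod C f = Dom C g \<longrightarrow> Cod C g = Dom C h \<longrightarrow>
        Comp C h (Comp C g f) = Comp C (Comp C h g) f)"

text \<open>A functor is a pair of its object part and its arrow part; only the values on
  \<open>Ob\<close> and \<open>Ar\<close> of the source matter, so functors are compared by \<open>functor_eq\<close>.\<close>

type_synonym ('o, 'm, 'p, 'n) fctr = "('o \<Rightarrow> 'p) \<times> ('m \<Rightarrow> 'n)"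

definition is_functor ::
    "('o, 'm) category \<Rightarrow> ('p, 'n) category \<Rightarrow> ('o, 'm, 'p, 'n) fctr \<Rightarrow> bool" where
  "is_functor C D F \<longleftrightarrow> is_category C \<and> is_category D \<and>
     (\<forall>x\<in>Ob C. fst F x \<in> Ob D) \<and>
     (\<forall>f\<in>Ar C. snd F f \<in> Ar D \<and> Dom D (snd F f) = fst F (Dom C f) \<and>
                Cod D (snd F f) = fst F (Cod C f)) \<and>
     (\<forall>x\<in>Ob C. snd F (Ident C x) = Ident D (fst F x)) \<and>
     (\<forall>f\<in>Ar C. \<forall>g\<in>Ar C. Cod C f = Dom C g \<longrightarrow>
        snd F (Comp C g f) = Comp D (snd F g) (snd F f))"

definition functor_eq ::
    "('o, 'm) category \<Rightarrow> ('o, 'm, 'p, 'n) fctr \<Rightarrow> ('o, 'm, 'p, 'n) fctr \<Rightarrow> bool" where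
  "functor_eq C F G \<longleftrightarrow> (\<forall>x\<in>Ob C. fst F x = fst G x) \<and> (\<forall>f\<in>Ar C. snd F f = snd G f)"

definition functor_comp ::
    "('p, 'n, 'q, 'k) fctr \<Rightarrow> ('o, 'm, 'p, 'n) fctr \<Rightarrow> ('o, 'm, 'q, 'k) fctr" where
  "functor_comp G F = (fst G \<circ> fst F, snd G \<circ> snd F)"

definition functor_id :: "('o, 'm, 'o, 'm) fctr" where
  "functor_id = (id, id)"

definition is_Cat_isomorphism ::
    "('o, 'm) category \<Rightarrow> ('p, 'n) category \<Rightarrow> ('o, 'm, 'p, 'n) fctr \<Rightarrow> bool" where
  "is_Cat_isomorphism C D F \<longleftrightarrow> is_functor C D F \<and>
     (\<exists>G. is_functor D C G \<and> functor_eq C (functor_comp G F) functor_id \<and>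
          functor_eq D (functor_comp F G) functor_id)"

record ('i, 'o, 'm) diagram =
  Idx :: "'i set"
  Leq :: "'i \<Rightarrow> 'i \<Rightarrow> bool"
  DCat :: "'i \<Rightarrow> ('o, 'm) category"
  DMap :: "'i \<Rightarrow> 'i \<Rightarrow> ('o, 'm, 'o, 'm) fctr"

definition is_diagram :: "('i, 'o, 'm) diagram \<Rightarrow> bool" where
  "is_diagram K \<longleftrightarrow>
     (\<forall>i\<in>Idx K. is_category (DCat K i) \<and> Leq K i i) \<and>
     (\<forall>i\<in>Idx K. \<forall>j\<in>Idx K. \<forall>k\<in>Idx K. Leq K i j \<longrightarrow> Leq K j k \<longrightarrow> Leq K i k) \<and>
     (\<forall>i\<in>Idx K. \<forall>j\<in>Idx K. Leq K i j \<longrightarrow> is_functor (DCat K i) (DCat K j) (DMap K i j)) \<and>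
     (\<forall>i\<in>Idx K. functor_eq (DCat K i) (DMap K i i) functor_id) \<and>
     (\<forall>i\<in>Idx K. \<forall>j\<in>Idx K. \<forall>k\<in>Idx K. Leq K i j \<longrightarrow> Leq K j k \<longrightarrow>
        functor_eq (DCat K i) (functor_comp (DMap K j k) (DMap K i j)) (DMap K i k))"

definition is_cocone ::
    "('i, 'o, 'm) diagram \<Rightarrow> ('p, 'n) category \<Rightarrow> ('i \<Rightarrow> ('o, 'm, 'p, 'n) fctr) \<Rightarrow> bool" where
  "is_cocone K C G \<longleftrightarrow> is_category C \<and>
     (\<forall>i\<in>Idx K. is_functor (DCat K i) C (G i)) \<and>
     (\<forall>i\<in>Idx K. \<forall>j\<in>Idx K. Leq K i j \<longrightarrow>
        functor_eq (DCat K i) (functor_comp (G j) (DMap K i j)) (G i))"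

text \<open>The colimit in \<open>Cat\<close>. Its objects are those of the colimit of the sets of objects. Its arrows
  are chains of arrows of the categories in the diagram that become composable after gluing objects,
  modulo the congruence generated by the transition functors, identities and compositions. A chain is
  a pair of its starting object and the list of its arrows, the first arrow to be applied standing
  first; the starting object is needed for the empty chain. The universal property is
  \<open>colim_cocone\<close> and \<open>colim_universal\<close> below.\<close>

definition glue_step :: "('i, 'o, 'm) diagram \<Rightarrow> 'i \<times> 'o \<Rightarrow> 'i \<times> 'o \<Rightarrow> bool" where
  "glue_step K p q \<longleftrightarrow> fst p \<in> Idx K \<and> fst q \<in> Idx K \<and> Leq K (fst p) (fst q) \<and>
     snd p \<in> Ob (DCat K (fst p)) \<and> snd q = fst (DMap K (fst p) (fst q)) (snd p)"

definition colim_ob :: "('i, 'o, 'm) diagram \<Rightarrow> 'i \<times> 'o \<Rightarrow> ('i \<times> 'o) set" where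
  "colim_ob K p = {q. equivclp (glue_step K) p q}"

fun is_chain :: "('i, 'o, 'm) diagram \<Rightarrow> ('i \<times> 'o) set \<Rightarrow> ('i \<times> 'm) list \<Rightarrow> bool" where
  "is_chain K a [] \<longleftrightarrow> a \<in> colim_ob K ` (SIGMA i:Idx K. Ob (DCat K i))"
| "is_chain K a ((i, m) # l) \<longleftrightarrow> i \<in> Idx K \<and> m \<in> Ar (DCat K i) \<and>
     a = colim_ob K (i, Dom (DCat K i) m) \<and> is_chain K (colim_ob K (i, Cod (DCat K i) m)) l"

fun chain_end :: "('i, 'o, 'm) diagram \<Rightarrow> ('i \<times> 'o) set \<Rightarrow> ('i \<times> 'm) list \<Rightarrow> ('i \<times> 'o) set" where
  "chain_end K a [] = a"
| "chain_end K a ((i, m) # l) = chain_end K (colim_ob K (i, Cod (DCat K i) m)) l"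

inductive chain_step :: "('i, 'o, 'm) diagram \<Rightarrow> ('i \<times> 'm) list \<Rightarrow> ('i \<times> 'm) list \<Rightarrow> bool"
  for K where
  transition: "i \<in> Idx K \<Longrightarrow> j \<in> Idx K \<Longrightarrow> Leq K i j \<Longrightarrow> m \<in> Ar (DCat K i) \<Longrightarrow>
     chain_step K (u @ (i, m) # v) (u @ (j, snd (DMap K i j) m) # v)"
| identity: "i \<in> Idx K \<Longrightarrow> x \<in> Ob (DCat K i) \<Longrightarrow>
     chain_step K (u @ (i, Ident (DCat K i) x) # v) (u @ v)"
| composition: "i \<in> Idx K \<Longrightarrow> f \<in> Ar (DCat K i) \<Longrightarrow> g \<in> Ar (DCat K i) \<Longrightarrow>
     Cod (DCat K i) f = Dom (DCat K i) g \<Longrightarrow>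
     chain_step K (u @ (i, f) # (i, g) # v) (u @ (i, Comp (DCat K i) g f) # v)"

definition chain_rel :: "('i, 'o, 'm) diagram \<Rightarrow> ('i \<times> 'o) set \<times> ('i \<times> 'm) list \<Rightarrow>
    ('i \<times> 'o) set \<times> ('i \<times> 'm) list \<Rightarrow> bool" where
  "chain_rel K = equivclp (\<lambda>p q. fst p = fst q \<and> is_chain K (fst p) (snd p) \<and>
     is_chain K (fst q) (snd q) \<and> chain_step K (snd p) (snd q))"

definition colim_ar :: "('i, 'o, 'm) diagram \<Rightarrow> ('i \<times> 'o) set \<times> ('i \<times> 'm) list \<Rightarrow>
    (('i \<times> 'o) set \<times> ('i \<times> 'm) list) set" where
  "colim_ar K p = {q. chain_rel K p q}"

definition colim :: "('i, 'o, 'm) diagram \<Rightarrow>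
    (('i \<times> 'o) set, (('i \<times> 'o) set \<times> ('i \<times> 'm) list) set) category" where
  "colim K = \<lparr>
     Ob = colim_ob K ` (SIGMA i:Idx K. Ob (DCat K i)),
     Ar = colim_ar K ` {p. is_chain K (fst p) (snd p)},
     Dom = (\<lambda>c. the_elem (fst ` c)),
     Cod = (\<lambda>c. the_elem ((\<lambda>p. chain_end K (fst p) (snd p)) ` c)),
     Ident = (\<lambda>a. colim_ar K (a, [])),
     Comp = (\<lambda>d c. \<Union>p\<in>c. \<Union>q\<in>d. colim_ar K (fst p, snd p @ snd q))\<rparr>"

definition colim_in :: "('i, 'o, 'm) diagram \<Rightarrow> 'i \<Rightarrow>
    ('o, 'm, ('i \<times> 'o) set, (('i \<times> 'o) set \<times> ('i \<times> 'm) list) set) fctr" where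
  "colim_in K i = (\<lambda>x. colim_ob K (i, x),
                   \<lambda>m. colim_ar K (colim_ob K (i, Dom (DCat K i) m), [(i, m)]))"

text \<open>The functor from the colimit induced by a cocone.\<close>

definition desc_ob :: "('i \<Rightarrow> ('o, 'm, 'p, 'n) fctr) \<Rightarrow> ('i \<times> 'o) set \<Rightarrow> 'p" where
  "desc_ob G a = the_elem ((\<lambda>(i, x). fst (G i) x) ` a)"

definition desc_chain :: "('p, 'n) category \<Rightarrow> ('i \<Rightarrow> ('o, 'm, 'p, 'n) fctr) \<Rightarrow>
    ('i \<times> 'o) set \<times> ('i \<times> 'm) list \<Rightarrow> 'n" where
  "desc_chain C G p =
     foldl (\<lambda>f (i, m). Comp C (snd (G i) m) f) (Ident C (desc_ob G (fst p))) (snd p)"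

definition colim_desc :: "('p, 'n) category \<Rightarrow> ('i \<Rightarrow> ('o, 'm, 'p, 'n) fctr) \<Rightarrow>
    (('i \<times> 'o) set, (('i \<times> 'o) set \<times> ('i \<times> 'm) list) set, 'p, 'n) fctr" where
  "colim_desc C G = (desc_ob G, \<lambda>c. the_elem (desc_chain C G ` c))"

lemma equivclp_invariant:
  assumes "equivclp r p q" "\<And>x y. r x y \<Longrightarrow> f x = f y"
  shows "f p = f q"
  using assms(1) by (induction rule: equivclp_induct) (use assms(2) in metis)+

lemma colim_ob_eq_iff: "colim_ob K p = colim_ob K q \<longleftrightarrow> equivclp (glue_step K) p q"
  unfolding colim_ob_def by (auto intro: equivclp_sym equivclp_trans)

lemma colim_ar_eq_iff: "colim_ar K p = colim_ar K q \<longleftrightarrow> chain_rel K p q"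
  unfolding colim_ar_def chain_rel_def by (auto intro: equivclp_sym equivclp_trans)

lemma colim_ar_self: "p \<in> colim_ar K p"
  by (simp add: colim_ar_def chain_rel_def)

lemma the_elem_image_const: "a \<in> A \<Longrightarrow> (\<And>x. x \<in> A \<Longrightarrow> f x = f a) \<Longrightarrow> the_elem (f ` A) = f a"
  by (metis the_elem_image_unique empty_iff)

lemma chain_step_append:
  assumes "chain_step K l l'"
  shows "chain_step K (u @ l @ v) (u @ l' @ v)"
  using assms
proof cases
  case (transition i j m u' v')
  then show ?thesis using chain_step.transition[of i K j m "u @ u'" "v' @ v"] by simp
next
  case (identity i x u' v')
  then show ?thesis using chain_step.identity[of i K x "u @ u'" "v' @ v"] by simp
next
  case (composition i f g u' v')
  then show ?thesis using chain_step.composition[of i K f g "u @ u'" "v' @ v"] by simp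
qed

lemma chain_end_append: "chain_end K a (u @ v) = chain_end K (chain_end K a u) v"
proof (induction u arbitrary: a)
  case (Cons p u)
  then show ?case by (cases p) simp
qed simp

context
  fixes K :: "('i, 'o, 'm) diagram"
  assumes K: "is_diagram K"
begin

lemma DCat_category: "i \<in> Idx K \<Longrightarrow> is_category (DCat K i)"
  using K unfolding is_diagram_def by blast

lemma DMap_functor: "i \<in> Idx K \<Longrightarrow> j \<in> Idx K \<Longrightarrow> Leq K i j \<Longrightarrow>
    is_functor (DCat K i) (DCat K j) (DMap K i j)"
  using K unfolding is_diagram_def by blast

lemma colim_ob_in: "i \<in> Idx K \<Longrightarrow> x \<in> Ob (DCat K i) \<Longrightarrow> colim_ob K (i, x) \<in> Ob (colim K)"
  unfolding colim_def by auto

lemma colim_ob_DMap: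
  assumes "i \<in> Idx K" "j \<in> Idx K" "Leq K i j" "x \<in> Ob (DCat K i)"
  shows "colim_ob K (j, fst (DMap K i j) x) = colim_ob K (i, x)"
proof -
  have "glue_step K (i, x) (j, fst (DMap K i j) x)" using assms by (simp add: glue_step_def)
  then show ?thesis unfolding colim_ob_eq_iff by (meson equivclp_sym r_into_equivclp)
qed

lemma is_chain_Nil: "is_chain K a [] \<longleftrightarrow> a \<in> Ob (colim K)"
  by (simp add: colim_def)

lemma is_chain_start: "is_chain K a l \<Longrightarrow> a \<in> Ob (colim K)"
proof (cases l)
  case (Cons p k)
  assume "is_chain K a l"
  then show ?thesis using Cons colim_ob_in DCat_category
    by (cases p) (auto simp: is_category_def)
qed (use is_chain_Nil in blast)

lemma chain_end_in: "is_chain K a l \<Longrightarrow> chain_end K a l \<in> Ob (colim K)"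
proof (induction l arbitrary: a)
  case Nil
  then show ?case using is_chain_Nil by simp
next
  case (Cons p l)
  then show ?case by (cases p) simp
qed

lemma is_chain_append:
  "is_chain K a (u @ v) \<longleftrightarrow> is_chain K a u \<and> is_chain K (chain_end K a u) v"
proof (induction u arbitrary: a)
  case Nil
  show ?case using is_chain_start is_chain_Nil by (metis append_Nil chain_end.simps(1))
next
  case (Cons p u)
  then show ?case by (cases p) auto
qed

lemma chain_step_chain:
  assumes "chain_step K l l'" "is_chain K a l"
  shows "is_chain K a l' \<and> chain_end K a l' = chain_end K a l"
  using assms(1)
proof cases
  case (transition i j m u v)
  have F: "is_functor (DCat K i) (DCat K j) (DMap K i j)" using DMap_functor transition by blast
  have m: "Dom (DCat K i) m \<in> Ob (DCat K i)" "Cod (DCat K i) m \<in> Ob (DCat K i)"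
    using DCat_category transition by (auto simp: is_category_def)
  have "snd (DMap K i j) m \<in> Ar (DCat K j)"
    "Dom (DCat K j) (snd (DMap K i j) m) = fst (DMap K i j) (Dom (DCat K i) m)"
    "Cod (DCat K j) (snd (DMap K i j) m) = fst (DMap K i j) (Cod (DCat K i) m)"
    using F transition by (auto simp: is_functor_def)
  then show ?thesis using assms(2) transition m colim_ob_DMap
    by (simp add: is_chain_append chain_end_append del: is_chain.simps(1))
next
  case (identity i x u v)
  have "Dom (DCat K i) (Ident (DCat K i) x) = x" "Cod (DCat K i) (Ident (DCat K i) x) = x"
    using DCat_category identity by (auto simp: is_category_def)
  then show ?thesis using assms(2) identity
    by (simp add: is_chain_append chain_end_append del: is_chain.simps(1))
next
  case (composition i f g u v)
  have "Comp (DCat K i) g f \<in> Ar (DCat K i)"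
    "Dom (DCat K i) (Comp (DCat K i) g f) = Dom (DCat K i) f"
    "Cod (DCat K i) (Comp (DCat K i) g f) = Cod (DCat K i) g"
    using DCat_category composition unfolding is_category_def by blast+
  then show ?thesis using assms(2) composition
    by (simp add: is_chain_append chain_end_append del: is_chain.simps(1))
qed

lemma chain_rel_step:
  "chain_step K l l' \<Longrightarrow> is_chain K a l \<Longrightarrow> colim_ar K (a, l) = colim_ar K (a, l')"
  unfolding colim_ar_eq_iff chain_rel_def
  by (rule r_into_equivclp) (simp add: chain_step_chain)

lemma chain_rel_fst: "chain_rel K p q \<Longrightarrow> fst q = fst p"
  unfolding chain_rel_def by (erule equivclp_invariant[symmetric]) simp

lemma chain_rel_end: "chain_rel K p q \<Longrightarrow> chain_end K (fst q) (snd q) = chain_end K (fst p) (snd p)"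
  unfolding chain_rel_def
  by (erule equivclp_invariant[symmetric, where f = "\<lambda>p. chain_end K (fst p) (snd p)"])
     (metis chain_step_chain)

lemma chain_rel_chain: "chain_rel K p q \<Longrightarrow> is_chain K (fst q) (snd q) \<longleftrightarrow> is_chain K (fst p) (snd p)"
  unfolding chain_rel_def
  by (erule equivclp_invariant[symmetric, where f = "\<lambda>p. is_chain K (fst p) (snd p)"]) metis

lemma chain_rel_append:
  assumes "chain_rel K p q" "is_chain K a u" "chain_end K a u = fst p"
    "is_chain K (fst p) (snd p)" "is_chain K (chain_end K (fst p) (snd p)) v"
  shows "chain_rel K (a, u @ snd p @ v) (a, u @ snd q @ v)"
  using assms(1) unfolding chain_rel_def
proof (induction rule: equivclp_induct)
  case base
  show ?case by simp
next
  case (step y z)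
  let ?r = "\<lambda>p q. fst p = fst q \<and> is_chain K (fst p) (snd p) \<and>
     is_chain K (fst q) (snd q) \<and> chain_step K (snd p) (snd q)"
  have "chain_rel K p y" using step(1) unfolding chain_rel_def .
  moreover have "chain_rel K p z" using step(1,2) unfolding chain_rel_def
    by (rule equivclp_into_equivclp)
  ultimately have y: "fst y = fst p" "chain_end K (fst p) (snd y) = chain_end K (fst p) (snd p)"
      "is_chain K (fst p) (snd y)"
    and z: "fst z = fst p" "chain_end K (fst p) (snd z) = chain_end K (fst p) (snd p)"
      "is_chain K (fst p) (snd z)"
    using chain_rel_fst chain_rel_end chain_rel_chain assms(4) by metis+
  have "is_chain K a (u @ snd y @ v)" "is_chain K a (u @ snd z @ v)"
    using y z assms by (simp_all add: is_chain_append del: is_chain.simps)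
  then have "?r (a, u @ snd y @ v) (a, u @ snd z @ v) \<or> ?r (a, u @ snd z @ v) (a, u @ snd y @ v)"
    using step(2) by (auto intro: chain_step_append)
  then have "equivclp ?r (a, u @ snd y @ v) (a, u @ snd z @ v)"
    by (blast intro: r_into_equivclp equivclp_sym)
  with step(3) show ?case by (rule equivclp_trans)
qed

lemma Ar_colimE:
  assumes "c \<in> Ar (colim K)"
  obtains a l where "is_chain K a l" "c = colim_ar K (a, l)"
  using assms unfolding colim_def by auto

lemma colim_ar_in: "is_chain K a l \<Longrightarrow> colim_ar K (a, l) \<in> Ar (colim K)"
  unfolding colim_def by auto

lemma Dom_colim: "Dom (colim K) (colim_ar K (a, l)) = a"
proof -
  have "the_elem (fst ` colim_ar K (a, l)) = fst (a, l)"
    by (rule the_elem_image_const[OF colim_ar_self]) (simp add: colim_ar_def chain_rel_fst)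
  then show ?thesis by (simp add: colim_def)
qed

lemma Cod_colim: "Cod (colim K) (colim_ar K (a, l)) = chain_end K a l"
proof -
  have "the_elem ((\<lambda>p. chain_end K (fst p) (snd p)) ` colim_ar K (a, l)) =
      (\<lambda>p. chain_end K (fst p) (snd p)) (a, l)"
    by (rule the_elem_image_const[OF colim_ar_self])
       (use chain_rel_end in \<open>fastforce simp: colim_ar_def\<close>)
  then show ?thesis by (simp add: colim_def)
qed

lemma Ident_colim: "Ident (colim K) a = colim_ar K (a, [])"
  by (simp add: colim_def)

lemma Comp_colim:
  assumes "is_chain K a l" "is_chain K (chain_end K a l) k"
  shows "Comp (colim K) (colim_ar K (chain_end K a l, k)) (colim_ar K (a, l)) = colim_ar K (a, l @ k)"
proof -
  let ?b = "chain_end K a l"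
  have "colim_ar K (fst p, snd p @ snd q) = colim_ar K (a, l @ k)"
    if p: "p \<in> colim_ar K (a, l)" and q: "q \<in> colim_ar K (?b, k)" for p q
  proof -
    have p': "chain_rel K (a, l) p" and q': "chain_rel K (?b, k) q"
      using p q by (auto simp: colim_ar_def)
    have fp: "fst p = a" "chain_end K a (snd p) = ?b" "is_chain K a (snd p)"
      using chain_rel_fst[OF p'] chain_rel_end[OF p'] chain_rel_chain[OF p'] assms by auto
    have "chain_rel K (a, l @ k) (a, snd p @ k)"
      using chain_rel_append[OF p', of a "[]" k] assms is_chain_start
      by (simp add: is_chain_Nil del: is_chain.simps)
    moreover have "chain_rel K (a, snd p @ k) (a, snd p @ snd q)"
      using chain_rel_append[OF q', of a "snd p" "[]"] fp assms chain_end_in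
      by (simp add: is_chain_Nil del: is_chain.simps)
    ultimately have "colim_ar K (a, l @ k) = colim_ar K (a, snd p @ snd q)"
      unfolding colim_ar_eq_iff[symmetric] by simp
    then show ?thesis using fp by simp
  qed
  then have "(\<Union>p\<in>colim_ar K (a, l). \<Union>q\<in>colim_ar K (?b, k). colim_ar K (fst p, snd p @ snd q)) =
      colim_ar K (a, l @ k)"
    using colim_ar_self[of "(a, l)" K] colim_ar_self[of "(?b, k)" K] by blast
  then show ?thesis by (simp add: colim_def)
qed

lemma composable_colimE:
  assumes "f \<in> Ar (colim K)" "g \<in> Ar (colim K)" "Cod (colim K) f = Dom (colim K) g"
  obtains a l k where "is_chain K a l" "f = colim_ar K (a, l)"
    "is_chain K (chain_end K a l) k" "g = colim_ar K (chain_end K a l, k)"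
proof -
  obtain a l where f: "is_chain K a l" "f = colim_ar K (a, l)" using assms(1) by (rule Ar_colimE)
  obtain b k where g: "is_chain K b k" "g = colim_ar K (b, k)" using assms(2) by (rule Ar_colimE)
  have "b = chain_end K a l" using assms(3) f g by (simp add: Dom_colim Cod_colim)
  then show ?thesis using that f g by blast
qed

lemma colim_category: "is_category (colim K)"
  unfolding is_category_def
proof (intro conjI ballI impI)
  fix f assume "f \<in> Ar (colim K)"
  then obtain a l where f: "is_chain K a l" "f = colim_ar K (a, l)" by (rule Ar_colimE)
  show "Dom (colim K) f \<in> Ob (colim K)" "Cod (colim K) f \<in> Ob (colim K)"
    using f is_chain_start chain_end_in by (auto simp: Dom_colim Cod_colim)
  show "Comp (colim K) f (Ident (colim K) (Dom (colim K) f)) = f"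
    using f Comp_colim[of a "[]" l] is_chain_start
    by (simp add: Dom_colim Ident_colim is_chain_Nil del: is_chain.simps)
  show "Comp (colim K) (Ident (colim K) (Cod (colim K) f)) f = f"
    using f Comp_colim[of a l "[]"] chain_end_in
    by (simp add: Cod_colim Ident_colim is_chain_Nil del: is_chain.simps)
next
  fix x assume "x \<in> Ob (colim K)"
  then show "Ident (colim K) x \<in> Ar (colim K)" "Dom (colim K) (Ident (colim K) x) = x"
    "Cod (colim K) (Ident (colim K) x) = x"
    by (simp_all add: Ident_colim Dom_colim Cod_colim colim_ar_in is_chain_Nil del: is_chain.simps)
next
  fix f g assume "f \<in> Ar (colim K)" "g \<in> Ar (colim K)" "Cod (colim K) f = Dom (colim K) g"
  then obtain a l k where *: "is_chain K a l" "f = colim_ar K (a, l)"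
    "is_chain K (chain_end K a l) k" "g = colim_ar K (chain_end K a l, k)"
    by (rule composable_colimE)
  then show "Comp (colim K) g f \<in> Ar (colim K)"
    "Dom (colim K) (Comp (colim K) g f) = Dom (colim K) f"
    "Cod (colim K) (Comp (colim K) g f) = Cod (colim K) g"
    by (simp_all add: Comp_colim Dom_colim Cod_colim chain_end_append colim_ar_in is_chain_append)
next
  fix f g h assume "f \<in> Ar (colim K)" "g \<in> Ar (colim K)" "h \<in> Ar (colim K)"
    "Cod (colim K) f = Dom (colim K) g" "Cod (colim K) g = Dom (colim K) h"
  note fgh = this
  obtain a l k where fg: "is_chain K a l" "f = colim_ar K (a, l)"
    "is_chain K (chain_end K a l) k" "g = colim_ar K (chain_end K a l, k)"
    using fgh(1,2,4) by (rule composable_colimE)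
  obtain b j where h: "is_chain K b j" "h = colim_ar K (b, j)" using fgh(3) by (rule Ar_colimE)
  have "b = chain_end K (chain_end K a l) k" using fgh(5) fg h by (simp add: Dom_colim Cod_colim)
  then have *: "is_chain K a l" "f = colim_ar K (a, l)"
    "is_chain K (chain_end K a l) k" "g = colim_ar K (chain_end K a l, k)"
    "is_chain K (chain_end K (chain_end K a l) k) j"
    "h = colim_ar K (chain_end K (chain_end K a l) k, j)"
    using fg h by simp_all
  have "Comp (colim K) h (Comp (colim K) g f) = colim_ar K (a, l @ k @ j)"
    using * Comp_colim[of a "l @ k" j] by (simp add: Comp_colim chain_end_append is_chain_append)
  moreover have "Comp (colim K) (Comp (colim K) h g) f = colim_ar K (a, l @ k @ j)"
    using * Comp_colim[of a l "k @ j"] by (simp add: Comp_colim chain_end_append is_chain_append)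
  ultimately show "Comp (colim K) h (Comp (colim K) g f) = Comp (colim K) (Comp (colim K) h g) f"
    by simp
qed

lemma is_chain_single:
  "i \<in> Idx K \<Longrightarrow> m \<in> Ar (DCat K i) \<Longrightarrow> is_chain K (colim_ob K (i, Dom (DCat K i) m)) [(i, m)]"
  using DCat_category[of i] colim_ob_in[of i "Cod (DCat K i) m"]
  by (simp add: is_chain_Nil is_category_def del: is_chain.simps(1))

lemma colim_in_functor:
  assumes i: "i \<in> Idx K"
  shows "is_functor (DCat K i) (colim K) (colim_in K i)"
  unfolding is_functor_def
proof (intro conjI ballI impI)
  let ?C = "DCat K i"
  have C: "is_category ?C" using DCat_category i .
  show "is_category ?C" by fact
  show "is_category (colim K)" by (rule colim_category)
  fix x assume x: "x \<in> Ob ?C"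
  then show "fst (colim_in K i) x \<in> Ob (colim K)" using colim_ob_in i by (simp add: colim_in_def)
  have I: "Dom ?C (Ident ?C x) = x" "Ident ?C x \<in> Ar ?C"
    using C x by (auto simp: is_category_def)
  have "chain_step K [(i, Ident ?C x)] []"
    using chain_step.identity[OF i x, of "[]" "[]"] by simp
  then show "snd (colim_in K i) (Ident ?C x) = Ident (colim K) (fst (colim_in K i) x)"
    using chain_rel_step is_chain_single[OF i I(2)] I by (simp add: colim_in_def Ident_colim)
next
  let ?C = "DCat K i"
  fix f assume f: "f \<in> Ar ?C"
  show "snd (colim_in K i) f \<in> Ar (colim K)"
    using is_chain_single i f by (simp add: colim_in_def colim_ar_in)
  show "Dom (colim K) (snd (colim_in K i) f) = fst (colim_in K i) (Dom ?C f)"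
    "Cod (colim K) (snd (colim_in K i) f) = fst (colim_in K i) (Cod ?C f)"
    by (simp_all add: colim_in_def Dom_colim Cod_colim)
  fix g assume g: "g \<in> Ar ?C" and fg: "Cod ?C f = Dom ?C g"
  let ?a = "colim_ob K (i, Dom ?C f)"
  have e: "chain_end K ?a [(i, f)] = colim_ob K (i, Dom ?C g)" by (simp add: fg)
  have c: "is_chain K ?a ([(i, f)] @ [(i, g)])"
    using is_chain_single i f g e unfolding is_chain_append by presburger
  have "chain_step K ([(i, f)] @ [(i, g)]) [(i, Comp ?C g f)]"
    using chain_step.composition[OF i f g fg, of "[]" "[]"] by simp
  then have "colim_ar K (?a, [(i, Comp ?C g f)]) = colim_ar K (?a, [(i, f)] @ [(i, g)])"
    using chain_rel_step c by metis
  also have "\<dots> = Comp (colim K) (colim_ar K (colim_ob K (i, Dom ?C g), [(i, g)])) (colim_ar K (?a, [(i, f)]))"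
    using Comp_colim[of ?a "[(i, f)]" "[(i, g)]"] c unfolding is_chain_append e by simp
  finally have "colim_ar K (?a, [(i, Comp ?C g f)]) = Comp (colim K)
      (colim_ar K (colim_ob K (i, Dom ?C g), [(i, g)])) (colim_ar K (?a, [(i, f)]))" .
  moreover have "Dom ?C (Comp ?C g f) = Dom ?C f"
    using DCat_category[OF i] f g fg by (simp add: is_category_def)
  ultimately show "snd (colim_in K i) (Comp ?C g f) =
      Comp (colim K) (snd (colim_in K i) g) (snd (colim_in K i) f)"
    by (simp add: colim_in_def)
qed

theorem colim_cocone: "is_cocone K (colim K) (colim_in K)"
  unfolding is_cocone_def
proof (intro conjI ballI impI)
  show "is_category (colim K)" by (rule colim_category)
  show "is_functor (DCat K i) (colim K) (colim_in K i)" if "i \<in> Idx K" for i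
    using that by (rule colim_in_functor)
  fix i j assume ij: "i \<in> Idx K" "j \<in> Idx K" "Leq K i j"
  note F = DMap_functor[OF ij]
  have "colim_ar K (colim_ob K (j, Dom (DCat K j) (snd (DMap K i j) m)), [(j, snd (DMap K i j) m)]) =
      colim_ar K (colim_ob K (i, Dom (DCat K i) m), [(i, m)])" if m: "m \<in> Ar (DCat K i)" for m
  proof -
    have "Dom (DCat K i) m \<in> Ob (DCat K i)"
      "Dom (DCat K j) (snd (DMap K i j) m) = fst (DMap K i j) (Dom (DCat K i) m)"
      using F m by (auto simp: is_functor_def is_category_def)
    then have "colim_ob K (j, Dom (DCat K j) (snd (DMap K i j) m)) = colim_ob K (i, Dom (DCat K i) m)"
      using colim_ob_DMap ij by simp
    moreover have "chain_step K [(i, m)] [(j, snd (DMap K i j) m)]"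
      using chain_step.transition[OF ij m, of "[]" "[]"] by simp
    ultimately show ?thesis using chain_rel_step is_chain_single[OF ij(1) m] by simp
  qed
  then show "functor_eq (DCat K i) (functor_comp (colim_in K j) (DMap K i j)) (colim_in K i)"
    using colim_ob_DMap ij by (simp add: functor_eq_def functor_comp_def colim_in_def)
qed

context
  fixes C :: "('p, 'n) category" and G :: "'i \<Rightarrow> ('o, 'm, 'p, 'n) fctr"
  assumes G: "is_cocone K C G"
begin

lemma C_category: "is_category C"
  using G by (simp add: is_cocone_def)

lemma G_functor: "i \<in> Idx K \<Longrightarrow> is_functor (DCat K i) C (G i)"
  using G by (simp add: is_cocone_def)

lemma desc_ob_colim_ob: "desc_ob G (colim_ob K (i, x)) = fst (G i) x"
proof -
  have "the_elem ((\<lambda>(i, x). fst (G i) x) ` colim_ob K (i, x)) = (\<lambda>(i, x). fst (G i) x) (i, x)"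
  proof (rule the_elem_image_const)
    show "(i, x) \<in> colim_ob K (i, x)" by (simp add: colim_ob_def)
    fix q assume "q \<in> colim_ob K (i, x)"
    then have "equivclp (glue_step K) (i, x) q" by (simp add: colim_ob_def)
    then show "(\<lambda>(i, x). fst (G i) x) q = (\<lambda>(i, x). fst (G i) x) (i, x)"
    proof (rule equivclp_invariant[symmetric, where f = "\<lambda>(i, x). fst (G i) x"])
      fix p q assume "glue_step K p q"
      then show "(\<lambda>(i, x). fst (G i) x) p = (\<lambda>(i, x). fst (G i) x) q"
        using G by (auto simp: glue_step_def is_cocone_def functor_eq_def functor_comp_def split: prod.splits)
    qed
  qed
  then show ?thesis by (simp add: desc_ob_def)
qed

lemma desc_ob_in: "a \<in> Ob (colim K) \<Longrightarrow> desc_ob G a \<in> Ob C"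
  using G_functor by (auto simp: colim_def desc_ob_colim_ob is_functor_def)

lemma desc_chain_snoc:
  "desc_chain C G (a, l @ [(i, m)]) = Comp C (snd (G i) m) (desc_chain C G (a, l))"
  by (simp add: desc_chain_def)

lemma G_arrow:
  assumes "i \<in> Idx K" "m \<in> Ar (DCat K i)"
  shows "snd (G i) m \<in> Ar C" "Dom C (snd (G i) m) = desc_ob G (colim_ob K (i, Dom (DCat K i) m))"
    "Cod C (snd (G i) m) = desc_ob G (colim_ob K (i, Cod (DCat K i) m))"
  using G_functor[OF assms(1)] assms(2) by (auto simp: is_functor_def desc_ob_colim_ob)

lemma desc_chain_arrow:
  assumes "is_chain K a l"
  shows "desc_chain C G (a, l) \<in> Ar C \<and> Dom C (desc_chain C G (a, l)) = desc_ob G a \<and>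
    Cod C (desc_chain C G (a, l)) = desc_ob G (chain_end K a l)"
  using assms
proof (induction l rule: rev_induct)
  case Nil
  then show ?case using C_category desc_ob_in is_chain_start
    by (simp add: desc_chain_def is_category_def del: is_chain.simps)
next
  case (snoc p l)
  obtain i m where p: "p = (i, m)" by (cases p)
  have l: "is_chain K a l" and im: "i \<in> Idx K" "m \<in> Ar (DCat K i)"
    and e: "chain_end K a l = colim_ob K (i, Dom (DCat K i) m)"
    using snoc.prems unfolding p is_chain_append by auto
  show ?case using snoc.IH[OF l] G_arrow[OF im] C_category e
    unfolding p desc_chain_snoc chain_end_append is_category_def by simp
qed

lemma desc_chain_append:
  assumes "is_chain K a l" "is_chain K (chain_end K a l) k"
  shows "desc_chain C G (a, l @ k) = Comp C (desc_chain C G (chain_end K a l, k)) (desc_chain C G (a, l))"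
  using assms(2)
proof (induction k rule: rev_induct)
  case Nil
  have "desc_chain C G (chain_end K a l, []) = Ident C (Cod C (desc_chain C G (a, l)))"
    using desc_chain_arrow[OF assms(1)] by (simp add: desc_chain_def)
  moreover have "Comp C (Ident C (Cod C (desc_chain C G (a, l)))) (desc_chain C G (a, l)) =
      desc_chain C G (a, l)"
    using C_category desc_chain_arrow[OF assms(1)] unfolding is_category_def by blast
  ultimately show ?case by simp
next
  case (snoc p k)
  obtain i m where p: "p = (i, m)" by (cases p)
  have k: "is_chain K (chain_end K a l) k" and im: "i \<in> Idx K" "m \<in> Ar (DCat K i)"
    and e: "chain_end K (chain_end K a l) k = colim_ob K (i, Dom (DCat K i) m)"
    using snoc.prems unfolding p is_chain_append by auto
  have "desc_chain C G (a, l @ k @ [(i, m)]) = Comp C (snd (G i) m)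
      (Comp C (desc_chain C G (chain_end K a l, k)) (desc_chain C G (a, l)))"
    using snoc.IH[OF k] desc_chain_snoc[of a "l @ k"] by simp
  also have "\<dots> = Comp C (Comp C (snd (G i) m) (desc_chain C G (chain_end K a l, k))) (desc_chain C G (a, l))"
    using C_category desc_chain_arrow[OF assms(1)] desc_chain_arrow[OF k] G_arrow[OF im] e
    unfolding is_category_def by simp
  finally show ?case unfolding p desc_chain_snoc .
qed

lemma desc_chain_single:
  assumes "i \<in> Idx K" "m \<in> Ar (DCat K i)"
  shows "desc_chain C G (colim_ob K (i, Dom (DCat K i) m), [(i, m)]) = snd (G i) m"
proof -
  have "desc_chain C G (colim_ob K (i, Dom (DCat K i) m), [(i, m)]) =
      Comp C (snd (G i) m) (Ident C (Dom C (snd (G i) m)))"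
    using G_arrow[OF assms] by (simp add: desc_chain_def)
  moreover have "Comp C (snd (G i) m) (Ident C (Dom C (snd (G i) m))) = snd (G i) m"
    using C_category G_arrow[OF assms] unfolding is_category_def by blast
  ultimately show ?thesis by simp
qed

lemma desc_chain_replace:
  assumes "is_chain K a (u @ x @ v)" "is_chain K a (u @ y @ v)"
    "desc_chain C G (chain_end K a u, x) = desc_chain C G (chain_end K a u, y)"
    "chain_end K (chain_end K a u) x = chain_end K (chain_end K a u) y"
  shows "desc_chain C G (a, u @ x @ v) = desc_chain C G (a, u @ y @ v)"
proof -
  have "is_chain K a u" "is_chain K (chain_end K a u) (x @ v)" "is_chain K (chain_end K a u) (y @ v)"
    using assms(1,2) by (simp_all add: is_chain_append)
  moreover have "desc_chain C G (chain_end K a u, x @ v) = desc_chain C G (chain_end K a u, y @ v)"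
    using assms by (simp add: is_chain_append desc_chain_append)
  ultimately show ?thesis by (simp add: desc_chain_append)
qed

lemma desc_chain_step:
  assumes "chain_step K l l'" "is_chain K a l"
  shows "desc_chain C G (a, l) = desc_chain C G (a, l')"
proof -
  have l': "is_chain K a l'" using chain_step_chain assms by blast
  show ?thesis using assms(1)
  proof cases
    case (transition i j m u v)
    have F: "is_functor (DCat K i) (DCat K j) (DMap K i j)" using DMap_functor transition by blast
    let ?m = "snd (DMap K i j) m"
    have m: "?m \<in> Ar (DCat K j)" "Dom (DCat K j) ?m = fst (DMap K i j) (Dom (DCat K i) m)"
      "Cod (DCat K j) ?m = fst (DMap K i j) (Cod (DCat K i) m)" using F transition by (auto simp: is_functor_def)
    have dc: "Dom (DCat K i) m \<in> Ob (DCat K i)" "Cod (DCat K i) m \<in> Ob (DCat K i)"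
      using DCat_category transition by (auto simp: is_category_def)
    have e: "chain_end K a u = colim_ob K (i, Dom (DCat K i) m)"
      using assms(2) transition by (simp add: is_chain_append del: is_chain.simps(1))
    have e2: "chain_end K a u = colim_ob K (j, Dom (DCat K j) ?m)"
      using e m dc colim_ob_DMap transition by simp
    have Gm: "snd (G j) ?m = snd (G i) m"
      using G transition by (simp add: is_cocone_def functor_eq_def functor_comp_def)
    have "desc_chain C G (a, u @ [(i, m)] @ v) = desc_chain C G (a, u @ [(j, ?m)] @ v)"
    proof (rule desc_chain_replace)
      show "desc_chain C G (chain_end K a u, [(i, m)]) = desc_chain C G (chain_end K a u, [(j, ?m)])"
        using desc_chain_single[of i m] desc_chain_single[of j ?m] transition m(1) e e2 Gm by simp
      show "chain_end K (chain_end K a u) [(i, m)] = chain_end K (chain_end K a u) [(j, ?m)]"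
        using colim_ob_DMap transition dc m by simp
    qed (use assms(2) l' transition in simp_all)
    then show ?thesis using transition by simp
  next
    case (identity i x u v)
    have I: "Ident (DCat K i) x \<in> Ar (DCat K i)" "Dom (DCat K i) (Ident (DCat K i) x) = x"
      "Cod (DCat K i) (Ident (DCat K i) x) = x"
      using DCat_category identity by (auto simp: is_category_def)
    have e: "chain_end K a u = colim_ob K (i, x)"
      using assms(2) identity I by (simp add: is_chain_append del: is_chain.simps(1))
    have "desc_chain C G (a, u @ [(i, Ident (DCat K i) x)] @ v) = desc_chain C G (a, u @ [] @ v)"
    proof (rule desc_chain_replace)
      have "desc_chain C G (chain_end K a u, [(i, Ident (DCat K i) x)]) = Ident C (fst (G i) x)"
        using desc_chain_single[of i "Ident (DCat K i) x"] identity I e G_functor[of i]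
        by (simp add: is_functor_def)
      then show "desc_chain C G (chain_end K a u, [(i, Ident (DCat K i) x)]) =
          desc_chain C G (chain_end K a u, [])"
        by (simp add: desc_chain_def e desc_ob_colim_ob)
    qed (use assms(2) l' identity I e in simp_all)
    then show ?thesis using identity by simp
  next
    case (composition i f g u v)
    have c: "Comp (DCat K i) g f \<in> Ar (DCat K i)"
      "Dom (DCat K i) (Comp (DCat K i) g f) = Dom (DCat K i) f"
      "Cod (DCat K i) (Comp (DCat K i) g f) = Cod (DCat K i) g"
      using DCat_category composition unfolding is_category_def by blast+
    have e: "chain_end K a u = colim_ob K (i, Dom (DCat K i) f)"
      using assms(2) composition by (simp add: is_chain_append del: is_chain.simps(1))
    have "desc_chain C G (a, u @ [(i, f), (i, g)] @ v) = desc_chain C G (a, u @ [(i, Comp (DCat K i) g f)] @ v)"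
    proof (rule desc_chain_replace)
      have "desc_chain C G (chain_end K a u, [(i, f)] @ [(i, g)]) = Comp C (snd (G i) g) (snd (G i) f)"
        using desc_chain_single[of i f] desc_chain_snoc[of _ "[(i, f)]" i g] composition e by simp
      then show "desc_chain C G (chain_end K a u, [(i, f), (i, g)]) =
          desc_chain C G (chain_end K a u, [(i, Comp (DCat K i) g f)])"
        using desc_chain_single[of i "Comp (DCat K i) g f"] composition c e G_functor[of i]
        by (simp add: is_functor_def)
    qed (use assms(2) l' composition c in simp_all)
    then show ?thesis using composition by simp
  qed
qed

lemma colim_desc_ar:
  "is_chain K a l \<Longrightarrow> snd (colim_desc C G) (colim_ar K (a, l)) = desc_chain C G (a, l)"
proof -
  assume "is_chain K a l"
  have "the_elem (desc_chain C G ` colim_ar K (a, l)) = desc_chain C G (a, l)"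
  proof (rule the_elem_image_const[where f = "desc_chain C G" and a = "(a, l)"])
    show "(a, l) \<in> colim_ar K (a, l)" by (rule colim_ar_self)
  next
    fix q assume "q \<in> colim_ar K (a, l)"
    then have "chain_rel K (a, l) q" by (simp add: colim_ar_def)
    then show "desc_chain C G q = desc_chain C G (a, l)"
      unfolding chain_rel_def
    proof (rule equivclp_invariant[symmetric, where f = "desc_chain C G"])
      fix x y :: "('i \<times> 'o) set \<times> ('i \<times> 'm) list"
      assume "fst x = fst y \<and> is_chain K (fst x) (snd x) \<and> is_chain K (fst y) (snd y) \<and>
        chain_step K (snd x) (snd y)"
      then show "desc_chain C G x = desc_chain C G y"
        using desc_chain_step[of "snd x" "snd y" "fst x"] by (cases x, cases y) auto
    qed
  qed
  then show ?thesis by (simp add: colim_desc_def)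
qed

lemma colim_desc_functor: "is_functor (colim K) C (colim_desc C G)"
  unfolding is_functor_def
proof (intro conjI ballI impI)
  show "is_category (colim K)" "is_category C" using colim_category C_category by auto
next
  fix x assume x: "x \<in> Ob (colim K)"
  show "fst (colim_desc C G) x \<in> Ob C" using desc_ob_in x by (simp add: colim_desc_def)
  have "is_chain K x []" using x is_chain_Nil by blast
  then show "snd (colim_desc C G) (Ident (colim K) x) = Ident C (fst (colim_desc C G) x)"
    unfolding Ident_colim by (subst colim_desc_ar) (simp_all add: desc_chain_def colim_desc_def)
next
  fix f assume "f \<in> Ar (colim K)"
  then obtain a l where f: "is_chain K a l" "f = colim_ar K (a, l)" by (rule Ar_colimE)
  show "snd (colim_desc C G) f \<in> Ar C"
    "Dom C (snd (colim_desc C G) f) = fst (colim_desc C G) (Dom (colim K) f)"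
    "Cod C (snd (colim_desc C G) f) = fst (colim_desc C G) (Cod (colim K) f)"
    unfolding f(2) colim_desc_ar[OF f(1)] Dom_colim Cod_colim
    using desc_chain_arrow[OF f(1)] by (simp_all add: colim_desc_def)
next
  fix f g assume "f \<in> Ar (colim K)" "g \<in> Ar (colim K)" "Cod (colim K) f = Dom (colim K) g"
  then obtain a l k where *: "is_chain K a l" "f = colim_ar K (a, l)"
    "is_chain K (chain_end K a l) k" "g = colim_ar K (chain_end K a l, k)"
    by (rule composable_colimE)
  have "is_chain K a (l @ k)" using * by (simp add: is_chain_append)
  then show "snd (colim_desc C G) (Comp (colim K) g f) =
      Comp C (snd (colim_desc C G) g) (snd (colim_desc C G) f)"
    using * by (simp add: Comp_colim colim_desc_ar desc_chain_append)
qed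

theorem colim_universal:
  "is_functor (colim K) C (colim_desc C G)"
  "i \<in> Idx K \<Longrightarrow> functor_eq (DCat K i) (functor_comp (colim_desc C G) (colim_in K i)) (G i)"
  "is_functor (colim K) C H \<Longrightarrow>
   (\<And>i. i \<in> Idx K \<Longrightarrow> functor_eq (DCat K i) (functor_comp H (colim_in K i)) (G i)) \<Longrightarrow>
   functor_eq (colim K) H (colim_desc C G)"
proof -
  show "is_functor (colim K) C (colim_desc C G)" by (rule colim_desc_functor)
  show "functor_eq (DCat K i) (functor_comp (colim_desc C G) (colim_in K i)) (G i)" if "i \<in> Idx K" for i
    using that colim_desc_ar[OF is_chain_single] desc_chain_single
    by (simp add: functor_eq_def functor_comp_def colim_in_def)
       (simp add: colim_desc_def desc_ob_colim_ob)
  assume H: "is_functor (colim K) C H"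
    and HG: "\<And>i. i \<in> Idx K \<Longrightarrow> functor_eq (DCat K i) (functor_comp H (colim_in K i)) (G i)"
  have ob: "fst H a = desc_ob G a" if "a \<in> Ob (colim K)" for a
    using that HG by (auto simp: colim_def desc_ob_colim_ob functor_eq_def functor_comp_def colim_in_def)
  have ar: "snd H (colim_ar K (a, l)) = desc_chain C G (a, l)" if "is_chain K a l" for a l
    using that
  proof (induction l rule: rev_induct)
    case Nil
    then have a: "a \<in> Ob (colim K)" using is_chain_Nil by blast
    then have "snd H (Ident (colim K) a) = Ident C (fst H a)" using H by (simp add: is_functor_def)
    then show ?case using ob a by (simp add: Ident_colim desc_chain_def)
  next
    case (snoc p l)
    obtain i m where p: "p = (i, m)" by (cases p)
    have l: "is_chain K a l" and im: "i \<in> Idx K" "m \<in> Ar (DCat K i)"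
      and e: "chain_end K a l = colim_ob K (i, Dom (DCat K i) m)"
      using snoc.prems unfolding p is_chain_append by auto
    have 1: "is_chain K (chain_end K a l) [(i, m)]" using snoc.prems unfolding p is_chain_append by blast
    have "snd H (Comp (colim K) (colim_ar K (chain_end K a l, [(i, m)])) (colim_ar K (a, l))) =
        Comp C (snd H (colim_ar K (chain_end K a l, [(i, m)]))) (snd H (colim_ar K (a, l)))"
      using H colim_ar_in[OF l] colim_ar_in[OF 1] unfolding is_functor_def
      by (simp add: Dom_colim Cod_colim)
    moreover have "snd H (colim_ar K (chain_end K a l, [(i, m)])) = snd (G i) m"
      using HG[OF im(1)] im(2) e by (simp add: functor_eq_def functor_comp_def colim_in_def)
    ultimately show ?case
      using snoc.IH[OF l] Comp_colim[OF l 1] unfolding p desc_chain_snoc by simp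
  qed
  show "functor_eq (colim K) H (colim_desc C G)"
    unfolding functor_eq_def
  proof (intro conjI ballI)
    show "fst H x = fst (colim_desc C G) x" if "x \<in> Ob (colim K)" for x
      using ob that by (simp add: colim_desc_def)
    show "snd H f = snd (colim_desc C G) f" if "f \<in> Ar (colim K)" for f
      using that by (rule Ar_colimE) (simp add: ar colim_desc_ar)
  qed
qed

end

end


section \<open>Filtered spaces\<close>

text \<open>A filtration is indexed by all of \<open>nat\<close>, being constant from its number of steps on; the
  subspace of degree \<open>-1\<close> is left implicit. With this convention the degrees of spaces whose
  filtrations have different numbers of steps can be compared.\<close>

record 'a filtered =
  top_of :: "'a topology"
  steps :: nat
  skel :: "nat \<Rightarrow> 'a set"

definition is_filtered_space :: "'a filtered \<Rightarrow> bool" where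
  "is_filtered_space A \<longleftrightarrow> (\<forall>k. closedin (top_of A) (skel A k)) \<and> mono (skel A) \<and>
     (\<forall>k\<ge>steps A. skel A k = topspace (top_of A))"

definition layer :: "'a filtered \<Rightarrow> nat \<Rightarrow> 'a set" where
  "layer A d = skel A d - (case d of 0 \<Rightarrow> {} | Suc k \<Rightarrow> skel A k)"

definition formal_dim :: "'a filtered \<Rightarrow> int" where
  "formal_dim A = (if topspace (top_of A) = {} then -1 else int (Sup {d. layer A d \<noteq> {}}))"

definition filtered_homeomorphism :: "'a filtered \<Rightarrow> 'b filtered \<Rightarrow> ('a \<Rightarrow> 'b) \<Rightarrow> bool" where
  "filtered_homeomorphism A B h \<longleftrightarrow> homeomorphic_map (top_of A) (top_of B) h \<and>
     (\<forall>k. homeomorphic_map (subtopology (top_of A) (skel A k)) (subtopology (top_of B) (skel B k)) h)"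

definition filtered_Euclidean :: "nat \<Rightarrow> (nat \<Rightarrow> real) filtered" where
  "filtered_Euclidean d = \<lparr>top_of = Euclidean_space d, steps = d,
     skel = (\<lambda>k. if k < d then {} else topspace (Euclidean_space d))\<rparr>"

definition filtered_prod :: "'a filtered \<Rightarrow> 'b filtered \<Rightarrow> ('a \<times> 'b) filtered" where
  "filtered_prod A B = \<lparr>top_of = prod_topology (top_of A) (top_of B), steps = steps A + steps B,
     skel = (\<lambda>k. \<Union>(i, j)\<in>{(i, j). i + j = k}. skel A i \<times> skel B j)\<rparr>"

definition filtered_sub :: "'a filtered \<Rightarrow> 'a set \<Rightarrow> 'a filtered" where
  "filtered_sub A U = \<lparr>top_of = subtopology (top_of A) U, steps = steps A,
     skel = (\<lambda>k. U \<inter> skel A k)\<rparr>"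

text \<open>In the cone, \<open>None\<close> is the cone point.\<close>

definition cone_open :: "'a topology \<Rightarrow> ('a \<times> real) option set \<Rightarrow> bool" where
  "cone_open L U \<longleftrightarrow> U \<subseteq> insert None (Some ` (topspace L \<times> {0<..})) \<and>
     openin (prod_topology L (top_of_set {0<..})) {p. Some p \<in> U} \<and>
     (None \<in> U \<longrightarrow> (\<exists>\<epsilon>>0. Some ` (topspace L \<times> {0<..<\<epsilon>}) \<subseteq> U))"

definition cone_topology :: "'a topology \<Rightarrow> ('a \<times> real) option topology" where
  "cone_topology L = topology (cone_open L)"

lemma istopology_cone_open: "istopology (cone_open L)"
  unfolding istopology_def
proof (intro conjI allI impI)
  fix S T assume S: "cone_open L S" and T: "cone_open L T"
  have "{p. Some p \<in> S \<inter> T} = {p. Some p \<in> S} \<inter> {p. Some p \<in> T}" by auto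
  moreover have "\<exists>\<epsilon>>0. Some ` (topspace L \<times> {0<..<\<epsilon>}) \<subseteq> S \<inter> T" if "None \<in> S \<inter> T"
  proof -
    from that S T obtain d e where "d > 0" "e > 0" "Some ` (topspace L \<times> {0<..<d}) \<subseteq> S"
      "Some ` (topspace L \<times> {0<..<e}) \<subseteq> T"
      unfolding cone_open_def by auto
    moreover have "Some ` (topspace L \<times> {0<..<min d e}) \<subseteq> Some ` (topspace L \<times> {0<..<d})"
      "Some ` (topspace L \<times> {0<..<min d e}) \<subseteq> Some ` (topspace L \<times> {0<..<e})" by auto
    ultimately have "min d e > 0 \<and> Some ` (topspace L \<times> {0<..<min d e}) \<subseteq> S \<inter> T" by auto
    then show ?thesis by blast
  qed
  ultimately show "cone_open L (S \<inter> T)" using S T unfolding cone_open_def by auto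
next
  fix \<K> assume K: "\<forall>k\<in>\<K>. cone_open L k"
  have "{p. Some p \<in> \<Union>\<K>} = (\<Union>k\<in>\<K>. {p. Some p \<in> k})" by auto
  moreover have "openin (prod_topology L (top_of_set {0<..})) (\<Union>k\<in>\<K>. {p. Some p \<in> k})"
    using K unfolding cone_open_def by (intro openin_Union) auto
  moreover have "\<exists>\<epsilon>>0. Some ` (topspace L \<times> {0<..<\<epsilon>}) \<subseteq> \<Union>\<K>" if "None \<in> \<Union>\<K>"
  proof -
    from that obtain k where k: "k \<in> \<K>" "None \<in> k" by blast
    with K obtain \<epsilon> where "\<epsilon> > 0" "Some ` (topspace L \<times> {0<..<\<epsilon>}) \<subseteq> k"
      unfolding cone_open_def by blast
    with k show ?thesis by (intro exI[of _ \<epsilon>] conjI) blast+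
  qed
  moreover have "\<Union>\<K> \<subseteq> insert None (Some ` (topspace L \<times> {0<..}))"
    using K unfolding cone_open_def by blast
  ultimately show "cone_open L (\<Union>\<K>)" unfolding cone_open_def by metis
qed

lemma openin_cone_topology: "openin (cone_topology L) U \<longleftrightarrow> cone_open L U"
  by (simp add: cone_topology_def istopology_cone_open topology_inverse')

definition filtered_cone :: "'a filtered \<Rightarrow> ('a \<times> real) option filtered" where
  "filtered_cone L = \<lparr>top_of = cone_topology (top_of L), steps = Suc (steps L),
     skel = (\<lambda>k. case k of 0 \<Rightarrow> {None} | Suc i \<Rightarrow> insert None (Some ` (skel L i \<times> {0<..})))\<rparr>"


section \<open>Conically stratified spaces\<close>

text \<open>It is no restriction to take the points of the link \<open>L\<close> in the type of the points of \<open>A\<close>,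
  since \<open>h\<close> embeds \<open>L\<close> in \<open>A\<close> as \<open>0 \<times> (L \<times> 1)\<close>.\<close>

definition basic_open :: "'a filtered \<Rightarrow> 'a \<Rightarrow> 'a set \<Rightarrow> bool" where
  "basic_open A x U \<longleftrightarrow> openin (top_of A) U \<and> x \<in> U \<and>
     (\<exists>d (L :: 'a filtered) h. x \<in> layer A d \<and> is_filtered_space L \<and>
        formal_dim L = int (steps A) - int d - 1 \<and>
        filtered_homeomorphism (filtered_prod (filtered_Euclidean d) (filtered_cone L))
          (filtered_sub A U) h \<and>
        h (\<lambda>_. 0, None) = x)"

definition conically_stratified :: "'a filtered \<Rightarrow> bool" where
  "conically_stratified A \<longleftrightarrow> is_filtered_space A \<and> Hausdorff_space (top_of A) \<and>
     (\<forall>d. \<forall>x\<in>layer A d. \<exists>U. basic_open A x U)"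

definition strata :: "'a filtered \<Rightarrow> 'a set set" where
  "strata A = (\<Union>d. connected_components_of (subtopology (top_of A) (layer A d)))"

definition stratum_preserving ::
    "'a topology \<Rightarrow> 'a set set \<Rightarrow> 'b topology \<Rightarrow> 'b set set \<Rightarrow> ('a \<Rightarrow> 'b) \<Rightarrow> bool" where
  "stratum_preserving Y \<T> X \<S> f \<longleftrightarrow> continuous_map Y X f \<and> (\<forall>T\<in>\<T>. \<exists>S\<in>\<S>. f ` T \<subseteq> S)"

definition stratified_isomorphism ::
    "'a topology \<Rightarrow> 'a set set \<Rightarrow> 'b topology \<Rightarrow> 'b set set \<Rightarrow> ('a \<Rightarrow> 'b) \<Rightarrow> bool" where
  "stratified_isomorphism Y \<T> X \<S> f \<longleftrightarrow> (\<exists>g. homeomorphic_maps Y X f g \<and>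
     stratum_preserving Y \<T> X \<S> f \<and> stratum_preserving X \<S> Y \<T> g)"


section \<open>Entrance paths\<close>

abbreviation II :: "real topology" where
  "II \<equiv> top_of_set {0..1}"

definition is_interval_stratification :: "real set \<Rightarrow> bool" where
  "is_interval_stratification P \<longleftrightarrow> finite P \<and> {0, 1} \<subseteq> P \<and> P \<subseteq> {0..1}"

definition interval_strata :: "real set \<Rightarrow> real set set" where
  "interval_strata P = (\<lambda>t. {t}) ` P \<union>
     {{a<..<b} | a b. a \<in> P \<and> b \<in> P \<and> a < b \<and> {a<..<b} \<inter> P = {}}"

text \<open>A path on the unit interval is given by its set of \<open>0\<close>-strata and its underlying map,
  the latter made canonical by extensionality outside the interval.\<close>

type_synonym 'a spath = "real set \<times> (real \<Rightarrow> 'a)"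

definition entrance_paths :: "'a filtered \<Rightarrow> 'a spath set" where
  "entrance_paths A = {(P, \<alpha>). is_interval_stratification P \<and> \<alpha> \<in> extensional {0..1} \<and>
     stratum_preserving II (interval_strata P) (top_of A) (strata A) \<alpha> \<and>
     (\<forall>s t d e. 0 \<le> s \<longrightarrow> s \<le> t \<longrightarrow> t \<le> 1 \<longrightarrow> \<alpha> s \<in> layer A d \<longrightarrow> \<alpha> t \<in> layer A e \<longrightarrow> e \<le> d)}"

definition path_source :: "'a spath \<Rightarrow> 'a" where
  "path_source p = snd p 0"

definition path_target :: "'a spath \<Rightarrow> 'a" where
  "path_target p = snd p 1"

text \<open>\<open>path_concat q p\<close> is \<open>q * p\<close>: first \<open>p\<close>, then \<open>q\<close>.\<close>

definition path_concat :: "'a spath \<Rightarrow> 'a spath \<Rightarrow> 'a spath" where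
  "path_concat q p = ((\<lambda>t. t / 2) ` fst p \<union> (\<lambda>t. (t + 1) / 2) ` fst q,
     restrict (\<lambda>t. if t \<le> 1/2 then snd p (2 * t) else snd q (2 * t - 1)) {0..1})"

definition reparametrization :: "'a spath \<Rightarrow> 'a spath \<Rightarrow> bool" where
  "reparametrization p q \<longleftrightarrow> is_interval_stratification (fst q) \<and>
     (\<exists>\<phi>. stratified_isomorphism II (interval_strata (fst q)) II (interval_strata (fst p)) \<phi> \<and>
          \<phi> 0 = 0 \<and> \<phi> 1 = 1 \<and> snd q = restrict (snd p \<circ> \<phi>) {0..1})"

abbreviation v0 :: "real \<times> real" where "v0 \<equiv> (0, 0)"
abbreviation v1 :: "real \<times> real" where "v1 \<equiv> (1, 0)"
abbreviation v2 :: "real \<times> real" where "v2 \<equiv> (0, 1)"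

definition triangle :: "(real \<times> real) set" where
  "triangle = convex hull {v0, v1, v2}"

definition triangle_strata :: "(real \<times> real) set set" where
  "triangle_strata = {{v0}, {v1}, {v2}, open_segment v0 v1, open_segment v1 v2, open_segment v0 v2,
     interior triangle}"

definition elementary_homotopy :: "'a filtered \<Rightarrow> 'a spath \<Rightarrow> 'a spath \<Rightarrow> bool" where
  "elementary_homotopy A p q \<longleftrightarrow>
     p \<in> entrance_paths A \<and> q \<in> entrance_paths A \<and> fst p = {0, 1/2, 1} \<and> fst q = {0, 1} \<and>
     (\<exists>h a b.
        stratum_preserving (top_of_set triangle) triangle_strata (top_of A) (strata A) h \<and>
        stratified_isomorphism II (interval_strata {0, 1/2, 1})
          (top_of_set (closed_segment v0 v1 \<union> closed_segment v1 v2))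
          {{v0}, {v1}, {v2}, open_segment v0 v1, open_segment v1 v2} a \<and>
        a 0 = v0 \<and> a (1/2) = v1 \<and> a 1 = v2 \<and>
        stratified_isomorphism II (interval_strata {0, 1})
          (top_of_set (closed_segment v0 v2)) {{v0}, {v2}, open_segment v0 v2} b \<and>
        b 0 = v0 \<and> b 1 = v2 \<and>
        (\<forall>t\<in>{0..1}. h (a t) = snd p t) \<and> (\<forall>t\<in>{0..1}. h (b t) = snd q t) \<and>
        (\<exists>S\<in>strata A. h ` (triangle - closed_segment v1 v2) \<subseteq> S) \<and>
        (\<exists>U. basic_open A (h v2) U \<and> h ` triangle \<subseteq> U))"

text \<open>\<open>decomposes p r q s\<close>: the path \<open>p\<close> is the concatenation of the pieces \<open>r\<close> (if present),
  \<open>q\<close> and \<open>s\<close> (if present), in this order. Cutting a path at a point which is not one of its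
  \<open>0\<close>-strata makes that point an end of two pieces and hence a \<open>0\<close>-stratum of their concatenation,
  so the cut points have to be added to the \<open>0\<close>-strata of \<open>p\<close>. If cuts were allowed only at
  \<open>0\<close>-strata of \<open>p\<close>, a loop winding once around a circle (stratified by itself), with \<open>0\<close>-strata only
  its ends, would not be equivalent to any path with further \<open>0\<close>-strata, in particular not to its
  composites with constant paths.\<close>

fun decomposes :: "'a spath \<Rightarrow> 'a spath option \<Rightarrow> 'a spath \<Rightarrow> 'a spath option \<Rightarrow> bool" where
  "decomposes p None q None \<longleftrightarrow> p = q"
| "decomposes p (Some r) q None \<longleftrightarrow> path_target r = path_source q \<and>
     (fst p \<union> {1/2}, snd p) = path_concat q r"
| "decomposes p None q (Some s) \<longleftrightarrow> path_target q = path_source s \<and>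
     (fst p \<union> {1/2}, snd p) = path_concat s q"
| "decomposes p (Some r) q (Some s) \<longleftrightarrow> path_target r = path_source q \<and>
     path_target q = path_source s \<and>
     (fst p \<union> {1/4, 1/2}, snd p) = path_concat s (path_concat q r)"

definition elementarily_related :: "'a filtered \<Rightarrow> 'a spath \<Rightarrow> 'a spath \<Rightarrow> bool" where
  "elementarily_related A p q \<longleftrightarrow> p \<in> entrance_paths A \<and> q \<in> entrance_paths A \<and>
     (\<exists>p' q' r s p2 q2. reparametrization p p' \<and> reparametrization q q' \<and>
        set_option r \<subseteq> entrance_paths A \<and> set_option s \<subseteq> entrance_paths A \<and>
        decomposes p' r p2 s \<and> decomposes q' r q2 s \<and>
        (elementary_homotopy A p2 q2 \<or> elementary_homotopy A q2 p2))"

definition path_equiv :: "'a filtered \<Rightarrow> ('a spath \<times> 'a spath) set" where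
  "path_equiv A = {(p, q). p \<in> entrance_paths A \<and> q \<in> entrance_paths A \<and>
     (elementarily_related A)\<^sup>*\<^sup>* p q}"


section \<open>The entrance path category\<close>

definition Ent :: "'a filtered \<Rightarrow> ('a, 'a spath set) category" where
  "Ent A = \<lparr>
     Ob = topspace (top_of A),
     Ar = entrance_paths A // path_equiv A,
     Dom = (\<lambda>c. the_elem (path_source ` c)),
     Cod = (\<lambda>c. the_elem (path_target ` c)),
     Ident = (\<lambda>x. path_equiv A `` {({0, 1}, restrict (\<lambda>_. x) {0..1})}),
     Comp = (\<lambda>d c. \<Union>p\<in>c. \<Union>q\<in>d. path_equiv A `` {path_concat q p})\<rparr>"

definition Ent_map :: "'b filtered \<Rightarrow> ('a \<Rightarrow> 'b) \<Rightarrow> ('a, 'a spath set, 'b, 'b spath set) fctr" where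
  "Ent_map B f = (f, \<lambda>c. \<Union>p\<in>c. path_equiv B `` {(fst p, restrict (f \<circ> snd p) {0..1})})"

definition complete_cover :: "'a topology \<Rightarrow> 'a set \<Rightarrow> 'a set set \<Rightarrow> bool" where
  "complete_cover X U \<U> \<longleftrightarrow> (\<forall>V\<in>\<U>. openin X V) \<and> \<Union>\<U> = U \<and>
     (\<forall>V\<in>\<U>. \<forall>W\<in>\<U>. \<exists>\<V>\<subseteq>\<U>. \<Union>\<V> = V \<inter> W)"

definition Ent_diagram ::
    "'a filtered \<Rightarrow> 'a set set \<Rightarrow> ('a set, 'a, 'a spath set) diagram" where
  "Ent_diagram A \<U> = \<lparr>
     Idx = \<U>,
     Leq = (\<subseteq>),
     DCat = (\<lambda>U. Ent (filtered_sub A U)),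
     DMap = (\<lambda>U V. Ent_map (filtered_sub A V) (\<lambda>x. x))\<rparr>"

end

theory Submission
  imports Defs
begin

text \<open>The dimension of the stratum through which a path passes is a non-increasing function, and
  conversely a continuous map from the interval along which this dimension does not increase is an
  entrance path for some finite set of \<open>0\<close>-strata, the choice of which does not matter up to
  equivalence. So the class of a path on any interval makes sense, and it is additive under
  subdivision and invariant under increasing reparametrization.

  Given a cocone \<open>G\<close> under the diagram of the cover with vertex \<open>C\<close>, a path of \<open>X\<close> is cut into
  pieces lying in members of the cover and the composite of their images in \<open>C\<close> is taken.
  Completeness of the cover makes the image of a piece independent of the member containing it, and
  hence the composite independent of the subdivision. An elementary homotopy is a map of the square
  (with one side collapsed), which is subdivided in the same way: on a small rectangle both halves
  cut off by the diagonal are elementary homotopies inside a single member of the cover, because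
  every point has arbitrarily small basic open neighbourhoods and a basic open set about a point is
  basic about all of its points of the same dimension. So the image of a path depends on its class
  only, which gives a functor from \<open>Ent X\<close> to \<open>C\<close>; for the colimit cocone it inverts the canonical
  functor.\<close>

subsection \<open>Dimensions along paths\<close>

text \<open>Two rigidities shape the proof. An elementary homotopy must lie in a basic open about
  its final vertex, not about an arbitrary point of its image. A small rectangle around
  \<open>(x, y)\<close> is therefore chosen so that its upper right corner has the same dimension as
  \<open>(x, y)\<close>; then the basic open found at \<open>(x, y)\<close> is also basic about that
  corner. Moreover, the generating relation asks for pieces in fixed positions with prescribed
  \<open>0\<close>-strata. Even inserting a \<open>0\<close>-stratum takes a homotopy, one that
  collapses the triangle to an interval; once this is available, cuts and parametrizations can be
  forgotten and only functions on intervals remain. The unit laws of \<open>Ent\<close> need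
  homotopies too, since a constant path followed by a path is not a reparametrization of it.

  Subdivisions are handled by bisection, which replaces Lebesgue numbers and common refinements. The
  inverse is not verified on generators and relations: one composite is the identity because
  functors out of a colimit are determined by their restrictions, the other because arrows from
  members of the cover generate \<open>Ent X\<close>.\<close>

definition pdim :: "'a filtered \<Rightarrow> 'a \<Rightarrow> nat" where
  "pdim A x = (LEAST d. x \<in> skel A d)"

text \<open>The \<open>0\<close>-strata are left out because \<open>entrance_on_cuts\<close>
  recovers a finite set of them. The end points are arbitrary so that the parts of a subdivided path
  are given by the same function.\<close>

definition entrance_on :: "'a filtered \<Rightarrow> (real \<Rightarrow> 'a) \<Rightarrow> real \<Rightarrow> real \<Rightarrow> bool" where
  "entrance_on A f a b \<longleftrightarrow> continuous_map (top_of_set {a..b}) (top_of A) f \<and>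
     (\<forall>s t. a \<le> s \<longrightarrow> s \<le> t \<longrightarrow> t \<le> b \<longrightarrow> pdim A (f t) \<le> pdim A (f s))"

lemma entrance_on_mono:
  "entrance_on A f a b \<Longrightarrow> a \<le> s \<Longrightarrow> s \<le> t \<Longrightarrow> t \<le> b \<Longrightarrow> pdim A (f t) \<le> pdim A (f s)"
  unfolding entrance_on_def by blast

lemma entrance_on_continuous:
  "entrance_on A f a b \<Longrightarrow> continuous_map (top_of_set {a..b}) (top_of A) f"
  unfolding entrance_on_def by blast

lemma entrance_on_in:
  "entrance_on A f a b \<Longrightarrow> t \<in> {a..b} \<Longrightarrow> f t \<in> topspace (top_of A)"
  unfolding entrance_on_def by (metis continuous_map_image_subset_topspace image_subset_iff topspace_euclidean_subtopology)

lemma entrance_on_subset: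
  assumes "entrance_on A f a b" "a \<le> c" "d \<le> b"
  shows "entrance_on A f c d"
proof -
  have "continuous_map (top_of_set {c..d}) (top_of A) f"
    using assms continuous_map_from_subtopology_mono[of euclidean "{a..b}" "top_of A" f "{c..d}"]
    unfolding entrance_on_def by simp
  then show ?thesis using assms unfolding entrance_on_def by force
qed

lemma entrance_on_cong:
  assumes "entrance_on A f a b" "\<And>t. t \<in> {a..b} \<Longrightarrow> f t = g t"
  shows "entrance_on A g a b"
  unfolding entrance_on_def
proof (intro conjI allI impI)
  show "continuous_map (top_of_set {a..b}) (top_of A) g"
    using continuous_map_eq[OF entrance_on_continuous[OF assms(1)]] assms(2) by simp
  fix s t assume "a \<le> s" "s \<le> t" "t \<le> b"
  then show "pdim A (g t) \<le> pdim A (g s)"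
    using entrance_on_mono[OF assms(1), of s t] assms(2)[of s] assms(2)[of t] by simp
qed

lemma entrance_on_compose:
  assumes "entrance_on A f a' b'" "continuous_on {a..b} \<phi>" "\<phi> ` {a..b} \<subseteq> {a'..b'}"
    "\<And>s t. a \<le> s \<Longrightarrow> s \<le> t \<Longrightarrow> t \<le> b \<Longrightarrow> \<phi> s \<le> \<phi> t"
  shows "entrance_on A (f \<circ> \<phi>) a b"
  unfolding entrance_on_def
proof (intro conjI allI impI)
  show "continuous_map (top_of_set {a..b}) (top_of A) (f \<circ> \<phi>)"
    by (rule continuous_map_compose[OF _ entrance_on_continuous[OF assms(1)]])
       (use assms in auto)
  fix s t assume *: "a \<le> s" "s \<le> t" "t \<le> b"
  then have "\<phi> s \<in> {a'..b'}" "\<phi> t \<in> {a'..b'}"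
    using assms(3) unfolding image_subset_iff by (meson atLeastAtMost_iff order_trans)+
  then show "pdim A ((f \<circ> \<phi>) t) \<le> pdim A ((f \<circ> \<phi>) s)"
    using entrance_on_mono[OF assms(1)] assms(4)[OF *] by simp
qed

lemma entrance_on_join:
  assumes "entrance_on A f a c" "entrance_on A f c b" "a \<le> c" "c \<le> b"
  shows "entrance_on A f a b"
  unfolding entrance_on_def
proof (intro conjI allI impI)
  have "continuous_map (top_of_set {a..b}) (top_of A) (\<lambda>x. if x \<le> c then f x else f x)"
  proof (rule continuous_map_cases_le)
    show "continuous_map (top_of_set {a..b}) euclideanreal (\<lambda>x. x)"
      "continuous_map (top_of_set {a..b}) euclideanreal (\<lambda>x. c)" by auto
    have "{a..b} \<inter> {x \<in> topspace (top_of_set {a..b}). x \<le> c} = {a..c}"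
      "{a..b} \<inter> {x \<in> topspace (top_of_set {a..b}). c \<le> x} = {c..b}"
      using assms(3,4) by auto
    then show "continuous_map (subtopology (top_of_set {a..b}) {x \<in> topspace (top_of_set {a..b}). x \<le> c}) (top_of A) f"
      "continuous_map (subtopology (top_of_set {a..b}) {x \<in> topspace (top_of_set {a..b}). c \<le> x}) (top_of A) f"
      using assms(1,2) unfolding entrance_on_def by (simp_all add: subtopology_subtopology)
  qed auto
  then show "continuous_map (top_of_set {a..b}) (top_of A) f" by simp
next
  fix s t assume "a \<le> s" "s \<le> t" "t \<le> b"
  then consider "t \<le> c" | "s \<ge> c" | "s \<le> c" "c \<le> t" by linarith
  then show "pdim A (f t) \<le> pdim A (f s)"
  proof cases
    case 3
    then show ?thesis using entrance_on_mono[OF assms(1), of s c] entrance_on_mono[OF assms(2), of c t]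
      \<open>a \<le> s\<close> \<open>t \<le> b\<close> by simp
  qed (use \<open>a \<le> s\<close> \<open>s \<le> t\<close> \<open>t \<le> b\<close> in \<open>auto intro: entrance_on_mono[OF assms(1)] entrance_on_mono[OF assms(2)]\<close>)
qed

lemma interval_stratum:
  assumes P: "is_interval_stratification P" and T: "T \<in> interval_strata P"
  shows "connected T" "T \<noteq> {}" "T \<subseteq> {0..1}"
proof -
  have "(\<exists>t\<in>P. T = {t}) \<or> (\<exists>a\<in>P. \<exists>b\<in>P. a < b \<and> T = {a<..<b})"
    using T unfolding interval_strata_def by blast
  then have "connected T \<and> T \<noteq> {} \<and> T \<subseteq> {0..1}"
  proof (elim disjE bexE conjE)
    fix a b assume "a \<in> P" "b \<in> P" "a < b" "T = {a<..<b}"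
    moreover have "0 \<le> a" "b \<le> 1"
      using P \<open>a \<in> P\<close> \<open>b \<in> P\<close> unfolding is_interval_stratification_def by auto
    ultimately show ?thesis by auto
  next
    fix t assume "t \<in> P" "T = {t}"
    then show ?thesis using P unfolding is_interval_stratification_def by auto
  qed
  then show "connected T" "T \<noteq> {}" "T \<subseteq> {0..1}" by blast+
qed

section \<open>Strata and 0-strata in terms of the dimension\<close>

context
  fixes A :: "'a filtered"
  assumes A: "is_filtered_space A"
begin

lemma skel_iff_pdim:
  assumes "x \<in> topspace (top_of A)"
  shows "x \<in> skel A d \<longleftrightarrow> pdim A x \<le> d"
proof
  show "x \<in> skel A d \<Longrightarrow> pdim A x \<le> d" unfolding pdim_def by (rule Least_le)
  have "x \<in> skel A (steps A)" using A assms unfolding is_filtered_space_def by simp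
  then have "x \<in> skel A (pdim A x)" unfolding pdim_def by (rule LeastI)
  moreover assume "pdim A x \<le> d"
  ultimately show "x \<in> skel A d" using A unfolding is_filtered_space_def mono_def by blast
qed

lemma skel_subset: "skel A d \<subseteq> topspace (top_of A)"
  using A unfolding is_filtered_space_def by (meson closedin_subset)

lemma layer_iff_pdim: "x \<in> layer A d \<longleftrightarrow> x \<in> topspace (top_of A) \<and> pdim A x = d"
proof (cases "x \<in> topspace (top_of A)")
  case True
  show ?thesis
    by (cases d) (simp_all add: layer_def skel_iff_pdim[OF True] True, linarith)
next
  case False
  then have "x \<notin> skel A d" using skel_subset[of d] by blast
  then show ?thesis using False by (simp add: layer_def)
qed

lemma closedin_pdim_le: "closedin (top_of A) {x \<in> topspace (top_of A). pdim A x \<le> d}"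
proof -
  have "{x \<in> topspace (top_of A). pdim A x \<le> d} = skel A d"
    using skel_iff_pdim skel_subset by blast
  then show ?thesis using A unfolding is_filtered_space_def by simp
qed

text \<open>A connected set inside a layer lies in a single component of it, and these components
  are the strata. From here on, preserving strata means that \<open>pdim\<close> is constant on
  suitable connected sets, which is checked with equalities and inequalities of numbers.\<close>

lemma in_stratum_iff_pdim_const:
  assumes C: "connected C" "C \<noteq> {}" and f: "continuous_map (top_of_set C) (top_of A) f"
  shows "(\<exists>S\<in>strata A. f ` C \<subseteq> S) \<longleftrightarrow> (\<exists>d. \<forall>x\<in>C. pdim A (f x) = d)"
proof
  assume "\<exists>S\<in>strata A. f ` C \<subseteq> S"
  then obtain S d where "S \<in> connected_components_of (subtopology (top_of A) (layer A d))" "f ` C \<subseteq> S"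
    unfolding strata_def by blast
  then have "f ` C \<subseteq> layer A d" using connected_components_of_subset by fastforce
  then show "\<exists>d. \<forall>x\<in>C. pdim A (f x) = d" using layer_iff_pdim by auto
next
  assume "\<exists>d. \<forall>x\<in>C. pdim A (f x) = d"
  then obtain d where d: "\<forall>x\<in>C. pdim A (f x) = d" by blast
  have "f ` C \<subseteq> topspace (top_of A)" using f by (simp add: continuous_map_def image_subset_iff_funcset)
  with d have sub: "f ` C \<subseteq> layer A d" using layer_iff_pdim by auto
  have "connectedin (top_of_set C) C" using C(1) by (simp add: connectedin_subtopology)
  then have "connectedin (top_of A) (f ` C)" by (rule connectedin_continuous_map_image[OF f])
  then have "connectedin (subtopology (top_of A) (layer A d)) (f ` C)"
    using sub by (simp add: connectedin_subtopology)
  moreover have "subtopology (top_of A) (layer A d) \<noteq> trivial_topology"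
    using sub C(2) calculation connectedin_subset_topspace
    by (metis image_is_empty subset_empty topspace_discrete_topology)
  ultimately obtain S where "S \<in> connected_components_of (subtopology (top_of A) (layer A d))" "f ` C \<subseteq> S"
    using exists_connected_component_of_superset by blast
  then show "\<exists>S\<in>strata A. f ` C \<subseteq> S" unfolding strata_def by blast
qed

lemma closed_pdim_le:
  assumes f: "continuous_map (top_of_set C) (top_of A) f" and C: "closed C"
  shows "closed {t \<in> C. pdim A (f t) \<le> d}"
proof -
  have "closedin (top_of_set C) {t \<in> topspace (top_of_set C). f t \<in> {x \<in> topspace (top_of A). pdim A x \<le> d}}"
    by (rule closedin_continuous_map_preimage[OF f closedin_pdim_le])
  moreover have "{t \<in> topspace (top_of_set C). f t \<in> {x \<in> topspace (top_of A). pdim A x \<le> d}} = {t \<in> C. pdim A (f t) \<le> d}"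
    using f by (auto simp: continuous_map_def)
  ultimately show ?thesis using C closedin_closed_trans by metis
qed

text \<open>The filtration is closed, so the dimension along a path cannot drop just after a point.\<close>

lemma pdim_le_at_left_end:
  fixes a b :: real
  assumes f: "continuous_map (top_of_set {a..b}) (top_of A) f" and "a < b"
    and d: "\<And>t. t \<in> {a<..<b} \<Longrightarrow> pdim A (f t) \<le> d"
  shows "pdim A (f a) \<le> d"
proof -
  have "{a<..<b} \<subseteq> {t \<in> {a..b}. pdim A (f t) \<le> d}" using d by auto
  then have "closure {a<..<b} \<subseteq> {t \<in> {a..b}. pdim A (f t) \<le> d}"
    using closed_pdim_le[OF f] by (simp add: closure_minimal)
  moreover have "a \<in> closure {a<..<b}" using \<open>a < b\<close> by simp
  ultimately show ?thesis by blast
qed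

text \<open>The point \<open>u\<close> is the first time after \<open>s\<close> at which the
  dimension has come down to its value at \<open>t\<close>. Such a first time exists because the
  sublevel sets of the dimension are closed.\<close>

lemma entrance_on_jump:
  assumes f: "entrance_on A f a b" and st: "a \<le> s" "s < t" "t \<le> b" and "pdim A (f t) < pdim A (f s)"
  obtains u where "s < u" "u \<le> t" "pdim A (f u) = pdim A (f t)"
    "\<And>v. a \<le> v \<Longrightarrow> v < u \<Longrightarrow> pdim A (f u) < pdim A (f v)"
proof -
  let ?T = "{u \<in> {s..t}. pdim A (f u) \<le> pdim A (f t)}"
  have st': "entrance_on A f s t" using f st by (auto intro: entrance_on_subset)
  have "closed ?T" using st' by (intro closed_pdim_le) (auto simp: entrance_on_def)
  moreover have "t \<in> ?T" using st by auto
  moreover have bd: "bdd_below ?T" by (rule bdd_belowI[of _ s]) simp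
  ultimately have u: "Inf ?T \<in> ?T" by (intro closed_contains_Inf) auto
  define u where "u = Inf ?T"
  have "s < u" using u assms(5) unfolding u_def[symmetric]
    by (metis (no_types, lifting) atLeastAtMost_iff leD mem_Collect_eq order_le_less)
  moreover have "u \<le> t" using u unfolding u_def by auto
  moreover have e: "pdim A (f u) = pdim A (f t)"
    using u entrance_on_mono[OF st', of u t] unfolding u_def[symmetric] by auto
  moreover have "pdim A (f u) < pdim A (f v)" if v: "a \<le> v" "v < u" for v
  proof (cases "v \<ge> s")
    case True
    have "v \<notin> ?T" using cInf_lower[OF _ bd, of v] v(2) unfolding u_def by fastforce
    then show ?thesis using True v \<open>u \<le> t\<close> e by auto
  next
    case False
    then have "pdim A (f s) \<le> pdim A (f v)" using v st by (intro entrance_on_mono[OF f]) auto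
    then show ?thesis using assms(5) e by simp
  qed
  ultimately show ?thesis using that by blast
qed

text \<open>Let \<open>J\<close> be the set of times at which the dimension falls below all its
  earlier values. The dimension is injective on \<open>J\<close> and bounded by its initial value,
  so \<open>J\<close> is finite, and by \<open>entrance_on_jump\<close> no change of dimension can
  avoid \<open>J\<close>.\<close>

lemma entrance_on_cuts:
  assumes f: "entrance_on A f 0 1"
  obtains P where "is_interval_stratification P"
    "\<And>x y. 0 \<le> x \<Longrightarrow> x < y \<Longrightarrow> y \<le> 1 \<Longrightarrow> {x<..y} \<inter> P = {} \<Longrightarrow> pdim A (f x) = pdim A (f y)"
proof -
  define J where "J = {u \<in> {0..1}. \<forall>v. 0 \<le> v \<longrightarrow> v < u \<longrightarrow> pdim A (f u) < pdim A (f v)}"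
  have "inj_on (\<lambda>u. pdim A (f u)) J"
    by (rule linorder_inj_onI) (auto simp: J_def)
  moreover have "(\<lambda>u. pdim A (f u)) ` J \<subseteq> {..pdim A (f 0)}"
    using entrance_on_mono[OF f] by (auto simp: J_def)
  ultimately have "finite J" using finite_image_iff finite_subset by blast
  then have "is_interval_stratification ({0, 1} \<union> J)"
    unfolding is_interval_stratification_def by (auto simp: J_def)
  moreover have "pdim A (f x) = pdim A (f y)"
    if "0 \<le> x" "x < y" "y \<le> 1" "{x<..y} \<inter> ({0, 1} \<union> J) = {}" for x y
  proof (rule ccontr)
    assume "pdim A (f x) \<noteq> pdim A (f y)"
    then have "pdim A (f y) < pdim A (f x)" using entrance_on_mono[OF f, of x y] that by simp
    from entrance_on_jump[OF f that(1,2,3) this] obtain u where "x < u" "u \<le> y"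
      "\<And>v. 0 \<le> v \<Longrightarrow> v < u \<Longrightarrow> pdim A (f u) < pdim A (f v)" by metis
    then have "u \<in> {x<..y} \<inter> J" using that by (auto simp: J_def)
    then show False using that by blast
  qed
  ultimately show ?thesis using that by blast
qed

text \<open>The intervals are open at the left only. At the right end of a gap between
  \<open>0\<close>-strata the dimension may drop, but at the left end it agrees with the value
  inside the gap: it is not larger because the filtration is closed, and not smaller because the
  path is an entrance path.\<close>

lemma entrance_paths_iff:
  "(P, f) \<in> entrance_paths A \<longleftrightarrow> is_interval_stratification P \<and> f \<in> extensional {0..1} \<and>
     entrance_on A f 0 1 \<and>
     (\<forall>x y. 0 \<le> x \<longrightarrow> x < y \<longrightarrow> y \<le> 1 \<longrightarrow> {x<..y} \<inter> P = {} \<longrightarrow> pdim A (f x) = pdim A (f y))"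
proof (intro iffI conjI allI impI)
  assume pf: "(P, f) \<in> entrance_paths A"
  then show P: "is_interval_stratification P" and "f \<in> extensional {0..1}"
    unfolding entrance_paths_def by auto
  have f: "continuous_map II (top_of A) f"
    and st: "\<And>T. T \<in> interval_strata P \<Longrightarrow> \<exists>S\<in>strata A. f ` T \<subseteq> S"
    and mono: "\<And>s t d e. 0 \<le> s \<Longrightarrow> s \<le> t \<Longrightarrow> t \<le> 1 \<Longrightarrow> f s \<in> layer A d \<Longrightarrow> f t \<in> layer A e \<Longrightarrow> e \<le> d"
    using pf unfolding entrance_paths_def stratum_preserving_def by blast+
  have inX: "f t \<in> topspace (top_of A)" if "t \<in> {0..1}" for t
    using f that by (auto simp: continuous_map_def)
  show fe: "entrance_on A f 0 1"
    unfolding entrance_on_def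
  proof (intro conjI allI impI)
    show "continuous_map II (top_of A) f" by fact
    fix s t :: real assume "0 \<le> s" "s \<le> t" "t \<le> 1"
    then show "pdim A (f t) \<le> pdim A (f s)"
      using mono[of s t "pdim A (f s)" "pdim A (f t)"] inX by (simp add: layer_iff_pdim)
  qed
  fix x y :: real assume xy: "0 \<le> x" "x < y" "y \<le> 1" "{x<..y} \<inter> P = {}"
  have fin: "finite P" "0 \<in> P" "1 \<in> P" "P \<subseteq> {0..1}" using P unfolding is_interval_stratification_def by auto
  let ?L = "{p \<in> P. p \<le> x}" and ?R = "{p \<in> P. y < p}"
  have "y \<noteq> 1" using xy fin(3) by auto
  then have LR: "finite ?L" "?L \<noteq> {}" "finite ?R" "?R \<noteq> {}" using fin xy by auto
  \<comment> \<open>The last \<open>0\<close>-stratum up to \<open>x\<close> and the first one after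
    \<open>y\<close>. No \<open>0\<close>-stratum lies strictly between them, so the open interval
    from \<open>p\<close> to \<open>q\<close> is a stratum.\<close>
  define p q where "p = Max ?L" and "q = Min ?R"
  have p: "p \<in> P" "p \<le> x" and q: "q \<in> P" "y < q"
    using Max_in[OF LR(1,2)] Min_in[OF LR(3,4)] unfolding p_def q_def by auto
  have e: "{p<..<q} \<inter> P = {}"
  proof (rule ccontr)
    assume "{p<..<q} \<inter> P \<noteq> {}"
    then obtain r where r: "r \<in> P" "p < r" "r < q" by auto
    then have "r \<notin> {x<..y}" using xy(4) by blast
    then consider "r \<le> x" | "y < r" by fastforce
    then show False
      using Max_ge[OF LR(1), of r] Min_le[OF LR(3), of r] r unfolding p_def q_def by cases auto
  qed
  have "0 \<le> p" "q \<le> 1" using p q fin(4) by auto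
  then have pq: "continuous_map (top_of_set {p..q}) (top_of A) f"
    by (intro continuous_map_from_subtopology_mono[OF f]) auto
  have "p < q" using p q xy by simp
  have "{p<..<q} \<in> interval_strata P" using p q e \<open>p < q\<close> unfolding interval_strata_def by auto
  then have "\<exists>S\<in>strata A. f ` {p<..<q} \<subseteq> S" by (rule st)
  moreover have "continuous_map (top_of_set {p<..<q}) (top_of A) f"
    by (rule continuous_map_from_subtopology_mono[OF pq]) auto
  moreover have "connected {p<..<q}" "{p<..<q} \<noteq> {}" using \<open>p < q\<close> by auto
  ultimately have "\<exists>d. \<forall>t\<in>{p<..<q}. pdim A (f t) = d"
    by (subst in_stratum_iff_pdim_const[symmetric])
  then obtain d where d: "\<And>t. t \<in> {p<..<q} \<Longrightarrow> pdim A (f t) = d" by blast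
  \<comment> \<open>The dimensions at \<open>p\<close>, \<open>x\<close> and \<open>y\<close>
    decrease in this order, and the first is bounded by the last.\<close>
  have "pdim A (f p) \<le> d" using d by (intro pdim_le_at_left_end[OF pq \<open>p < q\<close>]) auto
  moreover have "pdim A (f x) \<le> pdim A (f p)" "pdim A (f y) \<le> pdim A (f x)"
    using entrance_on_mono[OF fe] xy p \<open>0 \<le> p\<close> by auto
  moreover have "pdim A (f y) = d" using d p q xy by auto
  ultimately show "pdim A (f x) = pdim A (f y)" by simp
next
  assume *: "is_interval_stratification P \<and> f \<in> extensional {0..1} \<and> entrance_on A f 0 1 \<and>
     (\<forall>x y. 0 \<le> x \<longrightarrow> x < y \<longrightarrow> y \<le> 1 \<longrightarrow> {x<..y} \<inter> P = {} \<longrightarrow> pdim A (f x) = pdim A (f y))"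
  then have P0: "is_interval_stratification P" and ext: "f \<in> extensional {0..1}"
    and fe: "entrance_on A f 0 1"
    by blast+
  have eq0: "pdim A (f x) = pdim A (f y)" if "0 \<le> x" "x < y" "y \<le> 1" "{x<..y} \<inter> P = {}" for x y
    using * that by blast
  have P: "P \<subseteq> {0..1}" using P0 unfolding is_interval_stratification_def by blast
  have "\<exists>S\<in>strata A. f ` T \<subseteq> S" if T: "T \<in> interval_strata P" for T
  proof -
    have "connected T" "T \<noteq> {}" and T01: "T \<subseteq> {0..1}" using interval_stratum[OF P0 T] by auto
    moreover have "continuous_map (top_of_set T) (top_of A) f"
      by (rule continuous_map_from_subtopology_mono[OF entrance_on_continuous[OF fe] T01])
    moreover have "\<exists>d. \<forall>x\<in>T. pdim A (f x) = d"
    proof -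
      have eq: "pdim A (f x) = pdim A (f y)" if "x \<in> T" "y \<in> T" "x < y" for x y
      proof -
        have "T \<notin> (\<lambda>t. {t}) ` P" using that by auto
        then obtain a b where ab: "T = {a<..<b}" "{a<..<b} \<inter> P = {}"
          using T unfolding interval_strata_def by blast
        have "{x<..y} \<subseteq> {a<..<b}" using that ab(1) by auto
        then have "{x<..y} \<inter> P = {}" using ab(2) by blast
        then show ?thesis using T01 that by (intro eq0) auto
      qed
      then have "pdim A (f x) = pdim A (f y)" if "x \<in> T" "y \<in> T" for x y
        using that by (metis linorder_neqE)
      then show ?thesis by blast
    qed
    ultimately show ?thesis by (subst in_stratum_iff_pdim_const)
  qed
  moreover have "e \<le> d" if "0 \<le> s" "s \<le> t" "t \<le> 1" "f s \<in> layer A d" "f t \<in> layer A e" for s t d e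
    using that entrance_on_mono[OF fe that(1-3)] by (auto simp: layer_iff_pdim)
  ultimately have **: "stratum_preserving II (interval_strata P) (top_of A) (strata A) f" "\<forall>s t d e. 0 \<le> s \<longrightarrow> s \<le> t \<longrightarrow> t \<le> 1 \<longrightarrow> f s \<in> layer A d \<longrightarrow> f t \<in> layer A e \<longrightarrow> e \<le> d"
    using entrance_on_continuous[OF fe] unfolding stratum_preserving_def by blast+
  show "(P, f) \<in> entrance_paths A"
    unfolding entrance_paths_def using P0 ext ** by simp
qed

end

subsection \<open>Basic open sets\<close>

lemma filtered_sub_sub: "V \<subseteq> U \<Longrightarrow> filtered_sub (filtered_sub A U) V = filtered_sub A V"
  unfolding filtered_sub_def by (auto simp: subtopology_subtopology Int_absorb1)

lemma layer_filtered_sub: "layer (filtered_sub A U) d = U \<inter> layer A d"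
  unfolding layer_def filtered_sub_def by (cases d) auto

lemma pdim_filtered_sub: "x \<in> U \<Longrightarrow> pdim (filtered_sub A U) x = pdim A x"
  unfolding pdim_def filtered_sub_def by simp

lemma is_filtered_space_sub:
  assumes "is_filtered_space A"
  shows "is_filtered_space (filtered_sub A U)"
  using assms unfolding is_filtered_space_def filtered_sub_def mono_def
  by (auto simp: closedin_subtopology_Int_closed)

text \<open>The restricted filtration keeps the number of steps of \<open>A\<close>, so the formal
  dimension required of a link is the same in \<open>U\<close> as in \<open>A\<close>.\<close>

lemma basic_open_filtered_sub:
  assumes "openin (top_of A) U"
  shows "basic_open (filtered_sub A U) x V \<longleftrightarrow> basic_open A x V \<and> V \<subseteq> U"
proof -
  have open_iff: "openin (top_of (filtered_sub A U)) V \<longleftrightarrow> openin (top_of A) V \<and> V \<subseteq> U"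
    using openin_open_subtopology[OF assms] by (simp add: filtered_sub_def)
  have st: "steps (filtered_sub A U) = steps A" by (simp add: filtered_sub_def)
  show ?thesis
  proof (cases "V \<subseteq> U \<and> x \<in> V")
    case True
    then have "filtered_sub (filtered_sub A U) V = filtered_sub A V" "x \<in> U"
      using filtered_sub_sub by blast+
    then show ?thesis unfolding basic_open_def open_iff st layer_filtered_sub
      using True by simp
  next
    case False
    then show ?thesis unfolding basic_open_def open_iff by argo
  qed
qed

lemma topspace_cone_topology: "topspace (cone_topology L) = insert None (Some ` (topspace L \<times> {0<..}))"
proof
  have "cone_open L (topspace (cone_topology L))"
    by (simp add: openin_cone_topology[symmetric])
  then show "topspace (cone_topology L) \<subseteq> insert None (Some ` (topspace L \<times> {0<..}))"
    unfolding cone_open_def by blast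
  have "{p. Some p \<in> insert None (Some ` (topspace L \<times> {0<..}))} = topspace (prod_topology L (top_of_set {0<..}))"
    by auto
  then have "openin (prod_topology L (top_of_set {0<..})) {p. Some p \<in> insert None (Some ` (topspace L \<times> {0<..}))}"
    by (metis openin_topspace)
  moreover have "Some ` (topspace L \<times> {0<..<1::real}) \<subseteq> insert None (Some ` (topspace L \<times> {0<..}))" by auto
  ultimately have "cone_open L (insert None (Some ` (topspace L \<times> {0<..})))"
    unfolding cone_open_def by (intro conjI impI exI[of _ 1]) simp_all
  then show "insert None (Some ` (topspace L \<times> {0<..})) \<subseteq> topspace (cone_topology L)"
    unfolding openin_cone_topology[symmetric] by (rule openin_subset)
qed

text \<open>The map takes each skeleton onto the corresponding one, and being injective on the whole
  space it also reflects them.\<close>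

lemma homeomorphic_map_skel_iff:
  assumes "filtered_homeomorphism M N h" "z \<in> topspace (top_of M)"
  shows "h z \<in> skel N i \<longleftrightarrow> z \<in> skel M i"
proof -
  have h: "homeomorphic_map (top_of M) (top_of N) h"
    and hi: "homeomorphic_map (subtopology (top_of M) (skel M i)) (subtopology (top_of N) (skel N i)) h"
    using assms unfolding filtered_homeomorphism_def by auto
  have inj: "inj_on h (topspace (top_of M))" and im: "h ` topspace (top_of M) = topspace (top_of N)"
    using h by (auto simp: homeomorphic_eq_everything_map)
  have "h ` (topspace (top_of M) \<inter> skel M i) = topspace (top_of N) \<inter> skel N i"
    using hi by (auto simp: homeomorphic_eq_everything_map)
  moreover have "h z \<in> topspace (top_of N)" using im assms(2) by blast
  ultimately have "h z \<in> skel N i \<longleftrightarrow> h z \<in> h ` (topspace (top_of M) \<inter> skel M i)" by simp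
  also have "\<dots> \<longleftrightarrow> z \<in> topspace (top_of M) \<inter> skel M i"
    using inj_on_image_mem_iff[OF inj assms(2)] by simp
  finally show ?thesis using assms(2) by simp
qed

abbreviation cone_chart :: "nat \<Rightarrow> 'a filtered \<Rightarrow> ((nat \<Rightarrow> real) \<times> ('a \<times> real) option) filtered" where
  "cone_chart d L \<equiv> filtered_prod (filtered_Euclidean d) (filtered_cone L)"

lemma top_of_cone_chart:
  "top_of (cone_chart d L) = prod_topology (Euclidean_space d) (cone_topology (top_of L))"
  by (simp add: filtered_prod_def filtered_Euclidean_def filtered_cone_def)

lemma skel_cone_chart:
  "(u, v) \<in> skel (cone_chart d L) i \<longleftrightarrow>
     u \<in> topspace (Euclidean_space d) \<and> (\<exists>j. d + j \<le> i \<and> v \<in> skel (filtered_cone L) j)"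
proof -
  have "(u, v) \<in> skel (cone_chart d L) i \<longleftrightarrow> (\<exists>m j. m + j = i \<and> \<not> m < d \<and>
      u \<in> topspace (Euclidean_space d) \<and> v \<in> skel (filtered_cone L) j)"
    by (simp add: filtered_prod_def filtered_Euclidean_def) fastforce
  moreover have "(\<exists>m. m + j = i \<and> \<not> m < d) \<longleftrightarrow> d + j \<le> i" for j
    by presburger
  ultimately show ?thesis by blast
qed

text \<open>The common mechanism for moving and for shrinking basic opens: a chart is precomposed
  with a homeomorphism \<open>k\<close> of the model onto an open part \<open>W\<close> of it that
  respects the skeleta. The link stays the same, only the point under the origin changes.\<close>

lemma basic_open_reembed:
  fixes A L :: "'a filtered"
  assumes U: "openin (top_of A) U" and L: "is_filtered_space L"
    and dim: "formal_dim L = int (steps A) - int d - 1"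
    and h: "filtered_homeomorphism (cone_chart d L) (filtered_sub A U) h"
    and W: "openin (top_of (cone_chart d L)) W"
    and k: "homeomorphic_map (top_of (cone_chart d L)) (subtopology (top_of (cone_chart d L)) W) k"
    and skel: "\<And>z i. z \<in> topspace (top_of (cone_chart d L)) \<Longrightarrow>
      k z \<in> skel (cone_chart d L) i \<longleftrightarrow> z \<in> skel (cone_chart d L) i"
    and x: "h (k (\<lambda>_. 0, None)) = x" "x \<in> layer A d"
  shows "basic_open A x (h ` W)"
proof -
  let ?M = "cone_chart d L"
  let ?V = "h ` W"
  have hU: "homeomorphic_map (top_of ?M) (subtopology (top_of A) U) h"
    using h unfolding filtered_homeomorphism_def filtered_sub_def by simp
  have WM: "W \<subseteq> topspace (top_of ?M)" using W openin_subset by blast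
  have "openin (subtopology (top_of A) U) ?V" using hU W WM homeomorphic_map_openness by blast
  then have V: "openin (top_of A) ?V" "?V \<subseteq> U" using openin_open_subtopology[OF U] by auto
  have "h ` (topspace (top_of ?M) \<inter> W) = topspace (subtopology (top_of A) U) \<inter> ?V"
    using WM V openin_subset[OF V(1)] by auto
  from homeomorphic_map_subtopologies[OF hU this]
  have hV: "homeomorphic_map (subtopology (top_of ?M) W) (subtopology (top_of A) ?V) h"
    using V(2) by (simp add: subtopology_subtopology Int_absorb1)
  let ?g = "h \<circ> k"
  have g: "homeomorphic_map (top_of ?M) (top_of (filtered_sub A ?V)) ?g"
    using homeomorphic_map_compose[OF k hV] by (simp add: filtered_sub_def)
  have kW: "k z \<in> W" if "z \<in> topspace (top_of ?M)" for z
    using k that by (auto simp: homeomorphic_eq_everything_map)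
  have sk: "?g z \<in> skel (filtered_sub A ?V) i \<longleftrightarrow> z \<in> skel ?M i" if z: "z \<in> topspace (top_of ?M)" for z i
  proof -
    have "h (k z) \<in> U \<inter> skel A i \<longleftrightarrow> k z \<in> skel ?M i"
      using homeomorphic_map_skel_iff[OF h, of "k z" i] kW[OF z] WM by (auto simp: filtered_sub_def)
    then show ?thesis using skel[OF z] kW[OF z] V(2) by (auto simp: filtered_sub_def)
  qed
  have "filtered_homeomorphism ?M (filtered_sub A ?V) ?g"
    unfolding filtered_homeomorphism_def using g sk
    by (auto intro!: homeomorphic_map_subtopologies_alt)
  moreover have "(\<lambda>_. 0, None) \<in> topspace (top_of ?M)"
    by (simp add: top_of_cone_chart topspace_cone_topology topspace_Euclidean_space)
  then have "x \<in> ?V" using kW x(1) by blast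
  ultimately show ?thesis unfolding basic_open_def
    using V(1) x L dim by (intro conjI exI[of _ d] exI[of _ L] exI[of _ ?g]) auto
qed

text \<open>Translations of the Euclidean factor move the cone points along the stratum.\<close>

lemma basic_open_translate:
  fixes A :: "'a filtered"
  assumes A: "is_filtered_space A" and b: "basic_open A x U" and y: "y \<in> U" "pdim A y = pdim A x"
  shows "basic_open A y U"
proof -
  from b obtain d and L :: "'a filtered" and h where U: "openin (top_of A) U" and x: "x \<in> layer A d" and L: "is_filtered_space L"
    and dim: "formal_dim L = int (steps A) - int d - 1"
    and h: "filtered_homeomorphism (cone_chart d L) (filtered_sub A U) h"
    unfolding basic_open_def by blast
  let ?M = "cone_chart d L" and ?E = "Euclidean_space d"
  have hU: "homeomorphic_map (top_of ?M) (subtopology (top_of A) U) h"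
    using h unfolding filtered_homeomorphism_def filtered_sub_def by simp
  have UX: "U \<subseteq> topspace (top_of A)" using U openin_subset by blast
  have yd: "y \<in> layer A d" using x y UX layer_iff_pdim[OF A] by auto
  obtain z where z: "z \<in> topspace (top_of ?M)" "h z = y"
    using hU y(1) UX by (force simp: homeomorphic_eq_everything_map)
  obtain c v where cv: "z = (c, v)" by (cases z)
  have "y \<in> skel (filtered_sub A U) d" using yd y(1) by (auto simp: layer_def filtered_sub_def)
  \<comment> \<open>In degree \<open>d\<close> the model is the Euclidean factor times the cone
    point. So \<open>y\<close> lies on the axis of the chart, where a translation of the Euclidean
    factor carries the origin to it.\<close>
  then have "z \<in> skel ?M d" using homeomorphic_map_skel_iff[OF h z(1)] z(2) by simp
  then have "v = None" unfolding cv skel_cone_chart by (auto simp: filtered_cone_def)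
  have c: "c \<in> topspace ?E" using z(1) cv by (simp add: top_of_cone_chart)
  let ?t = "\<lambda>(s::real) u i. u i + s * c i :: real"
  have tc: "continuous_map ?E ?E (?t s)" for s
    unfolding Euclidean_space_def continuous_map_in_subtopology continuous_map_componentwise_UNIV
    using c by (auto simp: topspace_Euclidean_space Pi_iff intro!: continuous_map_add continuous_map_from_subtopology continuous_map_product_projection)
  have t: "homeomorphic_maps ?E ?E (?t 1) (?t (-1))"
    unfolding homeomorphic_maps_def using tc[of 1] tc[of "-1"] by simp
  have "homeomorphic_maps (top_of ?M) (top_of ?M) (\<lambda>(u, v). (?t 1 u, id v)) (\<lambda>(u, v). (?t (-1) u, id v))"
    unfolding top_of_cone_chart homeomorphic_maps_prod using t homeomorphic_maps_id by blast
  then have k: "homeomorphic_map (top_of ?M) (top_of ?M) (\<lambda>(u, v). (?t 1 u, id v))"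
    by (rule homeomorphic_maps_imp_map)
  have "basic_open A y (h ` topspace (top_of ?M))"
  proof (rule basic_open_reembed[OF U L dim h _ _ _ _ yd])
    show "homeomorphic_map (top_of ?M) (subtopology (top_of ?M) (topspace (top_of ?M))) (\<lambda>(u, v). (?t 1 u, id v))"
      using k by simp
    fix z i assume zM: "z \<in> topspace (top_of ?M)"
    then have "fst z \<in> topspace ?E" by (auto simp: top_of_cone_chart)
    moreover then have "?t 1 (fst z) \<in> topspace ?E"
      using tc[of 1] by (auto simp: continuous_map_def)
    ultimately show "(\<lambda>(u, v). (?t 1 u, id v)) z \<in> skel ?M i \<longleftrightarrow> z \<in> skel ?M i"
      by (cases z) (simp add: skel_cone_chart)
  next
    show "h ((\<lambda>(u, v). (?t 1 u, id v)) (\<lambda>_. 0, None)) = y"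
      using z(2) cv \<open>v = None\<close> by simp
  qed simp
  moreover have "h ` topspace (top_of ?M) = U"
    using hU UX by (auto simp: homeomorphic_eq_everything_map)
  ultimately show ?thesis by simp
qed

section \<open>Shrinking basic opens: cubes and truncated cones\<close>

lemma openin_Euclidean_cube:
  "openin (Euclidean_space d) {u \<in> topspace (Euclidean_space d). \<forall>i. \<bar>u i\<bar> < \<epsilon>}"
  if "\<epsilon> > 0" for \<epsilon> :: real
proof -
  have op: "openin (Euclidean_space d) {u \<in> topspace (Euclidean_space d). \<forall>i<n. \<bar>u i\<bar> < \<epsilon>}" for n
  proof (induction n)
    case (Suc n)
    have "continuous_map (Euclidean_space d) euclideanreal (\<lambda>u. u n)"
      unfolding Euclidean_space_def
      by (intro continuous_map_from_subtopology continuous_map_product_projection) simp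
    then have "openin (Euclidean_space d) {u \<in> topspace (Euclidean_space d). u n \<in> {-\<epsilon><..<\<epsilon>}}"
      by (rule openin_continuous_map_preimage) simp
    with Suc have "openin (Euclidean_space d) ({u \<in> topspace (Euclidean_space d). \<forall>i<n. \<bar>u i\<bar> < \<epsilon>} \<inter>
      {u \<in> topspace (Euclidean_space d). u n \<in> {-\<epsilon><..<\<epsilon>}})" by (rule openin_Int)
    moreover have "({u \<in> topspace (Euclidean_space d). \<forall>i<n. \<bar>u i\<bar> < \<epsilon>} \<inter>
      {u \<in> topspace (Euclidean_space d). u n \<in> {-\<epsilon><..<\<epsilon>}}) =
      {u \<in> topspace (Euclidean_space d). \<forall>i<Suc n. \<bar>u i\<bar> < \<epsilon>}"
    proof -
      have "\<bar>u n\<bar> < \<epsilon> \<longleftrightarrow> u n \<in> {-\<epsilon><..<\<epsilon>}" for u :: "nat \<Rightarrow> real" by (simp add: abs_less_iff) linarith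
      then show ?thesis unfolding All_less_Suc by blast
    qed
    ultimately show ?case by simp
  qed simp
  \<comment> \<open>An open set of the product topology can impose only finitely many coordinate
    conditions. The coordinates from \<open>d\<close> on vanish, so the first \<open>d\<close>
    conditions are all there is.\<close>
  have "(\<forall>i<d. \<bar>u i\<bar> < \<epsilon>) \<longleftrightarrow> (\<forall>i. \<bar>u i\<bar> < \<epsilon>)" if "u \<in> topspace (Euclidean_space d)" for u
  proof -
    have "\<bar>u i\<bar> < \<epsilon>" if "\<not> i < d" for i
      using that \<open>u \<in> topspace (Euclidean_space d)\<close> \<open>\<epsilon> > 0\<close> by (simp add: topspace_Euclidean_space)
    then show ?thesis by blast
  qed
  then have "{u \<in> topspace (Euclidean_space d). \<forall>i<d. \<bar>u i\<bar> < \<epsilon>} =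
      {u \<in> topspace (Euclidean_space d). \<forall>i. \<bar>u i\<bar> < \<epsilon>}" by (intro Collect_cong conj_cong refl)
  then show ?thesis using op[of d] by simp
qed

lemma Euclidean_cube_in_open:
  assumes "openin (Euclidean_space d) E" "(\<lambda>_. 0) \<in> E"
  obtains \<epsilon> :: real where "\<epsilon> > 0" "{u \<in> topspace (Euclidean_space d). \<forall>i. \<bar>u i\<bar> < \<epsilon>} \<subseteq> E"
proof -
  obtain T where T: "openin (powertop_real UNIV) T" "E = T \<inter> topspace (Euclidean_space d)"
    using assms(1) unfolding Euclidean_space_def openin_subtopology by (auto simp: topspace_Euclidean_space)
  then have "(\<lambda>_. 0) \<in> T" using assms(2) by simp
  with T(1) obtain N where N: "finite {i. N i \<noteq> (UNIV :: real set)}" "\<And>i. open (N i)"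
    "\<And>i. 0 \<in> N i" "Pi UNIV N \<subseteq> T"
    unfolding openin_product_topology_alt by (auto simp: PiE_UNIV_domain Pi_iff dest!: bspec[of T _ "\<lambda>_. 0"])
  have "\<exists>e>0. \<forall>t. \<bar>t\<bar> < e \<longrightarrow> t \<in> N i" for i
    using N(2)[of i] N(3)[of i] unfolding open_dist dist_real_def by (metis diff_zero)
  then obtain e where e: "\<And>i. e i > (0::real)" "\<And>i t. \<bar>t\<bar> < e i \<Longrightarrow> t \<in> N i" by metis
  \<comment> \<open>A basic open box restricts only finitely many coordinates, so the minimum is
    positive; the \<open>1\<close> keeps the set nonempty if no coordinate is restricted.\<close>
  define \<epsilon> where "\<epsilon> = Min (insert 1 (e ` {i. N i \<noteq> UNIV}))"
  have "\<epsilon> > 0" unfolding \<epsilon>_def using N(1) e(1) by auto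
  moreover have "u i \<in> N i" if "\<bar>u i\<bar> < \<epsilon>" for u :: "nat \<Rightarrow> real" and i
  proof (cases "N i = UNIV")
    case False
    then have "\<epsilon> \<le> e i" unfolding \<epsilon>_def using N(1) by (intro Min_le) auto
    then show ?thesis using e(2)[of "u i" i] that by simp
  qed simp
  then have "{u \<in> topspace (Euclidean_space d). \<forall>i. \<bar>u i\<bar> < \<epsilon>} \<subseteq> E" using N(4) T(2) by auto
  ultimately show ?thesis using that by blast
qed

text \<open>Each coordinate is contracted from the line to the interval of radius \<epsilon>. The
  contraction fixes 0, so vanishing coordinates and the origin are preserved. Cubes are used instead
  of balls because the map then acts on each coordinate separately.\<close>

lemma homeomorphic_map_Euclidean_cube:
  fixes \<epsilon> :: real
  assumes "\<epsilon> > 0"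
  shows "homeomorphic_map (Euclidean_space d)
     (subtopology (Euclidean_space d) {u \<in> topspace (Euclidean_space d). \<forall>i. \<bar>u i\<bar> < \<epsilon>})
     (\<lambda>u i. \<epsilon> * u i / (1 + \<bar>u i\<bar>))"
proof -
  let ?E = "Euclidean_space d" and ?O = "{u \<in> topspace (Euclidean_space d). \<forall>i. \<bar>u i\<bar> < \<epsilon>}"
  let ?f = "\<lambda>x. \<epsilon> * x / (1 + \<bar>x\<bar>)" and ?g = "\<lambda>x. x / (\<epsilon> - \<bar>x\<bar>)"
  have pos: "1 + \<bar>x\<bar> > 0" for x :: real by linarith
  have abs_f: "\<bar>?f x\<bar> = \<epsilon> * \<bar>x\<bar> / (1 + \<bar>x\<bar>)" for x using assms pos[of x] by (simp add: abs_mult)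
  have f_less: "\<bar>?f x\<bar> < \<epsilon>" for x
  proof -
    have "\<epsilon> * \<bar>x\<bar> < \<epsilon> * (1 + \<bar>x\<bar>)" using assms by (intro mult_strict_left_mono) auto
    then show ?thesis unfolding abs_f using pos[of x] by (simp add: divide_less_eq)
  qed
  have gf: "?g (?f x) = x" for x
  proof -
    have "\<epsilon> - \<bar>?f x\<bar> = \<epsilon> / (1 + \<bar>x\<bar>)" unfolding abs_f using pos[of x] by (simp add: field_simps)
    then show ?thesis using assms pos[of x] by simp
  qed
  have fg: "?f (?g x) = x" if "\<bar>x\<bar> < \<epsilon>" for x
  proof -
    have "\<bar>?g x\<bar> = \<bar>x\<bar> / (\<epsilon> - \<bar>x\<bar>)" using that by simp
    then have "1 + \<bar>?g x\<bar> = \<epsilon> / (\<epsilon> - \<bar>x\<bar>)" using that by (simp add: field_simps)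
    then show ?thesis using assms that by simp
  qed
  have proj: "continuous_map ?E euclideanreal (\<lambda>u. u i)" for i
    unfolding Euclidean_space_def
    by (intro continuous_map_from_subtopology continuous_map_product_projection) simp
  have cf: "continuous_map ?E (subtopology ?E ?O) (\<lambda>u i. ?f (u i))"
  proof -
    have "continuous_on UNIV ?f" by (intro continuous_intros) (use pos in \<open>simp add: less_imp_neq[symmetric]\<close>)
    then have "continuous_map euclideanreal euclideanreal ?f" by simp
    then have "continuous_map ?E euclideanreal (?f \<circ> (\<lambda>u. u i))" for i
      by (rule continuous_map_compose[OF proj])
    then have "continuous_map ?E (powertop_real UNIV) (\<lambda>u i. ?f (u i))"
      unfolding continuous_map_componentwise_UNIV by (simp add: comp_def)
    moreover have "(\<lambda>i. ?f (u i)) \<in> ?O" if "u \<in> topspace ?E" for u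
      using that f_less by (simp add: topspace_Euclidean_space)
    ultimately show ?thesis
      by (auto simp: continuous_map_in_subtopology Euclidean_space_def topspace_Euclidean_space subtopology_subtopology)
  qed
  have cg: "continuous_map (subtopology ?E ?O) ?E (\<lambda>u i. ?g (u i))"
  proof -
    have "continuous_on {-\<epsilon><..<\<epsilon>} ?g" by (intro continuous_intros) auto
    then have "continuous_map (top_of_set {-\<epsilon><..<\<epsilon>}) euclideanreal ?g" by simp
    moreover have "continuous_map (subtopology ?E ?O) (top_of_set {-\<epsilon><..<\<epsilon>}) (\<lambda>u. u i)" for i
      unfolding continuous_map_in_subtopology using proj
      by (auto simp: continuous_map_from_subtopology abs_less_iff minus_less_iff)
    ultimately have "continuous_map (subtopology ?E ?O) euclideanreal (?g \<circ> (\<lambda>u. u i))" for i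
      by (rule continuous_map_compose[rotated])
    then have "continuous_map (subtopology ?E ?O) (powertop_real UNIV) (\<lambda>u i. ?g (u i))"
      unfolding continuous_map_componentwise_UNIV by (simp add: comp_def)
    then show ?thesis
      by (subst (2) Euclidean_space_def) (auto simp: continuous_map_in_subtopology topspace_Euclidean_space)
  qed
  have "homeomorphic_maps ?E (subtopology ?E ?O) (\<lambda>u i. ?f (u i)) (\<lambda>u i. ?g (u i))"
    unfolding homeomorphic_maps_def
  proof (intro conjI cf cg ballI)
    show "(\<lambda>i. ?g (?f (u i))) = u" for u by (simp only: gf)
    show "(\<lambda>i. ?f (?g (u i))) = u" if "u \<in> topspace (subtopology ?E ?O)" for u
      by (rule ext, rule fg) (use that in simp)
  qed
  then show ?thesis by (rule homeomorphic_maps_imp_map)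
qed

text \<open>The radius is contracted by the function used for the cubes, and the point of the link
  is kept. Away from the cone point this is a product of homeomorphisms. At the cone point, whose
  neighbourhoods contain a whole collar \<open>L \<times> (0, \<delta>)\<close>, it is enough that
  small radii go to small radii and come from small radii.\<close>

lemma homeomorphic_map_cone_nbhd:
  fixes \<epsilon> :: real and L :: "'a topology"
  assumes "\<epsilon> > 0"
  defines "N \<equiv> insert None (Some ` (topspace L \<times> {0<..<\<epsilon>}))"
  shows "openin (cone_topology L) N"
    and "homeomorphic_map (cone_topology L) (subtopology (cone_topology L) N)
      (map_option (\<lambda>(l, r). (l, \<epsilon> * r / (1 + r))))"
proof -
  let ?B = "top_of_set {0::real<..}" and ?B' = "top_of_set {0<..<\<epsilon>}"
  let ?C = "cone_topology L"
  let ?f = "\<lambda>r. \<epsilon> * r / (1 + r)" and ?g = "\<lambda>s. s / (\<epsilon> - s)"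
  let ?F = "\<lambda>(l, r). (l, ?f r)"
  let ?k = "map_option ?F"
  have sub: "prod_topology L ?B' = subtopology (prod_topology L ?B) (topspace L \<times> {0<..<\<epsilon>})"
  proof -
    have "{0<..} \<inter> {0<..<\<epsilon>} = {0<..<\<epsilon>}" by auto
    then show ?thesis by (simp add: prod_topology_subtopology subtopology_subtopology Times_Int_Times)
  qed
  have opB: "openin (prod_topology L ?B) (topspace L \<times> {0<..<\<epsilon>})"
    by (auto simp: openin_prod_Times_iff openin_open_eq)
  have "{p. Some p \<in> N} = topspace L \<times> {0<..<\<epsilon>}" unfolding N_def by auto
  moreover have "N \<subseteq> insert None (Some ` (topspace L \<times> {0<..}))" unfolding N_def by auto
  moreover have "Some ` (topspace L \<times> {0<..<\<epsilon>}) \<subseteq> N" unfolding N_def by blast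
  ultimately show N: "openin ?C N"
    unfolding openin_cone_topology cone_open_def
    by (intro conjI impI exI[of _ \<epsilon>]) (simp_all only: opB assms(1))
  have f: "0 < ?f r \<and> ?f r < \<epsilon> \<and> ?g (?f r) = r" if "r > 0" for r
  proof -
    have "?f r = \<epsilon> * (r / (1 + r))" "r / (1 + r) < 1" using that by (auto simp: field_simps)
    then have "?f r < \<epsilon>" using assms by (metis mult.right_neutral mult_strict_left_mono)
    moreover have "\<epsilon> - ?f r = \<epsilon> / (1 + r)" using that by (simp add: field_simps)
    ultimately show ?thesis using that assms by simp
  qed
  have g: "0 < ?g s \<and> ?f (?g s) = s" if "0 < s" "s < \<epsilon>" for s
  proof -
    have "1 + ?g s = \<epsilon> / (\<epsilon> - s)" using that by (simp add: field_simps)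
    then show ?thesis using that assms by simp
  qed
  have "homeomorphic_maps ?B ?B' ?f ?g"
    unfolding homeomorphic_maps_def
  proof (intro conjI ballI)
    have "continuous_on {0<..} ?f" "continuous_on {0<..<\<epsilon>} ?g" by (intro continuous_intros; force)+
    then show "continuous_map ?B ?B' ?f" "continuous_map ?B' ?B ?g" using f g by simp_all
    show "?g (?f r) = r" if "r \<in> topspace ?B" for r using f that by simp
    show "?f (?g r) = r" if "r \<in> topspace ?B'" for r using g that by simp
  qed
  then have "homeomorphic_maps (prod_topology L ?B) (prod_topology L ?B') (\<lambda>(l, r). (id l, ?f r)) (\<lambda>(l, r). (id l, ?g r))"
    unfolding homeomorphic_maps_prod using homeomorphic_maps_id by blast
  then have F: "homeomorphic_map (prod_topology L ?B) (subtopology (prod_topology L ?B) (topspace L \<times> {0<..<\<epsilon>})) ?F"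
    unfolding sub by (intro homeomorphic_maps_imp_map) simp
  then have Fc: "continuous_map (prod_topology L ?B) (prod_topology L ?B) ?F"
    by (simp add: homeomorphic_eq_everything_map continuous_map_in_subtopology)
  have Fo: "openin (prod_topology L ?B) (?F ` V)" if V: "openin (prod_topology L ?B) V" for V
  proof -
    have "openin (subtopology (prod_topology L ?B) (topspace L \<times> {0<..<\<epsilon>})) (?F ` V)"
      using F V homeomorphic_map_openness openin_subset by blast
    then show ?thesis using openin_open_subtopology[OF opB] by simp
  qed
  have kN: "?k ` topspace ?C = N"
  proof -
    have "(topspace L \<times> {0<..}) \<inter> (topspace L \<times> {0<..<\<epsilon>}) = topspace L \<times> {0<..<\<epsilon>}" by auto
    then have "?F ` (topspace L \<times> {0<..}) = topspace L \<times> {0<..<\<epsilon>}"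
      using homeomorphic_imp_surjective_map[OF F]
      by (simp only: topspace_prod_topology topspace_subtopology topspace_euclidean Int_UNIV_left)
    moreover have "?k ` Some ` (topspace L \<times> {0<..}) = Some ` ?F ` (topspace L \<times> {0<..})"
      by (simp only: image_image option.map)
    ultimately show ?thesis unfolding topspace_cone_topology N_def by simp
  qed
  show "homeomorphic_map ?C (subtopology ?C N) ?k"
  proof (rule bijective_open_imp_homeomorphic_map)
    have "N \<subseteq> topspace ?C" using N openin_subset by blast
    then show "?k ` topspace ?C = topspace (subtopology ?C N)" using kN by auto
    show "inj_on ?k (topspace ?C)"
    proof (rule inj_onI)
      fix v w assume v: "v \<in> topspace ?C" "w \<in> topspace ?C" "?k v = ?k w"
      have "inj_on ?F (topspace L \<times> {0<..})" using F by (simp add: homeomorphic_eq_everything_map)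
      then show "v = w" using v unfolding topspace_cone_topology
        by (cases v; cases w) (simp_all, metis (no_types, lifting) inj_onD imageE option.inject)
    qed
    have "continuous_map ?C ?C ?k"
      unfolding continuous_map_def
    proof (intro conjI allI impI)
      show "?k \<in> topspace ?C \<rightarrow> topspace ?C" using kN \<open>N \<subseteq> topspace ?C\<close> by auto
      fix U assume "openin ?C U"
      then have U: "openin (prod_topology L ?B) {p. Some p \<in> U}"
        and UN: "None \<in> U \<Longrightarrow> \<exists>\<epsilon>>0. Some ` (topspace L \<times> {0<..<\<epsilon>}) \<subseteq> U"
        unfolding openin_cone_topology cone_open_def by auto
      have "{p. Some p \<in> {x \<in> topspace ?C. ?k x \<in> U}} =
        {p \<in> topspace (prod_topology L ?B). ?F p \<in> {p. Some p \<in> U}}"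
        by (auto simp: topspace_cone_topology)
      then have c1: "openin (prod_topology L ?B) {p. Some p \<in> {x \<in> topspace ?C. ?k x \<in> U}}"
        using openin_continuous_map_preimage[OF Fc U] by simp
      have c2: "\<exists>\<delta>>0. Some ` (topspace L \<times> {0<..<\<delta>}) \<subseteq> {x \<in> topspace ?C. ?k x \<in> U}" if n: "None \<in> U"
      proof -
        from UN[OF n] obtain e where e: "e > 0" "Some ` (topspace L \<times> {0<..<e}) \<subseteq> U" by blast
        \<comment> \<open>Since \<open>?f r \<le> \<epsilon> * r\<close>, the collar of width
          \<open>e / \<epsilon>\<close> is mapped into the collar of width \<open>e\<close>.\<close>
        have "?f r < e" if "0 < r" "r < e / \<epsilon>" for r
        proof -
          have "?f r \<le> \<epsilon> * r" using that assms by (simp add: divide_le_eq algebra_simps)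
          also have "\<dots> < e" using that assms by (simp add: field_simps)
          finally show ?thesis .
        qed
        then have "Some ` (topspace L \<times> {0<..<e / \<epsilon>}) \<subseteq> {x \<in> topspace ?C. ?k x \<in> U}"
          using e(2) f by (simp add: topspace_cone_topology image_subset_iff)
        then show ?thesis using e(1) assms by (meson divide_pos_pos)
      qed
      have "{x \<in> topspace ?C. ?k x \<in> U} \<subseteq> topspace ?C" by (rule Collect_restrict)
      then show "openin ?C {x \<in> topspace ?C. ?k x \<in> U}"
        unfolding openin_cone_topology cone_open_def topspace_cone_topology[symmetric]
        by (intro conjI impI c1) (assumption, rule c2, simp)
    qed
    then show "continuous_map ?C (subtopology ?C N) ?k"
      using kN by (auto simp: continuous_map_in_subtopology)
    show "open_map ?C (subtopology ?C N) ?k"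
      unfolding open_map_def openin_open_subtopology[OF N]
    proof (intro allI impI conjI)
      fix U assume U0: "openin ?C U"
      then have Us: "U \<subseteq> topspace ?C" by (rule openin_subset)
      then show "?k ` U \<subseteq> N" using kN by blast
      from U0 have U: "openin (prod_topology L ?B) {p. Some p \<in> U}"
        and UN: "None \<in> U \<Longrightarrow> \<exists>\<epsilon>>0. Some ` (topspace L \<times> {0<..<\<epsilon>}) \<subseteq> U"
        unfolding openin_cone_topology cone_open_def by auto
      have "{p. Some p \<in> ?k ` U} = ?F ` {p. Some p \<in> U}"
      proof (intro set_eqI iffI)
        fix p assume "p \<in> {p. Some p \<in> ?k ` U}"
        then obtain v where "v \<in> U" "Some p = ?k v" by blast
        then show "p \<in> ?F ` {p. Some p \<in> U}" by (cases v) auto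
      next
        fix p assume "p \<in> ?F ` {p. Some p \<in> U}"
        then obtain q where "Some q \<in> U" "p = ?F q" by blast
        then have "Some p = ?k (Some q)" by simp
        then show "p \<in> {p. Some p \<in> ?k ` U}" using \<open>Some q \<in> U\<close> by blast
      qed
      then have "openin (prod_topology L ?B) {p. Some p \<in> ?k ` U}" using Fo[OF U] by simp
      moreover have c: "\<exists>\<delta>>0. Some ` (topspace L \<times> {0<..<\<delta>}) \<subseteq> ?k ` U" if n: "None \<in> ?k ` U"
      proof -
        have "None \<in> U" using n by auto
        from UN[OF this] obtain e where e: "e > 0" "Some ` (topspace L \<times> {0<..<e}) \<subseteq> U" by blast
        \<comment> \<open>The contraction is increasing, so radii below \<open>?f e\<close> come
          from radii below \<open>e\<close>: the image of the collar of width \<open>e\<close>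
          contains the collar of width \<open>?f e\<close>.\<close>
        have "Some (l, s) \<in> ?k ` U" if l: "l \<in> topspace L" and s: "0 < s" "s < ?f e" for l s
        proof -
          have s': "s < \<epsilon>" using s f[OF e(1)] by linarith
          have "s * (1 + e) < \<epsilon> * e" using s e(1) by (simp add: less_divide_eq)
          then have "?g s < e" using s' by (simp add: divide_less_eq algebra_simps)
          then have "Some (l, ?g s) \<in> U" using e(2) l g[OF s(1) s'] by auto
          moreover have "Some (l, s) = ?k (Some (l, ?g s))" using g[OF s(1) s'] by simp
          ultimately show ?thesis by (rule rev_image_eqI)
        qed
        then have "Some ` (topspace L \<times> {0<..<?f e}) \<subseteq> ?k ` U"
          unfolding image_subset_iff split_paired_Ball_Sigma
          by (intro ballI) (simp only: greaterThanLessThan_iff)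
        moreover have "?f e > 0" using f[OF e(1)] by simp
        ultimately show ?thesis by (intro exI[of _ "?f e"] conjI)
      qed
      ultimately show "openin ?C (?k ` U)"
        unfolding openin_cone_topology cone_open_def topspace_cone_topology[symmetric]
        using order_trans[OF \<open>?k ` U \<subseteq> N\<close> \<open>N \<subseteq> topspace ?C\<close>]
        by (intro conjI impI c) assumption+
    qed
  qed
qed

text \<open>In a chart, every neighbourhood of the origin and the cone point contains a cube times a
  truncated cone, and this is again a copy of the entire model. Basic opens about a point thus form
  a neighbourhood base, which is what puts them inside members of the cover.\<close>

lemma basic_open_shrink:
  fixes A :: "'a filtered"
  assumes "basic_open A x U" and W: "openin (top_of A) W" "x \<in> W"
  obtains V where "V \<subseteq> W" "basic_open A x V"
proof -
  from assms(1) obtain d and L :: "'a filtered" and h where U: "openin (top_of A) U" "x \<in> U"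
    and x: "x \<in> layer A d" "h (\<lambda>_. 0, None) = x" and L: "is_filtered_space L"
    and dim: "formal_dim L = int (steps A) - int d - 1"
    and h: "filtered_homeomorphism (cone_chart d L) (filtered_sub A U) h"
    unfolding basic_open_def by blast
  let ?M = "cone_chart d L" and ?E = "Euclidean_space d" and ?C = "cone_topology (top_of L)"
  have "homeomorphic_map (top_of ?M) (subtopology (top_of A) U) h"
    using h unfolding filtered_homeomorphism_def filtered_sub_def by simp
  then have "continuous_map (top_of ?M) (top_of A) h"
    by (simp add: homeomorphic_eq_everything_map continuous_map_in_subtopology)
  then have "openin (top_of ?M) {z \<in> topspace (top_of ?M). h z \<in> W}"
    using W(1) by (rule openin_continuous_map_preimage)
  moreover have "(\<lambda>_. 0, None) \<in> {z \<in> topspace (top_of ?M). h z \<in> W}"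
    using x W by (simp add: top_of_cone_chart topspace_cone_topology topspace_Euclidean_space)
  ultimately have "\<exists>E0 C0. openin ?E E0 \<and> openin ?C C0 \<and> (\<lambda>_. 0) \<in> E0 \<and> None \<in> C0 \<and>
      E0 \<times> C0 \<subseteq> {z \<in> topspace (top_of ?M). h z \<in> W}"
    unfolding top_of_cone_chart by (rule iffD1[OF openin_prod_topology_alt, rule_format])
  then obtain E0 C0 where E0: "openin ?E E0" "(\<lambda>_. 0) \<in> E0" and C0: "openin ?C C0" "None \<in> C0"
    and EC: "E0 \<times> C0 \<subseteq> {z \<in> topspace (top_of ?M). h z \<in> W}" by (elim exE conjE)
  obtain \<epsilon> :: real where \<epsilon>: "\<epsilon> > 0" "{u \<in> topspace ?E. \<forall>i. \<bar>u i\<bar> < \<epsilon>} \<subseteq> E0"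
    using Euclidean_cube_in_open[OF E0] by blast
  obtain \<delta> :: real where \<delta>: "\<delta> > 0" "Some ` (topspace (top_of L) \<times> {0<..<\<delta>}) \<subseteq> C0"
    using C0 unfolding openin_cone_topology cone_open_def by blast
  let ?Q = "{u \<in> topspace ?E. \<forall>i. \<bar>u i\<bar> < \<epsilon>}"
  let ?N = "insert None (Some ` (topspace (top_of L) \<times> {0<..<\<delta>}))"
  let ?k1 = "\<lambda>u i. \<epsilon> * u i / (1 + \<bar>u i\<bar>)" and ?k2 = "map_option (\<lambda>(l, r). (l, \<delta> * r / (1 + r)))"
  obtain g1 where g1: "homeomorphic_maps ?E (subtopology ?E ?Q) ?k1 g1"
    using homeomorphic_map_Euclidean_cube[OF \<epsilon>(1)] unfolding homeomorphic_map_maps by blast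
  obtain g2 where g2: "homeomorphic_maps ?C (subtopology ?C ?N) ?k2 g2"
    using homeomorphic_map_cone_nbhd(2)[OF \<delta>(1)] unfolding homeomorphic_map_maps by blast
  let ?k = "\<lambda>(u, v). (?k1 u, ?k2 v)"
  have k: "homeomorphic_map (top_of ?M) (subtopology (top_of ?M) (?Q \<times> ?N)) ?k"
    unfolding top_of_cone_chart subtopology_Times
    by (rule homeomorphic_maps_imp_map[of _ _ _ "\<lambda>(u, v). (g1 u, g2 v)"])
       (simp only: homeomorphic_maps_prod g1 g2 simp_thms)
  have "basic_open A x (h ` (?Q \<times> ?N))"
  proof (rule basic_open_reembed[OF U(1) L dim h _ k _ _ x(1)])
    show "openin (top_of ?M) (?Q \<times> ?N)"
      unfolding top_of_cone_chart openin_prod_Times_iff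
      by (intro disjI2 conjI openin_Euclidean_cube[OF \<epsilon>(1)] homeomorphic_map_cone_nbhd(1)[OF \<delta>(1)])
    show "h (?k (\<lambda>_. 0, None)) = x" using x(2) by simp
    fix z i assume z: "z \<in> topspace (top_of ?M)"
    obtain u v where uv: "z = (u, v)" by (cases z)
    have u: "u \<in> topspace ?E" and v: "v \<in> topspace ?C" using z uv by (auto simp: top_of_cone_chart)
    have "?k1 u \<in> topspace ?E" using u by (simp add: topspace_Euclidean_space)
    moreover have "?k2 v \<in> skel (filtered_cone L) j \<longleftrightarrow> v \<in> skel (filtered_cone L) j" for j
    proof (cases v)
      case (Some p)
      then have "snd p > 0" using v by (auto simp: topspace_cone_topology)
      then have "\<delta> * snd p / (1 + snd p) > 0" using \<delta>(1) by simp
      then show ?thesis using Some \<open>snd p > 0\<close>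
        by (cases p; cases j) (auto simp: filtered_cone_def)
    qed (simp add: filtered_cone_def split: nat.split)
    ultimately show "?k z \<in> skel ?M i \<longleftrightarrow> z \<in> skel ?M i"
      using u by (simp add: uv skel_cone_chart)
  qed
  moreover have "?N \<subseteq> C0" using \<delta>(2) C0(2) by blast
  then have "h ` (?Q \<times> ?N) \<subseteq> W" using \<epsilon>(2) EC by blast
  ultimately show ?thesis using that by blast
qed

lemma basic_open_self: "basic_open A x U \<Longrightarrow> x \<in> U" "basic_open A x U \<Longrightarrow> openin (top_of A) U"
  unfolding basic_open_def by blast+

lemma conically_stratified_basic:
  assumes "conically_stratified A" "openin (top_of A) W" "x \<in> W"
  obtains V where "V \<subseteq> W" "basic_open A x V"
proof -
  have A: "is_filtered_space A" using assms(1) by (simp add: conically_stratified_def)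
  have "x \<in> topspace (top_of A)" using openin_subset[OF assms(2)] assms(3) by blast
  then have "x \<in> layer A (pdim A x)" by (simp add: layer_iff_pdim[OF A])
  then obtain U where "basic_open A x U" using assms(1) unfolding conically_stratified_def by blast
  then show ?thesis using basic_open_shrink[OF _ assms(2,3)] that by blast
qed

lemma conically_stratified_sub:
  assumes A: "conically_stratified A" and U: "openin (top_of A) U"
  shows "conically_stratified (filtered_sub A U)"
  unfolding conically_stratified_def
proof (intro conjI allI ballI)
  show "is_filtered_space (filtered_sub A U)"
    using A is_filtered_space_sub unfolding conically_stratified_def by blast
  show "Hausdorff_space (top_of (filtered_sub A U))"
    using A Hausdorff_space_subtopology unfolding conically_stratified_def filtered_sub_def by auto
  fix d x assume "x \<in> layer (filtered_sub A U) d"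
  then have "x \<in> U" by (simp add: layer_filtered_sub)
  then obtain V where "V \<subseteq> U" "basic_open A x V"
    using conically_stratified_basic[OF A U] by blast
  then show "\<exists>V. basic_open (filtered_sub A U) x V" using basic_open_filtered_sub[OF U] by blast
qed

subsection \<open>Increasing homeomorphisms of intervals and the triangle\<close>

text \<open>With prescribed values at the ends, inverses, restrictions, composites and gluings are
  again of this form. Continuity of the inverse comes from compactness of the interval.\<close>

definition incr_homeo :: "(real \<Rightarrow> real) \<Rightarrow> real \<Rightarrow> real \<Rightarrow> real \<Rightarrow> real \<Rightarrow> bool" where
  "incr_homeo \<phi> a b a' b' \<longleftrightarrow> continuous_on {a..b} \<phi> \<and> strict_mono_on {a..b} \<phi> \<and> \<phi> a = a' \<and> \<phi> b = b'"

lemma incr_homeo_less: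
  "incr_homeo \<phi> a b a' b' \<Longrightarrow> s \<in> {a..b} \<Longrightarrow> t \<in> {a..b} \<Longrightarrow> s < t \<Longrightarrow> \<phi> s < \<phi> t"
  unfolding incr_homeo_def by (meson strict_mono_onD)

lemma incr_homeo_less_iff:
  assumes "incr_homeo \<phi> a b a' b'" "s \<in> {a..b}" "t \<in> {a..b}"
  shows "\<phi> s < \<phi> t \<longleftrightarrow> s < t"
  using incr_homeo_less[OF assms(1,2,3)] incr_homeo_less[OF assms(1,3,2)]
  by (cases s t rule: linorder_cases) auto

lemma incr_homeo_le_iff:
  assumes "incr_homeo \<phi> a b a' b'" "s \<in> {a..b}" "t \<in> {a..b}"
  shows "\<phi> s \<le> \<phi> t \<longleftrightarrow> s \<le> t"
  using incr_homeo_less_iff[OF assms(1,3,2)] by linarith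

lemma incr_homeo_in:
  assumes "incr_homeo \<phi> a b a' b'" "t \<in> {a..b}"
  shows "\<phi> t \<in> {a'..b'}"
proof -
  have "a \<le> b" using assms(2) by simp
  moreover have "\<phi> a \<le> \<phi> t" "\<phi> t \<le> \<phi> b"
    using incr_homeo_le_iff[OF assms(1)] assms(2) \<open>a \<le> b\<close> by simp_all
  ultimately show ?thesis using assms(1) unfolding incr_homeo_def by simp
qed

lemma incr_homeo_image:
  assumes "incr_homeo \<phi> a b a' b'" "a \<le> b"
  shows "\<phi> ` {a..b} = {a'..b'}"
proof
  show "\<phi> ` {a..b} \<subseteq> {a'..b'}" using incr_homeo_in[OF assms(1)] by blast
  show "{a'..b'} \<subseteq> \<phi> ` {a..b}"
  proof
    fix y assume "y \<in> {a'..b'}"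
    then have "\<phi> a \<le> y" "y \<le> \<phi> b" using assms(1) unfolding incr_homeo_def by auto
    moreover have "continuous_on {a..b} \<phi>" using assms(1) unfolding incr_homeo_def by simp
    ultimately obtain x where "a \<le> x" "x \<le> b" "\<phi> x = y" using IVT'[of \<phi> a y b] assms(2) by blast
    then show "y \<in> \<phi> ` {a..b}" by auto
  qed
qed

lemma incr_homeo_inverse:
  assumes "incr_homeo \<phi> a b a' b'" "a \<le> b"
  obtains \<psi> where "incr_homeo \<psi> a' b' a b" "\<And>t. t \<in> {a..b} \<Longrightarrow> \<psi> (\<phi> t) = t"
    "\<And>t. t \<in> {a'..b'} \<Longrightarrow> \<phi> (\<psi> t) = t"
proof -
  have inj: "inj_on \<phi> {a..b}" using assms(1) strict_mono_on_imp_inj_on unfolding incr_homeo_def by blast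
  define \<psi> where "\<psi> = the_inv_into {a..b} \<phi>"
  have 1: "\<psi> (\<phi> t) = t" if "t \<in> {a..b}" for t
    unfolding \<psi>_def by (rule the_inv_into_f_f[OF inj that])
  have im: "\<phi> ` {a..b} = {a'..b'}" by (rule incr_homeo_image[OF assms])
  have 2: "\<phi> (\<psi> t) = t \<and> \<psi> t \<in> {a..b}" if t: "t \<in> {a'..b'}" for t
  proof -
    obtain u where "u \<in> {a..b}" "t = \<phi> u" using t im by blast
    then show ?thesis using 1 by simp
  qed
  have "continuous_on (\<phi> ` {a..b}) \<psi>"
    using assms(1) 1 unfolding incr_homeo_def by (intro continuous_on_inv) auto
  moreover have "strict_mono_on {a'..b'} \<psi>"
  proof (rule strict_mono_onI)
    fix r s assume "r \<in> {a'..b'}" "s \<in> {a'..b'}" "r < s"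
    then show "\<psi> r < \<psi> s" using 2 incr_homeo_less_iff[OF assms(1), of "\<psi> r" "\<psi> s"] by simp
  qed
  moreover have "\<psi> a' = a" "\<psi> b' = b" using assms 1[of a] 1[of b] unfolding incr_homeo_def by auto
  ultimately have "incr_homeo \<psi> a' b' a b" unfolding incr_homeo_def im by simp
  then show ?thesis using that 1 2 by blast
qed

lemma incr_homeo_compose:
  assumes "incr_homeo \<phi> a b a' b'" "incr_homeo \<psi> a' b' a'' b''"
  shows "incr_homeo (\<psi> \<circ> \<phi>) a b a'' b''"
proof -
  have "\<phi> ` {a..b} \<subseteq> {a'..b'}" using incr_homeo_in[OF assms(1)] by blast
  then have "continuous_on {a..b} (\<psi> \<circ> \<phi>)"
    using assms unfolding incr_homeo_def by (meson continuous_on_compose continuous_on_subset)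
  moreover have "strict_mono_on {a..b} (\<psi> \<circ> \<phi>)"
    using incr_homeo_less[OF assms(1)] incr_homeo_in[OF assms(1)] incr_homeo_less[OF assms(2)]
    by (intro strict_mono_onI) simp
  ultimately show ?thesis using assms unfolding incr_homeo_def by simp
qed

lemma incr_homeo_subset:
  "incr_homeo \<phi> a b a' b' \<Longrightarrow> a \<le> s \<Longrightarrow> t \<le> b \<Longrightarrow> incr_homeo \<phi> s t (\<phi> s) (\<phi> t)"
  unfolding incr_homeo_def strict_mono_on_def by (auto intro: continuous_on_subset)

definition affine_to :: "real \<Rightarrow> real \<Rightarrow> real \<Rightarrow> real" where
  "affine_to a b t = a + (b - a) * t"

lemma affine_to_simps [simp]: "affine_to a b 0 = a" "affine_to a b 1 = b" "affine_to 0 1 t = t"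
  by (simp_all add: affine_to_def)

lemma incr_homeo_affine: "a < b \<Longrightarrow> incr_homeo (affine_to a b) 0 1 a b"
  unfolding incr_homeo_def affine_to_def by (auto intro!: strict_mono_onI continuous_intros)

lemma affine_to_in: "a \<le> b \<Longrightarrow> t \<in> {0..1} \<Longrightarrow> affine_to a b t \<in> {a..b}"
  using mult_left_mono[of t 1 "b - a"] mult_nonneg_nonneg[of "b - a" t] by (simp add: affine_to_def)

lemma incr_homeo_linear:
  "a < b \<Longrightarrow> a' < b' \<Longrightarrow> incr_homeo (\<lambda>t. a' + (b' - a') * ((t - a) / (b - a))) a b a' b'"
  unfolding incr_homeo_def
  by (auto intro!: strict_mono_onI continuous_intros mult_strict_left_mono divide_strict_right_mono)

lemma incr_homeo_glue:
  assumes \<phi>: "incr_homeo \<phi> a c a' c'" and \<psi>: "incr_homeo \<psi> c b c' b'" and "a \<le> c" "c \<le> b"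
  shows "incr_homeo (\<lambda>t. if t \<le> c then \<phi> t else \<psi> t) a b a' b'"
proof -
  have e: "\<phi> c = c'" "\<psi> c = c'" using assms unfolding incr_homeo_def by auto
  have s1: "{x \<in> {a..b}. x \<le> c} = {a..c}" and s2: "{x \<in> {a..b}. c \<le> x} = {c..b}" using assms(3,4) by auto
  have "continuous_on {a..b} (\<lambda>t. if t \<le> c then \<phi> t else \<psi> t)"
    by (rule continuous_on_cases_le) (use \<phi> \<psi> e s1 s2 in \<open>auto simp: incr_homeo_def\<close>)
  moreover have "strict_mono_on {a..b} (\<lambda>t. if t \<le> c then \<phi> t else \<psi> t)"
  proof (rule strict_mono_onI)
    fix r s assume rs: "r \<in> {a..b}" "s \<in> {a..b}" "r < s"
    then consider "s \<le> c" | "c < r" | "r \<le> c" "c < s" by linarith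
    then show "(if r \<le> c then \<phi> r else \<psi> r) < (if s \<le> c then \<phi> s else \<psi> s)"
    proof cases
      case 1 then show ?thesis using rs incr_homeo_less[OF \<phi>, of r s] by simp
    next
      case 2 then show ?thesis using rs incr_homeo_less[OF \<psi>, of r s] by simp
    next
      case 3 then show ?thesis
        using rs e incr_homeo_le_iff[OF \<phi>, of r c] incr_homeo_less[OF \<psi>, of c s] assms(3,4) by simp
    qed
  qed
  ultimately show ?thesis using \<phi> \<psi> e assms(3,4) unfolding incr_homeo_def by auto
qed

lemma entrance_on_incr_homeo:
  assumes "incr_homeo \<phi> a b a' b'" "entrance_on A f a' b'"
  shows "entrance_on A (f \<circ> \<phi>) a b"
proof (rule entrance_on_compose[OF assms(2)])
  show "continuous_on {a..b} \<phi>" using assms(1) unfolding incr_homeo_def by simp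
  show "\<phi> ` {a..b} \<subseteq> {a'..b'}" using incr_homeo_in[OF assms(1)] by blast
  show "\<phi> s \<le> \<phi> t" if "a \<le> s" "s \<le> t" "t \<le> b" for s t
    using incr_homeo_le_iff[OF assms(1), of s t] that by simp
qed

section \<open>Reparametrizations and increasing homeomorphisms\<close>

lemma interval_strata_incr_homeo:
  assumes \<phi>: "incr_homeo \<phi> 0 1 0 1" and Q: "\<And>t. t \<in> {0..1} \<Longrightarrow> t \<in> Q \<longleftrightarrow> \<phi> t \<in> P"
    and Q01: "Q \<subseteq> {0..1}" and T: "T \<in> interval_strata Q"
  shows "\<exists>S\<in>interval_strata P. \<phi> ` T \<subseteq> S"
proof (cases "\<exists>t\<in>Q. T = {t}")
  case True
  then obtain t where "t \<in> Q" "T = {t}" by blast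
  then have "{\<phi> t} \<in> interval_strata P" "\<phi> ` T \<subseteq> {\<phi> t}"
    using Q Q01 unfolding interval_strata_def by auto
  then show ?thesis by blast
next
  case False
  then obtain a b where ab: "T = {a<..<b}" "a \<in> Q" "b \<in> Q" "a < b" "{a<..<b} \<inter> Q = {}"
    using T unfolding interval_strata_def by blast
  have ab01: "a \<in> {0..1}" "b \<in> {0..1}" using ab Q01 by blast+
  have "{\<phi> a<..<\<phi> b} \<inter> P = {}"
  proof (rule ccontr)
    assume "{\<phi> a<..<\<phi> b} \<inter> P \<noteq> {}"
    then obtain p where p: "p \<in> P" "\<phi> a < p" "p < \<phi> b" by auto
    then have "p \<in> {0..1}" using incr_homeo_in[OF \<phi> ab01(1)] incr_homeo_in[OF \<phi> ab01(2)] by auto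
    then have "p \<in> \<phi> ` {0..1}" using incr_homeo_image[OF \<phi>] by simp
    then obtain t where t: "t \<in> {0..1}" "p = \<phi> t" by blast
    then have "t \<in> {a<..<b}" "t \<in> Q"
      using p incr_homeo_less_iff[OF \<phi>] ab01 Q by auto
    then show False using ab(5) by blast
  qed
  then have "{\<phi> a<..<\<phi> b} \<in> interval_strata P"
    using ab ab01 Q incr_homeo_less[OF \<phi> ab01 ab(4)] unfolding interval_strata_def by blast
  moreover have "\<phi> ` T \<subseteq> {\<phi> a<..<\<phi> b}"
  proof
    fix y assume "y \<in> \<phi> ` T"
    then obtain t where t: "t \<in> T" "y = \<phi> t" by blast
    then have "t \<in> {0..1}" using ab(1) ab01 by auto
    then show "y \<in> {\<phi> a<..<\<phi> b}" using t ab(1) ab01 incr_homeo_less[OF \<phi>] by simp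
  qed
  ultimately show ?thesis by blast
qed

lemma reparametrizationI:
  assumes \<phi>: "incr_homeo \<phi> 0 1 0 1" and P: "is_interval_stratification P"
    and Q: "Q = {t \<in> {0..1}. \<phi> t \<in> P}"
  shows "reparametrization (P, f) (Q, restrict (f \<circ> \<phi>) {0..1})"
proof -
  obtain \<psi> where \<psi>: "incr_homeo \<psi> 0 1 0 1" "\<And>t. t \<in> {0..1} \<Longrightarrow> \<psi> (\<phi> t) = t"
    "\<And>t. t \<in> {0..1} \<Longrightarrow> \<phi> (\<psi> t) = t"
    using incr_homeo_inverse[OF \<phi>] by (metis zero_le_one)
  have P': "finite P" "{0, 1} \<subseteq> P" "P \<subseteq> {0..1}" using P unfolding is_interval_stratification_def by auto
  have "Q \<subseteq> \<psi> ` P" using Q \<psi>(2) by force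
  then have "finite Q" using P'(1) finite_surj by blast
  moreover have "{0, 1} \<subseteq> Q" using P' \<phi> unfolding Q incr_homeo_def by auto
  ultimately have sQ: "is_interval_stratification Q" using Q unfolding is_interval_stratification_def by auto
  have "homeomorphic_maps II II \<phi> \<psi>"
    unfolding homeomorphic_maps_def
  proof (intro conjI ballI)
    show "continuous_map II II \<phi>" "continuous_map II II \<psi>"
      using \<phi> \<psi>(1) incr_homeo_in[OF \<phi>] incr_homeo_in[OF \<psi>(1)] unfolding incr_homeo_def by auto
  qed (use \<psi> in auto)
  moreover have "stratum_preserving II (interval_strata Q) II (interval_strata P) \<phi>"
    unfolding stratum_preserving_def
  proof (intro conjI ballI)
    show "\<exists>S\<in>interval_strata P. \<phi> ` T \<subseteq> S" if "T \<in> interval_strata Q" for T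
      by (rule interval_strata_incr_homeo[OF \<phi> _ _ that]) (use Q in auto)
  qed (use calculation in \<open>simp add: homeomorphic_maps_def\<close>)
  moreover have "stratum_preserving II (interval_strata P) II (interval_strata Q) \<psi>"
    unfolding stratum_preserving_def
  proof (intro conjI ballI)
    show "\<exists>S\<in>interval_strata Q. \<psi> ` T \<subseteq> S" if "T \<in> interval_strata P" for T
      by (rule interval_strata_incr_homeo[OF \<psi>(1) _ P'(3) that])
         (use Q \<psi>(3) incr_homeo_in[OF \<psi>(1)] in auto)
  qed (use calculation in \<open>simp add: homeomorphic_maps_def\<close>)
  ultimately have "stratified_isomorphism II (interval_strata Q) II (interval_strata P) \<phi>"
    unfolding stratified_isomorphism_def by blast
  then show ?thesis using sQ \<phi> unfolding reparametrization_def incr_homeo_def by auto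
qed

text \<open>A continuous injection of an interval is monotone, and the values at 0 and 1 exclude the
  decreasing case. Hence the homeomorphisms occurring in reparametrizations are increasing.\<close>

lemma homeomorphic_maps_incr_homeo:
  assumes "homeomorphic_maps II II \<phi> \<psi>" "\<phi> 0 = 0" "\<phi> 1 = 1"
  shows "incr_homeo \<phi> 0 1 0 1"
proof -
  have c: "continuous_on {0..1} \<phi>" and "inj_on \<phi> {0..1}"
    using assms(1) unfolding homeomorphic_maps_def by (auto intro: inj_on_inverseI)
  then have "strict_mono_on {0..1} \<phi> \<or> strict_antimono_on {0..1} \<phi>"
    using injective_eq_monotone_map[OF is_interval_cc c] by simp
  then have "strict_mono_on {0..1} \<phi>"
  proof
    assume "strict_antimono_on {0..1} \<phi>"
    then have "\<phi> 0 > \<phi> 1" using monotone_onD[of "{0..1}" "(<)" "(>)" \<phi> 0 1] by simp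
    then show ?thesis using assms by simp
  qed
  then show ?thesis using c assms unfolding incr_homeo_def by simp
qed

lemma stratified_isomorphism_incr_homeo:
  assumes "stratified_isomorphism II S II T \<phi>" "\<phi> 0 = 0" "\<phi> 1 = 1"
  shows "incr_homeo \<phi> 0 1 0 1"
proof -
  obtain \<psi> where "homeomorphic_maps II II \<phi> \<psi>" using assms(1) unfolding stratified_isomorphism_def by blast
  then show ?thesis using homeomorphic_maps_incr_homeo assms(2,3) by blast
qed

lemma reparametrizationE:
  assumes "reparametrization p q"
  obtains \<phi> where "incr_homeo \<phi> 0 1 0 1" "snd q = restrict (snd p \<circ> \<phi>) {0..1}"
proof -
  obtain \<phi> where \<phi>: "stratified_isomorphism II (interval_strata (fst q)) II (interval_strata (fst p)) \<phi>"
    "\<phi> 0 = 0" "\<phi> 1 = 1" "snd q = restrict (snd p \<circ> \<phi>) {0..1}"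
    using assms unfolding reparametrization_def by blast
  show ?thesis by (rule that[OF stratified_isomorphism_incr_homeo[OF \<phi>(1-3)] \<phi>(4)])
qed

lemma stratum_preserving_compose:
  assumes f: "stratum_preserving X \<S> Y \<T> f" and g: "stratum_preserving Y \<T> Z \<R> g"
  shows "stratum_preserving X \<S> Z \<R> (g \<circ> f)"
  unfolding stratum_preserving_def
proof (intro conjI ballI)
  show "continuous_map X Z (g \<circ> f)"
    using f g unfolding stratum_preserving_def by (auto intro: continuous_map_compose)
  fix S assume "S \<in> \<S>"
  then obtain T where T: "T \<in> \<T>" "f ` S \<subseteq> T" using f unfolding stratum_preserving_def by blast
  then obtain R where R: "R \<in> \<R>" "g ` T \<subseteq> R" using g unfolding stratum_preserving_def by blast
  have "(g \<circ> f) ` S \<subseteq> R" using T(2) R(2) by auto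
  then show "\<exists>R\<in>\<R>. (g \<circ> f) ` S \<subseteq> R" using R(1) by blast
qed

lemma reparametrization_trans:
  assumes "reparametrization p q" "reparametrization q r"
  shows "reparametrization p r"
proof -
  obtain \<phi> where \<phi>: "stratified_isomorphism II (interval_strata (fst q)) II (interval_strata (fst p)) \<phi>"
    "\<phi> 0 = 0" "\<phi> 1 = 1" "snd q = restrict (snd p \<circ> \<phi>) {0..1}"
    using assms(1) unfolding reparametrization_def by blast
  obtain \<psi> where \<psi>: "stratified_isomorphism II (interval_strata (fst r)) II (interval_strata (fst q)) \<psi>"
    "\<psi> 0 = 0" "\<psi> 1 = 1" "snd r = restrict (snd q \<circ> \<psi>) {0..1}"
    and r: "is_interval_stratification (fst r)"
    using assms(2) unfolding reparametrization_def by blast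
  have "stratified_isomorphism II (interval_strata (fst r)) II (interval_strata (fst p)) (\<phi> \<circ> \<psi>)"
    using \<phi>(1) \<psi>(1) unfolding stratified_isomorphism_def
    by (blast intro: homeomorphic_maps_compose stratum_preserving_compose)
  moreover have "\<psi> t \<in> {0..1}" if "t \<in> {0..1}" for t
    using incr_homeo_in[OF stratified_isomorphism_incr_homeo[OF \<psi>(1-3)] that] .
  then have "snd r = restrict (snd p \<circ> (\<phi> \<circ> \<psi>)) {0..1}"
    unfolding \<psi>(4) \<phi>(4) by (intro restrict_ext) simp
  ultimately show ?thesis using r \<phi>(2,3) \<psi>(2,3) unfolding reparametrization_def
    by (intro conjI exI[of _ "\<phi> \<circ> \<psi>"]) simp_all
qed

lemma reparametrization_sym:
  assumes "reparametrization p q" "is_interval_stratification (fst p)" "snd p \<in> extensional {0..1}"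
  shows "reparametrization q p"
proof -
  obtain \<phi> where \<phi>: "stratified_isomorphism II (interval_strata (fst q)) II (interval_strata (fst p)) \<phi>"
    "\<phi> 0 = 0" "\<phi> 1 = 1" "snd q = restrict (snd p \<circ> \<phi>) {0..1}"
    using assms(1) unfolding reparametrization_def by blast
  obtain \<psi> where h: "homeomorphic_maps II II \<phi> \<psi>"
    and s: "stratum_preserving II (interval_strata (fst q)) II (interval_strata (fst p)) \<phi>"
      "stratum_preserving II (interval_strata (fst p)) II (interval_strata (fst q)) \<psi>"
    using \<phi>(1) unfolding stratified_isomorphism_def by blast
  have inv: "\<phi> (\<psi> t) = t \<and> \<psi> t \<in> {0..1}" "\<psi> (\<phi> t) = t" if "t \<in> {0..1}" for t
    using h that unfolding homeomorphic_maps_def by (auto simp: Pi_iff)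
  have "stratified_isomorphism II (interval_strata (fst p)) II (interval_strata (fst q)) \<psi>"
    using h s homeomorphic_maps_sym unfolding stratified_isomorphism_def by blast
  moreover have "\<psi> 0 = 0" "\<psi> 1 = 1" using inv(2)[of 0] inv(2)[of 1] \<phi>(2,3) by auto
  moreover have "snd p = restrict (snd q \<circ> \<psi>) {0..1}"
  proof
    fix t show "snd p t = restrict (snd q \<circ> \<psi>) {0..1} t"
    proof (cases "t \<in> {0..1}")
      case True
      then show ?thesis using inv(1)[OF True] by (simp add: \<phi>(4))
    next
      case False
      then show ?thesis using extensional_arb[OF assms(3) False] by (simp only: restrict_apply if_False)
    qed
  qed
  ultimately show ?thesis using assms(2) unfolding reparametrization_def by blast
qed

lemma reparametrization_entrance_path:
  assumes p: "p \<in> entrance_paths A" and "reparametrization p q"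
  shows "q \<in> entrance_paths A"
proof -
  obtain \<phi> where q: "is_interval_stratification (fst q)"
    and \<phi>: "stratified_isomorphism II (interval_strata (fst q)) II (interval_strata (fst p)) \<phi>"
    "\<phi> 0 = 0" "\<phi> 1 = 1" "snd q = restrict (snd p \<circ> \<phi>) {0..1}"
    using assms(2) unfolding reparametrization_def by blast
  have p': "stratum_preserving II (interval_strata (fst p)) (top_of A) (strata A) (snd p)"
    "\<And>s t d e. 0 \<le> s \<Longrightarrow> s \<le> t \<Longrightarrow> t \<le> 1 \<Longrightarrow> snd p s \<in> layer A d \<Longrightarrow> snd p t \<in> layer A e \<Longrightarrow> e \<le> d"
    using p unfolding entrance_paths_def case_prod_beta by blast+
  note inc = stratified_isomorphism_incr_homeo[OF \<phi>(1-3)]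
  have "stratum_preserving II (interval_strata (fst q)) (top_of A) (strata A) (snd p \<circ> \<phi>)"
    using \<phi>(1) p'(1) stratum_preserving_compose unfolding stratified_isomorphism_def by blast
  then have "stratum_preserving II (interval_strata (fst q)) (top_of A) (strata A) (snd q)"
    unfolding stratum_preserving_def
  proof (elim conjE, intro conjI ballI)
    assume c: "continuous_map II (top_of A) (snd p \<circ> \<phi>)"
    then show "continuous_map II (top_of A) (snd q)"
      by (rule continuous_map_eq) (simp add: \<phi>(4))
    fix T assume st: "\<forall>T\<in>interval_strata (fst q). \<exists>S\<in>strata A. (snd p \<circ> \<phi>) ` T \<subseteq> S"
      and T: "T \<in> interval_strata (fst q)"
    have "T \<subseteq> {0..1}" using interval_stratum[OF q T] by simp
    then have "snd q ` T = (snd p \<circ> \<phi>) ` T" unfolding \<phi>(4) by (intro image_cong) auto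
    then show "\<exists>S\<in>strata A. snd q ` T \<subseteq> S" using st T by simp
  qed
  moreover have "e \<le> d" if "0 \<le> s" "s \<le> t" "t \<le> 1" "snd q s \<in> layer A d" "snd q t \<in> layer A e" for s t d e
  proof (rule p'(2))
    show "0 \<le> \<phi> s" "\<phi> t \<le> 1" using incr_homeo_in[OF inc, of s] incr_homeo_in[OF inc, of t] that by auto
    show "\<phi> s \<le> \<phi> t" using incr_homeo_le_iff[OF inc, of s t] that by simp
    show "snd p (\<phi> s) \<in> layer A d" "snd p (\<phi> t) \<in> layer A e" using that unfolding \<phi>(4) by auto
  qed
  moreover have "snd q \<in> extensional {0..1}" unfolding \<phi>(4) by simp
  ultimately have "(fst q, snd q) \<in> entrance_paths A" using q unfolding entrance_paths_def by blast
  then show ?thesis by simp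
qed

section \<open>Coordinates on the triangle\<close>

lemma in_triangle: "(x, y) \<in> triangle \<longleftrightarrow> 0 \<le> x \<and> 0 \<le> y \<and> x + y \<le> 1"
proof -
  have "triangle = {p. \<exists>u v. p = (u, v) \<and> 0 \<le> u \<and> 0 \<le> v \<and> u + v \<le> (1::real)}"
    unfolding triangle_def convex_hull_3_alt by (auto simp: zero_prod_def[symmetric])
  then show ?thesis by auto
qed

lemma in_triangle_edges:
  "(x, y) \<in> closed_segment v0 v1 \<longleftrightarrow> 0 \<le> x \<and> x \<le> 1 \<and> y = 0"
  "(x, y) \<in> closed_segment v0 v2 \<longleftrightarrow> x = 0 \<and> 0 \<le> y \<and> y \<le> 1"
  "(x, y) \<in> closed_segment v1 v2 \<longleftrightarrow> 0 \<le> x \<and> 0 \<le> y \<and> x + y = 1"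
  "(x, y) \<in> open_segment v0 v1 \<longleftrightarrow> 0 < x \<and> x < 1 \<and> y = 0"
  "(x, y) \<in> open_segment v0 v2 \<longleftrightarrow> x = 0 \<and> 0 < y \<and> y < 1"
  "(x, y) \<in> open_segment v1 v2 \<longleftrightarrow> 0 < x \<and> 0 < y \<and> x + y = 1"
proof -
  show *: "(x, y) \<in> closed_segment v0 v1 \<longleftrightarrow> 0 \<le> x \<and> x \<le> 1 \<and> y = 0" for x y
    unfolding closed_segment_def by auto
  show **: "(x, y) \<in> closed_segment v0 v2 \<longleftrightarrow> x = 0 \<and> 0 \<le> y \<and> y \<le> 1" for x y
    unfolding closed_segment_def by auto
  show ***: "(x, y) \<in> closed_segment v1 v2 \<longleftrightarrow> 0 \<le> x \<and> 0 \<le> y \<and> x + y = 1" for x y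
  proof -
    have "(x, y) \<in> closed_segment v1 v2 \<longleftrightarrow> (\<exists>u. x = 1 - u \<and> y = u \<and> 0 \<le> u \<and> u \<le> 1)"
      unfolding closed_segment_def by auto
    then show ?thesis by auto
  qed
  show "(x, y) \<in> open_segment v0 v1 \<longleftrightarrow> 0 < x \<and> x < 1 \<and> y = 0"
    unfolding open_segment_def using * by auto
  show "(x, y) \<in> open_segment v0 v2 \<longleftrightarrow> x = 0 \<and> 0 < y \<and> y < 1"
    unfolding open_segment_def using ** by auto
  show "(x, y) \<in> open_segment v1 v2 \<longleftrightarrow> 0 < x \<and> 0 < y \<and> x + y = 1"
    unfolding open_segment_def using *** by auto
qed

text \<open>A small step to the right from a point of the edge leaves the triangle, because
  \<open>x + y\<close> exceeds 1.\<close>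

lemma interior_triangle_disjoint: "interior triangle \<inter> closed_segment v1 v2 = {}"
proof (rule ccontr)
  assume "interior triangle \<inter> closed_segment v1 v2 \<noteq> {}"
  then obtain x y where xy: "(x, y) \<in> interior triangle" "(x, y) \<in> closed_segment v1 v2" by auto
  then obtain e where e: "e > 0" "ball (x, y) e \<subseteq> triangle" unfolding mem_interior by blast
  have "dist (x, y) (x + e / 2, y) = e / 2" using e(1) by (simp add: dist_Pair_Pair dist_real_def)
  then have "(x + e / 2, y) \<in> triangle" using e by (intro subsetD[OF e(2)]) simp
  then show False using xy(2) e(1) by (simp add: in_triangle in_triangle_edges)
qed

text \<open>The standard parametrization of the broken line from \<open>v0\<close> through
  \<open>v1\<close> to \<open>v2\<close>, the source side of an elementary homotopy.\<close>

definition bent :: "real \<Rightarrow> real \<times> real" where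
  "bent t = (if t \<le> 1/2 then (2 * t, 0) else (2 - 2 * t, 2 * t - 1))"

lemma bent_cases: "t \<le> 1/2 \<Longrightarrow> bent t = (2 * t, 0)" "1/2 \<le> t \<Longrightarrow> bent t = (2 - 2 * t, 2 * t - 1)"
  by (auto simp: bent_def)

text \<open>On the two edges through \<open>v1\<close> the function \<open>x/2 + y\<close> inverts \<open>bent\<close>.\<close>

lemma bent_inverse:
  "(\<lambda>(x, y). x / 2 + y) (bent t) = t"
  "z \<in> closed_segment v0 v1 \<union> closed_segment v1 v2 \<Longrightarrow> bent ((\<lambda>(x, y). x / 2 + y) z) = z"
proof -
  show "(\<lambda>(x, y). x / 2 + y) (bent t) = t" by (simp add: bent_def field_simps)
  assume z: "z \<in> closed_segment v0 v1 \<union> closed_segment v1 v2"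
  obtain x y where xy: "z = (x, y)" by (cases z)
  from z consider "0 \<le> x" "x \<le> 1" "y = 0" | "0 \<le> x" "0 \<le> y" "y = 1 - x"
    unfolding xy by (auto simp: in_triangle_edges)
  then show "bent ((\<lambda>(x, y). x / 2 + y) z) = z"
    by cases (auto simp: xy bent_cases bent_def field_simps)
qed

subsection \<open>Elementary homotopies\<close>

lemma bent_in_triangle: "t \<in> {0..1} \<Longrightarrow> bent t \<in> triangle"
  by (auto simp: bent_def in_triangle)

lemma continuous_on_bent: "continuous_on S bent"
proof -
  have "continuous_on UNIV (\<lambda>t::real. if t \<le> 1/2 then (2 * t, 0) else (2 - 2 * t, 2 * t - 1 :: real))"
    by (rule continuous_on_cases_le) (auto intro!: continuous_intros)
  then have "continuous_on UNIV bent" unfolding bent_def by simp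
  then show ?thesis using continuous_on_subset by blast
qed

lemma homeomorphic_maps_bent:
  "homeomorphic_maps II (top_of_set (closed_segment v0 v1 \<union> closed_segment v1 v2)) bent (\<lambda>(x, y). x / 2 + y)"
  unfolding homeomorphic_maps_def
proof (intro conjI ballI)
  show "continuous_map II (top_of_set (closed_segment v0 v1 \<union> closed_segment v1 v2)) bent"
    by (auto simp: continuous_on_bent) (auto simp: bent_def in_triangle_edges split: if_splits)
  have "continuous_on (closed_segment v0 v1 \<union> closed_segment v1 v2) (\<lambda>z::real\<times>real. fst z / 2 + snd z)"
    by (intro continuous_intros) auto
  then show "continuous_map (top_of_set (closed_segment v0 v1 \<union> closed_segment v1 v2)) II (\<lambda>(x, y). x / 2 + y)"
    by (auto simp: case_prod_beta' in_triangle_edges)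
  show "(\<lambda>(x, y). x / 2 + y) (bent t) = t" for t by (rule bent_inverse)
  show "bent ((\<lambda>(x, y). x / 2 + y) z) = z"
    if "z \<in> topspace (top_of_set (closed_segment v0 v1 \<union> closed_segment v1 v2))" for z
    by (rule bent_inverse(2)) (use that in simp)
qed

lemma homeomorphic_maps_straight:
  "homeomorphic_maps II (top_of_set (closed_segment v0 v2)) (\<lambda>t. (0, t)) snd"
  unfolding homeomorphic_maps_def
  by (auto simp: in_triangle_edges intro!: continuous_intros)

lemma interval_strata_simps:
  "interval_strata {0, 1} = {{0}, {1}, {0<..<1}}"
  "interval_strata {0, 1/2, 1} = {{0}, {1/2}, {1}, {0<..<1/2}, {1/2<..<1}}"
proof -
  have *: "interval_strata P = (\<lambda>t. {t}) ` P \<union>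
      (\<lambda>(a, b). {a<..<b}) ` {(a, b) \<in> P \<times> P. a < b \<and> {a<..<b} \<inter> P = {}}" for P
    unfolding interval_strata_def by auto
  have "{(a, b) \<in> {0, 1} \<times> {0, 1}. a < b \<and> {a<..<b} \<inter> {0, 1} = {}} = {(0, 1::real)}" by auto
  then show "interval_strata {0, 1} = {{0}, {1}, {0<..<1}}" unfolding * by simp blast
  have "{(a, b) \<in> {0, 1/2, 1} \<times> {0, 1/2, 1}. a < b \<and> {a<..<b} \<inter> {0, 1/2, 1} = {}} =
      {(0, 1/2), (1/2, 1::real)}" by auto
  then show "interval_strata {0, 1/2, 1} = {{0}, {1/2}, {1}, {0<..<1/2}, {1/2<..<1}}"
    unfolding * by simp blast
qed

lemma stratified_isomorphism_bent:
  "stratified_isomorphism II (interval_strata {0, 1/2, 1})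
     (top_of_set (closed_segment v0 v1 \<union> closed_segment v1 v2))
     {{v0}, {v1}, {v2}, open_segment v0 v1, open_segment v1 v2} bent"
proof -
  let ?l = "\<lambda>(x::real, y). x / 2 + y"
  have 1: "bent ` {0} \<subseteq> {v0}" "bent ` {1/2} \<subseteq> {v1}" "bent ` {1} \<subseteq> {v2}"
    "bent ` {0<..<1/2} \<subseteq> open_segment v0 v1" "bent ` {1/2<..<1} \<subseteq> open_segment v1 v2"
    by (auto simp: bent_def in_triangle_edges)
  have 2: "?l ` {v0} \<subseteq> {0}" "?l ` {v1} \<subseteq> {1/2}" "?l ` {v2} \<subseteq> {1}"
    "?l ` open_segment v0 v1 \<subseteq> {0<..<1/2}" "?l ` open_segment v1 v2 \<subseteq> {1/2<..<1}"
    by (auto simp: in_triangle_edges)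
  show ?thesis
    unfolding stratified_isomorphism_def stratum_preserving_def interval_strata_simps
  proof (intro exI[of _ ?l] conjI ballI)
    show "homeomorphic_maps II (top_of_set (closed_segment v0 v1 \<union> closed_segment v1 v2)) bent ?l"
      by (rule homeomorphic_maps_bent)
    show "continuous_map II (top_of_set (closed_segment v0 v1 \<union> closed_segment v1 v2)) bent"
      "continuous_map (top_of_set (closed_segment v0 v1 \<union> closed_segment v1 v2)) II ?l"
      using homeomorphic_maps_bent unfolding homeomorphic_maps_def by blast+
  next
    fix T :: "real set" assume "T \<in> {{0}, {1/2}, {1}, {0<..<1/2}, {1/2<..<1}}"
    then show "\<exists>S\<in>{{v0}, {v1}, {v2}, open_segment v0 v1, open_segment v1 v2}. bent ` T \<subseteq> S"
      unfolding insert_iff empty_iff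
      by (elim disjE FalseE) (use 1 in \<open>blast\<close>)+
  next
    fix T :: "(real \<times> real) set" assume "T \<in> {{v0}, {v1}, {v2}, open_segment v0 v1, open_segment v1 v2}"
    then show "\<exists>S\<in>{{0}, {1/2}, {1}, {0<..<1/2}, {1/2<..<1}}. ?l ` T \<subseteq> S"
      unfolding insert_iff empty_iff
      by (elim disjE FalseE) (use 2 in \<open>blast\<close>)+
  qed
qed

lemma stratified_isomorphism_straight:
  "stratified_isomorphism II (interval_strata {0, 1})
     (top_of_set (closed_segment v0 v2)) {{v0}, {v2}, open_segment v0 v2} (\<lambda>t. (0, t))"
proof -
  have 1: "(\<lambda>t. (0, t)) ` {0} \<subseteq> {v0}" "(\<lambda>t. (0, t)) ` {1} \<subseteq> {v2}"
    "(\<lambda>t. (0, t)) ` {0<..<1} \<subseteq> open_segment v0 v2"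
    by (auto simp: in_triangle_edges)
  have 2: "snd ` {v0} \<subseteq> {0}" "snd ` {v2} \<subseteq> {1}" "snd ` open_segment v0 v2 \<subseteq> {0<..<1}"
    by (auto simp: in_triangle_edges)
  show ?thesis
    unfolding stratified_isomorphism_def stratum_preserving_def interval_strata_simps
  proof (intro exI[of _ snd] conjI ballI)
    show "homeomorphic_maps II (top_of_set (closed_segment v0 v2)) (\<lambda>t. (0, t)) snd"
      by (rule homeomorphic_maps_straight)
    show "continuous_map II (top_of_set (closed_segment v0 v2)) (\<lambda>t. (0, t))"
      "continuous_map (top_of_set (closed_segment v0 v2)) II snd"
      using homeomorphic_maps_straight unfolding homeomorphic_maps_def by blast+
  next
    fix T :: "real set" assume "T \<in> {{0}, {1}, {0<..<1}}"
    then show "\<exists>S\<in>{{v0}, {v2}, open_segment v0 v2}. (\<lambda>t. (0, t)) ` T \<subseteq> S"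
      unfolding insert_iff empty_iff
      by (elim disjE FalseE) (use 1 in \<open>blast\<close>)+
  next
    fix T :: "(real \<times> real) set" assume "T \<in> {{v0}, {v2}, open_segment v0 v2}"
    then show "\<exists>S\<in>{{0}, {1}, {0<..<1}}. snd ` T \<subseteq> S"
      unfolding insert_iff empty_iff
      by (elim disjE FalseE) (use 2 in \<open>blast\<close>)+
  qed
qed

text \<open>Any two parametrizations of the same side of the triangle differ by an increasing
  homeomorphism of the interval, so the given ones are traded for \<open>bent\<close> and the
  vertical segment. Strata become constant dimensions. The value \<open>e\<close> is obtained on the
  open edge only; at \<open>v1\<close> it has to be derived from the path.\<close>

lemma elementary_homotopyE:
  assumes A: "is_filtered_space A" and "elementary_homotopy A p q"
  obtains h d e \<phi> \<psi> where "continuous_map (top_of_set triangle) (top_of A) h"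
    "\<forall>x y. (x, y) \<in> triangle \<longrightarrow> x + y < 1 \<longrightarrow> pdim A (h (x, y)) = d"
    "\<forall>x y. 0 < x \<longrightarrow> 0 < y \<longrightarrow> x + y = 1 \<longrightarrow> pdim A (h (x, y)) = e"
    "incr_homeo \<phi> 0 1 0 1" "incr_homeo \<psi> 0 1 0 1"
    "\<forall>t\<in>{0..1}. snd p t = h (bent (\<phi> t))" "\<forall>t\<in>{0..1}. snd q t = h (0, \<psi> t)"
proof -
  let ?E = "closed_segment v0 v1 \<union> closed_segment v1 v2" and ?l = "\<lambda>(x::real, y). x / 2 + y"
  obtain h a b where h: "stratum_preserving (top_of_set triangle) triangle_strata (top_of A) (strata A) h"
    and a: "stratified_isomorphism II (interval_strata {0, 1/2, 1}) (top_of_set ?E)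
          {{v0}, {v1}, {v2}, open_segment v0 v1, open_segment v1 v2} a" "a 0 = v0" "a 1 = v2"
    and b: "stratified_isomorphism II (interval_strata {0, 1})
          (top_of_set (closed_segment v0 v2)) {{v0}, {v2}, open_segment v0 v2} b" "b 0 = v0" "b 1 = v2"
    and p: "\<forall>t\<in>{0..1}. h (a t) = snd p t" and q: "\<forall>t\<in>{0..1}. h (b t) = snd q t"
    and S: "\<exists>S\<in>strata A. h ` (triangle - closed_segment v1 v2) \<subseteq> S"
    using assms(2) unfolding elementary_homotopy_def by (elim conjE exE) (rule that, assumption+)
  have hc: "continuous_map (top_of_set triangle) (top_of A) h" using h unfolding stratum_preserving_def by blast
  have layers: "\<exists>d. \<forall>z\<in>T. pdim A (h z) = d" if T: "\<exists>S\<in>strata A. h ` T \<subseteq> S" for T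
  proof -
    obtain S k where "S \<in> connected_components_of (subtopology (top_of A) (layer A k))" "h ` T \<subseteq> S"
      using T unfolding strata_def by blast
    moreover from this(1) have "S \<subseteq> layer A k" using connected_components_of_subset by fastforce
    ultimately have "pdim A (h z) = k" if "z \<in> T" for z
      using layer_iff_pdim[OF A, of "h z" k] that by blast
    then show ?thesis by blast
  qed
  obtain d where d: "\<forall>z\<in>triangle - closed_segment v1 v2. pdim A (h z) = d"
    using layers[OF S] by blast
  have "\<exists>S\<in>strata A. h ` open_segment v1 v2 \<subseteq> S"
    using h unfolding stratum_preserving_def triangle_strata_def by simp
  from layers[OF this] obtain e where e: "\<forall>z\<in>open_segment v1 v2. pdim A (h z) = e" by blast
  obtain a' where a': "homeomorphic_maps II (top_of_set ?E) a a'"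
    using a(1) unfolding stratified_isomorphism_def by blast
  obtain b' where b': "homeomorphic_maps II (top_of_set (closed_segment v0 v2)) b b'"
    using b(1) unfolding stratified_isomorphism_def by blast
  have "homeomorphic_maps II II (?l \<circ> a) (a' \<circ> bent)"
    using a' homeomorphic_maps_bent homeomorphic_maps_sym by (blast intro: homeomorphic_maps_compose)
  then have \<phi>: "incr_homeo (?l \<circ> a) 0 1 0 1" by (rule homeomorphic_maps_incr_homeo) (simp_all add: a)
  have "homeomorphic_maps II II (snd \<circ> b) (b' \<circ> (\<lambda>t. (0, t)))"
    using b' homeomorphic_maps_straight homeomorphic_maps_sym by (blast intro: homeomorphic_maps_compose)
  then have \<psi>: "incr_homeo (snd \<circ> b) 0 1 0 1" by (rule homeomorphic_maps_incr_homeo) (simp_all add: b)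
  have "bent ((?l \<circ> a) t) = a t" if "t \<in> {0..1}" for t
  proof -
    have "a t \<in> ?E" using a' that unfolding homeomorphic_maps_def continuous_map_def by (simp add: Pi_iff)
    then show ?thesis using bent_inverse(2)[of "a t"] by simp
  qed
  then have "snd p t = h (bent ((?l \<circ> a) t))" if "t \<in> {0..1}" for t using p that by simp
  moreover have "(0, (snd \<circ> b) t) = b t" if "t \<in> {0..1}" for t
  proof -
    have "b t \<in> closed_segment v0 v2" using b' that unfolding homeomorphic_maps_def continuous_map_def by (simp add: Pi_iff)
    then show ?thesis by (cases "b t") (simp add: in_triangle_edges)
  qed
  then have "snd q t = h (0, (snd \<circ> b) t)" if "t \<in> {0..1}" for t using q that by simp
  moreover have "pdim A (h (x, y)) = d" if "(x, y) \<in> triangle" "x + y < 1" for x y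
    using that d by (simp add: in_triangle_edges)
  moreover have "pdim A (h (x, y)) = e" if "0 < x" "0 < y" "x + y = 1" for x y
    using that e by (simp add: in_triangle_edges)
  ultimately show ?thesis using that[OF hc _ _ \<phi> \<psi>] by blast
qed

text \<open>The interior and the open edges at \<open>v0\<close> lie in the triangle without its
  edge from \<open>v1\<close> to \<open>v2\<close>. This part is convex, hence connected, and the
  dimension is constant on it, so a single stratum contains its image. The open opposite edge and
  the vertices are connected as well. The two inequalities make both sides entrance paths.\<close>

lemma elementary_homotopyI:
  assumes A: "is_filtered_space A"
    and h: "continuous_map (top_of_set triangle) (top_of A) h"
    and d: "\<And>x y. (x, y) \<in> triangle \<Longrightarrow> x + y < 1 \<Longrightarrow> pdim A (h (x, y)) = d"
    and e: "\<And>x y. 0 < x \<Longrightarrow> 0 \<le> y \<Longrightarrow> x + y = 1 \<Longrightarrow> pdim A (h (x, y)) = e"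
    and le: "e \<le> d" "pdim A (h v2) \<le> e"
    and U: "basic_open A (h v2) U" "h ` triangle \<subseteq> U"
  shows "elementary_homotopy A ({0, 1/2, 1}, restrict (h \<circ> bent) {0..1}) ({0, 1}, restrict (\<lambda>t. h (0, t)) {0..1})"
proof -
  have dim1: "pdim A (h (bent t)) = (if t < 1/2 then d else if t < 1 then e else pdim A (h v2))"
    if t: "0 \<le> t" "t \<le> 1" for t
  proof -
    consider "t < 1/2" | "1/2 \<le> t" "t < 1" | "t = 1" using t by linarith
    then show ?thesis
      by cases (use t in \<open>auto simp: bent_cases in_triangle intro!: d e\<close>)
  qed
  have dim2: "pdim A (h (0, t)) = (if t < 1 then d else pdim A (h v2))" if "0 \<le> t" "t \<le> 1" for t
    using that d[of 0 t] by (simp add: in_triangle)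
  have "continuous_map II (top_of A) (h \<circ> bent)"
    using bent_in_triangle by (intro continuous_map_compose[OF _ h]) (auto simp: continuous_on_bent)
  then have "entrance_on A (h \<circ> bent) 0 1"
    unfolding entrance_on_def using dim1 le by simp
  then have "entrance_on A (restrict (h \<circ> bent) {0..1}) 0 1"
    by (rule entrance_on_cong) simp
  moreover have "pdim A (restrict (h \<circ> bent) {0..1} x) = pdim A (restrict (h \<circ> bent) {0..1} y)"
    if xy: "0 \<le> x" "x < y" "y \<le> 1" "{x<..y} \<inter> {0, 1/2, 1} = {}" for x y
  proof -
    have "1/2 \<notin> {x<..y}" "1 \<notin> {x<..y}" using xy(4) by blast+
    then have "y < 1/2 \<or> 1/2 \<le> x \<and> y < 1" using xy by auto
    then show ?thesis using xy dim1[of x] dim1[of y] by auto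
  qed
  ultimately have p: "({0, 1/2, 1}, restrict (h \<circ> bent) {0..1}) \<in> entrance_paths A"
    unfolding entrance_paths_iff[OF A] is_interval_stratification_def by simp
  have "continuous_map II (top_of A) (h \<circ> (\<lambda>t. (0, t)))"
  proof (rule continuous_map_compose[OF _ h])
    have "continuous_on {0..1} (\<lambda>t::real. (0::real, t))" by (intro continuous_intros)
    then show "continuous_map II (top_of_set triangle) (\<lambda>t. (0, t))"
      by (simp add: in_triangle image_subset_iff flip: image_subset_iff_funcset)
  qed
  then have "entrance_on A (h \<circ> (\<lambda>t. (0, t))) 0 1"
    unfolding entrance_on_def
  proof (intro conjI allI impI)
    fix s t :: real assume "0 \<le> s" "s \<le> t" "t \<le> 1"
    then show "pdim A ((h \<circ> (\<lambda>t. (0, t))) t) \<le> pdim A ((h \<circ> (\<lambda>t. (0, t))) s)"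
      using dim2[of s] dim2[of t] le by simp
  qed
  then have "entrance_on A (restrict (\<lambda>t. h (0, t)) {0..1}) 0 1"
    by (rule entrance_on_cong) (simp only: comp_apply restrict_apply if_True)
  moreover have "pdim A (restrict (\<lambda>t. h (0, t)) {0..1} x) = pdim A (restrict (\<lambda>t. h (0, t)) {0..1} y)"
    if xy: "0 \<le> x" "x < y" "y \<le> 1" "{x<..y} \<inter> {0, 1} = {}" for x y
  proof -
    have "1 \<notin> {x<..y}" using xy(4) by blast
    then show ?thesis using xy dim2[of x] dim2[of y] by auto
  qed
  ultimately have q: "({0, 1}, restrict (\<lambda>t. h (0, t)) {0..1}) \<in> entrance_paths A"
    unfolding entrance_paths_iff[OF A] is_interval_stratification_def by simp
  have str: "\<exists>S\<in>strata A. h ` T \<subseteq> S"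
    if "connected T" "T \<noteq> {}" "T \<subseteq> triangle" "\<exists>k. \<forall>z\<in>T. pdim A (h z) = k" for T
    using that by (subst in_stratum_iff_pdim_const[OF A])
      (auto intro: continuous_map_from_subtopology_mono[OF h])
  have d': "pdim A (h z) = d" if "z \<in> triangle - closed_segment v1 v2" for z
    using that by (cases z) (auto simp: in_triangle in_triangle_edges intro!: d)
  have e': "pdim A (h z) = e" if "z \<in> open_segment v1 v2" for z
    using that by (cases z) (auto simp: in_triangle_edges intro!: e)
  have conv: "convex triangle" unfolding triangle_def by (rule convex_convex_hull)
  have 1: "\<exists>S\<in>strata A. h ` (triangle - closed_segment v1 v2) \<subseteq> S"
  proof (rule str)
    have "triangle - closed_segment v1 v2 = triangle \<inter> {z. (1, 1) \<bullet> z < 1}"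
      by (auto simp: in_triangle in_triangle_edges inner_prod_def)
    then have "convex (triangle - closed_segment v1 v2)"
      using conv by (simp add: convex_Int convex_halfspace_lt)
    then show "connected (triangle - closed_segment v1 v2)" by (rule convex_connected)
    have "v0 \<in> triangle - closed_segment v1 v2" by (simp add: in_triangle in_triangle_edges)
    then show "triangle - closed_segment v1 v2 \<noteq> {}" by blast
  qed (use d' in auto)
  have int: "interior triangle \<subseteq> triangle - closed_segment v1 v2"
    using interior_subset[of triangle] interior_triangle_disjoint by blast
  have "\<exists>S\<in>strata A. h ` interior triangle \<subseteq> S" "\<exists>S\<in>strata A. h ` open_segment v0 v1 \<subseteq> S"
    "\<exists>S\<in>strata A. h ` open_segment v0 v2 \<subseteq> S"
  proof -
    have "open_segment v0 v1 \<subseteq> triangle - closed_segment v1 v2"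
      "open_segment v0 v2 \<subseteq> triangle - closed_segment v1 v2"
      by (auto simp: in_triangle in_triangle_edges)
    then show "\<exists>S\<in>strata A. h ` interior triangle \<subseteq> S" "\<exists>S\<in>strata A. h ` open_segment v0 v1 \<subseteq> S"
      "\<exists>S\<in>strata A. h ` open_segment v0 v2 \<subseteq> S"
      using 1 int by (meson image_mono order_trans)+
  qed
  moreover have "\<exists>S\<in>strata A. h ` open_segment v1 v2 \<subseteq> S"
    using e' by (intro str) (auto simp: convex_connected in_triangle in_triangle_edges)
  moreover have "\<exists>S\<in>strata A. h ` {v} \<subseteq> S" if "v \<in> triangle" for v
    using that by (intro str) auto
  then have "\<exists>S\<in>strata A. h ` {v0} \<subseteq> S" "\<exists>S\<in>strata A. h ` {v1} \<subseteq> S" "\<exists>S\<in>strata A. h ` {v2} \<subseteq> S"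
    by (simp_all add: in_triangle)
  ultimately have sp: "stratum_preserving (top_of_set triangle) triangle_strata (top_of A) (strata A) h"
    unfolding stratum_preserving_def triangle_strata_def using h by simp
  show ?thesis
    unfolding elementary_homotopy_def
    using p q sp stratified_isomorphism_bent stratified_isomorphism_straight 1 U
    by (intro conjI exI[of _ h] exI[of _ bent] exI[of _ "\<lambda>t. (0, t)"]) (auto simp: bent_def)
qed

subsection \<open>Equivalence of entrance paths\<close>

text \<open>The path may be cut at points that are not among its \<open>0\<close>-strata, so the two
  ends are added explicitly.\<close>

definition subpath_between :: "real set \<Rightarrow> (real \<Rightarrow> 'a) \<Rightarrow> real \<Rightarrow> real \<Rightarrow> 'a spath" where
  "subpath_between P f a b =
     ({0, 1} \<union> {t \<in> {0..1}. affine_to a b t \<in> P}, restrict (f \<circ> affine_to a b) {0..1})"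

lemma restrict_eq_extensional:
  "g \<in> extensional S \<Longrightarrow> (\<And>t. t \<in> S \<Longrightarrow> f t = g t) \<Longrightarrow> restrict f S = g"
  by (rule extensionalityI[of _ S]) simp_all

lemma subpath_between_cong:
  assumes "a \<le> b" "\<And>t. t \<in> {a..b} \<Longrightarrow> t \<in> P \<longleftrightarrow> t \<in> Q" "\<And>t. t \<in> {a..b} \<Longrightarrow> f t = g t"
  shows "subpath_between P f a b = subpath_between Q g a b"
proof -
  have "{t \<in> {0..1}. affine_to a b t \<in> P} = {t \<in> {0..1}. affine_to a b t \<in> Q}"
    using assms(2) affine_to_in[OF assms(1)] by blast
  moreover have "restrict (f \<circ> affine_to a b) {0..1} = restrict (g \<circ> affine_to a b) {0..1}"
    using assms(3) affine_to_in[OF assms(1)] by (intro restrict_ext) simp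
  ultimately show ?thesis unfolding subpath_between_def by simp
qed

lemma subpath_between_whole:
  assumes "is_interval_stratification P" "f \<in> extensional {0..1}"
  shows "subpath_between P f 0 1 = (P, f)"
proof -
  have P: "{0, 1} \<union> {t \<in> {0..1}. affine_to 0 1 t \<in> P} = P"
    using assms(1) unfolding is_interval_stratification_def by auto
  have f: "restrict (f \<circ> affine_to 0 1) {0..1} = f"
    by (rule restrict_eq_extensional[OF assms(2)]) simp
  show ?thesis unfolding subpath_between_def P f ..
qed

text \<open>Concatenation gives each piece half of the unit interval, so a cut at the midpoint
  restores the original speed. The cut point becomes a \<open>0\<close>-stratum, whence
  \<open>insert c P\<close>.\<close>

lemma subpath_between_concat:
  assumes "a < b" and c: "c = (a + b) / 2"
  shows "path_concat (subpath_between P f c b) (subpath_between P f a c) = subpath_between (insert c P) f a b"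
proof -
  let ?S = "{0, 1} \<union> {t \<in> {0..1}. affine_to a c t \<in> P}" and ?T = "{0, 1} \<union> {t \<in> {0..1}. affine_to c b t \<in> P}"
  have a1: "affine_to a c (2 * t) = affine_to a b t" for t unfolding affine_to_def c by (simp add: field_simps)
  have a2: "affine_to c b (2 * t - 1) = affine_to a b t" for t unfolding affine_to_def c by (simp add: field_simps)
  have a3: "affine_to a b t = c \<longleftrightarrow> t = 1/2" for t
  proof -
    have "affine_to a b t = c \<longleftrightarrow> (b - a) * (2 * t - 1) = 0" unfolding affine_to_def c by (simp add: field_simps)
    then show ?thesis using assms(1) by auto
  qed
  have "(\<lambda>t. t / 2) ` ?S = {t. 2 * t \<in> ?S}"
  proof (intro set_eqI iffI)
    fix t assume "t \<in> {t. 2 * t \<in> ?S}"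
    then have "2 * t \<in> ?S" "t = 2 * t / 2" by simp_all
    then show "t \<in> (\<lambda>t. t / 2) ` ?S" by (rule rev_image_eqI)
  next
    fix t assume "t \<in> (\<lambda>t. t / 2) ` ?S"
    then obtain u where "u \<in> ?S" "t = u / 2" by blast
    then have "2 * t = u" by simp
    then show "t \<in> {t. 2 * t \<in> ?S}" using \<open>u \<in> ?S\<close> by (simp only: mem_Collect_eq)
  qed
  moreover have "(\<lambda>t. (t + 1) / 2) ` ?T = {t. 2 * t - 1 \<in> ?T}"
  proof (intro set_eqI iffI)
    fix t assume "t \<in> {t. 2 * t - 1 \<in> ?T}"
    then have "2 * t - 1 \<in> ?T" "t = (2 * t - 1 + 1) / 2" by simp_all
    then show "t \<in> (\<lambda>t. (t + 1) / 2) ` ?T" by (rule rev_image_eqI)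
  next
    fix t assume "t \<in> (\<lambda>t. (t + 1) / 2) ` ?T"
    then obtain u where "u \<in> ?T" "t = (u + 1) / 2" by blast
    then have "2 * t - 1 = u" by simp
    then show "t \<in> {t. 2 * t - 1 \<in> ?T}" using \<open>u \<in> ?T\<close> by (simp only: mem_Collect_eq)
  qed
  moreover have "{t. 2 * t \<in> ?S} \<union> {t. 2 * t - 1 \<in> ?T} =
      {0, 1} \<union> {t \<in> {0..1}. affine_to a b t \<in> insert c P}" (is "?L = ?R")
  proof (rule set_eqI)
    fix t
    have "t \<in> ?L \<longleftrightarrow> t = 0 \<or> t = 1/2 \<or> t = 1 \<or> (0 \<le> t \<and> t \<le> 1/2 \<and> affine_to a b t \<in> P) \<or>
        (1/2 \<le> t \<and> t \<le> 1 \<and> affine_to a b t \<in> P)"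
      by (auto simp: a1 a2)
    also have "\<dots> \<longleftrightarrow> t \<in> ?R" by (auto simp: a3)
    finally show "t \<in> ?L \<longleftrightarrow> t \<in> ?R" .
  qed
  moreover have "restrict (\<lambda>t. if t \<le> 1/2 then restrict (f \<circ> affine_to a c) {0..1} (2 * t)
      else restrict (f \<circ> affine_to c b) {0..1} (2 * t - 1)) {0..1} = restrict (f \<circ> affine_to a b) {0..1}"
    by (rule restrict_ext) (simp add: a1 a2)
  ultimately show ?thesis unfolding path_concat_def subpath_between_def by (simp only: fst_conv snd_conv)
qed

lemma subpath_between_ends:
  "path_source (subpath_between P f a b) = f a" "path_target (subpath_between P f a b) = f b"
  unfolding path_source_def path_target_def subpath_between_def by simp_all

text \<open>The pairs \<open>(s, t)\<close> are the possible positions of the middle piece in \<open>decomposes\<close>.\<close>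

lemma decomposes_subpaths:
  assumes P: "is_interval_stratification P" and f: "f \<in> extensional {0..1}"
    and st: "(s, t) \<in> {(0, 1), (0, 1/2), (1/2, 1), (1/4, 1/2)}"
  shows "decomposes (P, f) (if s = 0 then None else Some (subpath_between P f 0 s))
     (subpath_between P f s t) (if t = 1 then None else Some (subpath_between P f t 1))"
proof -
  consider "s = 0" "t = 1" | "s = 0" "t = 1/2" | "s = 1/2" "t = 1" | "s = 1/4" "t = 1/2"
    using st by auto
  moreover have P': "is_interval_stratification (insert (1/2) P)" "is_interval_stratification (insert (1/2) (insert (1/4) P))"
    using P unfolding is_interval_stratification_def by auto
  have half: "path_concat (subpath_between P f (1/2) 1) (subpath_between P f 0 (1/2)) = (insert (1/2) P, f)"
    using subpath_between_concat[of 0 1 "1/2" P f] subpath_between_whole[OF P'(1) f] by simp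
  have "subpath_between P f (1/2) 1 = subpath_between (insert (1/4) P) f (1/2) 1"
    by (rule subpath_between_cong) auto
  then have quarter: "path_concat (subpath_between P f (1/2) 1) (path_concat (subpath_between P f (1/4) (1/2))
      (subpath_between P f 0 (1/4))) = (insert (1/2) (insert (1/4) P), f)"
    using subpath_between_concat[of 0 "1/2" "1/4" P f] subpath_between_concat[of 0 1 "1/2" "insert (1/4) P" f]
      subpath_between_whole[OF P'(2) f] by simp
  ultimately show ?thesis
  proof cases
    case 1
    show ?thesis unfolding 1 by (simp add: subpath_between_whole[OF P f])
  next
    case 2
    show ?thesis unfolding 2 using half by (simp add: subpath_between_ends)
  next
    case 3
    show ?thesis unfolding 3 using half by (simp add: subpath_between_ends)
  next
    case 4
    show ?thesis unfolding 4 using quarter by (simp add: subpath_between_ends insert_commute)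
  qed
qed

text \<open>The interval is determined by which outer pieces are present. With both of them it is
  \<open>[1/4, 1/2]\<close>, because the two inner pieces share the first half of the outer
  concatenation. Agreement at \<open>a\<close> and \<open>b\<close> themselves is added later, from
  the ends of the homotopy.\<close>

lemma decomposes_middle:
  assumes "decomposes p r q s" "decomposes p' r q' s"
  obtains a b where "0 \<le> a" "a < b" "b \<le> 1"
    "\<forall>t\<in>{0..1}. snd p (affine_to a b t) = snd q t"
    "\<forall>t\<in>{0..1}. snd p' (affine_to a b t) = snd q' t"
    "\<forall>t\<in>{0..1}. t < a \<or> b < t \<longrightarrow> snd p t = snd p' t"
proof (cases r; cases s)
  assume "r = None" "s = None"
  then show thesis using that[of 0 1] assms by simp
next
  fix r' assume *: "r = Some r'" "s = None"
  then have "snd p = snd (path_concat q r')" "snd p' = snd (path_concat q' r')"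
    "path_target r' = path_source q" "path_target r' = path_source q'"
    using assms by (auto simp: prod_eq_iff)
  then show thesis
    by (intro that[of "1/2" 1]) (auto simp: path_concat_def affine_to_def path_target_def path_source_def)
next
  fix s' assume *: "r = None" "s = Some s'"
  then have "snd p = snd (path_concat s' q)" "snd p' = snd (path_concat s' q')"
    using assms by (auto simp: prod_eq_iff)
  then show thesis
    by (intro that[of 0 "1/2"]) (auto simp: path_concat_def affine_to_def)
next
  fix r' s' assume *: "r = Some r'" "s = Some s'"
  then have "snd p = snd (path_concat s' (path_concat q r'))" "snd p' = snd (path_concat s' (path_concat q' r'))"
    "path_target r' = path_source q" "path_target r' = path_source q'"
    using assms by (auto simp: prod_eq_iff)
  then show thesis
    by (intro that[of "1/4" "1/2"]) (auto simp: path_concat_def affine_to_def path_target_def path_source_def field_simps)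
qed

text \<open>\<open>decomposes\<close> knows only four positions of the middle piece. A homotopy on
  an arbitrary subinterval has to be moved to one of them by a piecewise linear change of parameter
  that is affine on the piece itself.\<close>

lemma incr_homeo_standard_position:
  assumes "0 \<le> s" "s < t" "t \<le> 1"
  obtains \<phi> s0 t0 where "incr_homeo \<phi> 0 1 0 1" "(s0, t0) \<in> {(0, 1), (0, 1/2), (1/2, 1), (1/4, 1/2)}"
    "\<And>u. u \<in> {0..1} \<Longrightarrow> \<phi> (affine_to s0 t0 u) = affine_to s t u"
proof -
  let ?lin = "\<lambda>a b a' b' t. a' + (b' - a') * ((t - a) / (b - a)) :: real"
  consider "s = 0" "t = 1" | "s = 0" "t < 1" | "0 < s" "t = 1" | "0 < s" "t < 1" using assms by linarith
  then show ?thesis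
  proof cases
    case 1
    have "incr_homeo (\<lambda>x. x) 0 1 0 1" unfolding incr_homeo_def by (auto intro: strict_mono_onI)
    then show ?thesis using that[of "\<lambda>x. x" 0 1] 1 by simp
  next
    case 2
    have "incr_homeo (\<lambda>x. if x \<le> 1/2 then ?lin 0 (1/2) 0 t x else ?lin (1/2) 1 t 1 x) 0 1 0 1"
      by (rule incr_homeo_glue[OF incr_homeo_linear incr_homeo_linear]) (use 2 assms in auto)
    then show ?thesis by (rule that[of _ 0 "1/2"]) (use 2 in \<open>auto simp: affine_to_def field_simps\<close>)
  next
    case 3
    have "incr_homeo (\<lambda>x. if x \<le> 1/2 then ?lin 0 (1/2) 0 s x else ?lin (1/2) 1 s 1 x) 0 1 0 1"
      by (rule incr_homeo_glue[OF incr_homeo_linear incr_homeo_linear]) (use 3 assms in auto)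
    then show ?thesis by (rule that[of _ "1/2" 1]) (use 3 in \<open>auto simp: affine_to_def field_simps\<close>)
  next
    case 4
    have g: "incr_homeo (\<lambda>x. if x \<le> 1/2 then ?lin (1/4) (1/2) s t x else ?lin (1/2) 1 t 1 x) (1/4) 1 s 1"
      by (rule incr_homeo_glue[OF incr_homeo_linear incr_homeo_linear]) (use 4 assms in auto)
    have "incr_homeo (\<lambda>x. if x \<le> 1/4 then ?lin 0 (1/4) 0 s x else
        if x \<le> 1/2 then ?lin (1/4) (1/2) s t x else ?lin (1/2) 1 t 1 x) 0 1 0 1"
      by (rule incr_homeo_glue[OF incr_homeo_linear g]) (use 4 in auto)
    then show ?thesis by (rule that[of _ "1/4" "1/2"]) (use 4 in \<open>auto simp: affine_to_def field_simps\<close>)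
  qed
qed

lemma continuous_map_nbhd:
  fixes C :: "'b::metric_space set"
  assumes f: "continuous_map (top_of_set C) X f" and V: "openin X V" and x: "x \<in> C" "f x \<in> V"
  obtains \<delta> where "\<delta> > 0" "\<And>y. y \<in> C \<Longrightarrow> dist y x < \<delta> \<Longrightarrow> f y \<in> V"
proof -
  have "openin (top_of_set C) {y \<in> topspace (top_of_set C). f y \<in> V}"
    by (rule openin_continuous_map_preimage[OF f V])
  moreover have "x \<in> {y \<in> topspace (top_of_set C). f y \<in> V}" using x by simp
  ultimately obtain \<delta> where "\<delta> > 0" "\<And>y. y \<in> C \<Longrightarrow> dist y x < \<delta> \<Longrightarrow> y \<in> {y \<in> topspace (top_of_set C). f y \<in> V}"
    unfolding openin_euclidean_subtopology_iff by blast
  then show ?thesis using that by blast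
qed

context
  fixes A :: "'a filtered"
  assumes conical: "conically_stratified A"
begin

lemma conical_filtered: "is_filtered_space A"
  using conical unfolding conically_stratified_def by simp

lemma entrance_pathD:
  assumes "p \<in> entrance_paths A"
  shows "is_interval_stratification (fst p)" "snd p \<in> extensional {0..1}" "entrance_on A (snd p) 0 1"
  using assms entrance_paths_iff[OF conical_filtered, of "fst p" "snd p"] by auto

lemma entrance_path_cut:
  assumes "p \<in> entrance_paths A" "0 \<le> x" "x < y" "y \<le> 1" "{x<..y} \<inter> fst p = {}"
  shows "pdim A (snd p x) = pdim A (snd p y)"
  using assms entrance_paths_iff[OF conical_filtered, of "fst p" "snd p"] by simp

lemma entrance_path_insert:
  assumes "(P, f) \<in> entrance_paths A" "0 \<le> m" "m \<le> 1"
  shows "(insert m P, f) \<in> entrance_paths A"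
  using assms unfolding entrance_paths_iff[OF conical_filtered] is_interval_stratification_def by auto

lemma subpath_between_entrance_path:
  assumes p: "(P, f) \<in> entrance_paths A" and ab: "0 \<le> a" "a < b" "b \<le> 1"
  shows "subpath_between P f a b \<in> entrance_paths A"
proof -
  note P = p[unfolded entrance_paths_iff[OF conical_filtered]]
  let ?Q = "{0, 1} \<union> {t \<in> {0..1}. affine_to a b t \<in> P}"
  note inc = incr_homeo_affine[OF ab(2)]
  have "inj (affine_to a b)" using ab(2) by (auto simp: inj_on_def affine_to_def)
  then have "finite {t. affine_to a b t \<in> P}"
    using P finite_vimageI[of P "affine_to a b"] unfolding is_interval_stratification_def vimage_def by simp
  then have Q: "is_interval_stratification ?Q" unfolding is_interval_stratification_def by auto
  have "entrance_on A (f \<circ> affine_to a b) 0 1"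
    by (rule entrance_on_incr_homeo[OF inc]) (use P ab entrance_on_subset in auto)
  then have "entrance_on A (restrict (f \<circ> affine_to a b) {0..1}) 0 1" by (rule entrance_on_cong) simp
  moreover have "pdim A (f (affine_to a b x)) = pdim A (f (affine_to a b y))"
    if xy: "0 \<le> x" "x < y" "y \<le> 1" "{x<..y} \<inter> ?Q = {}" for x y
  proof -
    have x: "affine_to a b x \<in> {a..b}" "affine_to a b y \<in> {a..b}"
      using incr_homeo_in[OF inc] xy by simp_all
    have "{affine_to a b x<..affine_to a b y} \<inter> P = {}"
    proof (rule ccontr)
      assume "{affine_to a b x<..affine_to a b y} \<inter> P \<noteq> {}"
      then obtain p where p: "p \<in> P" "affine_to a b x < p" "p \<le> affine_to a b y" by auto
      then have "p \<in> {a..b}" using x by auto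
      then have "p \<in> affine_to a b ` {0..1}" using incr_homeo_image[OF inc] by simp
      then obtain t where t: "t \<in> {0..1}" "p = affine_to a b t" by blast
      then have "x < t" "t \<le> y"
        using p xy incr_homeo_less_iff[OF inc, of x t] incr_homeo_le_iff[OF inc, of t y] by auto
      then have "t \<in> {x<..y} \<inter> ?Q" using t p by simp
      then show False using xy(4) by blast
    qed
    moreover have "affine_to a b x < affine_to a b y" using incr_homeo_less[OF inc, of x y] xy by simp
    ultimately show ?thesis using P x ab by simp
  qed
  ultimately show ?thesis
    unfolding subpath_between_def entrance_paths_iff[OF conical_filtered] using Q by simp
qed

text \<open>The same change of parameter is applied to both paths, so the outer pieces remain equal
  while the middle ones reach a standard position. The extra cut \<open>m\<close> has to be the
  midpoint because the source of an elementary homotopy has its middle \<open>0\<close>-stratum at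
  \<open>1/2\<close>.\<close>

lemma elementarily_related_local:
  assumes p: "(insert m P, f) \<in> entrance_paths A" and q: "(P, g) \<in> entrance_paths A"
    and st: "0 \<le> s" "s < t" "t \<le> 1" and m: "m = (s + t) / 2" and P: "P \<inter> {s<..<t} = {}"
    and fg: "\<And>u. u \<in> {0..1} \<Longrightarrow> u \<le> s \<or> t \<le> u \<Longrightarrow> f u = g u"
    and h: "elementary_homotopy A ({0, 1/2, 1}, restrict (f \<circ> affine_to s t) {0..1})
        ({0, 1}, restrict (g \<circ> affine_to s t) {0..1})"
  shows "elementarily_related A (insert m P, f) (P, g)"
proof -
  obtain \<phi> s0 t0 where \<phi>: "incr_homeo \<phi> 0 1 0 1"
    and pos: "(s0, t0) \<in> {(0, 1), (0, 1/2), (1/2, 1), (1/4, 1/2)}"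
    and \<phi>st: "\<And>u. u \<in> {0..1} \<Longrightarrow> \<phi> (affine_to s0 t0 u) = affine_to s t u"
    using incr_homeo_standard_position[OF st] by blast
  have st0: "0 \<le> s0" "s0 < t0" "t0 \<le> 1" using pos by auto
  define m0 where "m0 = affine_to s0 t0 (1/2)"
  have m0: "s0 < m0" "m0 < t0" unfolding m0_def affine_to_def using st0 by (auto simp: field_simps)
  \<comment> \<open>The change of parameter is affine on the standard position, so it carries
    midpoint to midpoint.\<close>
  have "\<phi> m0 = affine_to s t (1/2)" unfolding m0_def by (rule \<phi>st) simp
  then have \<phi>m: "\<phi> m0 = m" unfolding m affine_to_def by (simp add: field_simps)
  have \<phi>s: "\<phi> s0 = s" "\<phi> t0 = t" using \<phi>st[of 0] \<phi>st[of 1] by simp_all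
  define P0 where "P0 = {u \<in> {0..1}. \<phi> u \<in> P}"
  define f0 where "f0 = restrict (f \<circ> \<phi>) {0..1}"
  define g0 where "g0 = restrict (g \<circ> \<phi>) {0..1}"
  have "\<phi> u = m \<longleftrightarrow> u = m0" if "u \<in> {0..1}" for u
    using that m0 st0 \<phi>m incr_homeo_less_iff[OF \<phi>, of u m0] incr_homeo_less_iff[OF \<phi>, of m0 u] by auto
  then have P0': "insert m0 P0 = {u \<in> {0..1}. \<phi> u \<in> insert m P}"
    using m0 st0 unfolding P0_def by auto
  have r: "reparametrization (insert m P, f) (insert m0 P0, f0)" "reparametrization (P, g) (P0, g0)"
    unfolding f0_def g0_def
    using reparametrizationI[OF \<phi> _ P0'] reparametrizationI[OF \<phi> _ P0_def] entrance_pathD[OF p] entrance_pathD[OF q]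
    by simp_all
  have p0: "(insert m0 P0, f0) \<in> entrance_paths A" and q0: "(P0, g0) \<in> entrance_paths A"
    using reparametrization_entrance_path[OF p r(1)] reparametrization_entrance_path[OF q r(2)] by auto
  have aff: "affine_to s0 t0 u \<in> {0..1}" if "u \<in> {0..1}" for u
    using affine_to_in[of s0 t0 u] that st0 by auto
  have P0st: "affine_to s0 t0 u \<notin> P0" if u: "0 < u" "u < 1" for u
  proof -
    have "affine_to s t u \<in> {s<..<t}"
      using u st incr_homeo_less[OF incr_homeo_affine[OF st(2)], of 0 u] incr_homeo_less[OF incr_homeo_affine[OF st(2)], of u 1] by simp
    then show ?thesis using P u \<phi>st[of u] unfolding P0_def by auto
  qed
  have m0u: "affine_to s0 t0 u = m0 \<longleftrightarrow> u = 1/2" for u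
    unfolding m0_def affine_to_def using st0 by auto
  have "{0, 1} \<union> {u \<in> {0..1}. affine_to s0 t0 u \<in> insert m0 P0} = {0, 1/2, 1}"
    using P0st m0u by (auto simp: less_le)
  moreover have "restrict (f0 \<circ> affine_to s0 t0) {0..1} = restrict (f \<circ> affine_to s t) {0..1}"
    by (rule restrict_ext) (use aff \<phi>st in \<open>simp add: f0_def\<close>)
  ultimately have p2: "subpath_between (insert m0 P0) f0 s0 t0 = ({0, 1/2, 1}, restrict (f \<circ> affine_to s t) {0..1})"
    unfolding subpath_between_def by simp
  have "{0, 1} \<union> {u \<in> {0..1}. affine_to s0 t0 u \<in> P0} = {0, 1}"
    using P0st by (auto simp: less_le)
  moreover have "restrict (g0 \<circ> affine_to s0 t0) {0..1} = restrict (g \<circ> affine_to s t) {0..1}"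
    by (rule restrict_ext) (use aff \<phi>st in \<open>simp add: g0_def\<close>)
  ultimately have q2: "subpath_between P0 g0 s0 t0 = ({0, 1}, restrict (g \<circ> affine_to s t) {0..1})"
    unfolding subpath_between_def by simp
  have fg0: "f0 u = g0 u" if u: "u \<in> {0..1}" "u \<le> s0 \<or> t0 \<le> u" for u
  proof -
    have "\<phi> u \<le> s \<or> t \<le> \<phi> u"
      using u st0 \<phi>s incr_homeo_le_iff[OF \<phi>, of u s0] incr_homeo_le_iff[OF \<phi>, of t0 u] by auto
    then show ?thesis using fg[OF incr_homeo_in[OF \<phi> u(1)]] u(1) by (simp add: f0_def g0_def)
  qed
  have left: "subpath_between (insert m0 P0) f0 0 s0 = subpath_between P0 g0 0 s0"
    by (rule subpath_between_cong) (use st0 m0 fg0 in auto)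
  have right: "subpath_between (insert m0 P0) f0 t0 1 = subpath_between P0 g0 t0 1"
    by (rule subpath_between_cong) (use st0 m0 fg0 in auto)
  let ?r = "if s0 = 0 then None else Some (subpath_between P0 g0 0 s0)"
  let ?s = "if t0 = 1 then None else Some (subpath_between P0 g0 t0 1)"
  have "decomposes (insert m0 P0, f0) ?r ({0, 1/2, 1}, restrict (f \<circ> affine_to s t) {0..1}) ?s"
    using decomposes_subpaths[OF _ _ pos, of "insert m0 P0" f0] entrance_pathD[OF p0] unfolding left right p2 by simp
  moreover have "decomposes (P0, g0) ?r ({0, 1}, restrict (g \<circ> affine_to s t) {0..1}) ?s"
    using decomposes_subpaths[OF _ _ pos, of P0 g0] entrance_pathD[OF q0] unfolding q2 by simp
  moreover have "set_option ?r \<subseteq> entrance_paths A" "set_option ?s \<subseteq> entrance_paths A"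
    using subpath_between_entrance_path[OF q0, of 0 s0] subpath_between_entrance_path[OF q0, of t0 1] st0 by auto
  ultimately show ?thesis
    unfolding elementarily_related_def using p q r h by blast
qed

text \<open>The function \<open>x / 2 + y\<close> collapses the triangle to an interval and
  restricts to the parameter \<open>t\<close> on the broken line \<open>bent t\<close> as well as on
  the straight edge \<open>(0, t)\<close>. Composed with a short stretch of the path around
  \<open>m\<close> it is a homotopy whose two sides are the same function, with and without the
  middle cut. No \<open>0\<close>-stratum is near \<open>m\<close>, so the dimension is constant
  there, and the basic open about \<open>f m\<close> is also basic about the end of the
  stretch.\<close>

lemma elementarily_related_insert:
  assumes p: "(P, f) \<in> entrance_paths A" and m: "0 < m" "m < 1" "m \<notin> P"
  shows "elementarily_related A (insert m P, f) (P, f)"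
proof -
  note P = p[unfolded entrance_paths_iff[OF conical_filtered]]
  have fe: "entrance_on A f 0 1" using P by simp
  have cut: "pdim A (f x) = pdim A (f y)" if "0 \<le> x" "x < y" "y \<le> 1" "{x<..y} \<inter> P = {}" for x y
    using P that by blast
  have fm: "f m \<in> topspace (top_of A)" using entrance_on_in[OF fe, of m] m by simp
  obtain V where V: "basic_open A (f m) V"
    using conically_stratified_basic[OF conical openin_topspace fm] by blast
  obtain \<delta> where \<delta>: "\<delta> > 0" "\<And>y. y \<in> {0..1} \<Longrightarrow> dist y m < \<delta> \<Longrightarrow> f y \<in> V"
    by (rule continuous_map_nbhd[OF entrance_on_continuous[OF fe] basic_open_self(2)[OF V] _ basic_open_self(1)[OF V]])
       (use m in auto)
  have "open (- P)" using P finite_imp_closed unfolding is_interval_stratification_def by blast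
  then obtain \<eta> where \<eta>: "\<eta> > 0" "ball m \<eta> \<subseteq> - P" using m(3) unfolding open_contains_ball by blast
  \<comment> \<open>The stretch from \<open>m - \<epsilon>\<close> to \<open>m + \<epsilon>\<close>
    has to stay inside the unit interval, to be mapped into \<open>V\<close> and to avoid
    \<open>P\<close>; halving makes all these bounds strict.\<close>
  define \<epsilon> where "\<epsilon> = min (min m (1 - m)) (min \<delta> \<eta>) / 2"
  have \<epsilon>: "\<epsilon> > 0" "\<epsilon> < m" "\<epsilon> < 1 - m" "\<epsilon> < \<delta>" "\<epsilon> < \<eta>" unfolding \<epsilon>_def using m \<delta> \<eta> by auto
  let ?s = "m - \<epsilon>" and ?t = "m + \<epsilon>"
  have notP: "u \<notin> P" if "u \<in> {?s..?t}" for u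
  proof -
    have "u \<in> ball m \<eta>" using that \<epsilon> by (auto simp: dist_real_def)
    then show ?thesis using \<eta>(2) by blast
  qed
  have dim: "pdim A (f u) = pdim A (f ?s)" if u: "u \<in> {?s..?t}" for u
  proof (cases "u = ?s")
    case False
    then have "{?s<..u} \<inter> P = {}" using notP u by auto
    then show ?thesis using \<epsilon> u False by (intro cut[symmetric]) auto
  qed simp
  have "f ?t \<in> V" using \<epsilon> m by (intro \<delta>(2)) (auto simp: dist_real_def)
  moreover have "pdim A (f ?t) = pdim A (f m)" using dim[of ?t] dim[of m] \<epsilon> by auto
  ultimately have Vt: "basic_open A (f ?t) V" by (rule basic_open_translate[OF conical_filtered V])
  let ?h = "f \<circ> (affine_to ?s ?t \<circ> (\<lambda>(x, y). x / 2 + y))"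
  have aff: "affine_to ?s ?t u \<in> {?s..?t}" if "u \<in> {0..1}" for u
    using affine_to_in[of ?s ?t u] \<epsilon> that by simp
  have hin: "affine_to ?s ?t (x / 2 + y) \<in> {?s..?t}" if "(x, y) \<in> triangle" for x y
    using that by (intro aff) (auto simp: in_triangle)
  have "elementary_homotopy A ({0, 1/2, 1}, restrict (?h \<circ> bent) {0..1}) ({0, 1}, restrict (\<lambda>t. ?h (0, t)) {0..1})"
  proof (rule elementary_homotopyI[OF conical_filtered])
    have "continuous_on triangle (\<lambda>z. affine_to ?s ?t (fst z / 2 + snd z))"
      unfolding affine_to_def by (intro continuous_intros) auto
    moreover have "affine_to ?s ?t (x / 2 + y) \<in> {0..1}" if "(x, y) \<in> triangle" for x y
      using hin[OF that] \<epsilon> by auto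
    ultimately show "continuous_map (top_of_set triangle) (top_of A) ?h"
      by (intro continuous_map_compose[OF _ entrance_on_continuous[OF fe]])
         (auto simp: comp_def case_prod_beta')
    show "pdim A (?h (x, y)) = pdim A (f ?s)" if "(x, y) \<in> triangle" "x + y < 1" for x y
      using dim hin that by simp
    show "pdim A (?h (x, y)) = pdim A (f ?s)" if "0 < x" "0 \<le> y" "x + y = 1" for x y
      using dim[OF hin[of x y]] that by (simp add: in_triangle)
    show "pdim A (f ?s) \<le> pdim A (f ?s)" ..
    show "pdim A (?h v2) \<le> pdim A (f ?s)" using dim[of ?t] \<epsilon> by simp
    show "basic_open A (?h v2) V" using Vt by simp
    show "?h ` triangle \<subseteq> V"
    proof
      fix z assume "z \<in> ?h ` triangle"
      then obtain x y where xy: "(x, y) \<in> triangle" "z = f (affine_to ?s ?t (x / 2 + y))" by auto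
      then show "z \<in> V" using hin[OF xy(1)] \<epsilon> by (auto intro!: \<delta>(2) simp: dist_real_def)
    qed
  qed
  moreover have "restrict (?h \<circ> bent) {0..1} = restrict (f \<circ> affine_to ?s ?t) {0..1}"
    by (rule restrict_ext) (simp add: bent_inverse)
  moreover have "restrict (\<lambda>t. ?h (0, t)) {0..1} = restrict (f \<circ> affine_to ?s ?t) {0..1}"
    by (rule restrict_ext) simp
  ultimately have hom: "elementary_homotopy A ({0, 1/2, 1}, restrict (f \<circ> affine_to ?s ?t) {0..1})
      ({0, 1}, restrict (f \<circ> affine_to ?s ?t) {0..1})" by simp
  show ?thesis
    by (rule elementarily_related_local[OF _ p _ _ _ _ _ _ hom])
       (use entrance_path_insert[OF p] m \<epsilon> notP in auto)
qed

lemma elementarily_related_sym: "elementarily_related A p q \<Longrightarrow> elementarily_related A q p"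
  unfolding elementarily_related_def by blast

lemma elementarily_related_paths:
  "elementarily_related A p q \<Longrightarrow> p \<in> entrance_paths A \<and> q \<in> entrance_paths A"
  unfolding elementarily_related_def by blast

lemma equiv_path_equiv: "equiv (entrance_paths A) (path_equiv A)"
proof (rule equivI)
  show "path_equiv A \<subseteq> entrance_paths A \<times> entrance_paths A" unfolding path_equiv_def by blast
  show "refl_on (entrance_paths A) (path_equiv A)" unfolding path_equiv_def by (rule refl_onI) auto
  have "symp (elementarily_related A)\<^sup>*\<^sup>*"
    by (intro symp_rtranclp sympI) (rule elementarily_related_sym)
  then show "sym (path_equiv A)" unfolding path_equiv_def by (intro symI) (simp add: sympD)
  show "trans (path_equiv A)" unfolding path_equiv_def by (intro transI) (simp, elim conjE, rule rtranclp_trans)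
qed

lemma path_equiv_sym: "(p, q) \<in> path_equiv A \<Longrightarrow> (q, p) \<in> path_equiv A"
  using equiv_path_equiv unfolding equiv_def by (blast dest: symD)

lemma path_equiv_trans: "(p, q) \<in> path_equiv A \<Longrightarrow> (q, r) \<in> path_equiv A \<Longrightarrow> (p, r) \<in> path_equiv A"
  using equiv_path_equiv unfolding equiv_def by (blast dest: transD)

lemma path_equiv_refl: "p \<in> entrance_paths A \<Longrightarrow> (p, p) \<in> path_equiv A"
  unfolding path_equiv_def by simp

lemma path_equiv_related: "elementarily_related A p q \<Longrightarrow> (p, q) \<in> path_equiv A"
  using elementarily_related_paths unfolding path_equiv_def by auto

text \<open>Cut points are inserted one at a time, and two finite sets of them are compared through
  their union.\<close>

lemma path_equiv_cuts:
  assumes p: "(P, f) \<in> entrance_paths A" and q: "(Q, f) \<in> entrance_paths A"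
  shows "((P, f), (Q, f)) \<in> path_equiv A"
proof -
  have *: "((P, f), (P \<union> R, f)) \<in> path_equiv A \<and> (P \<union> R, f) \<in> entrance_paths A"
    if "finite R" "R \<subseteq> {0..1}" "(P, f) \<in> entrance_paths A" for P R
    using that
  proof (induction R rule: finite_induct)
    case empty
    then show ?case using path_equiv_refl by simp
  next
    case (insert m R)
    then have IH: "((P, f), (P \<union> R, f)) \<in> path_equiv A" "(P \<union> R, f) \<in> entrance_paths A" by auto
    show ?case
    proof (cases "m \<in> P \<union> R")
      case True
      then have "P \<union> insert m R = P \<union> R" by blast
      then show ?thesis using IH by simp
    next
      case False
      have "{0, 1} \<subseteq> P" using entrance_pathD(1)[OF insert.prems(2)] by (simp add: is_interval_stratification_def)
      then have "m \<noteq> 0" "m \<noteq> 1" using False by auto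
      then have m: "0 < m" "m < 1" using insert.prems(1) by (auto simp: less_le)
      have "elementarily_related A (insert m (P \<union> R), f) (P \<union> R, f)"
        by (rule elementarily_related_insert[OF IH(2) m False])
      then have "((P \<union> R, f), (insert m (P \<union> R), f)) \<in> path_equiv A"
        by (rule path_equiv_sym[OF path_equiv_related])
      from path_equiv_trans[OF IH(1) this] show ?thesis
        using entrance_path_insert[OF IH(2), of m] m by simp
    qed
  qed
  have "finite P" "finite Q" "P \<subseteq> {0..1}" "Q \<subseteq> {0..1}"
    using entrance_pathD(1)[OF p] entrance_pathD(1)[OF q] by (auto simp: is_interval_stratification_def)
  then have "((P, f), (P \<union> Q, f)) \<in> path_equiv A" "((Q, f), (P \<union> Q, f)) \<in> path_equiv A"
    using *[of Q P] *[of P Q] p q by (simp_all add: Un_commute)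
  then show ?thesis by (rule path_equiv_trans[OF _ path_equiv_sym])
qed

text \<open>A reparametrization alone is not an elementary relation, which must contain a homotopy.
  But the relation sees its two paths only up to reparametrization, so any path related to
  \<open>p\<close> is also related to \<open>q\<close>. Such a path is \<open>p\<close> with one new
  cut.\<close>

lemma path_equiv_reparametrization:
  assumes p: "p \<in> entrance_paths A" and r: "reparametrization p q"
  shows "(p, q) \<in> path_equiv A"
proof -
  note P = entrance_pathD[OF p]
  have "finite (fst p)" using P(1) by (simp add: is_interval_stratification_def)
  then obtain m where m: "m \<in> {0<..<1::real}" "m \<notin> fst p"
    using infinite_Ioo[of 0 "1::real"] by (metis finite_subset subsetI zero_less_one)
  have rel: "elementarily_related A (insert m (fst p), snd p) p"
    using elementarily_related_insert[of "fst p" "snd p" m] p m by simp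
  have q: "q \<in> entrance_paths A" by (rule reparametrization_entrance_path[OF p r])
  from rel obtain p' q' r' s p2 q2 where *: "reparametrization (insert m (fst p), snd p) p'" "reparametrization p q'"
    "set_option r' \<subseteq> entrance_paths A" "set_option s \<subseteq> entrance_paths A"
    "decomposes p' r' p2 s" "decomposes q' r' q2 s"
    "elementary_homotopy A p2 q2 \<or> elementary_homotopy A q2 p2"
    unfolding elementarily_related_def by blast
  have "reparametrization q q'"
    by (rule reparametrization_trans[OF reparametrization_sym[OF r P(1,2)] *(2)])
  then have "elementarily_related A (insert m (fst p), snd p) q"
    unfolding elementarily_related_def using elementarily_related_paths[OF rel] q * by blast
  then show ?thesis
    by (rule path_equiv_trans[OF path_equiv_sym[OF path_equiv_related[OF rel]] path_equiv_related])
qed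

lemma path_equiv_incr_homeo:
  assumes p: "p \<in> entrance_paths A" and q: "q \<in> entrance_paths A"
    and \<phi>: "incr_homeo \<phi> 0 1 0 1" and e: "\<And>t. t \<in> {0..1} \<Longrightarrow> snd q t = snd p (\<phi> t)"
  shows "(p, q) \<in> path_equiv A"
proof -
  let ?Q = "{t \<in> {0..1}. \<phi> t \<in> fst p}"
  have "restrict (snd p \<circ> \<phi>) {0..1} = snd q"
    by (rule restrict_eq_extensional[OF entrance_pathD(2)[OF q]]) (simp add: e)
  then have r: "reparametrization p (?Q, snd q)"
    using reparametrizationI[OF \<phi> entrance_pathD(1)[OF p] refl, of "snd p"] by simp
  have "(p, (?Q, snd q)) \<in> path_equiv A" by (rule path_equiv_reparametrization[OF p r])
  moreover have "((?Q, snd q), (fst q, snd q)) \<in> path_equiv A"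
    using reparametrization_entrance_path[OF p r] q by (intro path_equiv_cuts) auto
  ultimately show ?thesis using path_equiv_trans by simp
qed

text \<open>The given \<open>0\<close>-strata of \<open>p\<close> and \<open>q\<close> need not fit
  the pattern of an elementary relation. By \<open>path_equiv_cuts\<close> they may be exchanged for
  a common set outside the open interval from \<open>s\<close> to \<open>t\<close>, with the
  midpoint as an additional cut of \<open>p\<close>.\<close>

lemma path_equiv_local:
  assumes p: "p \<in> entrance_paths A" and q: "q \<in> entrance_paths A"
    and st: "0 \<le> s" "s < t" "t \<le> 1"
    and pq: "\<And>u. u \<in> {0..1} \<Longrightarrow> u < s \<or> t < u \<Longrightarrow> snd p u = snd q u"
    and ends: "snd p s = snd q s" "snd p t = snd q t"
    and h: "elementary_homotopy A p2 q2"
    and p2: "\<And>u. u \<in> {0..1} \<Longrightarrow> snd p (affine_to s t u) = snd p2 u"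
    and q2: "\<And>u. u \<in> {0..1} \<Longrightarrow> snd q (affine_to s t u) = snd q2 u"
  shows "(p, q) \<in> path_equiv A"
proof -
  have ep: "p2 \<in> entrance_paths A" "q2 \<in> entrance_paths A" "fst p2 = {0, 1/2, 1}" "fst q2 = {0, 1}"
    using h unfolding elementary_homotopy_def by auto
  define m where "m = (s + t) / 2"
  have m: "s < m" "m < t" unfolding m_def using st by auto
  \<comment> \<open>All cuts of either path inside the open interval are dropped: there the paths
    are \<open>p2\<close> and \<open>q2\<close>, and the cuts of these at 0, 1/2, 1 and at 0, 1
    correspond to \<open>s\<close>, \<open>m\<close>, \<open>t\<close> and to \<open>s\<close>,
    \<open>t\<close>.\<close>
  define P where "P = {0, 1, s, t} \<union> (fst p \<union> fst q) - {s<..<t}"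
  note Pp = entrance_pathD[OF p] and Pq = entrance_pathD[OF q]
  have P: "is_interval_stratification P" "is_interval_stratification (insert m P)"
    using Pp Pq st m unfolding P_def is_interval_stratification_def by auto
  note inc = incr_homeo_affine[OF st(2)]
  have piece: "pdim A (snd w x) = pdim A (snd w y)"
    if w: "w2 \<in> entrance_paths A" "\<And>u. u \<in> {0..1} \<Longrightarrow> snd w (affine_to s t u) = snd w2 u"
      and xy: "s \<le> x" "x < y" "y \<le> t" "{x<..y} \<inter> affine_to s t ` fst w2 = {}" for w w2 :: "'a spath" and x y
  proof -
    have "x \<in> affine_to s t ` {0..1}" "y \<in> affine_to s t ` {0..1}" using incr_homeo_image[OF inc] xy by simp_all
    then obtain x' y' where x': "x' \<in> {0..1}" "x = affine_to s t x'" and y': "y' \<in> {0..1}" "y = affine_to s t y'"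
      by blast
    have "x' < y'" using incr_homeo_less_iff[OF inc x'(1) y'(1)] x' y' xy by simp
    moreover have "{x'<..y'} \<inter> fst w2 = {}"
    proof (rule ccontr)
      assume "{x'<..y'} \<inter> fst w2 \<noteq> {}"
      then obtain u where u: "x' < u" "u \<le> y'" "u \<in> fst w2" by auto
      then have "affine_to s t u \<in> {x<..y}"
        using incr_homeo_less_iff[OF inc x'(1), of u] incr_homeo_le_iff[OF inc _ y'(1), of u] x' y' by auto
      then show False using u(3) xy(4) by blast
    qed
    ultimately have "pdim A (snd w2 x') = pdim A (snd w2 y')"
      using x'(1) y'(1) by (intro entrance_path_cut[OF w(1)]) auto
    then show ?thesis using w(2) x' y' by simp
  qed
  have outside: "pdim A (snd w x) = pdim A (snd w y)"
    if w: "w \<in> entrance_paths A" "fst w - {s<..<t} \<subseteq> P"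
      and xy: "0 \<le> x" "x < y" "y \<le> 1" "y \<le> s \<or> t \<le> x" "{x<..y} \<inter> P = {}" for w x y
  proof -
    have "{x<..y} \<inter> {s<..<t} = {}" using xy(4) by auto
    then have "{x<..y} \<inter> fst w = {}" using w(2) xy(5) by blast
    then show ?thesis using xy by (intro entrance_path_cut[OF w(1)]) auto
  qed
  \<comment> \<open>As \<open>s\<close> and \<open>t\<close> are cuts, an interval containing no cut
    either stays within \<open>[s, t)\<close> or stays outside the open interval between
    them.\<close>
  have cases: "s \<le> x \<and> y \<le> t \<and> y < t \<or> y \<le> s \<or> t \<le> x"
    if "0 \<le> x" "x < y" "y \<le> 1" "{x<..y} \<inter> P = {}" for x y
  proof -
    have "s \<in> P" "t \<in> P" using st unfolding P_def by auto
    then have "s \<notin> {x<..y}" "t \<notin> {x<..y}" using that(4) by blast+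
    then show ?thesis using that by auto
  qed
  have pP: "fst p - {s<..<t} \<subseteq> P" "fst q - {s<..<t} \<subseteq> P" unfolding P_def by blast+
  have "affine_to s t (1/2) = m" unfolding m_def affine_to_def by (simp add: field_simps)
  then have im: "affine_to s t ` fst p2 = {s, m, t}" "affine_to s t ` fst q2 = {s, t}" using ep by auto
  have "pdim A (snd p x) = pdim A (snd p y)"
    if xy: "0 \<le> x" "x < y" "y \<le> 1" "{x<..y} \<inter> insert m P = {}" for x y
  proof (cases "s \<le> x \<and> y \<le> t \<and> y < t")
    case True
    have "{x<..y} \<inter> affine_to s t ` fst p2 = {}" using True xy unfolding im by auto
    then show ?thesis using piece[OF ep(1) p2] True xy by blast
  next
    case False
    then show ?thesis using outside[OF p pP(1)] cases[of x y] xy by blast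
  qed
  then have p': "(insert m P, snd p) \<in> entrance_paths A"
    unfolding entrance_paths_iff[OF conical_filtered] using Pp P by blast
  have "pdim A (snd q x) = pdim A (snd q y)"
    if xy: "0 \<le> x" "x < y" "y \<le> 1" "{x<..y} \<inter> P = {}" for x y
  proof (cases "s \<le> x \<and> y \<le> t \<and> y < t")
    case True
    have "{x<..y} \<inter> affine_to s t ` fst q2 = {}" using True xy unfolding im by auto
    then show ?thesis using piece[OF ep(2) q2] True xy by blast
  next
    case False
    then show ?thesis using outside[OF q pP(2)] cases[of x y] xy by blast
  qed
  then have q': "(P, snd q) \<in> entrance_paths A"
    unfolding entrance_paths_iff[OF conical_filtered] using Pq P by blast
  have "restrict (snd p \<circ> affine_to s t) {0..1} = snd p2" "restrict (snd q \<circ> affine_to s t) {0..1} = snd q2"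
    using restrict_eq_extensional[OF entrance_pathD(2)[OF ep(1)], of "snd p \<circ> affine_to s t"]
      restrict_eq_extensional[OF entrance_pathD(2)[OF ep(2)], of "snd q \<circ> affine_to s t"] p2 q2 by simp_all
  then have h': "elementary_homotopy A ({0, 1/2, 1}, restrict (snd p \<circ> affine_to s t) {0..1})
      ({0, 1}, restrict (snd q \<circ> affine_to s t) {0..1})"
    using h ep(3,4) by (metis prod.collapse)
  have "elementarily_related A (insert m P, snd p) (P, snd q)"
    by (rule elementarily_related_local[OF p' q' st m_def _ _ h']) (use pq ends in \<open>auto simp: P_def less_le\<close>)
  then have "((insert m P, snd p), (P, snd q)) \<in> path_equiv A" by (rule path_equiv_related)
  moreover have "(p, (insert m P, snd p)) \<in> path_equiv A" "((P, snd q), q) \<in> path_equiv A"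
    using path_equiv_cuts[of "fst p" "snd p"] path_equiv_cuts[of P "snd q" "fst q"] p q p' q' by simp_all
  ultimately show ?thesis using path_equiv_trans by metis
qed

end

subsection \<open>Classes of paths on intervals\<close>

definition path_class :: "'a filtered \<Rightarrow> (real \<Rightarrow> 'a) \<Rightarrow> real \<Rightarrow> real \<Rightarrow> 'a spath set" where
  "path_class A f a b = path_equiv A `` {(SOME P. (P, restrict (f \<circ> affine_to a b) {0..1}) \<in> entrance_paths A,
     restrict (f \<circ> affine_to a b) {0..1})}"

lemma incr_homeo_double:
  "incr_homeo (\<lambda>t. 2 * t) 0 (1/2) 0 1" "incr_homeo (\<lambda>t. 2 * t - 1) (1/2) 1 0 1"
  unfolding incr_homeo_def by (auto intro!: strict_mono_onI continuous_intros)

lemma incr_homeo_halves: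
  assumes "incr_homeo \<phi> 0 1 0 1" "incr_homeo \<psi> 0 1 0 1"
  shows "incr_homeo (\<lambda>t. if t \<le> 1/2 then \<phi> (2 * t) / 2 else (\<psi> (2 * t - 1) + 1) / 2) 0 1 0 1"
proof (rule incr_homeo_glue)
  have *: "incr_homeo (\<lambda>t. t / 2) 0 1 0 (1/2)" "incr_homeo (\<lambda>t. (t + 1) / 2) 0 1 (1/2) 1"
    unfolding incr_homeo_def by (auto intro!: strict_mono_onI continuous_intros)
  show "incr_homeo (\<lambda>t. \<phi> (2 * t) / 2) 0 (1/2) 0 (1/2)"
    using incr_homeo_compose[OF incr_homeo_compose[OF incr_homeo_double(1) assms(1)] *(1)] by (simp add: comp_def)
  show "incr_homeo (\<lambda>t. (\<psi> (2 * t - 1) + 1) / 2) (1/2) 1 (1/2) 1"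
    using incr_homeo_compose[OF incr_homeo_compose[OF incr_homeo_double(2) assms(2)] *(2)] by (simp add: comp_def)
qed auto

lemma affine_to_inverse:
  assumes "a < b"
  obtains \<theta> where "incr_homeo \<theta> a b 0 1" "\<forall>t. \<theta> (affine_to a b t) = t" "\<forall>t. affine_to a b (\<theta> t) = t"
proof (rule that)
  show "incr_homeo (\<lambda>t. (t - a) / (b - a)) a b 0 1" using incr_homeo_linear[OF assms zero_less_one] by simp
qed (use assms in \<open>simp_all add: affine_to_def\<close>)

lemma snd_path_concat:
  "t \<in> {0..1} \<Longrightarrow> snd (path_concat q p) t = (if t \<le> 1/2 then snd p (2 * t) else snd q (2 * t - 1))"
  unfolding path_concat_def by simp

lemma entrance_on_const: "x \<in> topspace (top_of A) \<Longrightarrow> entrance_on A (\<lambda>_. x) a b"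
  unfolding entrance_on_def by simp

lemma entrance_on_glue:
  assumes "entrance_on A f a b" "entrance_on A g b c" "a \<le> b" "b \<le> c" "f b = g b"
  shows "entrance_on A (\<lambda>t. if t \<le> b then f t else g t) a c"
proof (rule entrance_on_join[OF _ _ assms(3,4)])
  show "entrance_on A (\<lambda>t. if t \<le> b then f t else g t) a b" by (rule entrance_on_cong[OF assms(1)]) simp
  show "entrance_on A (\<lambda>t. if t \<le> b then f t else g t) b c"
    by (rule entrance_on_cong[OF assms(2)]) (use assms(5) in auto)
qed

context
  fixes A :: "'a filtered"
  assumes conical: "conically_stratified A"
begin

lemma elementary_homotopy_ends:
  assumes "elementary_homotopy A p q"
  shows "snd p 0 = snd q 0" "snd p 1 = snd q 1"
proof -
  obtain h d e \<phi> \<psi> where "continuous_map (top_of_set triangle) (top_of A) h"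
    "\<forall>x y. (x, y) \<in> triangle \<longrightarrow> x + y < 1 \<longrightarrow> pdim A (h (x, y)) = d"
    "\<forall>x y. 0 < x \<longrightarrow> 0 < y \<longrightarrow> x + y = 1 \<longrightarrow> pdim A (h (x, y)) = e"
    "incr_homeo \<phi> 0 1 0 1" "incr_homeo \<psi> 0 1 0 1"
    "\<forall>t\<in>{0..1}. snd p t = h (bent (\<phi> t))" "\<forall>t\<in>{0..1}. snd q t = h (0, \<psi> t)"
    by (rule elementary_homotopyE[OF conical_filtered[OF conical] assms])
  then show "snd p 0 = snd q 0" "snd p 1 = snd q 1" by (simp_all add: incr_homeo_def bent_def)
qed

lemma elementary_homotopy_path_equiv:
  assumes "elementary_homotopy A p q"
  shows "(p, q) \<in> path_equiv A"
  by (rule path_equiv_local[OF conical _ _ _ _ _ _ _ _ assms, of _ _ 0 1])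
     (use assms elementary_homotopy_ends[OF assms] in \<open>auto simp: elementary_homotopy_def\<close>)

text \<open>Frees an elementary relation from \<open>0\<close>-strata and from the bracketing of
  concatenations: what is left is a change of parameter and an interval on which the two sides of a
  homotopy are exchanged. Concatenation and the lifting of paths use relations in this form.\<close>

lemma elementarily_relatedE:
  assumes "elementarily_related A p q"
  obtains p' q' \<phi> \<psi> p2 q2 a b where "p' \<in> entrance_paths A" "q' \<in> entrance_paths A"
    "incr_homeo \<phi> 0 1 0 1" "\<forall>t\<in>{0..1}. snd p' t = snd p (\<phi> t)"
    "incr_homeo \<psi> 0 1 0 1" "\<forall>t\<in>{0..1}. snd q' t = snd q (\<psi> t)"
    "elementary_homotopy A p2 q2 \<or> elementary_homotopy A q2 p2"
    "0 \<le> a" "a < b" "b \<le> 1"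
    "\<forall>t\<in>{0..1}. snd p' (affine_to a b t) = snd p2 t"
    "\<forall>t\<in>{0..1}. snd q' (affine_to a b t) = snd q2 t"
    "\<forall>t\<in>{0..1}. t \<le> a \<or> b \<le> t \<longrightarrow> snd p' t = snd q' t"
proof -
  obtain p' q' r s p2 q2 where *: "reparametrization p p'" "reparametrization q q'"
    "decomposes p' r p2 s" "decomposes q' r q2 s"
    "elementary_homotopy A p2 q2 \<or> elementary_homotopy A q2 p2"
    and pq: "p \<in> entrance_paths A" "q \<in> entrance_paths A"
    using assms unfolding elementarily_related_def by blast
  obtain \<phi> where \<phi>: "incr_homeo \<phi> 0 1 0 1" "snd p' = restrict (snd p \<circ> \<phi>) {0..1}"
    using *(1) by (rule reparametrizationE)
  obtain \<psi> where \<psi>: "incr_homeo \<psi> 0 1 0 1" "snd q' = restrict (snd q \<circ> \<psi>) {0..1}"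
    using *(2) by (rule reparametrizationE)
  obtain a b where ab: "0 \<le> a" "a < b" "b \<le> 1"
    and m: "\<forall>t\<in>{0..1}. snd p' (affine_to a b t) = snd p2 t"
    "\<forall>t\<in>{0..1}. snd q' (affine_to a b t) = snd q2 t"
    and off: "\<forall>t\<in>{0..1}. t < a \<or> b < t \<longrightarrow> snd p' t = snd q' t"
    using *(3,4) by (rule decomposes_middle)
  have "snd p2 0 = snd q2 0 \<and> snd p2 1 = snd q2 1" using *(5) elementary_homotopy_ends by metis
  then have "snd p' a = snd q' a" "snd p' b = snd q' b" 
    using m(1)[THEN bspec, of 0] m(1)[THEN bspec, of 1] m(2)[THEN bspec, of 0] m(2)[THEN bspec, of 1] by simp_all
  then have "\<forall>t\<in>{0..1}. t \<le> a \<or> b \<le> t \<longrightarrow> snd p' t = snd q' t"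
    using off by (auto simp: le_less)
  then show ?thesis
    using that[of p' q' \<phi> \<psi> p2 q2 a b] reparametrization_entrance_path[OF pq(1) *(1)]
      reparametrization_entrance_path[OF pq(2) *(2)] \<phi> \<psi> *(5) ab m by simp
qed

lemma path_equiv_ends:
  assumes "(p, q) \<in> path_equiv A"
  shows "path_source p = path_source q" "path_target p = path_target q"
proof -
  have *: "snd p 0 = snd q 0 \<and> snd p 1 = snd q 1" if r: "elementarily_related A p q" for p q
  proof -
    obtain p' q' \<phi> \<psi> p2 q2 a b where "p' \<in> entrance_paths A" "q' \<in> entrance_paths A"
      and \<phi>: "incr_homeo \<phi> 0 1 0 1" "\<forall>t\<in>{0..1}. snd p' t = snd p (\<phi> t)"
      "incr_homeo \<psi> 0 1 0 1" "\<forall>t\<in>{0..1}. snd q' t = snd q (\<psi> t)"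
      and "elementary_homotopy A p2 q2 \<or> elementary_homotopy A q2 p2"
      and ab: "0 \<le> a" "a < b" "b \<le> (1::real)"
      and "\<forall>t\<in>{0..1}. snd p' (affine_to a b t) = snd p2 t"
      and "\<forall>t\<in>{0..1}. snd q' (affine_to a b t) = snd q2 t" and off: "\<forall>t\<in>{0..1}. t \<le> a \<or> b \<le> t \<longrightarrow> snd p' t = snd q' t"
      using r by (elim elementarily_relatedE) (rule that, assumption+)
    show ?thesis using off[THEN bspec, of 0] off[THEN bspec, of 1] ab \<phi>(1,3)
        \<phi>(2)[THEN bspec, of 0] \<phi>(2)[THEN bspec, of 1] \<phi>(4)[THEN bspec, of 0] \<phi>(4)[THEN bspec, of 1]
      by (simp add: incr_homeo_def)
  qed
  have "(elementarily_related A)\<^sup>*\<^sup>* p q" using assms unfolding path_equiv_def by simp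
  then have "snd p 0 = snd q 0 \<and> snd p 1 = snd q 1"
    by (induction rule: rtranclp_induct) (use * in simp_all)
  then show "path_source p = path_source q" "path_target p = path_target q"
    unfolding path_source_def path_target_def by auto
qed

section \<open>Concatenation respects equivalence\<close>

lemma path_concat_entrance_path:
  assumes p: "p \<in> entrance_paths A" and q: "q \<in> entrance_paths A" and pq: "path_target p = path_source q"
  shows "path_concat q p \<in> entrance_paths A"
proof -
  note P = entrance_pathD[OF conical p] and Q = entrance_pathD[OF conical q]
  let ?R = "(\<lambda>t. t / 2) ` fst p \<union> (\<lambda>t. (t + 1) / 2) ` fst q"
  let ?f = "\<lambda>t. if t \<le> 1/2 then (snd p \<circ> (\<lambda>t. 2 * t)) t else (snd q \<circ> (\<lambda>t. 2 * t - 1)) t"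
  have "entrance_on A ?f 0 1"
    by (rule entrance_on_glue[OF entrance_on_incr_homeo[OF incr_homeo_double(1) P(3)] entrance_on_incr_homeo[OF incr_homeo_double(2) Q(3)]])
       (use pq in \<open>simp_all add: path_source_def path_target_def\<close>)
  then have e: "entrance_on A (snd (path_concat q p)) 0 1"
    by (rule entrance_on_cong) (simp add: snd_path_concat)
  have "0 \<in> (\<lambda>t. t / 2) ` fst p" "1 \<in> (\<lambda>t. (t + 1) / 2) ` fst q" "1/2 \<in> (\<lambda>t. t / 2) ` fst p"
    using P(1) Q(1) unfolding is_interval_stratification_def
    by (auto intro: rev_image_eqI[of 0] rev_image_eqI[of 1])
  moreover have "(\<lambda>t. t / 2) ` fst p \<subseteq> {0..1}" "(\<lambda>t. (t + 1) / 2) ` fst q \<subseteq> {0..1}"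
    using P(1) Q(1) unfolding is_interval_stratification_def by (auto simp: subset_iff)
  ultimately have R: "is_interval_stratification ?R"
    using P(1) Q(1) unfolding is_interval_stratification_def by simp
  have "pdim A (snd (path_concat q p) x) = pdim A (snd (path_concat q p) y)"
    if xy: "0 \<le> x" "x < y" "y \<le> 1" "{x<..y} \<inter> ?R = {}" for x y
  proof -
    have "1/2 \<notin> {x<..y}" using xy(4) \<open>1/2 \<in> (\<lambda>t. t / 2) ` fst p\<close> by blast
    then consider "y < 1/2" | "1/2 \<le> x" using xy(2) by fastforce
    then show ?thesis
    proof cases
      case 1
      have "{2 * x<..2 * y} \<inter> fst p = {}"
      proof (rule ccontr)
        assume "{2 * x<..2 * y} \<inter> fst p \<noteq> {}"
        then obtain u where "u \<in> fst p" "2 * x < u" "u \<le> 2 * y" by auto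
        then have "u / 2 \<in> {x<..y} \<inter> ?R" by auto
        then show False using xy(4) by blast
      qed
      then show ?thesis
        using 1 xy entrance_path_cut[OF conical p, of "2 * x" "2 * y"] by (simp add: snd_path_concat)
    next
      case 2
      have "{2 * x - 1<..2 * y - 1} \<inter> fst q = {}"
      proof (rule ccontr)
        assume "{2 * x - 1<..2 * y - 1} \<inter> fst q \<noteq> {}"
        then obtain u where "u \<in> fst q" "2 * x - 1 < u" "u \<le> 2 * y - 1" by auto
        then have "(u + 1) / 2 \<in> {x<..y} \<inter> ?R" by auto
        then show False using xy(4) by blast
      qed
      then have "pdim A (snd q (2 * x - 1)) = pdim A (snd q (2 * y - 1))"
        using 2 xy entrance_path_cut[OF conical q, of "2 * x - 1" "2 * y - 1"] by simp
      moreover have "snd (path_concat q p) x = snd q (2 * x - 1)"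
      proof (cases "x = 1/2")
        case True
        show ?thesis using pq unfolding True by (simp add: snd_path_concat path_source_def path_target_def)
      qed (use 2 xy in \<open>simp add: snd_path_concat\<close>)
      moreover have "snd (path_concat q p) y = snd q (2 * y - 1)" using 2 xy by (simp add: snd_path_concat)
      ultimately show ?thesis by simp
    qed
  qed
  then have "(?R, snd (path_concat q p)) \<in> entrance_paths A"
    unfolding entrance_paths_iff[OF conical_filtered[OF conical]] using R e by (simp add: path_concat_def)
  then show ?thesis by (simp add: path_concat_def)
qed

lemma path_concat_reparam:
  assumes p: "p \<in> entrance_paths A" "p' \<in> entrance_paths A" and q: "q \<in> entrance_paths A" "q' \<in> entrance_paths A"
    and \<phi>: "incr_homeo \<phi> 0 1 0 1" "\<And>t. t \<in> {0..1} \<Longrightarrow> snd p' t = snd p (\<phi> t)"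
    and \<psi>: "incr_homeo \<psi> 0 1 0 1" "\<And>t. t \<in> {0..1} \<Longrightarrow> snd q' t = snd q (\<psi> t)"
    and pq: "path_target p = path_source q" "path_target p' = path_source q'"
  shows "(path_concat q p, path_concat q' p') \<in> path_equiv A"
proof (rule path_equiv_incr_homeo[OF conical path_concat_entrance_path[OF p(1) q(1) pq(1)]
    path_concat_entrance_path[OF p(2) q(2) pq(2)] incr_homeo_halves[OF \<phi>(1) \<psi>(1)]])
  fix t :: real assume t: "t \<in> {0..1}"
  show "snd (path_concat q' p') t =
    snd (path_concat q p) (if t \<le> 1/2 then \<phi> (2 * t) / 2 else (\<psi> (2 * t - 1) + 1) / 2)"
  proof (cases "t \<le> 1/2")
    case True
    then have "2 * t \<in> {0..1}" using t by auto
    then show ?thesis using True t incr_homeo_in[OF \<phi>(1), of "2 * t"] \<phi>(2)[of "2 * t"] by (simp add: snd_path_concat)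
  next
    case False
    then have u: "2 * t - 1 \<in> {0..1}" "0 < 2 * t - 1" using t by auto
    then have "0 < \<psi> (2 * t - 1)" "\<psi> (2 * t - 1) \<le> 1"
      using incr_homeo_less[OF \<psi>(1), of 0 "2 * t - 1"] incr_homeo_in[OF \<psi>(1) u(1)] \<psi>(1)
      by (simp_all add: incr_homeo_def)
    moreover have "(2 * \<psi> (2 * t - 1) + 2) / 2 - 1 = \<psi> (2 * t - 1)" by (simp add: add_divide_distrib)
    ultimately show ?thesis using False t u \<psi>(2)[of "2 * t - 1"] by (simp add: snd_path_concat)
  qed
qed

lemma incr_homeo_id: "incr_homeo (\<lambda>t. t) a b a b"
  unfolding incr_homeo_def by (auto intro: strict_mono_onI)

text \<open>Concatenating with \<open>w\<close> changes the bracketing, so a decomposition of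
  \<open>p\<close> does not directly yield one of the composite. The interval of the homotopy,
  however, merely moves to \<open>[a/2, b/2]\<close> or \<open>[(a+1)/2, (b+1)/2]\<close>, and
  \<open>path_equiv_local\<close> accepts a homotopy on any subinterval.\<close>

lemma path_concat_related:
  assumes r: "elementarily_related A p q" and w: "w \<in> entrance_paths A"
  shows "path_target p = path_source w \<Longrightarrow> (path_concat w p, path_concat w q) \<in> path_equiv A"
    and "path_target w = path_source p \<Longrightarrow> (path_concat p w, path_concat q w) \<in> path_equiv A"
proof -
  have pq: "p \<in> entrance_paths A" "q \<in> entrance_paths A" using elementarily_related_paths[OF conical r] by auto
  have e: "path_source p = path_source q" "path_target p = path_target q"
    using path_equiv_ends[OF path_equiv_related[OF conical r]] by auto
  obtain p' q' \<phi> \<psi> p2 q2 a b where pq': "p' \<in> entrance_paths A" "q' \<in> entrance_paths A"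
    and \<phi>: "incr_homeo \<phi> 0 1 0 1" "\<forall>t\<in>{0..1}. snd p' t = snd p (\<phi> t)"
    and \<psi>: "incr_homeo \<psi> 0 1 0 1" "\<forall>t\<in>{0..1}. snd q' t = snd q (\<psi> t)"
    and h: "elementary_homotopy A p2 q2 \<or> elementary_homotopy A q2 p2"
    and ab: "0 \<le> a" "a < b" "b \<le> 1"
    and m1: "\<forall>t\<in>{0..1}. snd p' (affine_to a b t) = snd p2 t"
    and m2: "\<forall>t\<in>{0..1}. snd q' (affine_to a b t) = snd q2 t"
    and off: "\<forall>t\<in>{0..1}. t \<le> a \<or> b \<le> t \<longrightarrow> snd p' t = snd q' t"
    using r by (elim elementarily_relatedE) (rule that, assumption+)
  note \<phi>2 = \<phi>(2)[rule_format] and \<psi>2 = \<psi>(2)[rule_format]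
    and m1 = m1[rule_format] and m2 = m2[rule_format] and off = off[rule_format]
  have e': "path_source p' = path_source p" "path_target p' = path_target p"
    "path_source q' = path_source q" "path_target q' = path_target q"
    using \<phi>(1) \<psi>(1) \<phi>2 \<psi>2 by (simp_all add: path_source_def path_target_def incr_homeo_def)
  have aff01: "affine_to a b u \<in> {a..b}" if "u \<in> {0..1}" for u using affine_to_in[of a b u] ab that by simp
  have local: "(c, d) \<in> path_equiv A"
    if cd: "c \<in> entrance_paths A" "d \<in> entrance_paths A" and st: "0 \<le> s" "s < t" "t \<le> 1"
      and off: "\<And>u. u \<in> {0..1} \<Longrightarrow> u \<le> s \<or> t \<le> u \<Longrightarrow> snd c u = snd d u"
      and c: "\<And>u. u \<in> {0..1} \<Longrightarrow> snd c (affine_to s t u) = snd p2 u"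
      and d: "\<And>u. u \<in> {0..1} \<Longrightarrow> snd d (affine_to s t u) = snd q2 u" for c d s t
    using h
  proof
    assume h: "elementary_homotopy A p2 q2"
    show ?thesis by (rule path_equiv_local[OF conical cd st _ _ _ h c d]) (use st in \<open>auto intro!: off\<close>)
  next
    assume h: "elementary_homotopy A q2 p2"
    have "(d, c) \<in> path_equiv A"
      by (rule path_equiv_local[OF conical cd(2,1) st _ _ _ h d c]) (use st in \<open>auto intro!: off[symmetric]\<close>)
    then show ?thesis by (rule path_equiv_sym[OF conical])
  qed
  {
    assume t: "path_target p = path_source w"
    have E: "path_target p' = path_source w" "path_target q' = path_source w" "path_target q = path_source w"
      using t e e' by simp_all
    have "(path_concat w p', path_concat w q') \<in> path_equiv A"
    proof (rule local[of _ _ "a / 2" "b / 2"])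
      have aff: "affine_to (a / 2) (b / 2) u = affine_to a b u / 2" for u
        unfolding affine_to_def by (simp add: field_simps)
      show "snd (path_concat w p') (affine_to (a / 2) (b / 2) u) = snd p2 u" if "u \<in> {0..1}" for u
        using aff01[OF that] ab m1[OF that] unfolding aff by (simp add: snd_path_concat)
      show "snd (path_concat w q') (affine_to (a / 2) (b / 2) u) = snd q2 u" if "u \<in> {0..1}" for u
        using aff01[OF that] ab m2[OF that] unfolding aff by (simp add: snd_path_concat)
      show "snd (path_concat w p') u = snd (path_concat w q') u" if "u \<in> {0..1}" "u \<le> a / 2 \<or> b / 2 \<le> u" for u
        using that off[of "2 * u"] by (auto simp: snd_path_concat)
    qed (use ab path_concat_entrance_path pq' w E in auto)
    moreover have "(path_concat w p, path_concat w p') \<in> path_equiv A"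
      by (rule path_concat_reparam[OF pq(1) pq'(1) w w \<phi>(1) \<phi>2 incr_homeo_id _ t E(1)]) simp_all
    moreover have "(path_concat w q, path_concat w q') \<in> path_equiv A"
      by (rule path_concat_reparam[OF pq(2) pq'(2) w w \<psi>(1) \<psi>2 incr_homeo_id _ E(3,2)]) simp_all
    ultimately show "(path_concat w p, path_concat w q) \<in> path_equiv A"
      by (metis path_equiv_trans[OF conical] path_equiv_sym[OF conical])
  }
  {
    assume t: "path_target w = path_source p"
    have E: "path_target w = path_source p'" "path_target w = path_source q'" "path_target w = path_source q"
      using t e e' by simp_all
    have "(path_concat p' w, path_concat q' w) \<in> path_equiv A"
    proof (rule local[of _ _ "(a + 1) / 2" "(b + 1) / 2"])
      have aff: "affine_to ((a + 1) / 2) ((b + 1) / 2) u = (affine_to a b u + 1) / 2" for u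
        unfolding affine_to_def by (simp add: field_simps)
      \<comment> \<open>At \<open>v = 0\<close> the value of the concatenation is taken from its
        first piece \<open>w\<close>, so this instance rests on the matching of the ends.\<close>
      have sndr: "snd (path_concat r w) ((v + 1) / 2) = snd r v"
        if "path_target w = path_source r" "v \<in> {0..1}" for r v
        using that by (cases "v = 0") (simp_all add: snd_path_concat path_source_def path_target_def add_divide_distrib)
      show "snd (path_concat p' w) (affine_to ((a + 1) / 2) ((b + 1) / 2) u) = snd p2 u" if "u \<in> {0..1}" for u
        using aff01[OF that] ab m1[OF that] unfolding aff by (simp add: sndr[OF E(1)])
      show "snd (path_concat q' w) (affine_to ((a + 1) / 2) ((b + 1) / 2) u) = snd q2 u" if "u \<in> {0..1}" for u
        using aff01[OF that] ab m2[OF that] unfolding aff by (simp add: sndr[OF E(2)])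
      show "snd (path_concat p' w) u = snd (path_concat q' w) u"
        if "u \<in> {0..1}" "u \<le> (a + 1) / 2 \<or> (b + 1) / 2 \<le> u" for u
        using that off[of "2 * u - 1"] by (auto simp: snd_path_concat)
    qed (use ab path_concat_entrance_path pq' w E in auto)
    moreover have "(path_concat p w, path_concat p' w) \<in> path_equiv A"
      by (rule path_concat_reparam[OF w w pq(1) pq'(1) incr_homeo_id _ \<phi>(1) \<phi>2 t E(1)]) simp_all
    moreover have "(path_concat q w, path_concat q' w) \<in> path_equiv A"
      by (rule path_concat_reparam[OF w w pq(2) pq'(2) incr_homeo_id _ \<psi>(1) \<psi>2 E(3,2)]) simp_all
    ultimately show "(path_concat p w, path_concat q w) \<in> path_equiv A"
      by (metis path_equiv_trans[OF conical] path_equiv_sym[OF conical])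
  }
qed

lemma path_concat_equiv:
  assumes p: "(p, p') \<in> path_equiv A" and q: "(q, q') \<in> path_equiv A" and pq: "path_target p = path_source q"
  shows "(path_concat q p, path_concat q' p') \<in> path_equiv A"
proof -
  have P: "p \<in> entrance_paths A" "(elementarily_related A)\<^sup>*\<^sup>* p p'" "p' \<in> entrance_paths A"
    and Q: "q \<in> entrance_paths A" "(elementarily_related A)\<^sup>*\<^sup>* q q'" "q' \<in> entrance_paths A"
    using p q unfolding path_equiv_def by auto
  have 1: "(path_concat q p, path_concat q p') \<in> path_equiv A \<and> path_target p' = path_target p"
    using P(2)
  proof (induction rule: rtranclp_induct)
    case base
    then show ?case using path_equiv_refl[OF conical] path_concat_entrance_path[OF P(1) Q(1) pq] by simp
  next
    case (step y z)
    have "path_target y = path_target z"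
      using path_equiv_ends[OF path_equiv_related[OF conical step(2)]] by simp
    then show ?case
      using path_concat_related(1)[OF step(2) Q(1)] step(3) pq path_equiv_trans[OF conical] by metis
  qed
  have "(path_concat q p', path_concat q' p') \<in> path_equiv A \<and> path_source q' = path_source q"
    using Q(2)
  proof (induction rule: rtranclp_induct)
    case base
    then show ?case using path_equiv_refl[OF conical] path_concat_entrance_path[OF P(3) Q(1)] pq 1 by simp
  next
    case (step y z)
    have "path_source y = path_source z"
      using path_equiv_ends[OF path_equiv_related[OF conical step(2)]] by simp
    then show ?case
      using path_concat_related(2)[OF step(2) P(3)] step(3) pq 1 path_equiv_trans[OF conical] by metis
  qed
  then show ?thesis using 1 path_equiv_trans[OF conical] by blast
qed

lemma Dom_Ent: "p \<in> entrance_paths A \<Longrightarrow> Dom (Ent A) (path_equiv A `` {p}) = path_source p"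
proof -
  assume p: "p \<in> entrance_paths A"
  have "the_elem (path_source ` (path_equiv A `` {p})) = path_source p"
    by (rule the_elem_image_const) (use path_equiv_refl[OF conical p] path_equiv_ends(1) in auto)
  then show ?thesis by (simp add: Ent_def)
qed

lemma Cod_Ent: "p \<in> entrance_paths A \<Longrightarrow> Cod (Ent A) (path_equiv A `` {p}) = path_target p"
proof -
  assume p: "p \<in> entrance_paths A"
  have "the_elem (path_target ` (path_equiv A `` {p})) = path_target p"
    by (rule the_elem_image_const) (use path_equiv_refl[OF conical p] path_equiv_ends(2) in auto)
  then show ?thesis by (simp add: Ent_def)
qed

lemma Comp_Ent:
  assumes p: "p \<in> entrance_paths A" and q: "q \<in> entrance_paths A" and pq: "path_target p = path_source q"
  shows "Comp (Ent A) (path_equiv A `` {q}) (path_equiv A `` {p}) = path_equiv A `` {path_concat q p}"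
proof -
  have "path_equiv A `` {path_concat q' p'} = path_equiv A `` {path_concat q p}"
    if "p' \<in> path_equiv A `` {p}" "q' \<in> path_equiv A `` {q}" for p' q'
    using path_concat_equiv[of p p' q q'] that pq equiv_class_eq[OF equiv_path_equiv[OF conical]] by blast
  moreover have "p \<in> path_equiv A `` {p}" "q \<in> path_equiv A `` {q}"
    using path_equiv_refl[OF conical] p q by auto
  ultimately have "(\<Union>p'\<in>path_equiv A `` {p}. \<Union>q'\<in>path_equiv A `` {q}. path_equiv A `` {path_concat q' p'}) =
      path_equiv A `` {path_concat q p}"
    by (metis (no_types, lifting) SUP_eq_const empty_iff)
  then show ?thesis by (simp add: Ent_def)
qed

section \<open>Arrows as classes of functions on arbitrary intervals\<close>

lemma entrance_path_exists:
  assumes "entrance_on A f a b" "a < b"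
  shows "\<exists>P. (P, restrict (f \<circ> affine_to a b) {0..1}) \<in> entrance_paths A"
proof -
  have e: "entrance_on A (restrict (f \<circ> affine_to a b) {0..1}) 0 1"
    by (rule entrance_on_cong[OF entrance_on_incr_homeo[OF incr_homeo_affine[OF assms(2)] assms(1)]]) simp
  from entrance_on_cuts[OF conical_filtered[OF conical] e] obtain P where P: "is_interval_stratification P"
    "\<And>x y. 0 \<le> x \<Longrightarrow> x < y \<Longrightarrow> y \<le> 1 \<Longrightarrow> {x<..y} \<inter> P = {} \<Longrightarrow>
      pdim A (restrict (f \<circ> affine_to a b) {0..1} x) = pdim A (restrict (f \<circ> affine_to a b) {0..1} y)"
    by blast
  have "(P, restrict (f \<circ> affine_to a b) {0..1}) \<in> entrance_paths A"
    unfolding entrance_paths_iff[OF conical_filtered[OF conical]]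
    by (intro conjI allI impI P e) simp_all
  then show ?thesis ..
qed

lemma path_class_rep:
  assumes "entrance_on A f a b" "a < b"
  obtains P where "(P, restrict (f \<circ> affine_to a b) {0..1}) \<in> entrance_paths A"
    "path_class A f a b = path_equiv A `` {(P, restrict (f \<circ> affine_to a b) {0..1})}"
  using someI_ex[OF entrance_path_exists[OF assms]] that unfolding path_class_def by blast

lemma path_class_eqI:
  assumes f: "entrance_on A f a b" "a < b" and q: "q \<in> entrance_paths A"
    and \<phi>: "incr_homeo \<phi> 0 1 a b" "\<And>t. t \<in> {0..1} \<Longrightarrow> snd q t = f (\<phi> t)"
  shows "path_equiv A `` {q} = path_class A f a b"
proof -
  obtain P where P: "(P, restrict (f \<circ> affine_to a b) {0..1}) \<in> entrance_paths A"
    "path_class A f a b = path_equiv A `` {(P, restrict (f \<circ> affine_to a b) {0..1})}"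
    using f by (rule path_class_rep)
  obtain \<theta> where \<theta>: "incr_homeo \<theta> a b 0 1" "\<forall>t. \<theta> (affine_to a b t) = t"
    "\<forall>t. affine_to a b (\<theta> t) = t"
    by (rule affine_to_inverse[OF f(2)])
  note inc = incr_homeo_compose[OF \<phi>(1) \<theta>(1)]
  have "((P, restrict (f \<circ> affine_to a b) {0..1}), q) \<in> path_equiv A"
    by (rule path_equiv_incr_homeo[OF conical P(1) q inc])
       (use \<phi>(2) \<theta>(3) incr_homeo_in[OF \<phi>(1)] incr_homeo_in[OF inc] in simp)
  then show ?thesis unfolding P(2) by (rule equiv_class_eq[OF equiv_path_equiv[OF conical], symmetric])
qed

lemma path_class_reparam:
  assumes f: "entrance_on A f a' b'" and \<phi>: "incr_homeo \<phi> a b a' b'" and "a < b"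
    and g: "\<And>t. t \<in> {a..b} \<Longrightarrow> g t = f (\<phi> t)"
  shows "path_class A g a b = path_class A f a' b'"
proof -
  have ge: "entrance_on A g a b"
    by (rule entrance_on_cong[OF entrance_on_incr_homeo[OF \<phi> f]]) (simp add: g)
  obtain P where P: "(P, restrict (g \<circ> affine_to a b) {0..1}) \<in> entrance_paths A"
    "path_class A g a b = path_equiv A `` {(P, restrict (g \<circ> affine_to a b) {0..1})}"
    using ge assms(3) by (rule path_class_rep)
  have "a' < b'" using incr_homeo_less[OF \<phi>, of a b] \<phi> assms(3) unfolding incr_homeo_def by simp
  show ?thesis unfolding P(2)
    by (rule path_class_eqI[OF f \<open>a' < b'\<close> P(1) incr_homeo_compose[OF incr_homeo_affine[OF assms(3)] \<phi>]])
       (use g affine_to_in[of a b] assms(3) in simp)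
qed

lemma path_class_cong:
  assumes "entrance_on A f a b" "a < b" "\<And>t. t \<in> {a..b} \<Longrightarrow> g t = f t"
  shows "path_class A g a b = path_class A f a b"
  using path_class_reparam[OF assms(1) incr_homeo_id assms(2,3)] by simp

lemma path_class_arrow:
  assumes f: "entrance_on A f a b" "a < b"
  shows "path_class A f a b \<in> Ar (Ent A)" "Dom (Ent A) (path_class A f a b) = f a"
    "Cod (Ent A) (path_class A f a b) = f b"
proof -
  obtain P where P: "(P, restrict (f \<circ> affine_to a b) {0..1}) \<in> entrance_paths A"
    "path_class A f a b = path_equiv A `` {(P, restrict (f \<circ> affine_to a b) {0..1})}"
    using f by (rule path_class_rep)
  show "path_class A f a b \<in> Ar (Ent A)" unfolding P(2) using P(1) by (simp add: Ent_def quotientI)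
  show "Dom (Ent A) (path_class A f a b) = f a" "Cod (Ent A) (path_class A f a b) = f b"
    unfolding P(2) using Dom_Ent[OF P(1)] Cod_Ent[OF P(1)] by (simp_all add: path_source_def path_target_def)
qed

text \<open>The concatenation of the two pieces is the path on \<open>[a, c]\<close> with its
  parameter changed by a piecewise affine map that takes \<open>1/2\<close> to
  \<open>b\<close>.\<close>

lemma path_class_Comp:
  assumes f: "entrance_on A f a c" and abc: "a < b" "b < c"
  shows "Comp (Ent A) (path_class A f b c) (path_class A f a b) = path_class A f a c"
proof -
  have fe: "entrance_on A f a b" "entrance_on A f b c" using f abc by (auto intro: entrance_on_subset)
  obtain P where P: "(P, restrict (f \<circ> affine_to a b) {0..1}) \<in> entrance_paths A"
    "path_class A f a b = path_equiv A `` {(P, restrict (f \<circ> affine_to a b) {0..1})}"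
    using fe(1) abc(1) by (rule path_class_rep)
  obtain Q where Q: "(Q, restrict (f \<circ> affine_to b c) {0..1}) \<in> entrance_paths A"
    "path_class A f b c = path_equiv A `` {(Q, restrict (f \<circ> affine_to b c) {0..1})}"
    using fe(2) abc(2) by (rule path_class_rep)
  have t: "path_target (P, restrict (f \<circ> affine_to a b) {0..1}) = path_source (Q, restrict (f \<circ> affine_to b c) {0..1})"
    by (simp add: path_source_def path_target_def)
  have inc: "incr_homeo (\<lambda>t. if t \<le> 1/2 then (affine_to a b \<circ> (\<lambda>t. 2 * t)) t
      else (affine_to b c \<circ> (\<lambda>t. 2 * t - 1)) t) 0 1 a c"
    by (rule incr_homeo_glue[OF incr_homeo_compose[OF incr_homeo_double(1) incr_homeo_affine]
        incr_homeo_compose[OF incr_homeo_double(2) incr_homeo_affine]]) (use abc in auto)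
  show ?thesis unfolding P(2) Q(2) Comp_Ent[OF P(1) Q(1) t]
    by (rule path_class_eqI[OF f _ path_concat_entrance_path[OF P(1) Q(1) t] inc])
       (use abc in \<open>auto simp: snd_path_concat\<close>)
qed

text \<open>The interval can be prescribed. Composable arrows are put on adjacent intervals and
  become parts of one function, so associativity and functoriality reduce to subdividing a single
  path.\<close>

lemma Ar_EntE:
  assumes "c \<in> Ar (Ent A)" "a < b"
  obtains f where "entrance_on A f a b" "c = path_class A f a b"
proof -
  obtain p where p: "p \<in> entrance_paths A" "c = path_equiv A `` {p}"
    using assms(1) by (auto simp: Ent_def elim: quotientE)
  obtain \<theta> where \<theta>: "incr_homeo \<theta> a b 0 1" "\<forall>t. \<theta> (affine_to a b t) = t"
    "\<forall>t. affine_to a b (\<theta> t) = t"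
    by (rule affine_to_inverse[OF assms(2)])
  have e: "entrance_on A (snd p \<circ> \<theta>) a b"
    by (rule entrance_on_incr_homeo[OF \<theta>(1) entrance_pathD(3)[OF conical p(1)]])
  have "c = path_class A (snd p \<circ> \<theta>) a b"
    unfolding p(2) by (rule path_class_eqI[OF e assms(2) p(1) incr_homeo_affine[OF assms(2)]]) (simp add: \<theta>(2))
  then show ?thesis using e that by blast
qed

lemma Ident_Ent:
  assumes "x \<in> topspace (top_of A)" "a < b"
  shows "Ident (Ent A) x = path_class A (\<lambda>_. x) a b"
proof -
  have "entrance_on A (restrict (\<lambda>_. x) {0..1}) 0 1"
    by (rule entrance_on_cong[OF entrance_on_const[OF assms(1)]]) simp
  then have "({0, 1}, restrict (\<lambda>_. x) {0..1}) \<in> entrance_paths A"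
    unfolding entrance_paths_iff[OF conical_filtered[OF conical]] is_interval_stratification_def by simp
  from path_class_eqI[OF entrance_on_const[OF assms(1)] assms(2) this incr_homeo_affine[OF assms(2)]]
  show ?thesis by (simp add: Ent_def)
qed

end

subsection \<open>The entrance path category as a functor\<close>

text \<open>The pattern of dimensions on the triangle after \<open>v0\<close> has been blown up to
  the left side of a rectangle: the right side corresponds to the edge from \<open>v1\<close> to
  \<open>v2\<close>, and the corner \<open>(b, d)\<close> to \<open>v2\<close>. Unlike the pattern
  of the triangle it is inherited by subrectangles.\<close>

definition entrance_rect :: "'a filtered \<Rightarrow> (real \<Rightarrow> real \<Rightarrow> 'a) \<Rightarrow> real \<Rightarrow> real \<Rightarrow> real \<Rightarrow> real \<Rightarrow> bool" where
  "entrance_rect A H a b c d \<longleftrightarrow>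
     continuous_map (top_of_set ({a..b} \<times> {c..d})) (top_of A) (\<lambda>(u, w). H u w) \<and>
     (\<exists>k l. (\<forall>u\<in>{a..<b}. \<forall>w\<in>{c..d}. pdim A (H u w) = k) \<and> (\<forall>w\<in>{c..<d}. pdim A (H b w) = l) \<and>
        l \<le> k \<and> pdim A (H b d) \<le> l)"

lemma entrance_rect_horizontal:
  assumes "entrance_rect A H a b c d" "w \<in> {c..d}"
  shows "entrance_on A (\<lambda>u. H u w) a b"
proof -
  obtain k l where k: "\<forall>u\<in>{a..<b}. \<forall>w\<in>{c..d}. pdim A (H u w) = k" "\<forall>w\<in>{c..<d}. pdim A (H b w) = l"
    "l \<le> k" "pdim A (H b d) \<le> l"
    and c: "continuous_map (top_of_set ({a..b} \<times> {c..d})) (top_of A) (\<lambda>(u, w). H u w)"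
    using assms(1) unfolding entrance_rect_def by (elim conjE exE)
  have "continuous_map (top_of_set {a..b}) (top_of A) ((\<lambda>(u, w). H u w) \<circ> (\<lambda>u. (u, w)))"
  proof (rule continuous_map_compose[OF _ c])
    have "continuous_on {a..b} (\<lambda>u. (u, w))" by (intro continuous_intros)
    then show "continuous_map (top_of_set {a..b}) (top_of_set ({a..b} \<times> {c..d})) (\<lambda>u. (u, w))"
      using assms(2) by auto
  qed
  moreover have "pdim A (H t w) \<le> pdim A (H s w)" if "a \<le> s" "s \<le> t" "t \<le> b" for s t
  proof -
    have "pdim A (H b w) \<le> k" using k assms(2) by (cases "w = d") auto
    moreover have "pdim A (H v w) = k" if "a \<le> v" "v < b" for v using k(1) assms(2) that by simp
    ultimately show ?thesis using that by (cases "s = t"; cases "t = b") simp_all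
  qed
  ultimately show ?thesis unfolding entrance_on_def by (simp add: comp_def)
qed

lemma entrance_rect_vertical:
  assumes "entrance_rect A H a b c d" "u \<in> {a..b}"
  shows "entrance_on A (H u) c d"
proof -
  obtain k l where k: "\<forall>u\<in>{a..<b}. \<forall>w\<in>{c..d}. pdim A (H u w) = k" "\<forall>w\<in>{c..<d}. pdim A (H b w) = l"
    "l \<le> k" "pdim A (H b d) \<le> l"
    and c: "continuous_map (top_of_set ({a..b} \<times> {c..d})) (top_of A) (\<lambda>(u, w). H u w)"
    using assms(1) unfolding entrance_rect_def by (elim conjE exE)
  have "continuous_map (top_of_set {c..d}) (top_of A) ((\<lambda>(u, w). H u w) \<circ> (\<lambda>w. (u, w)))"
  proof (rule continuous_map_compose[OF _ c])
    have "continuous_on {c..d} (\<lambda>w. (u, w))" by (intro continuous_intros)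
    then show "continuous_map (top_of_set {c..d}) (top_of_set ({a..b} \<times> {c..d})) (\<lambda>w. (u, w))"
      using assms(2) by auto
  qed
  moreover have "pdim A (H u t) \<le> pdim A (H u s)" if "c \<le> s" "s \<le> t" "t \<le> d" for s t
  proof (cases "u < b")
    case True
    then show ?thesis using k(1) assms(2) that by auto
  next
    case False
    then have "u = b" using assms(2) by simp
    show ?thesis
    proof (cases "s = t")
      case False
      then have "pdim A (H b s) = l" using k(2) that by simp
      moreover have "pdim A (H b t) \<le> l"
        using k(2,4) that by (cases "t = d") simp_all
      ultimately show ?thesis using \<open>u = b\<close> by simp
    qed simp
  qed
  ultimately show ?thesis unfolding entrance_on_def by (simp add: comp_def)
qed

lemma entrance_rect_subset:
  assumes "entrance_rect A H a b c d" "a \<le> a'" "a' \<le> b'" "b' \<le> b" "c \<le> c'" "c' \<le> d'" "d' \<le> d"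
  shows "entrance_rect A H a' b' c' d'"
proof -
  obtain k l where k: "\<forall>u\<in>{a..<b}. \<forall>w\<in>{c..d}. pdim A (H u w) = k" "\<forall>w\<in>{c..<d}. pdim A (H b w) = l"
    "l \<le> k" "pdim A (H b d) \<le> l"
    and c: "continuous_map (top_of_set ({a..b} \<times> {c..d})) (top_of A) (\<lambda>(u, w). H u w)"
    using assms(1) unfolding entrance_rect_def by (elim conjE exE)
  have "continuous_map (top_of_set ({a'..b'} \<times> {c'..d'})) (top_of A) (\<lambda>(u, w). H u w)"
    by (rule continuous_map_from_subtopology_mono[OF c]) (use assms in auto)
  moreover have "\<forall>u\<in>{a'..<b'}. \<forall>w\<in>{c'..d'}. pdim A (H u w) = k" using k(1) assms by auto
  \<comment> \<open>If \<open>b' < b\<close>, the new right side lies in the region of dimension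
    \<open>k\<close>, and \<open>k\<close> takes the role of \<open>l\<close>.\<close>
  moreover have "\<exists>l. (\<forall>w\<in>{c'..<d'}. pdim A (H b' w) = l) \<and> l \<le> k \<and> pdim A (H b' d') \<le> l"
  proof (cases "b' < b")
    case True
    then have "\<forall>w\<in>{c'..d'}. pdim A (H b' w) = k" using k(1) assms by auto
    then show ?thesis using assms(6) by (intro exI[of _ k]) auto
  next
    case False
    then have "b' = b" using assms by simp
    moreover have "\<forall>w\<in>{c'..<d'}. pdim A (H b w) = l" using k(2) assms by auto
    moreover have "pdim A (H b d') \<le> l"
    proof (cases "d' = d")
      case False
      then have "d' \<in> {c..<d}" using assms by simp
      then show ?thesis using k(2) by simp
    qed (use k(4) in simp)
    ultimately show ?thesis using k(3) by blast
  qed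
  ultimately show ?thesis unfolding entrance_rect_def by blast
qed

lemma affine_to_less: "a < b \<Longrightarrow> t < 1 \<Longrightarrow> affine_to a b t < b"
proof -
  assume "a < b" "t < 1"
  then have "(b - a) * t < (b - a) * 1" by (intro mult_strict_left_mono) simp_all
  then show ?thesis unfolding affine_to_def by simp
qed

context
  fixes A :: "'a filtered"
  assumes conical: "conically_stratified A"
begin

lemma path_class_triangle:
  assumes h: "elementary_homotopy A ({0, 1/2, 1}, restrict (h \<circ> bent) {0..1}) ({0, 1}, restrict (\<lambda>t. h (0, t)) {0..1})"
    and f: "entrance_on A f a b" "a < b" "\<And>t. t \<in> {0..1} \<Longrightarrow> h (t, 0) = f (affine_to a b t)"
    and g: "entrance_on A g c d" "c < d" "\<And>t. t \<in> {0..1} \<Longrightarrow> h (1 - t, t) = g (affine_to c d t)"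
  shows "Comp (Ent A) (path_class A g c d) (path_class A f a b) = path_class A (\<lambda>t. h (0, t)) 0 1"
proof -
  let ?p = "({0, 1/2, 1}, restrict (h \<circ> bent) {0..1})" and ?q = "({0, 1}, restrict (\<lambda>t. h (0, t)) {0..1})"
  have pq: "?p \<in> entrance_paths A" "?q \<in> entrance_paths A" using h unfolding elementary_homotopy_def by auto
  have e: "entrance_on A (h \<circ> bent) 0 1"
    by (rule entrance_on_cong[OF entrance_pathD(3)[OF conical pq(1)]]) simp
  have e': "entrance_on A (\<lambda>t. h (0, t)) 0 1"
    by (rule entrance_on_cong[OF entrance_pathD(3)[OF conical pq(2)]]) simp
  have "path_class A (h \<circ> bent) 0 (1/2) = path_class A f a b"
    by (rule path_class_reparam[OF conical f(1) incr_homeo_compose[OF incr_homeo_double(1) incr_homeo_affine[OF f(2)]]])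
       (use f(3) in \<open>auto simp: bent_cases\<close>)
  moreover have "path_class A (h \<circ> bent) (1/2) 1 = path_class A g c d"
  proof (rule path_class_reparam[OF conical g(1) incr_homeo_compose[OF incr_homeo_double(2) incr_homeo_affine[OF g(2)]]])
    fix t :: real assume "t \<in> {1/2..1}"
    then show "(h \<circ> bent) t = g ((affine_to c d \<circ> (\<lambda>t. 2 * t - 1)) t)"
      using g(3)[of "2 * t - 1"] by (simp add: bent_cases)
  qed simp
  ultimately have "Comp (Ent A) (path_class A g c d) (path_class A f a b) = path_class A (h \<circ> bent) 0 1"
    using path_class_Comp[OF conical e, of "1/2"] by simp
  also have "\<dots> = path_equiv A `` {?p}"
    by (rule path_class_eqI[OF conical e _ pq(1) incr_homeo_id[OF conical], symmetric]) simp_all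
  also have "\<dots> = path_equiv A `` {?q}"
    by (rule equiv_class_eq[OF equiv_path_equiv[OF conical] elementary_homotopy_path_equiv[OF conical h]])
  also have "\<dots> = path_class A (\<lambda>t. h (0, t)) 0 1"
    by (rule path_class_eqI[OF conical e' _ pq(2) incr_homeo_id[OF conical]]) simp_all
  finally show ?thesis .
qed

text \<open>The diagonal cuts the rectangle into two triangles, both with \<open>v0\<close> at
  \<open>(a, c)\<close> and \<open>v2\<close> at \<open>(b, d)\<close>. Both homotopies thus end at
  the corner \<open>(b, d)\<close>, which is why the basic open has to be taken about this point,
  and both have the diagonal as their straight side.\<close>

lemma entrance_rect_diagonal:
  assumes H: "entrance_rect A H a b c d" and ab: "a < b" "c < d"
    and U: "basic_open A (H b d) U" "\<And>u w. u \<in> {a..b} \<Longrightarrow> w \<in> {c..d} \<Longrightarrow> H u w \<in> U"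
  shows "Comp (Ent A) (path_class A (H b) c d) (path_class A (\<lambda>u. H u c) a b) =
      path_class A (\<lambda>t. H (affine_to a b t) (affine_to c d t)) 0 1"
    and "Comp (Ent A) (path_class A (\<lambda>u. H u d) a b) (path_class A (H a) c d) =
      path_class A (\<lambda>t. H (affine_to a b t) (affine_to c d t)) 0 1"
proof -
  obtain k l where k: "\<forall>u\<in>{a..<b}. \<forall>w\<in>{c..d}. pdim A (H u w) = k" "\<forall>w\<in>{c..<d}. pdim A (H b w) = l"
    "l \<le> k" "pdim A (H b d) \<le> l"
    and cont: "continuous_map (top_of_set ({a..b} \<times> {c..d})) (top_of A) (\<lambda>(u, w). H u w)"
    using H unfolding entrance_rect_def by (elim conjE exE)
  note A = conical_filtered[OF conical]
  have i1: "affine_to a b s \<in> {a..b}" and i2: "affine_to c d s \<in> {c..d}" if "s \<in> {0..1}" for s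
    using affine_to_in that ab by simp_all
  have j1: "affine_to a b s \<in> {a..<b}" and j2: "affine_to c d s \<in> {c..<d}" if "0 \<le> s" "s < 1" for s
    using i1[of s] i2[of s] affine_to_less that ab by simp_all
  have ends: "entrance_on A (\<lambda>u. H u c) a b" "entrance_on A (\<lambda>u. H u d) a b" "entrance_on A (H a) c d" "entrance_on A (H b) c d"
    using entrance_rect_horizontal[OF H] entrance_rect_vertical[OF H] ab by simp_all
  \<comment> \<open>The lower triangle: \<open>v1\<close> goes to \<open>(b, c)\<close>, and its
    edge to \<open>v2\<close> becomes the right side, of dimension \<open>l\<close> below the
    corner.\<close>
  let ?h = "\<lambda>z. H (affine_to a b (fst z + snd z)) (affine_to c d (snd z))"
  have "elementary_homotopy A ({0, 1/2, 1}, restrict (?h \<circ> bent) {0..1}) ({0, 1}, restrict (\<lambda>t. ?h (0, t)) {0..1})"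
  proof (rule elementary_homotopyI[OF A, where d = k and e = l and U = U])
    have "continuous_on triangle (\<lambda>z::real\<times>real. (affine_to a b (fst z + snd z), affine_to c d (snd z)))"
      unfolding affine_to_def by (intro continuous_intros)
    moreover have "(affine_to a b (fst z + snd z), affine_to c d (snd z)) \<in> {a..b} \<times> {c..d}" if "z \<in> triangle" for z
      using that i1 i2 by (cases z) (simp add: in_triangle)
    ultimately have "continuous_map (top_of_set triangle) (top_of A)
        ((\<lambda>(u, w). H u w) \<circ> (\<lambda>z. (affine_to a b (fst z + snd z), affine_to c d (snd z))))"
      by (intro continuous_map_compose[OF _ cont]) auto
    then show "continuous_map (top_of_set triangle) (top_of A) ?h" by (simp add: comp_def)
    show "pdim A (?h (x, y)) = k" if "(x, y) \<in> triangle" "x + y < 1" for x y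
      using k(1) j1[of "x + y"] i2[of y] that by (simp add: in_triangle)
    show "pdim A (?h (x, y)) = l" if "0 < x" "0 \<le> y" "x + y = 1" for x y
      using k(2) j2[of y] that by simp
    show "pdim A (?h v2) \<le> l" "l \<le> k" using k by simp_all
    show "basic_open A (?h v2) U" using U(1) by simp
    show "?h ` triangle \<subseteq> U"
    proof
      fix y assume "y \<in> ?h ` triangle"
      then obtain p q where "(p, q) \<in> triangle" "y = ?h (p, q)" by auto
      then show "y \<in> U" using U(2)[OF i1[of "p + q"] i2[of q]] by (simp add: in_triangle)
    qed
  qed
  from path_class_triangle[OF this ends(1) ab(1) _ ends(4) ab(2)]
  show "Comp (Ent A) (path_class A (H b) c d) (path_class A (\<lambda>u. H u c) a b) =
      path_class A (\<lambda>t. H (affine_to a b t) (affine_to c d t)) 0 1" by simp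
  \<comment> \<open>The upper triangle: \<open>v1\<close> goes to \<open>(a, d)\<close>, and its
    edge to \<open>v2\<close> becomes the top side, which has dimension \<open>k\<close> up to the
    corner.\<close>
  let ?g = "\<lambda>z. H (affine_to a b (snd z)) (affine_to c d (fst z + snd z))"
  have "elementary_homotopy A ({0, 1/2, 1}, restrict (?g \<circ> bent) {0..1}) ({0, 1}, restrict (\<lambda>t. ?g (0, t)) {0..1})"
  proof (rule elementary_homotopyI[OF A, where d = k and e = k and U = U])
    have "continuous_on triangle (\<lambda>z::real\<times>real. (affine_to a b (snd z), affine_to c d (fst z + snd z)))"
      unfolding affine_to_def by (intro continuous_intros)
    moreover have "(affine_to a b (snd z), affine_to c d (fst z + snd z)) \<in> {a..b} \<times> {c..d}" if "z \<in> triangle" for z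
      using that i1 i2 by (cases z) (simp add: in_triangle)
    ultimately have "continuous_map (top_of_set triangle) (top_of A)
        ((\<lambda>(u, w). H u w) \<circ> (\<lambda>z. (affine_to a b (snd z), affine_to c d (fst z + snd z))))"
      by (intro continuous_map_compose[OF _ cont]) auto
    then show "continuous_map (top_of_set triangle) (top_of A) ?g" by (simp add: comp_def)
    show "pdim A (?g (x, y)) = k" if "(x, y) \<in> triangle" "x + y < 1" for x y
      using k(1) j1[of y] i2[of "x + y"] that by (simp add: in_triangle)
    show "pdim A (?g (x, y)) = k" if "0 < x" "0 \<le> y" "x + y = 1" for x y
      using k(1) j1[of y] i2[of "x + y"] that by simp
    show "pdim A (?g v2) \<le> k" "k \<le> k" using k by simp_all
    show "basic_open A (?g v2) U" using U(1) by simp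
    show "?g ` triangle \<subseteq> U"
    proof
      fix y assume "y \<in> ?g ` triangle"
      then obtain p q where "(p, q) \<in> triangle" "y = ?g (p, q)" by auto
      then show "y \<in> U" using U(2)[OF i1[of q] i2[of "p + q"]] by (simp add: in_triangle)
    qed
  qed
  from path_class_triangle[OF this ends(3) ab(2) _ ends(2) ab(1)]
  show "Comp (Ent A) (path_class A (\<lambda>u. H u d) a b) (path_class A (H a) c d) =
      path_class A (\<lambda>t. H (affine_to a b t) (affine_to c d t)) 0 1" by simp
qed

section \<open>The category axioms\<close>

lemma entrance_on_start:
  assumes f: "entrance_on A f 0 1"
  obtains \<epsilon> U k where "0 < \<epsilon>" "\<epsilon> < 1" "\<forall>t\<in>{0..\<epsilon>}. pdim A (f t) = k"
    "basic_open A (f \<epsilon>) U" "\<forall>t\<in>{0..\<epsilon>}. f t \<in> U"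
proof -
  obtain P where P: "is_interval_stratification P"
    "\<And>x y. 0 \<le> x \<Longrightarrow> x < y \<Longrightarrow> y \<le> 1 \<Longrightarrow> {x<..y} \<inter> P = {} \<Longrightarrow> pdim A (f x) = pdim A (f y)"
    using entrance_on_cuts[OF conical_filtered[OF conical] f] by metis
  have f0: "f 0 \<in> topspace (top_of A)" using entrance_on_in[OF f, of 0] by simp
  obtain U where U: "basic_open A (f 0) U"
    using conically_stratified_basic[OF conical openin_topspace f0] by blast
  obtain \<delta> where \<delta>: "\<delta> > 0" "\<And>y. y \<in> {0..1} \<Longrightarrow> dist y 0 < \<delta> \<Longrightarrow> f y \<in> U"
    by (rule continuous_map_nbhd[OF entrance_on_continuous[OF f] basic_open_self(2)[OF U] _ basic_open_self(1)[OF U]]) auto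
  obtain \<eta> where \<eta>: "\<eta> > 0" "\<forall>p\<in>P. p \<noteq> 0 \<longrightarrow> \<eta> \<le> dist 0 p"
    using finite_set_avoid[of P 0] P(1) unfolding is_interval_stratification_def by blast
  define \<epsilon> where "\<epsilon> = min 1 (min \<delta> \<eta>) / 2"
  have \<epsilon>: "0 < \<epsilon>" "\<epsilon> < 1" "\<epsilon> < \<delta>" "\<epsilon> < \<eta>" unfolding \<epsilon>_def using \<delta>(1) \<eta>(1) by auto
  have dim: "pdim A (f t) = pdim A (f 0)" if t: "t \<in> {0..\<epsilon>}" for t
  proof (cases "t = 0")
    case False
    have "p \<notin> P" if "p \<in> {0<..t}" for p using \<eta>(2) that t \<epsilon> by (force simp: dist_real_def)
    then have "{0<..t} \<inter> P = {}" by blast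
    then show ?thesis using P(2)[of 0 t] t \<epsilon> False by simp
  qed simp
  have in_U: "f t \<in> U" if "t \<in> {0..\<epsilon>}" for t using that \<epsilon> by (intro \<delta>(2)) (auto simp: dist_real_def)
  \<comment> \<open>A homotopy on the initial piece ends at \<open>f \<epsilon>\<close>. The basic
    open was found at \<open>f 0\<close>, and constancy of the dimension moves it to that
    end.\<close>
  have "basic_open A (f \<epsilon>) U"
    by (rule basic_open_translate[OF conical_filtered[OF conical] U in_U dim]) (use \<epsilon> in auto)
  then show ?thesis using that[of \<epsilon> "pdim A (f 0)" U] \<epsilon>(1,2) dim in_U by blast
qed

text \<open>The dimension may drop at the time 1 itself, so it is constant on a half-open interval
  only. The basic open is found at the very point where the homotopy ends.\<close>

lemma entrance_on_end:
  assumes f: "entrance_on A f 0 1"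
  obtains \<epsilon> U k where "0 < \<epsilon>" "\<epsilon> < 1" "\<forall>t\<in>{\<epsilon>..<1}. pdim A (f t) = k"
    "pdim A (f 1) \<le> k" "basic_open A (f 1) U" "\<forall>t\<in>{\<epsilon>..1}. f t \<in> U"
proof -
  obtain P where P: "is_interval_stratification P"
    "\<And>x y. 0 \<le> x \<Longrightarrow> x < y \<Longrightarrow> y \<le> 1 \<Longrightarrow> {x<..y} \<inter> P = {} \<Longrightarrow> pdim A (f x) = pdim A (f y)"
    using entrance_on_cuts[OF conical_filtered[OF conical] f] by metis
  have f1: "f 1 \<in> topspace (top_of A)" using entrance_on_in[OF f, of 1] by simp
  obtain U where U: "basic_open A (f 1) U"
    using conically_stratified_basic[OF conical openin_topspace f1] by blast
  obtain \<delta> where \<delta>: "\<delta> > 0" "\<And>y. y \<in> {0..1} \<Longrightarrow> dist y 1 < \<delta> \<Longrightarrow> f y \<in> U"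
    by (rule continuous_map_nbhd[OF entrance_on_continuous[OF f] basic_open_self(2)[OF U] _ basic_open_self(1)[OF U]]) auto
  obtain \<eta> where \<eta>: "\<eta> > 0" "\<forall>p\<in>P. p \<noteq> 1 \<longrightarrow> \<eta> \<le> dist 1 p"
    using finite_set_avoid[of P 1] P(1) unfolding is_interval_stratification_def by blast
  define \<epsilon> where "\<epsilon> = 1 - min 1 (min \<delta> \<eta>) / 2"
  have \<epsilon>: "0 < \<epsilon>" "\<epsilon> < 1" "1 - \<epsilon> < \<delta>" "1 - \<epsilon> < \<eta>" unfolding \<epsilon>_def using \<delta>(1) \<eta>(1) by auto
  have dim: "pdim A (f t) = pdim A (f \<epsilon>)" if t: "t \<in> {\<epsilon>..<1}" for t
  proof (cases "t = \<epsilon>")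
    case False
    have "p \<notin> P" if "p \<in> {\<epsilon><..t}" for p using \<eta>(2) that t \<epsilon> by (force simp: dist_real_def)
    then have "{\<epsilon><..t} \<inter> P = {}" by blast
    then show ?thesis using P(2)[of \<epsilon> t] t \<epsilon> False by simp
  qed simp
  have "f t \<in> U" if "t \<in> {\<epsilon>..1}" for t using that \<epsilon> by (intro \<delta>(2)) (auto simp: dist_real_def)
  moreover have "pdim A (f 1) \<le> pdim A (f \<epsilon>)" using entrance_on_mono[OF f, of \<epsilon> 1] \<epsilon> by simp
  ultimately show ?thesis using that[of \<epsilon> "pdim A (f \<epsilon>)" U] \<epsilon>(1,2) dim U by blast
qed

lemma Comp_Ent_assoc:
  assumes "f \<in> Ar (Ent A)" "g \<in> Ar (Ent A)" "h \<in> Ar (Ent A)"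
    "Cod (Ent A) f = Dom (Ent A) g" "Cod (Ent A) g = Dom (Ent A) h"
  shows "Comp (Ent A) h (Comp (Ent A) g f) = Comp (Ent A) (Comp (Ent A) h g) f"
proof -
  have lt: "(0::real) < 1" "1 < (2::real)" "2 < (3::real)" by simp_all
  obtain f' where f': "entrance_on A f' 0 1" "f = path_class A f' 0 1"
    using assms(1) lt(1) by (rule Ar_EntE[OF conical])
  obtain g' where g': "entrance_on A g' 1 2" "g = path_class A g' 1 2"
    using assms(2) lt(2) by (rule Ar_EntE[OF conical])
  obtain h' where h': "entrance_on A h' 2 3" "h = path_class A h' 2 3"
    using assms(3) lt(3) by (rule Ar_EntE[OF conical])
  have e: "f' 1 = g' 1" "g' 2 = h' 2"
    using assms(4,5) path_class_arrow[OF conical] f' g' h' by simp_all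
  let ?G = "\<lambda>t. if t \<le> 2 then g' t else h' t"
  let ?F = "\<lambda>t. if t \<le> 1 then f' t else ?G t"
  have "entrance_on A ?G 1 3" by (rule entrance_on_glue[OF g'(1) h'(1)]) (use e in simp_all)
  then have F: "entrance_on A ?F 0 3" by (intro entrance_on_glue[OF f'(1)]) (use e in simp_all)
  have "path_class A ?F 0 1 = f" unfolding f'(2) by (rule path_class_cong[OF conical f'(1)]) simp_all
  moreover have "path_class A ?F 1 2 = g" unfolding g'(2)
    by (rule path_class_cong[OF conical g'(1)]) (use e in auto)
  moreover have "path_class A ?F 2 3 = h" unfolding h'(2)
    by (rule path_class_cong[OF conical h'(1)]) (use e in auto)
  moreover have "entrance_on A ?F 0 2" "entrance_on A ?F 1 3"
    using entrance_on_subset[OF F] by simp_all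
  then have "Comp (Ent A) (path_class A ?F 1 2) (path_class A ?F 0 1) = path_class A ?F 0 2"
    "Comp (Ent A) (path_class A ?F 2 3) (path_class A ?F 1 2) = path_class A ?F 1 3"
    using path_class_Comp[OF conical, of ?F 0 2 1] path_class_Comp[OF conical, of ?F 1 3 2] by simp_all
  moreover have "Comp (Ent A) (path_class A ?F 2 3) (path_class A ?F 0 2) = path_class A ?F 0 3"
    "Comp (Ent A) (path_class A ?F 1 3) (path_class A ?F 0 1) = path_class A ?F 0 3"
    using path_class_Comp[OF conical F, of 2] path_class_Comp[OF conical F, of 1] by simp_all
  ultimately show ?thesis by simp
qed

lemma Comp_Ent_arrow:
  assumes "f \<in> Ar (Ent A)" "g \<in> Ar (Ent A)" "Cod (Ent A) f = Dom (Ent A) g"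
  shows "Comp (Ent A) g f \<in> Ar (Ent A)" "Dom (Ent A) (Comp (Ent A) g f) = Dom (Ent A) f"
    "Cod (Ent A) (Comp (Ent A) g f) = Cod (Ent A) g"
proof -
  have lt: "(0::real) < 1" "1 < (2::real)" by simp_all
  obtain f' where f': "entrance_on A f' 0 1" "f = path_class A f' 0 1"
    using assms(1) lt(1) by (rule Ar_EntE[OF conical])
  obtain g' where g': "entrance_on A g' 1 2" "g = path_class A g' 1 2"
    using assms(2) lt(2) by (rule Ar_EntE[OF conical])
  have e: "f' 1 = g' 1"
    using assms(3) path_class_arrow[OF conical] f' g' by simp_all
  let ?F = "\<lambda>t. if t \<le> 1 then f' t else g' t"
  have F: "entrance_on A ?F 0 2" by (rule entrance_on_glue[OF f'(1) g'(1)]) (use e in simp_all)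
  have "path_class A ?F 0 1 = f" unfolding f'(2) by (rule path_class_cong[OF conical f'(1)]) simp_all
  moreover have "path_class A ?F 1 2 = g" unfolding g'(2)
    by (rule path_class_cong[OF conical g'(1)]) (use e in auto)
  ultimately have c: "Comp (Ent A) g f = path_class A ?F 0 2"
    using path_class_Comp[OF conical F, of 1] by simp
  show "Comp (Ent A) g f \<in> Ar (Ent A)" "Dom (Ent A) (Comp (Ent A) g f) = Dom (Ent A) f"
    "Cod (Ent A) (Comp (Ent A) g f) = Cod (Ent A) g"
    unfolding c using path_class_arrow[OF conical F] path_class_arrow[OF conical f'(1)]
      path_class_arrow[OF conical g'(1)] f'(2) g'(2) by simp_all
qed

text \<open>A rectangle on which one coordinate is ignored has constant paths as two of its sides,
  while its diagonal is a reparametrization of the other two; this absorbs an identity. The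
  rectangle has to fit into one basic open, so this is done for a short piece at the start or at the
  end of the path, and the rest is attached by associativity.\<close>

lemma Comp_Ent_Ident:
  assumes "f \<in> Ar (Ent A)"
  shows "Comp (Ent A) f (Ident (Ent A) (Dom (Ent A) f)) = f"
    and "Comp (Ent A) (Ident (Ent A) (Cod (Ent A) f)) f = f"
proof -
  obtain f' where f': "entrance_on A f' 0 1" "f = path_class A f' 0 1"
    using assms(1) zero_less_one by (rule Ar_EntE[OF conical])
  have ends: "Dom (Ent A) f = f' 0" "Cod (Ent A) f = f' 1"
    "f' 0 \<in> topspace (top_of A)" "f' 1 \<in> topspace (top_of A)"
    using path_class_arrow[OF conical f'(1)] entrance_on_in[OF f'(1)] f'(2) by simp_all
  note [simp] = path_class_arrow[OF conical]
  obtain \<epsilon> U k where \<epsilon>: "0 < \<epsilon>" "\<epsilon> < 1" "\<forall>t\<in>{0..\<epsilon>}. pdim A (f' t) = k"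
    "basic_open A (f' \<epsilon>) U" "\<forall>t\<in>{0..\<epsilon>}. f' t \<in> U"
    using f'(1) by (rule entrance_on_start)
  have e1: "entrance_on A f' 0 \<epsilon>" "entrance_on A f' \<epsilon> 1" using f'(1) \<epsilon> by (auto intro: entrance_on_subset)
  \<comment> \<open>The rectangle \<open>H u w = f' w\<close>: the bottom side is constant at
    \<open>f' 0\<close>, the right side is the initial piece.\<close>
  have "continuous_map (top_of_set ({0..\<epsilon>} \<times> {0..\<epsilon>})) (top_of A) (f' \<circ> snd)"
    by (rule continuous_map_compose[OF _ entrance_on_continuous[OF e1(1)]]) (auto intro!: continuous_intros)
  then have R: "entrance_rect A (\<lambda>u w. f' w) 0 \<epsilon> 0 \<epsilon>"
    unfolding entrance_rect_def using \<epsilon>(1,3)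
    by (intro conjI exI[of _ k]) (auto simp: comp_def case_prod_beta')
  have "Comp (Ent A) (path_class A f' 0 \<epsilon>) (path_class A (\<lambda>u. f' 0) 0 \<epsilon>) =
      path_class A (\<lambda>t. f' (affine_to 0 \<epsilon> t)) 0 1"
    by (rule entrance_rect_diagonal(1)[OF R \<epsilon>(1) \<epsilon>(1) \<epsilon>(4)]) (use \<epsilon>(5) in simp)
  also have "\<dots> = path_class A f' 0 \<epsilon>"
    by (rule path_class_reparam[OF conical e1(1) incr_homeo_affine[OF \<epsilon>(1)]]) simp_all
  finally have "Comp (Ent A) (path_class A f' 0 \<epsilon>) (Ident (Ent A) (f' 0)) = path_class A f' 0 \<epsilon>"
    using Ident_Ent[OF conical ends(3) \<epsilon>(1)] by simp
  moreover have "f = Comp (Ent A) (path_class A f' \<epsilon> 1) (path_class A f' 0 \<epsilon>)"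
    using path_class_Comp[OF conical f'(1) \<epsilon>(1,2)] f'(2) by simp
  moreover have "Ident (Ent A) (f' 0) \<in> Ar (Ent A)" "Cod (Ent A) (Ident (Ent A) (f' 0)) = f' 0"
    using Ident_Ent[OF conical ends(3) zero_less_one] entrance_on_const[OF ends(3)] by simp_all
  ultimately show "Comp (Ent A) f (Ident (Ent A) (Dom (Ent A) f)) = f"
    using Comp_Ent_assoc[of "Ident (Ent A) (f' 0)" "path_class A f' 0 \<epsilon>" "path_class A f' \<epsilon> 1"] e1 \<epsilon> ends by simp
next
  obtain f' where f': "entrance_on A f' 0 1" "f = path_class A f' 0 1"
    using assms(1) zero_less_one by (rule Ar_EntE[OF conical])
  have ends: "Dom (Ent A) f = f' 0" "Cod (Ent A) f = f' 1"
    "f' 0 \<in> topspace (top_of A)" "f' 1 \<in> topspace (top_of A)"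
    using path_class_arrow[OF conical f'(1)] entrance_on_in[OF f'(1)] f'(2) by simp_all
  note [simp] = path_class_arrow[OF conical]
  obtain \<epsilon> U k where \<epsilon>: "0 < \<epsilon>" "\<epsilon> < 1" "\<forall>t\<in>{\<epsilon>..<1}. pdim A (f' t) = k"
    "pdim A (f' 1) \<le> k" "basic_open A (f' 1) U" "\<forall>t\<in>{\<epsilon>..1}. f' t \<in> U"
    using f'(1) by (rule entrance_on_end)
  have e1: "entrance_on A f' 0 \<epsilon>" "entrance_on A f' \<epsilon> 1" using f'(1) \<epsilon> by (auto intro: entrance_on_subset)
  \<comment> \<open>The rectangle \<open>H u w = f' u\<close>: the bottom side is the final piece,
    the right side is constant at \<open>f' 1\<close>, where the dimension may be lower.\<close>
  have "continuous_map (top_of_set ({\<epsilon>..1} \<times> {\<epsilon>..1})) (top_of A) (f' \<circ> fst)"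
    by (rule continuous_map_compose[OF _ entrance_on_continuous[OF e1(2)]]) (auto intro!: continuous_intros)
  then have R: "entrance_rect A (\<lambda>u w. f' u) \<epsilon> 1 \<epsilon> 1"
    unfolding entrance_rect_def using \<epsilon>(1-4)
    by (intro conjI exI[of _ k] exI[of _ "pdim A (f' 1)"]) (auto simp: comp_def case_prod_beta')
  have "Comp (Ent A) (path_class A (\<lambda>w. f' 1) \<epsilon> 1) (path_class A f' \<epsilon> 1) =
      path_class A (\<lambda>t. f' (affine_to \<epsilon> 1 t)) 0 1"
    by (rule entrance_rect_diagonal(1)[OF R \<epsilon>(2) \<epsilon>(2) \<epsilon>(5)]) (use \<epsilon>(6) in simp)
  also have "\<dots> = path_class A f' \<epsilon> 1"
    by (rule path_class_reparam[OF conical e1(2) incr_homeo_affine[OF \<epsilon>(2)]]) simp_all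
  finally have "Comp (Ent A) (Ident (Ent A) (f' 1)) (path_class A f' \<epsilon> 1) = path_class A f' \<epsilon> 1"
    using Ident_Ent[OF conical ends(4) \<epsilon>(2)] by simp
  moreover have "f = Comp (Ent A) (path_class A f' \<epsilon> 1) (path_class A f' 0 \<epsilon>)"
    using path_class_Comp[OF conical f'(1) \<epsilon>(1,2)] f'(2) by simp
  moreover have "Ident (Ent A) (f' 1) \<in> Ar (Ent A)" "Dom (Ent A) (Ident (Ent A) (f' 1)) = f' 1"
    using Ident_Ent[OF conical ends(4) zero_less_one] entrance_on_const[OF ends(4)] by simp_all
  ultimately show "Comp (Ent A) (Ident (Ent A) (Cod (Ent A) f)) f = f"
    using Comp_Ent_assoc[of "path_class A f' 0 \<epsilon>" "path_class A f' \<epsilon> 1" "Ident (Ent A) (f' 1)"] e1 \<epsilon> ends by simp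
qed

lemma Ent_category: "is_category (Ent A)"
  unfolding is_category_def
proof (intro conjI ballI impI)
  fix f assume f: "f \<in> Ar (Ent A)"
  then obtain f' where f': "entrance_on A f' 0 1" "f = path_class A f' 0 1"
    using zero_less_one by (rule Ar_EntE[OF conical])
  then show "Dom (Ent A) f \<in> Ob (Ent A)" "Cod (Ent A) f \<in> Ob (Ent A)"
    using path_class_arrow[OF conical f'(1)] entrance_on_in[OF f'(1)] by (simp_all add: Ent_def)
  show "Comp (Ent A) f (Ident (Ent A) (Dom (Ent A) f)) = f" "Comp (Ent A) (Ident (Ent A) (Cod (Ent A) f)) f = f"
    using Comp_Ent_Ident[OF f] by auto
next
  fix x assume "x \<in> Ob (Ent A)"
  then have x: "x \<in> topspace (top_of A)" by (simp add: Ent_def)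
  show "Ident (Ent A) x \<in> Ar (Ent A)" "Dom (Ent A) (Ident (Ent A) x) = x" "Cod (Ent A) (Ident (Ent A) x) = x"
    unfolding Ident_Ent[OF conical x zero_less_one]
    using path_class_arrow[OF conical entrance_on_const[OF x] zero_less_one] by auto
qed (use Comp_Ent_arrow Comp_Ent_assoc in auto)

end

section \<open>Inclusions of open subspaces\<close>

lemma entrance_on_filtered_sub:
  "entrance_on (filtered_sub A U) f a b \<longleftrightarrow> entrance_on A f a b \<and> f ` {a..b} \<subseteq> U"
proof (cases "f ` {a..b} \<subseteq> U")
  case True
  then have "pdim (filtered_sub A U) (f t) = pdim A (f t)" if "t \<in> {a..b}" for t
    using that by (intro pdim_filtered_sub) auto
  then show ?thesis using True unfolding entrance_on_def
    by (auto simp: filtered_sub_def continuous_map_in_subtopology)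
next
  case False
  then show ?thesis unfolding entrance_on_def
    by (auto simp: filtered_sub_def continuous_map_in_subtopology)
qed

text \<open>A component of a layer of the subspace is connected and contained in the layer of
  \<open>A\<close>, so it lies in one component there. Because of this, paths and homotopies of an
  open subspace are paths and homotopies of the ambient space.\<close>

lemma strata_filtered_sub:
  assumes "S \<in> strata (filtered_sub A U)"
  shows "\<exists>S'\<in>strata A. S \<subseteq> S'"
proof -
  obtain d where S: "S \<in> connected_components_of (subtopology (top_of (filtered_sub A U)) (layer (filtered_sub A U) d))"
    using assms unfolding strata_def by blast
  let ?T = "subtopology (top_of A) (layer A d)"
  have "connectedin (subtopology (top_of (filtered_sub A U)) (layer (filtered_sub A U) d)) S"
    using S by (rule connectedin_connected_components_of)
  then have c: "connectedin ?T S"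
    unfolding layer_filtered_sub by (simp add: connectedin_subtopology filtered_sub_def)
  moreover have "S \<noteq> {}" using S by (rule nonempty_connected_components_of)
  then have "?T \<noteq> trivial_topology"
    using connectedin_subset_topspace[OF c] by (metis subset_empty topspace_discrete_topology)
  ultimately obtain S' where "S' \<in> connected_components_of ?T" "S \<subseteq> S'"
    using exists_connected_component_of_superset by blast
  then show ?thesis unfolding strata_def by blast
qed

lemma stratum_preserving_filtered_sub:
  assumes "stratum_preserving Y \<T> (top_of (filtered_sub A U)) (strata (filtered_sub A U)) f"
  shows "stratum_preserving Y \<T> (top_of A) (strata A) f"
  unfolding stratum_preserving_def
proof (intro conjI ballI)
  show "continuous_map Y (top_of A) f"
    using assms unfolding stratum_preserving_def filtered_sub_def by (simp add: continuous_map_in_subtopology)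
  fix T assume "T \<in> \<T>"
  then obtain S where "S \<in> strata (filtered_sub A U)" "f ` T \<subseteq> S" using assms unfolding stratum_preserving_def by blast
  then show "\<exists>S\<in>strata A. f ` T \<subseteq> S" using strata_filtered_sub by (meson order_trans)
qed

context
  fixes B :: "'a filtered" and U :: "'a set"
  assumes conical: "conically_stratified B" and U: "openin (top_of B) U"
begin

lemma conical_sub: "conically_stratified (filtered_sub B U)"
  by (rule conically_stratified_sub[OF conical U])

lemma entrance_paths_sub: "p \<in> entrance_paths (filtered_sub B U) \<Longrightarrow> p \<in> entrance_paths B"
proof (cases p)
  fix P f assume p: "p = (P, f)" "p \<in> entrance_paths (filtered_sub B U)"
  note F = conical_filtered[OF conical] conical_filtered[OF conical_sub]
  have c: "is_interval_stratification P \<and> f \<in> extensional {0..1} \<and> entrance_on (filtered_sub B U) f 0 1 \<and>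
     (\<forall>x y. 0 \<le> x \<longrightarrow> x < y \<longrightarrow> y \<le> 1 \<longrightarrow> {x<..y} \<inter> P = {} \<longrightarrow>
       pdim (filtered_sub B U) (f x) = pdim (filtered_sub B U) (f y))"
    using p(2) unfolding p(1) entrance_paths_iff[OF F(2)] .
  then have *: "is_interval_stratification P" "f \<in> extensional {0..1}" "entrance_on (filtered_sub B U) f 0 1"
    by simp_all
  have cut: "pdim (filtered_sub B U) (f x) = pdim (filtered_sub B U) (f y)"
    if "0 \<le> x" "x < y" "y \<le> 1" "{x<..y} \<inter> P = {}" for x y
    using c that by blast
  have e: "entrance_on B f 0 1" "f ` {0..1} \<subseteq> U" using *(3) unfolding entrance_on_filtered_sub by simp_all
  have "pdim B (f x) = pdim B (f y)" if "0 \<le> x" "x < y" "y \<le> 1" "{x<..y} \<inter> P = {}" for x y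
  proof -
    have "f x \<in> U" "f y \<in> U" using e(2) that by auto
    then show ?thesis using cut[OF that] by (simp add: pdim_filtered_sub)
  qed
  then show "p \<in> entrance_paths B" unfolding p(1) entrance_paths_iff[OF F(1)] using * e by simp
qed

lemma elementary_homotopy_sub:
  assumes "elementary_homotopy (filtered_sub B U) p q"
  shows "elementary_homotopy B p q"
proof -
  have pq: "p \<in> entrance_paths B" "q \<in> entrance_paths B" "fst p = {0, 1/2, 1}" "fst q = {0, 1}"
    using assms entrance_paths_sub unfolding elementary_homotopy_def by auto
  obtain h a b where h: "stratum_preserving (top_of_set triangle) triangle_strata (top_of (filtered_sub B U)) (strata (filtered_sub B U)) h"
    and ab: "stratified_isomorphism II (interval_strata {0, 1/2, 1})
          (top_of_set (closed_segment v0 v1 \<union> closed_segment v1 v2))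
          {{v0}, {v1}, {v2}, open_segment v0 v1, open_segment v1 v2} a"
      "a 0 = v0" "a (1/2) = v1" "a 1 = v2"
      "stratified_isomorphism II (interval_strata {0, 1})
          (top_of_set (closed_segment v0 v2)) {{v0}, {v2}, open_segment v0 v2} b"
      "b 0 = v0" "b 1 = v2"
      "\<forall>t\<in>{0..1}. h (a t) = snd p t" "\<forall>t\<in>{0..1}. h (b t) = snd q t"
    and S: "\<exists>S\<in>strata (filtered_sub B U). h ` (triangle - closed_segment v1 v2) \<subseteq> S"
    and V: "\<exists>V. basic_open (filtered_sub B U) (h v2) V \<and> h ` triangle \<subseteq> V"
    using assms unfolding elementary_homotopy_def by (elim conjE exE) (rule that, assumption+, blast)
  have "\<exists>S\<in>strata B. h ` (triangle - closed_segment v1 v2) \<subseteq> S"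
    using S strata_filtered_sub by (meson order_trans)
  moreover have "\<exists>V. basic_open B (h v2) V \<and> h ` triangle \<subseteq> V"
    using V basic_open_filtered_sub[OF U] by blast
  ultimately show ?thesis unfolding elementary_homotopy_def
    by (intro conjI pq exI[of _ h] exI[of _ a] exI[of _ b] stratum_preserving_filtered_sub[OF h] ab)
qed

lemma elementarily_related_sub:
  assumes "elementarily_related (filtered_sub B U) p q"
  shows "elementarily_related B p q"
proof -
  obtain p' q' r s p2 q2 where *: "reparametrization p p'" "reparametrization q q'"
    "set_option r \<subseteq> entrance_paths (filtered_sub B U)" "set_option s \<subseteq> entrance_paths (filtered_sub B U)"
    "decomposes p' r p2 s" "decomposes q' r q2 s"
    "elementary_homotopy (filtered_sub B U) p2 q2 \<or> elementary_homotopy (filtered_sub B U) q2 p2"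
    and pq: "p \<in> entrance_paths (filtered_sub B U)" "q \<in> entrance_paths (filtered_sub B U)"
    using assms unfolding elementarily_related_def by blast
  have "set_option r \<subseteq> entrance_paths B" "set_option s \<subseteq> entrance_paths B"
    using *(3,4) entrance_paths_sub by blast+
  then show ?thesis unfolding elementarily_related_def
    using * pq entrance_paths_sub elementary_homotopy_sub by blast
qed

lemma path_equiv_sub:
  assumes "(p, q) \<in> path_equiv (filtered_sub B U)"
  shows "(p, q) \<in> path_equiv B"
proof -
  have "(elementarily_related (filtered_sub B U))\<^sup>*\<^sup>* p q" using assms unfolding path_equiv_def by simp
  then have "(elementarily_related B)\<^sup>*\<^sup>* p q"
    by (rule rtranclp_mono[THEN predicate2D, rotated]) (use elementarily_related_sub in blast)
  then show ?thesis using assms entrance_paths_sub unfolding path_equiv_def by simp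
qed

text \<open>The functor of an inclusion is henceforth computed on functions: it keeps the function
  and changes the ambient space, with no reference to cuts or representatives.\<close>

lemma Ent_map_path_class:
  assumes f: "entrance_on (filtered_sub B U) f a b" and ab: "a < b"
  shows "snd (Ent_map B (\<lambda>x. x)) (path_class (filtered_sub B U) f a b) = path_class B f a b"
proof -
  let ?C = "filtered_sub B U"
  obtain P where P: "(P, restrict (f \<circ> affine_to a b) {0..1}) \<in> entrance_paths ?C"
    "path_class ?C f a b = path_equiv ?C `` {(P, restrict (f \<circ> affine_to a b) {0..1})}"
    using f ab by (rule path_class_rep[OF conical_sub])
  let ?p = "(P, restrict (f \<circ> affine_to a b) {0..1})"
  have fB: "entrance_on B f a b" using f entrance_on_filtered_sub by blast
  have cls: "path_equiv B `` {?p} = path_class B f a b"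
    by (rule path_class_eqI[OF conical fB ab entrance_paths_sub[OF P(1)] incr_homeo_affine[OF ab]]) simp
  have "path_equiv B `` {(fst p, restrict ((\<lambda>x. x) \<circ> snd p) {0..1})} = path_class B f a b"
    if p: "p \<in> path_equiv ?C `` {?p}" for p
  proof -
    have pq: "(?p, p) \<in> path_equiv ?C" using p by simp
    then have "p \<in> entrance_paths ?C" unfolding path_equiv_def by simp
    moreover have "(?p, p) \<in> path_equiv B" by (rule path_equiv_sub[OF pq])
    moreover from calculation(1) have "restrict ((\<lambda>x. x) \<circ> snd p) {0..1} = snd p"
      using entrance_pathD(2)[OF conical_sub] by (intro restrict_eq_extensional) simp_all
    ultimately show ?thesis
      using equiv_class_eq[OF equiv_path_equiv[OF conical], of ?p p] cls by simp
  qed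
  moreover have "?p \<in> path_equiv ?C `` {?p}" using path_equiv_refl[OF conical_sub P(1)] by simp
  ultimately show ?thesis unfolding P(2) Ent_map_def by auto
qed

lemma Ent_map_functor: "is_functor (Ent (filtered_sub B U)) (Ent B) (Ent_map B (\<lambda>x. x))"
  unfolding is_functor_def
proof (intro conjI ballI impI)
  let ?C = "filtered_sub B U"
  show "is_category (Ent ?C)" "is_category (Ent B)" using Ent_category conical conical_sub by auto
  fix x assume x: "x \<in> Ob (Ent ?C)"
  then have x': "x \<in> topspace (top_of ?C)" "x \<in> topspace (top_of B)" by (auto simp: Ent_def filtered_sub_def)
  then show "fst (Ent_map B (\<lambda>x. x)) x \<in> Ob (Ent B)" by (simp add: Ent_map_def Ent_def)
  show "snd (Ent_map B (\<lambda>x. x)) (Ident (Ent ?C) x) = Ident (Ent B) (fst (Ent_map B (\<lambda>x. x)) x)"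
    unfolding Ident_Ent[OF conical_sub x'(1) zero_less_one]
    using Ent_map_path_class[OF entrance_on_const[OF x'(1)] zero_less_one] Ident_Ent[OF conical x'(2) zero_less_one]
    by (simp add: Ent_map_def)
next
  let ?C = "filtered_sub B U"
  fix f assume f: "f \<in> Ar (Ent ?C)"
  then obtain f' where f': "entrance_on ?C f' 0 1" "f = path_class ?C f' 0 1"
    using zero_less_one by (rule Ar_EntE[OF conical_sub])
  have f'B: "entrance_on B f' 0 1" using f'(1) entrance_on_filtered_sub by blast
  have F: "snd (Ent_map B (\<lambda>x. x)) f = path_class B f' 0 1"
    using Ent_map_path_class[OF f'(1)] f'(2) by simp
  show "snd (Ent_map B (\<lambda>x. x)) f \<in> Ar (Ent B)"
    "Dom (Ent B) (snd (Ent_map B (\<lambda>x. x)) f) = fst (Ent_map B (\<lambda>x. x)) (Dom (Ent ?C) f)"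
    "Cod (Ent B) (snd (Ent_map B (\<lambda>x. x)) f) = fst (Ent_map B (\<lambda>x. x)) (Cod (Ent ?C) f)"
    unfolding F using path_class_arrow[OF conical f'B] path_class_arrow[OF conical_sub f'(1)] f'(2)
    by (simp_all add: Ent_map_def)
  fix g assume g: "g \<in> Ar (Ent ?C)" and fg: "Cod (Ent ?C) f = Dom (Ent ?C) g"
  have lt: "1 < (2::real)" by simp
  obtain g' where g': "entrance_on ?C g' 1 2" "g = path_class ?C g' 1 2"
    using g lt by (rule Ar_EntE[OF conical_sub])
  have e: "f' 1 = g' 1"
    using fg path_class_arrow[OF conical_sub] f' g' by simp
  let ?F = "\<lambda>t. if t \<le> 1 then f' t else g' t"
  have G: "entrance_on ?C ?F 0 2" by (rule entrance_on_glue[OF f'(1) g'(1)]) (use e in simp_all)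
  have GB: "entrance_on B ?F 0 2" using G entrance_on_filtered_sub by blast
  have f2: "f = path_class ?C ?F 0 1" unfolding f'(2)
    by (rule path_class_cong[OF conical_sub f'(1), symmetric]) simp_all
  have g2: "g = path_class ?C ?F 1 2" unfolding g'(2)
    by (rule path_class_cong[OF conical_sub g'(1), symmetric]) (use e in auto)
  have pieces: "entrance_on ?C ?F 0 1" "entrance_on ?C ?F 1 2" using entrance_on_subset[OF G] by simp_all
  show "snd (Ent_map B (\<lambda>x. x)) (Comp (Ent ?C) g f) =
      Comp (Ent B) (snd (Ent_map B (\<lambda>x. x)) g) (snd (Ent_map B (\<lambda>x. x)) f)"
    unfolding f2 g2 using path_class_Comp[OF conical_sub G, of 1] path_class_Comp[OF conical GB, of 1]
      Ent_map_path_class[OF G] Ent_map_path_class[OF pieces(1)] Ent_map_path_class[OF pieces(2)] by simp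
qed

end

subsection \<open>Lifting paths to a cocone\<close>

text \<open>Bisection in each coordinate in turn. For a fixed \<open>x\<close>, bisection in the
  second coordinate yields a full strip around \<open>x\<close>, whose width is the smaller one of
  the widths found for the two halves; bisection in the first coordinate then joins the
  strips.\<close>

lemma Bolzano_square:
  fixes Q :: "real \<Rightarrow> real \<Rightarrow> real \<Rightarrow> real \<Rightarrow> bool"
  assumes glue1: "\<And>a b e c d. Q a b c d \<Longrightarrow> Q b e c d \<Longrightarrow> a \<le> b \<Longrightarrow> b \<le> e \<Longrightarrow> Q a e c d"
    and glue2: "\<And>a b c d e. Q a b c d \<Longrightarrow> Q a b d e \<Longrightarrow> c \<le> d \<Longrightarrow> d \<le> e \<Longrightarrow> Q a b c e"
    and local: "\<And>x y. x \<in> {0..1} \<Longrightarrow> y \<in> {0..1} \<Longrightarrow>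
      \<exists>\<delta>>0. \<forall>a b c d. a \<le> x \<and> x \<le> b \<and> b - a < \<delta> \<and> c \<le> y \<and> y \<le> d \<and> d - c < \<delta> \<longrightarrow> Q a b c d"
  shows "Q 0 1 0 1"
proof -
  have strip: "\<exists>\<delta>>0. \<forall>a b. a \<le> x \<and> x \<le> b \<and> b - a < \<delta> \<longrightarrow> Q a b 0 1" if x: "x \<in> {0..1}" for x
  proof (rule Bolzano[OF zero_le_one, where P = "\<lambda>c d. \<exists>\<delta>>0. \<forall>a b. a \<le> x \<and> x \<le> b \<and> b - a < \<delta> \<longrightarrow> Q a b c d"])
    fix c d e :: real
    assume "\<exists>\<delta>>0. \<forall>a b. a \<le> x \<and> x \<le> b \<and> b - a < \<delta> \<longrightarrow> Q a b c d"
      "\<exists>\<delta>>0. \<forall>a b. a \<le> x \<and> x \<le> b \<and> b - a < \<delta> \<longrightarrow> Q a b d e"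
    then obtain \<delta>1 \<delta>2 where "\<delta>1 > 0" "\<delta>2 > 0"
      and 1: "\<And>a b. a \<le> x \<Longrightarrow> x \<le> b \<Longrightarrow> b - a < \<delta>1 \<Longrightarrow> Q a b c d"
      and 2: "\<And>a b. a \<le> x \<Longrightarrow> x \<le> b \<Longrightarrow> b - a < \<delta>2 \<Longrightarrow> Q a b d e" by metis
    moreover assume "c \<le> d" "d \<le> e"
    ultimately show "\<exists>\<delta>>0. \<forall>a b. a \<le> x \<and> x \<le> b \<and> b - a < \<delta> \<longrightarrow> Q a b c e"
      by (intro exI[of _ "min \<delta>1 \<delta>2"]) (auto intro: glue2[OF 1 2])
  next
    fix y :: real assume "0 \<le> y" "y \<le> 1"
    then obtain \<delta> where "\<delta> > 0"
      "\<And>a b c d. a \<le> x \<Longrightarrow> x \<le> b \<Longrightarrow> b - a < \<delta> \<Longrightarrow> c \<le> y \<Longrightarrow> y \<le> d \<Longrightarrow> d - c < \<delta> \<Longrightarrow> Q a b c d"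
      using local[OF x, of y] by auto
    then show "\<exists>\<delta>>0. \<forall>c d. c \<le> y \<and> y \<le> d \<and> d - c < \<delta> \<longrightarrow>
        (\<exists>\<delta>>0. \<forall>a b. a \<le> x \<and> x \<le> b \<and> b - a < \<delta> \<longrightarrow> Q a b c d)"
      by (intro exI[of _ \<delta>] conjI allI impI) auto
  qed
  show ?thesis
    by (rule Bolzano[OF zero_le_one, where P = "\<lambda>a b. Q a b 0 1"]) (use glue1 strip in auto)
qed

lemma entrance_rect_filtered_sub:
  assumes H: "entrance_rect A H a b c d" and U: "\<And>u w. u \<in> {a..b} \<Longrightarrow> w \<in> {c..d} \<Longrightarrow> H u w \<in> U" and "a \<le> b" "c \<le> d"
  shows "entrance_rect (filtered_sub A U) H a b c d"
proof -
  obtain k l where k: "\<forall>u\<in>{a..<b}. \<forall>w\<in>{c..d}. pdim A (H u w) = k" "\<forall>w\<in>{c..<d}. pdim A (H b w) = l"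
    "l \<le> k" "pdim A (H b d) \<le> l"
    and cont: "continuous_map (top_of_set ({a..b} \<times> {c..d})) (top_of A) (\<lambda>(u, w). H u w)"
    using H unfolding entrance_rect_def by (elim conjE exE)
  have dim: "pdim (filtered_sub A U) (H u w) = pdim A (H u w)" if "u \<in> {a..b}" "w \<in> {c..d}" for u w
    by (rule pdim_filtered_sub[OF U[OF that]])
  have "continuous_map (top_of_set ({a..b} \<times> {c..d})) (top_of (filtered_sub A U)) (\<lambda>(u, w). H u w)"
    using cont U unfolding filtered_sub_def by (auto simp: continuous_map_in_subtopology)
  moreover have "\<forall>u\<in>{a..<b}. \<forall>w\<in>{c..d}. pdim (filtered_sub A U) (H u w) = k" using k(1) dim by simp
  moreover have "\<forall>w\<in>{c..<d}. pdim (filtered_sub A U) (H b w) = l" using k(2) dim assms(3) by simp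
  moreover have "pdim (filtered_sub A U) (H b d) \<le> l" using k(4) dim assms(3,4) by simp
  ultimately show ?thesis unfolding entrance_rect_def using k(3) by blast
qed

text \<open>A property that survives gluing at a common end needs to be checked only on pieces
  mapped into some neighbourhood of each point. This takes the place of a Lebesgue number and of
  common refinements of subdivisions.\<close>

lemma entrance_on_interval_induct:
  assumes f: "entrance_on A f a b" "a < b"
    and glue: "\<And>s t u. a \<le> s \<Longrightarrow> s < t \<Longrightarrow> t < u \<Longrightarrow> u \<le> b \<Longrightarrow> P s t \<Longrightarrow> P t u \<Longrightarrow> P s u"
    and local: "\<And>x. x \<in> {a..b} \<Longrightarrow> \<exists>W. openin (top_of A) W \<and> f x \<in> W \<and>
      (\<forall>s t. a \<le> s \<longrightarrow> s < t \<longrightarrow> t \<le> b \<longrightarrow> f ` {s..t} \<subseteq> W \<longrightarrow> P s t)"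
  shows "P a b"
proof -
  have "a \<le> b" using f(2) by simp
  \<comment> \<open>Bisection ranges over all intervals. The premises turn the property into a
    vacuous one on degenerate intervals and on those reaching beyond \<open>[a, b]\<close>.\<close>
  then have "a \<le> a \<longrightarrow> b \<le> b \<longrightarrow> a < b \<longrightarrow> P a b"
  proof (rule Bolzano[where P = "\<lambda>s t. a \<le> s \<longrightarrow> t \<le> b \<longrightarrow> s < t \<longrightarrow> P s t"])
    fix s t u
    assume *: "a \<le> s \<longrightarrow> t \<le> b \<longrightarrow> s < t \<longrightarrow> P s t" "a \<le> t \<longrightarrow> u \<le> b \<longrightarrow> t < u \<longrightarrow> P t u" "s \<le> t" "t \<le> u"
    show "a \<le> s \<longrightarrow> u \<le> b \<longrightarrow> s < u \<longrightarrow> P s u"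
    proof (cases "s < t \<and> t < u")
      case True
      then show ?thesis using * glue[of s t u] by simp
    next
      case False
      then show ?thesis using * by (cases "s = t") auto
    qed
  next
    fix x assume "a \<le> x" "x \<le> b"
    then have x: "x \<in> {a..b}" by simp
    obtain W where W: "openin (top_of A) W" "f x \<in> W"
      and P: "\<forall>s t. a \<le> s \<longrightarrow> s < t \<longrightarrow> t \<le> b \<longrightarrow> f ` {s..t} \<subseteq> W \<longrightarrow> P s t"
      using local[OF x] by (elim exE conjE)
    obtain \<delta> where \<delta>: "\<delta> > 0" "\<And>y. y \<in> {a..b} \<Longrightarrow> dist y x < \<delta> \<Longrightarrow> f y \<in> W"
      by (rule continuous_map_nbhd[OF entrance_on_continuous[OF f(1)] W(1) x W(2)]) auto
    have "P s t" if st: "s \<le> x \<and> x \<le> t \<and> t - s < \<delta>" "a \<le> s" "t \<le> b" "s < t" for s t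
    proof -
      have "f u \<in> W" if "u \<in> {s..t}" for u
        using that st by (intro \<delta>(2)) (auto simp: dist_real_def)
      then have "f ` {s..t} \<subseteq> W" by (rule image_subsetI)
      then show ?thesis using P st by simp
    qed
    then show "\<exists>d>0. \<forall>s t. s \<le> x \<and> x \<le> t \<and> t - s < d \<longrightarrow> (a \<le> s \<longrightarrow> t \<le> b \<longrightarrow> s < t \<longrightarrow> P s t)"
      using \<delta>(1) by (intro exI[of _ \<delta>] conjI allI impI)
  qed
  then show ?thesis using f(2) by simp
qed

definition piece :: "'a filtered \<Rightarrow> ('a set \<Rightarrow> ('a, 'a spath set, 'p, 'n) fctr) \<Rightarrow> 'a set \<Rightarrow> (real \<Rightarrow> 'a) \<Rightarrow> real \<Rightarrow> real \<Rightarrow> 'n" where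
  "piece X G U f a b = snd (G U) (path_class (filtered_sub X U) f a b)"

text \<open>A derivation is a bracketed subdivision of \<open>f\<close> into pieces lying in members
  of the cover, and the last argument is the composite of their images. As an inductive relation it
  can be split, compared and reparametrized without lists of division points; that the arrow is
  determined by the interval is left to \<open>lifts_exists\<close> and
  \<open>lifts_unique\<close>.\<close>

inductive lifts for X :: "'a filtered" and \<U> and C :: "('p, 'n) category" and G and f where
  lifts_piece: "U \<in> \<U> \<Longrightarrow> a < b \<Longrightarrow> entrance_on (filtered_sub X U) f a b \<Longrightarrow> lifts X \<U> C G f a b (piece X G U f a b)"
| lifts_Comp: "lifts X \<U> C G f a b m \<Longrightarrow> lifts X \<U> C G f b c n \<Longrightarrow> lifts X \<U> C G f a c (Comp C n m)"

context
  fixes X :: "'a filtered" and \<U> :: "'a set set" and C :: "('p, 'n) category"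
    and G :: "'a set \<Rightarrow> ('a, 'a spath set, 'p, 'n) fctr"
  assumes conical: "conically_stratified X"
    and cover: "complete_cover (top_of X) (topspace (top_of X)) \<U>"
    and cocone: "is_cocone (Ent_diagram X \<U>) C G"
begin

lemma cover_open: "U \<in> \<U> \<Longrightarrow> openin (top_of X) U"
  using cover unfolding complete_cover_def by simp

lemma cover_conical: "U \<in> \<U> \<Longrightarrow> conically_stratified (filtered_sub X U)"
  by (rule conically_stratified_sub[OF conical cover_open])

lemma cover_ex:
  assumes "x \<in> topspace (top_of X)"
  shows "\<exists>U\<in>\<U>. x \<in> U"
proof -
  have "\<Union>\<U> = topspace (top_of X)" using cover unfolding complete_cover_def by simp
  then show ?thesis using assms by blast
qed

text \<open>Completeness of the cover, as opposed to its being an open cover, enters here: a point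
  of an intersection of two members has a third member around it inside the intersection.\<close>

lemma cover_refine:
  assumes "U \<in> \<U>" "V \<in> \<U>" "x \<in> U" "x \<in> V"
  obtains W where "W \<in> \<U>" "x \<in> W" "W \<subseteq> U" "W \<subseteq> V"
proof -
  obtain \<V> where \<V>: "\<V> \<subseteq> \<U>" "\<Union>\<V> = U \<inter> V"
    using cover[unfolded complete_cover_def, THEN conjunct2, THEN conjunct2, THEN bspec, OF assms(1), THEN bspec, OF assms(2)]
    by (elim exE conjE)
  have "x \<in> \<Union>\<V>" using \<V>(2) assms(3,4) by simp
  then obtain W where W: "W \<in> \<V>" "x \<in> W" by (rule UnionE)
  have "W \<in> \<U>" by (rule subsetD[OF \<V>(1) W(1)])
  moreover have "W \<subseteq> U \<inter> V" unfolding \<V>(2)[symmetric] using W(1) by (rule Union_upper)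
  ultimately show ?thesis using that[of W] W(2) by simp
qed

lemma C_cat: "is_category C"
  using cocone unfolding is_cocone_def by simp

lemma C_assoc:
  "f \<in> Ar C \<Longrightarrow> g \<in> Ar C \<Longrightarrow> h \<in> Ar C \<Longrightarrow> Cod C f = Dom C g \<Longrightarrow> Cod C g = Dom C h \<Longrightarrow>
    Comp C (Comp C h g) f = Comp C h (Comp C g f)"
  using C_cat unfolding is_category_def by simp

lemma C_Comp:
  "f \<in> Ar C \<Longrightarrow> g \<in> Ar C \<Longrightarrow> Cod C f = Dom C g \<Longrightarrow>
    Comp C g f \<in> Ar C \<and> Dom C (Comp C g f) = Dom C f \<and> Cod C (Comp C g f) = Cod C g"
  using C_cat unfolding is_category_def by simp

lemma cocone_functor: "U \<in> \<U> \<Longrightarrow> is_functor (Ent (filtered_sub X U)) C (G U)"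
  using cocone unfolding is_cocone_def Ent_diagram_def by simp

lemma cocone_compat:
  assumes "U \<in> \<U>" "V \<in> \<U>" "U \<subseteq> V"
  shows "x \<in> U \<Longrightarrow> fst (G V) x = fst (G U) x"
    and "c \<in> Ar (Ent (filtered_sub X U)) \<Longrightarrow> snd (G V) (snd (Ent_map (filtered_sub X V) (\<lambda>x. x)) c) = snd (G U) c"
proof -
  have *: "functor_eq (Ent (filtered_sub X U)) (functor_comp (G V) (Ent_map (filtered_sub X V) (\<lambda>x. x))) (G U)"
    using cocone assms unfolding is_cocone_def Ent_diagram_def by simp
  have "x \<in> U \<Longrightarrow> x \<in> Ob (Ent (filtered_sub X U))" for x
    using openin_subset[OF cover_open[OF assms(1)]] by (auto simp: Ent_def filtered_sub_def)
  then show "x \<in> U \<Longrightarrow> fst (G V) x = fst (G U) x"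
    using * unfolding functor_eq_def functor_comp_def Ent_map_def by simp
  show "c \<in> Ar (Ent (filtered_sub X U)) \<Longrightarrow> snd (G V) (snd (Ent_map (filtered_sub X V) (\<lambda>x. x)) c) = snd (G U) c"
    using * unfolding functor_eq_def functor_comp_def by simp
qed

lemma entrance_on_sub: "entrance_on X f a b \<Longrightarrow> f ` {a..b} \<subseteq> U \<Longrightarrow> entrance_on (filtered_sub X U) f a b"
  unfolding entrance_on_filtered_sub by simp

lemma piece_mono:
  assumes UV: "U \<in> \<U>" "V \<in> \<U>" "U \<subseteq> V" and f: "entrance_on X f a b" "a < b" "f ` {a..b} \<subseteq> U"
  shows "piece X G V f a b = piece X G U f a b"
proof -
  let ?V = "filtered_sub X V"
  have sub: "filtered_sub ?V U = filtered_sub X U" by (rule filtered_sub_sub[OF UV(3)])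
  have "openin (top_of ?V) U"
    using cover_open UV unfolding filtered_sub_def by (simp add: openin_open_subtopology)
  moreover have e: "entrance_on (filtered_sub X U) f a b" by (rule entrance_on_sub[OF f(1,3)])
  ultimately have "snd (Ent_map ?V (\<lambda>x. x)) (path_class (filtered_sub X U) f a b) = path_class ?V f a b"
    using Ent_map_path_class[OF cover_conical[OF UV(2)], of U f a b] f(2) unfolding sub by simp
  then show ?thesis
    using cocone_compat(2)[OF UV path_class_arrow(1)[OF cover_conical[OF UV(1)] e f(2)]]
    unfolding piece_def by simp
qed

lemma piece_Comp:
  assumes U: "U \<in> \<U>" and f: "entrance_on (filtered_sub X U) f a c" and abc: "a < b" "b < c"
  shows "Comp C (piece X G U f b c) (piece X G U f a b) = piece X G U f a c"
proof -
  note con = cover_conical[OF U]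
  have e: "entrance_on (filtered_sub X U) f a b" "entrance_on (filtered_sub X U) f b c"
    using entrance_on_subset[OF f] abc by simp_all
  have "Comp (Ent (filtered_sub X U)) (path_class (filtered_sub X U) f b c) (path_class (filtered_sub X U) f a b) =
      path_class (filtered_sub X U) f a c"
    by (rule path_class_Comp[OF con f abc])
  moreover have "snd (G U) (Comp (Ent (filtered_sub X U)) (path_class (filtered_sub X U) f b c) (path_class (filtered_sub X U) f a b)) =
      Comp C (snd (G U) (path_class (filtered_sub X U) f b c)) (snd (G U) (path_class (filtered_sub X U) f a b))"
    using cocone_functor[OF U] path_class_arrow[OF con e(1) abc(1)] path_class_arrow[OF con e(2) abc(2)]
    unfolding is_functor_def by simp
  ultimately show ?thesis unfolding piece_def by simp
qed

definition point_image :: "'a \<Rightarrow> 'p" where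
  "point_image x = fst (G (SOME U. U \<in> \<U> \<and> x \<in> U)) x"

lemma point_image_eq:
  assumes "U \<in> \<U>" "x \<in> U"
  shows "point_image x = fst (G U) x"
proof -
  let ?V = "SOME U. U \<in> \<U> \<and> x \<in> U"
  have V: "?V \<in> \<U> \<and> x \<in> ?V" using assms by (intro someI[of "\<lambda>U. U \<in> \<U> \<and> x \<in> U"]) simp
  obtain W where W: "W \<in> \<U>" "x \<in> W" "W \<subseteq> ?V" "W \<subseteq> U"
    by (rule cover_refine[OF conjunct1[OF V] assms(1) conjunct2[OF V] assms(2)])
  have "fst (G ?V) x = fst (G W) x" by (rule cocone_compat(1)[OF W(1) _ W(3,2)]) (use V in simp)
  moreover have "fst (G U) x = fst (G W) x" by (rule cocone_compat(1)[OF W(1) assms(1) W(4,2)])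
  ultimately show ?thesis unfolding point_image_def by simp
qed

lemma piece_arrow:
  assumes U: "U \<in> \<U>" and f: "entrance_on (filtered_sub X U) f a b" "a < b"
  shows "piece X G U f a b \<in> Ar C" "Dom C (piece X G U f a b) = point_image (f a)"
    "Cod C (piece X G U f a b) = point_image (f b)"
proof -
  have "f ` {a..b} \<subseteq> U" using f(1) unfolding entrance_on_filtered_sub by simp
  then have "f a \<in> U" "f b \<in> U" using f(2) by auto
  then show "piece X G U f a b \<in> Ar C" "Dom C (piece X G U f a b) = point_image (f a)"
    "Cod C (piece X G U f a b) = point_image (f b)"
    using cocone_functor[OF U] path_class_arrow[OF cover_conical[OF U] f] point_image_eq[OF U]
    unfolding is_functor_def piece_def by simp_all
qed

section \<open>Existence and uniqueness of lifts of a path\<close>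

lemma lifts_arrow:
  assumes "lifts X \<U> C G f a b m"
  shows "a < b \<and> entrance_on X f a b \<and> m \<in> Ar C \<and> Dom C m = point_image (f a) \<and> Cod C m = point_image (f b)"
  using assms
proof (induction rule: lifts.induct)
  case (lifts_piece U a b)
  then show ?case using piece_arrow[OF lifts_piece(1,3,2)] by (simp add: entrance_on_filtered_sub)
next
  case (lifts_Comp a b m c n)
  then show ?case using C_Comp[of m n] entrance_on_join[of X f a b c] by simp
qed

text \<open>By induction on the derivation. A cut inside a piece divides it by
  \<open>piece_Comp\<close>; a cut inside one factor of a composite is brought to the top by
  associativity in \<open>C\<close>. Two lifts of the same path can then be divided at the same
  point.\<close>

lemma lifts_split:
  assumes "lifts X \<U> C G f a b m" "a < c" "c < b"
  shows "\<exists>m1 m2. lifts X \<U> C G f a c m1 \<and> lifts X \<U> C G f c b m2 \<and> m = Comp C m2 m1"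
  using assms
proof (induction arbitrary: c rule: lifts.induct)
  case (lifts_piece U a b)
  have e: "entrance_on (filtered_sub X U) f a c" "entrance_on (filtered_sub X U) f c b"
    using entrance_on_subset[OF lifts_piece(3)] lifts_piece(4,5) by simp_all
  show ?case
    using lifts.lifts_piece[OF lifts_piece(1,4) e(1)] lifts.lifts_piece[OF lifts_piece(1,5) e(2)]
      piece_Comp[OF lifts_piece(1,3,4,5)] by metis
next
  case (lifts_Comp a b m b' n)
  have arr: "m \<in> Ar C" "n \<in> Ar C" "Cod C m = Dom C n"
    using lifts_arrow[OF lifts_Comp(1)] lifts_arrow[OF lifts_Comp(2)] by simp_all
  consider "c < b" | "c = b" | "b < c" by linarith
  then show ?case
  proof cases
    case 1
    then obtain m1 m2 where m: "lifts X \<U> C G f a c m1" "lifts X \<U> C G f c b m2" "m = Comp C m2 m1"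
      using lifts_Comp(3)[OF lifts_Comp(5)] by blast
    have "Comp C n m = Comp C (Comp C n m2) m1"
      unfolding m(3) using lifts_arrow[OF m(1)] lifts_arrow[OF m(2)] lifts_arrow[OF lifts_Comp(2)]
      by (intro C_assoc[symmetric]) simp_all
    then show ?thesis using m(1) lifts.lifts_Comp[OF m(2) lifts_Comp(2)] by blast
  next
    case 2
    then show ?thesis using lifts_Comp(1,2) by blast
  next
    case 3
    then obtain n1 n2 where n: "lifts X \<U> C G f b c n1" "lifts X \<U> C G f c b' n2" "n = Comp C n2 n1"
      using lifts_Comp(4)[OF _ lifts_Comp(6)] by blast
    have "Comp C n m = Comp C n2 (Comp C n1 m)"
      unfolding n(3) using lifts_arrow[OF n(1)] lifts_arrow[OF n(2)] lifts_arrow[OF lifts_Comp(1)]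
      by (intro C_assoc) simp_all
    then show ?thesis using n(2) lifts.lifts_Comp[OF lifts_Comp(1) n(1)] by blast
  qed
qed

text \<open>The path need not lie in a single member contained in \<open>U \<inter> V\<close>, but
  its short pieces do by \<open>cover_refine\<close>. For these \<open>piece_mono\<close> compares
  both sides with the smaller member, and \<open>piece_Comp\<close> glues the equalities.\<close>

lemma piece_independent:
  assumes UV: "U \<in> \<U>" "V \<in> \<U>" and f: "entrance_on X f a b" "a < b" "f ` {a..b} \<subseteq> U" "f ` {a..b} \<subseteq> V"
  shows "piece X G U f a b = piece X G V f a b"
proof (rule entrance_on_interval_induct[OF f(1,2), where P = "\<lambda>s t. piece X G U f s t = piece X G V f s t"])
  fix s t u
  assume st: "a \<le> s" "s < t" "t < u" "u \<le> b"
    and eq: "piece X G U f s t = piece X G V f s t" "piece X G U f t u = piece X G V f t u"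
  have "f ` {s..u} \<subseteq> f ` {a..b}" using st by (intro image_mono) auto
  then have "entrance_on (filtered_sub X U) f s u" "entrance_on (filtered_sub X V) f s u"
    using entrance_on_subset[OF f(1)] st f(3,4) by (auto intro!: entrance_on_sub)
  then show "piece X G U f s u = piece X G V f s u"
    using piece_Comp[OF UV(1), of f s u t] piece_Comp[OF UV(2), of f s u t] st eq by simp
next
  fix x assume x: "x \<in> {a..b}"
  then have "f x \<in> U" "f x \<in> V" using f(3,4) by auto
  then obtain W where W: "W \<in> \<U>" "f x \<in> W" "W \<subseteq> U" "W \<subseteq> V" by (rule cover_refine[OF UV])
  have "piece X G U f s t = piece X G V f s t" if st: "a \<le> s" "s < t" "t \<le> b" "f ` {s..t} \<subseteq> W" for s t
  proof -
    have "entrance_on X f s t" using entrance_on_subset[OF f(1)] st by simp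
    then show ?thesis
      using piece_mono[OF W(1) UV(1) W(3)] piece_mono[OF W(1) UV(2) W(4)] st by simp
  qed
  then show "\<exists>W. openin (top_of X) W \<and> f x \<in> W \<and>
      (\<forall>s t. a \<le> s \<longrightarrow> s < t \<longrightarrow> t \<le> b \<longrightarrow> f ` {s..t} \<subseteq> W \<longrightarrow> piece X G U f s t = piece X G V f s t)"
    using W(2) cover_open[OF W(1)] by (intro exI[of _ W] conjI allI impI)
qed

lemma lifts_eq_piece:
  assumes V: "V \<in> \<U>" and "lifts X \<U> C G f a b m" "f ` {a..b} \<subseteq> V"
  shows "m = piece X G V f a b"
  using assms(2,3)
proof (induction rule: lifts.induct)
  case (lifts_piece U a b)
  then show ?case using piece_independent[OF lifts_piece(1) V] unfolding entrance_on_filtered_sub by simp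
next
  case (lifts_Comp a b m c n)
  have l: "a < b" "b < c" "entrance_on X f a b" "entrance_on X f b c"
    using lifts_arrow[OF lifts_Comp(1)] lifts_arrow[OF lifts_Comp(2)] by simp_all
  have "f ` {a..b} \<subseteq> f ` {a..c}" "f ` {b..c} \<subseteq> f ` {a..c}" using l by (auto intro!: image_mono)
  then have "m = piece X G V f a b" "n = piece X G V f b c" using lifts_Comp(3,4,5) by auto
  moreover have "entrance_on (filtered_sub X V) f a c"
    by (rule entrance_on_sub[OF entrance_on_join[OF l(3,4)] lifts_Comp(5)]) (use l in simp_all)
  ultimately show ?case using piece_Comp[OF V _ l(1,2)] by simp
qed

text \<open>On a short interval the path stays in one member, and \<open>lifts_eq_piece\<close>
  identifies every lift with the image of that one piece. The equality is glued by splitting both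
  lifts at the common point.\<close>

lemma lifts_unique:
  assumes "lifts X \<U> C G f a b m" "lifts X \<U> C G f a b n"
  shows "m = n"
proof -
  let ?P = "\<lambda>s t. \<forall>m n. lifts X \<U> C G f s t m \<longrightarrow> lifts X \<U> C G f s t n \<longrightarrow> m = n"
  have f: "entrance_on X f a b" "a < b" using lifts_arrow[OF assms(1)] by simp_all
  have "?P a b"
  proof (rule entrance_on_interval_induct[OF f, where P = ?P], intro allI impI)
    fix s t u m n
    assume st: "s < t" "t < u" and P: "?P s t" "?P t u"
      and mn: "lifts X \<U> C G f s u m" "lifts X \<U> C G f s u n"
    obtain m1 m2 where m: "lifts X \<U> C G f s t m1" "lifts X \<U> C G f t u m2" "m = Comp C m2 m1"
      using lifts_split[OF mn(1) st] by blast
    obtain n1 n2 where n: "lifts X \<U> C G f s t n1" "lifts X \<U> C G f t u n2" "n = Comp C n2 n1"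
      using lifts_split[OF mn(2) st] by blast
    have "m1 = n1" "m2 = n2" using P m n by auto
    then show "m = n" using m(3) n(3) by simp
  next
    fix x assume "x \<in> {a..b}"
    then obtain U where U: "U \<in> \<U>" "f x \<in> U" using cover_ex entrance_on_in[OF f(1)] by blast
    then show "\<exists>W. openin (top_of X) W \<and> f x \<in> W \<and>
        (\<forall>s t. a \<le> s \<longrightarrow> s < t \<longrightarrow> t \<le> b \<longrightarrow> f ` {s..t} \<subseteq> W \<longrightarrow> ?P s t)"
      using cover_open lifts_eq_piece[OF U(1)] by (intro exI[of _ U] conjI allI impI) metis+
  qed
  then show ?thesis using assms by simp
qed

lemma lifts_exists:
  assumes f: "entrance_on X f a b" "a < b"
  shows "\<exists>m. lifts X \<U> C G f a b m"
proof (rule entrance_on_interval_induct[OF f, where P = "\<lambda>s t. \<exists>m. lifts X \<U> C G f s t m"])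
  fix s t u assume "\<exists>m. lifts X \<U> C G f s t m" "\<exists>m. lifts X \<U> C G f t u m"
  then obtain m n where "lifts X \<U> C G f s t m" "lifts X \<U> C G f t u n" by blast
  then have "lifts X \<U> C G f s u (Comp C n m)" by (rule lifts_Comp)
  then show "\<exists>m. lifts X \<U> C G f s u m" by (rule exI)
next
  fix x assume x: "x \<in> {a..b}"
  then obtain U where U: "U \<in> \<U>" "f x \<in> U" using cover_ex entrance_on_in[OF f(1)] by blast
  have "\<exists>m. lifts X \<U> C G f s t m" if st: "a \<le> s" "s < t" "t \<le> b" "f ` {s..t} \<subseteq> U" for s t
    using lifts_piece[OF U(1) st(2) entrance_on_sub[OF entrance_on_subset[OF f(1) st(1,3)] st(4)]] by (rule exI)
  then show "\<exists>W. openin (top_of X) W \<and> f x \<in> W \<and>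
      (\<forall>s t. a \<le> s \<longrightarrow> s < t \<longrightarrow> t \<le> b \<longrightarrow> f ` {s..t} \<subseteq> W \<longrightarrow> (\<exists>m. lifts X \<U> C G f s t m))"
    using U cover_open[OF U(1)] by (intro exI[of _ U] conjI allI impI)
qed

definition path_image_arrow :: "(real \<Rightarrow> 'a) \<Rightarrow> real \<Rightarrow> real \<Rightarrow> 'n" where
  "path_image_arrow f a b = (THE m. lifts X \<U> C G f a b m)"

lemma path_image_arrow_eq: "lifts X \<U> C G f a b m \<Longrightarrow> path_image_arrow f a b = m"
  unfolding path_image_arrow_def using lifts_unique by (intro the_equality) simp_all

lemma lifts_path_image_arrow:
  "entrance_on X f a b \<Longrightarrow> a < b \<Longrightarrow> lifts X \<U> C G f a b (path_image_arrow f a b)"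
  using lifts_exists path_image_arrow_eq by metis

lemma path_image_arrow_in:
  assumes "entrance_on X f a b" "a < b"
  shows "path_image_arrow f a b \<in> Ar C" "Dom C (path_image_arrow f a b) = point_image (f a)"
    "Cod C (path_image_arrow f a b) = point_image (f b)"
  using lifts_arrow[OF lifts_path_image_arrow[OF assms]] by simp_all

lemma path_image_arrow_Comp:
  assumes "entrance_on X f a c" "a < b" "b < c"
  shows "Comp C (path_image_arrow f b c) (path_image_arrow f a b) = path_image_arrow f a c"
proof -
  have "entrance_on X f a b" "entrance_on X f b c" using entrance_on_subset[OF assms(1)] assms(2,3) by simp_all
  then show ?thesis
    using lifts_Comp[OF lifts_path_image_arrow lifts_path_image_arrow] assms(2,3)
    by (intro path_image_arrow_eq[symmetric]) simp
qed

lemma path_image_arrow_piece: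
  assumes "U \<in> \<U>" "entrance_on X f a b" "a < b" "f ` {a..b} \<subseteq> U"
  shows "path_image_arrow f a b = piece X G U f a b"
  by (rule path_image_arrow_eq[OF lifts_piece[OF assms(1,3) entrance_on_sub[OF assms(2,4)]]])

text \<open>Division points are pulled back along \<open>\<phi>\<close>, and on each piece the class
  in the member of the cover does not change.\<close>

lemma lifts_reparam:
  assumes "lifts X \<U> C G f a' b' m" "incr_homeo \<phi> a b a' b'" "a < b" "\<forall>t\<in>{a..b}. g t = f (\<phi> t)"
  shows "lifts X \<U> C G g a b m"
  using assms
proof (induction arbitrary: a b rule: lifts.induct)
  case (lifts_piece U a' b')
  note con = cover_conical[OF lifts_piece(1)]
  have e: "entrance_on (filtered_sub X U) g a b"
    by (rule entrance_on_cong[OF entrance_on_incr_homeo[OF lifts_piece(4,3)]]) (use lifts_piece(6) in simp)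
  have "path_class (filtered_sub X U) g a b = path_class (filtered_sub X U) f a' b'"
    by (rule path_class_reparam[OF con lifts_piece(3,4,5)]) (use lifts_piece(6) in blast)
  then have "piece X G U f a' b' = piece X G U g a b" unfolding piece_def by simp
  then show ?case using lifts.lifts_piece[OF lifts_piece(1,5) e] by simp
next
  case (lifts_Comp a' c' m b' n)
  have l: "a' < c'" "c' < b'" using lifts_arrow[OF lifts_Comp(1)] lifts_arrow[OF lifts_Comp(2)] by simp_all
  have "c' \<in> \<phi> ` {a..b}" using incr_homeo_image[OF lifts_Comp(5)] lifts_Comp(6) l by simp
  then obtain c where c: "c \<in> {a..b}" "\<phi> c = c'" by blast
  have ends: "\<phi> a = a'" "\<phi> b = b'" using lifts_Comp(5) unfolding incr_homeo_def by auto
  have ac: "a < c" "c < b"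
    using incr_homeo_less_iff[OF lifts_Comp(5), of a c] incr_homeo_less_iff[OF lifts_Comp(5), of c b] c l ends by simp_all
  have "lifts X \<U> C G g a c m"
    by (rule lifts_Comp(3)[OF _ ac(1)])
      (use incr_homeo_subset[OF lifts_Comp(5), of a c] ac c ends lifts_Comp(7) in auto)
  moreover have "lifts X \<U> C G g c b n"
    by (rule lifts_Comp(4)[OF _ ac(2)])
      (use incr_homeo_subset[OF lifts_Comp(5), of c b] ac c ends lifts_Comp(7) in auto)
  ultimately show ?case by (rule lifts.lifts_Comp)
qed

lemma path_image_arrow_reparam:
  assumes "entrance_on X f a' b'" "incr_homeo \<phi> a b a' b'" "a < b" "\<And>t. t \<in> {a..b} \<Longrightarrow> g t = f (\<phi> t)"
  shows "path_image_arrow g a b = path_image_arrow f a' b'"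
proof -
  have "a' < b'" using incr_homeo_less[OF assms(2), of a b] assms(2,3) unfolding incr_homeo_def by simp
  from lifts_reparam[OF lifts_path_image_arrow[OF assms(1) this] assms(2,3)] assms(4)
  show ?thesis by (intro path_image_arrow_eq) blast
qed

lemma path_image_arrow_cong:
  assumes "entrance_on X f a b" "a < b" "\<And>t. t \<in> {a..b} \<Longrightarrow> g t = f t"
  shows "path_image_arrow g a b = path_image_arrow f a b"
  by (rule path_image_arrow_reparam[OF assms(1) incr_homeo_id[OF conical] assms(2,3)])

lemma path_image_arrow_const:
  assumes x: "x \<in> topspace (top_of X)" and "a < b"
  shows "path_image_arrow (\<lambda>_. x) a b = Ident C (point_image x)"
proof -
  obtain U where U: "U \<in> \<U>" "x \<in> U" using cover_ex[OF x] by blast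
  have x': "x \<in> topspace (top_of (filtered_sub X U))" using x U by (simp add: filtered_sub_def)
  have "path_image_arrow (\<lambda>_. x) a b = piece X G U (\<lambda>_. x) a b"
    by (rule path_image_arrow_piece[OF U(1) entrance_on_const[OF x] assms(2)]) (use U(2) in auto)
  also have "\<dots> = snd (G U) (Ident (Ent (filtered_sub X U)) x)"
    unfolding piece_def Ident_Ent[OF cover_conical[OF U(1)] x' assms(2)] ..
  also have "\<dots> = Ident C (point_image x)"
    using cocone_functor[OF U(1)] x' point_image_eq[OF U] unfolding is_functor_def by (simp add: Ent_def)
  finally show ?thesis .
qed

section \<open>Invariance of lifts under homotopy\<close>

lemma path_image_arrow_rect_local:
  assumes H: "entrance_rect X H a b c d" and ab: "a < b" "c < d" and U: "U \<in> \<U>" "V \<subseteq> U"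
    and V: "basic_open X (H b d) V" "\<And>u w. u \<in> {a..b} \<Longrightarrow> w \<in> {c..d} \<Longrightarrow> H u w \<in> V"
  shows "Comp C (path_image_arrow (H b) c d) (path_image_arrow (\<lambda>u. H u c) a b) =
      Comp C (path_image_arrow (\<lambda>u. H u d) a b) (path_image_arrow (H a) c d)"
proof -
  let ?A = "filtered_sub X U"
  note con = cover_conical[OF U(1)]
  have HU: "H u w \<in> U" if "u \<in> {a..b}" "w \<in> {c..d}" for u w using V(2)[OF that] U(2) by blast
  have R: "entrance_rect ?A H a b c d"
    by (rule entrance_rect_filtered_sub[OF H HU]) (use ab in auto)
  have "basic_open ?A (H b d) V" using basic_open_filtered_sub[OF cover_open[OF U(1)]] V(1) U(2) by simp
  \<comment> \<open>The square commutes already in the category of the single member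
    \<open>U\<close>, both ways around it being equal to the diagonal; \<open>G U\<close> carries
    this over to \<open>C\<close>.\<close>
  from entrance_rect_diagonal[OF con R ab this V(2)]
  have eq: "Comp (Ent ?A) (path_class ?A (H b) c d) (path_class ?A (\<lambda>u. H u c) a b) =
      Comp (Ent ?A) (path_class ?A (\<lambda>u. H u d) a b) (path_class ?A (H a) c d)" by simp
  have e: "entrance_on ?A (\<lambda>u. H u c) a b" "entrance_on ?A (\<lambda>u. H u d) a b"
    "entrance_on ?A (H a) c d" "entrance_on ?A (H b) c d"
    using entrance_rect_horizontal[OF R] entrance_rect_vertical[OF R] ab by simp_all
  have p: "path_image_arrow f s t = snd (G U) (path_class ?A f s t)" if "entrance_on ?A f s t" "s < t" for f s t
    using path_image_arrow_piece[OF U(1)] that unfolding piece_def entrance_on_filtered_sub by simp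
  have F: "snd (G U) (Comp (Ent ?A) n m) = Comp C (snd (G U) n) (snd (G U) m)"
    if "m \<in> Ar (Ent ?A)" "n \<in> Ar (Ent ?A)" "Cod (Ent ?A) m = Dom (Ent ?A) n" for m n
    using cocone_functor[OF U(1)] that unfolding is_functor_def by simp
  note arr = path_class_arrow[OF con e(1) ab(1)] path_class_arrow[OF con e(2) ab(1)]
    path_class_arrow[OF con e(3) ab(2)] path_class_arrow[OF con e(4) ab(2)]
  have "snd (G U) (Comp (Ent ?A) (path_class ?A (H b) c d) (path_class ?A (\<lambda>u. H u c) a b)) =
      Comp C (path_image_arrow (H b) c d) (path_image_arrow (\<lambda>u. H u c) a b)"
    unfolding p[OF e(1) ab(1)] p[OF e(4) ab(2)] by (rule F) (simp_all add: arr)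
  moreover have "snd (G U) (Comp (Ent ?A) (path_class ?A (\<lambda>u. H u d) a b) (path_class ?A (H a) c d)) =
      Comp C (path_image_arrow (\<lambda>u. H u d) a b) (path_image_arrow (H a) c d)"
    unfolding p[OF e(2) ab(1)] p[OF e(3) ab(2)] by (rule F) (simp_all add: arr)
  ultimately show ?thesis using eq by simp
qed

text \<open>Pasting of two commutative squares along the arrow \<open>r1\<close>.\<close>

lemma C_paste:
  assumes "p1 \<in> Ar C" "p2 \<in> Ar C" "q1 \<in> Ar C" "q2 \<in> Ar C" "r0 \<in> Ar C" "r1 \<in> Ar C" "r2 \<in> Ar C"
    "Cod C p1 = Dom C p2" "Cod C p2 = Dom C r2" "Cod C p1 = Dom C r1" "Cod C r1 = Dom C q2"
    "Cod C r0 = Dom C q1" "Cod C q1 = Dom C q2"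
    and e1: "Comp C r1 p1 = Comp C q1 r0" and e2: "Comp C r2 p2 = Comp C q2 r1"
  shows "Comp C r2 (Comp C p2 p1) = Comp C (Comp C q2 q1) r0"
proof -
  have "Comp C r2 (Comp C p2 p1) = Comp C (Comp C r2 p2) p1" by (rule C_assoc[symmetric]) fact+
  also have "\<dots> = Comp C q2 (Comp C r1 p1)" unfolding e2 by (rule C_assoc) fact+
  also have "\<dots> = Comp C (Comp C q2 q1) r0" unfolding e1 by (rule C_assoc[symmetric]) fact+
  finally show ?thesis .
qed

lemma path_image_arrow_square:
  assumes H: "entrance_rect X H 0 1 0 1"
  shows "Comp C (path_image_arrow (H 1) 0 1) (path_image_arrow (\<lambda>u. H u 0) 0 1) =
      Comp C (path_image_arrow (\<lambda>u. H u 1) 0 1) (path_image_arrow (H 0) 0 1)"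
proof -
  let ?eq = "\<lambda>a b c d. Comp C (path_image_arrow (H b) c d) (path_image_arrow (\<lambda>u. H u c) a b) =
      Comp C (path_image_arrow (\<lambda>u. H u d) a b) (path_image_arrow (H a) c d)"
  \<comment> \<open>The premises make degenerate rectangles and those outside the unit square
    satisfy \<open>?Q\<close> vacuously, as bisection ranges over all rectangles.\<close>
  let ?Q = "\<lambda>a b c d. 0 \<le> a \<longrightarrow> b \<le> 1 \<longrightarrow> 0 \<le> c \<longrightarrow> d \<le> 1 \<longrightarrow> a < b \<longrightarrow> c < d \<longrightarrow> ?eq a b c d"
  have hz: "entrance_on X (\<lambda>u. H u w) a b" if "0 \<le> a" "b \<le> 1" "0 \<le> w" "w \<le> 1" for a b w
    using entrance_on_subset[OF entrance_rect_horizontal[OF H, of w]] that by simp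
  have vt: "entrance_on X (H u) c d" if "0 \<le> c" "d \<le> 1" "0 \<le> u" "u \<le> 1" for c d u
    using entrance_on_subset[OF entrance_rect_vertical[OF H, of u]] that by simp
  note arr = path_image_arrow_in[OF hz] path_image_arrow_in[OF vt]
  have "?Q 0 1 0 1"
  proof (rule Bolzano_square[where Q = ?Q])
    fix a b e c d :: real assume Q: "?Q a b c d" "?Q b e c d" and ab: "a \<le> b" "b \<le> e"
    show "?Q a e c d"
    proof (intro impI)
      assume bd: "0 \<le> a" "e \<le> 1" "0 \<le> c" "d \<le> 1" "a < e" "c < d"
      show "?eq a e c d"
      proof (cases "a < b \<and> b < e")
        case True
        have "Comp C (path_image_arrow (H e) c d)
            (Comp C (path_image_arrow (\<lambda>u. H u c) b e) (path_image_arrow (\<lambda>u. H u c) a b)) =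
          Comp C (Comp C (path_image_arrow (\<lambda>u. H u d) b e) (path_image_arrow (\<lambda>u. H u d) a b))
            (path_image_arrow (H a) c d)"
          by (rule C_paste[where ?r1.0 = "path_image_arrow (H b) c d"]) (use Q bd True in \<open>simp_all add: arr\<close>)
        then show ?thesis
          using path_image_arrow_Comp[OF hz, of a e c b] path_image_arrow_Comp[OF hz, of a e d b] bd True by simp
      next
        case False
        then show ?thesis using Q bd ab by (cases "a = b") auto
      qed
    qed
  next
    fix a b c d e :: real assume Q: "?Q a b c d" "?Q a b d e" and cd: "c \<le> d" "d \<le> e"
    show "?Q a b c e"
    proof (intro impI)
      assume bd: "0 \<le> a" "b \<le> 1" "0 \<le> c" "e \<le> 1" "a < b" "c < e"
      show "?eq a b c e"
      proof (cases "c < d \<and> d < e")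
        case True
        \<comment> \<open>The same pasting with horizontal and vertical sides exchanged: the squares
          now share the horizontal arrow at height \<open>d\<close>.\<close>
        have "Comp C (path_image_arrow (\<lambda>u. H u e) a b)
            (Comp C (path_image_arrow (H a) d e) (path_image_arrow (H a) c d)) =
          Comp C (Comp C (path_image_arrow (H b) d e) (path_image_arrow (H b) c d))
            (path_image_arrow (\<lambda>u. H u c) a b)"
          by (rule C_paste[where ?r1.0 = "path_image_arrow (\<lambda>u. H u d) a b"]) (use Q bd True in \<open>simp_all add: arr\<close>)
        then show ?thesis
          using path_image_arrow_Comp[OF vt, of c e a d] path_image_arrow_Comp[OF vt, of c e b d] bd True by simp
      next
        case False
        then show ?thesis using Q bd cd by (cases "c = d") auto
      qed
    qed
  next
    fix x y :: real assume x: "x \<in> {0..1}" and y: "y \<in> {0..1}"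
    obtain k l where k: "\<forall>u\<in>{0..<1}. \<forall>w\<in>{0..1}. pdim X (H u w) = k" "\<forall>w\<in>{0..<1}. pdim X (H 1 w) = l"
      "l \<le> k" "pdim X (H 1 1) \<le> l"
      and cont: "continuous_map (top_of_set ({0..1} \<times> {0..1})) (top_of X) (\<lambda>(u, w). H u w)"
      using H unfolding entrance_rect_def by (elim conjE exE)
    have "H x y \<in> topspace (top_of X)" using entrance_on_in[OF hz[of 0 1 y], of x] x y by simp
    then obtain U where U: "U \<in> \<U>" "H x y \<in> U" using cover_ex by blast
    obtain V where V: "V \<subseteq> U" "basic_open X (H x y) V"
      using conically_stratified_basic[OF conical cover_open[OF U(1)] U(2)] by blast
    have "(x, y) \<in> {0..1} \<times> {0..1}" "(\<lambda>(u, w). H u w) (x, y) \<in> V" using x y basic_open_self(1)[OF V(2)] by simp_all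
    then obtain \<eta> where \<eta>: "\<eta> > 0"
      "\<And>z. z \<in> {0..1} \<times> {0..1} \<Longrightarrow> dist z (x, y) < \<eta> \<Longrightarrow> (\<lambda>(u, w). H u w) z \<in> V"
      by (rule continuous_map_nbhd[OF cont basic_open_self(2)[OF V(2)]]) auto
    \<comment> \<open>The bound \<open>\<eta> / 2\<close> suffices because the distance in the plane
      is at most the sum of the distances of the coordinates. The second bound keeps the rectangle
      off the right side if \<open>x < 1\<close>, and off the corner \<open>(1, 1)\<close> if
      \<open>x = 1\<close> and \<open>y < 1\<close>. In every case \<open>(b, d)\<close> has the
      dimension of \<open>(x, y)\<close>, so that \<open>V\<close> is basic about it.\<close>
    define \<delta> where "\<delta> = min (\<eta> / 2) (if x < 1 then 1 - x else if y < 1 then 1 - y else 1)"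
    have \<delta>: "\<delta> > 0" "\<delta> \<le> \<eta> / 2" unfolding \<delta>_def using \<eta>(1) by auto
    have "?eq a b c d" if r: "a \<le> x \<and> x \<le> b \<and> b - a < \<delta> \<and> c \<le> y \<and> y \<le> d \<and> d - c < \<delta>"
      "0 \<le> a" "b \<le> 1" "0 \<le> c" "d \<le> 1" "a < b" "c < d" for a b c d
    proof (rule path_image_arrow_rect_local[OF _ r(6,7) U(1) V(1)])
      show "entrance_rect X H a b c d" using entrance_rect_subset[OF H] r by simp
      show HV: "H u w \<in> V" if uw: "u \<in> {a..b}" "w \<in> {c..d}" for u w
      proof -
        have "dist u x < \<delta>" "dist w y < \<delta>" using uw r by (auto simp: dist_real_def)
        then have "dist (u, w) (x, y) < \<eta>"
          using \<delta>(2) sqrt_sum_squares_le_sum[of "dist u x" "dist w y"] by (simp add: dist_Pair_Pair)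
        then show ?thesis using \<eta>(2)[of "(u, w)"] uw r by simp
      qed
      have "pdim X (H b d) = pdim X (H x y)"
      proof (cases "x < 1")
        case True
        then have "b < 1" using r(1,2) unfolding \<delta>_def by auto
        then show ?thesis using k(1) True r x y by simp
      next
        case False
        then have x1: "x = 1" "b = 1" using x r by auto
        show ?thesis
        proof (cases "y < 1")
          case True
          then have "d < 1" using r(1) x1 unfolding \<delta>_def by auto
          then show ?thesis using k(2) True r y x1 by simp
        next
          case False
          then have "y = 1" "d = 1" using y r by auto
          then show ?thesis using x1 by simp
        qed
      qed
      then show "basic_open X (H b d) V"
        using basic_open_translate[OF conical_filtered[OF conical] V(2)] HV[of b d] r by simp
    qed
    then show "\<exists>\<delta>>0. \<forall>a b c d. a \<le> x \<and> x \<le> b \<and> b - a < \<delta> \<and> c \<le> y \<and> y \<le> d \<and> d - c < \<delta> \<longrightarrow> ?Q a b c d"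
      using \<delta>(1) by (intro exI[of _ \<delta>] conjI allI impI) blast+
  qed
  then show ?thesis by simp
qed

lemma path_image_arrow_homotopy:
  assumes hom: "elementary_homotopy X p q"
  shows "path_image_arrow (snd p) 0 1 = path_image_arrow (snd q) 0 1"
proof -
  note F = conical_filtered[OF conical]
  obtain h k l \<phi> \<psi> where h: "continuous_map (top_of_set triangle) (top_of X) h"
    and k: "\<forall>x y. (x, y) \<in> triangle \<longrightarrow> x + y < 1 \<longrightarrow> pdim X (h (x, y)) = k"
    and l: "\<forall>x y. 0 < x \<longrightarrow> 0 < y \<longrightarrow> x + y = 1 \<longrightarrow> pdim X (h (x, y)) = l"
    and \<phi>: "incr_homeo \<phi> 0 1 0 1" and \<psi>: "incr_homeo \<psi> 0 1 0 1"
    and p: "\<forall>t\<in>{0..1}. snd p t = h (bent (\<phi> t))" and q: "\<forall>t\<in>{0..1}. snd q t = h (0, \<psi> t)"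
    by (rule elementary_homotopyE[OF F hom])
  note k = k[rule_format] and l = l[rule_format]
  have pq: "p \<in> entrance_paths X" using hom unfolding elementary_homotopy_def by simp
  \<comment> \<open>Undoing \<open>\<phi>\<close> shows that \<open>h \<circ> bent\<close> itself is
    an entrance path.\<close>
  obtain \<theta> where \<theta>: "incr_homeo \<theta> 0 1 0 1" "\<And>t. t \<in> {0..1} \<Longrightarrow> \<phi> (\<theta> t) = t"
    using incr_homeo_inverse[OF \<phi>] by (metis zero_le_one)
  have eb: "entrance_on X (h \<circ> bent) 0 1"
    by (rule entrance_on_cong[OF entrance_on_incr_homeo[OF \<theta>(1) entrance_pathD(3)[OF conical pq]]])
       (use p \<theta> incr_homeo_in[OF \<theta>(1)] in simp)
  \<comment> \<open>Polar coordinates of the triangle seen from \<open>v0\<close>: \<open>u\<close>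
    is \<open>x + y\<close> and \<open>w\<close> selects the ray. The left side is collapsed to
    \<open>v0\<close>, the bottom and right sides make up the broken line, and the top side is the
    straight edge.\<close>
  define H where "H u w = h (u * (1 - w), u * w)" for u w
  have tri: "(u * (1 - w), u * w) \<in> triangle" if "u \<in> {0..1}" "w \<in> {0..1}" for u w
    using that by (auto simp: in_triangle algebra_simps mult_left_le)
  have Hb: "H u 0 = (h \<circ> bent) (u / 2)" if "u \<in> {0..1}" for u
    using that unfolding H_def by (simp add: bent_cases)
  have H1: "H 1 w = (h \<circ> bent) ((w + 1) / 2)" if "w \<in> {0..1}" for w
    using that unfolding H_def by (simp add: bent_cases add_divide_distrib)
  have dimb: "pdim X ((h \<circ> bent) t) = l" if "1/2 < t" "t < 1" for t
    using l[of "2 - 2 * t" "2 * t - 1"] that by (simp add: bent_cases)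
  \<comment> \<open>The homotopy fixes the dimension \<open>l\<close> on the open edge only. At
    \<open>v1\<close> it is not larger because the filtration is closed, and not smaller because
    dimensions do not increase along the path.\<close>
  have l0: "pdim X (H 1 0) = l"
  proof -
    have "pdim X ((h \<circ> bent) (1/2)) \<le> l"
      using dimb by (intro pdim_le_at_left_end[OF F entrance_on_continuous[OF entrance_on_subset[OF eb]], of "1/2" 1]) auto
    moreover have "pdim X ((h \<circ> bent) (3/4)) \<le> pdim X ((h \<circ> bent) (1/2))" by (rule entrance_on_mono[OF eb]) simp_all
    ultimately show ?thesis using dimb[of "3/4"] Hb[of 1] by simp
  qed
  have dim0: "pdim X (H u w) = k" if "u \<in> {0..<1}" "w \<in> {0..1}" for u w
    using tri[of u w] k[of "u * (1 - w)" "u * w"] that unfolding H_def by (simp add: algebra_simps)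
  have R: "entrance_rect X H 0 1 0 1"
    unfolding entrance_rect_def
  proof (rule conjI[OF _ exI[of _ k, OF exI[of _ l]]]; (intro conjI)?)
    have "continuous_on ({0..1} \<times> {0..1}) (\<lambda>z::real\<times>real. (fst z * (1 - snd z), fst z * snd z))"
      by (intro continuous_intros)
    then have "continuous_map (top_of_set ({0..1} \<times> {0..1})) (top_of X) (h \<circ> (\<lambda>z. (fst z * (1 - snd z), fst z * snd z)))"
      using tri by (intro continuous_map_compose[OF _ h]) auto
    then show "continuous_map (top_of_set ({0..1} \<times> {0..1})) (top_of X) (\<lambda>(u, w). H u w)"
      by (simp add: comp_def H_def case_prod_beta')
    show "\<forall>u\<in>{0..<1}. \<forall>w\<in>{0..1}. pdim X (H u w) = k" using dim0 by blast
    show "\<forall>w\<in>{0..<1}. pdim X (H 1 w) = l"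
    proof
      fix w :: real assume w: "w \<in> {0..<1}"
      show "pdim X (H 1 w) = l"
      proof (cases "w = 0")
        case False
        then show ?thesis using w l[of "1 - w" w] unfolding H_def by simp
      qed (use l0 in simp)
    qed
    have "pdim X ((h \<circ> bent) (1/2)) \<le> pdim X ((h \<circ> bent) 0)" "pdim X ((h \<circ> bent) 1) \<le> pdim X ((h \<circ> bent) (1/2))"
      by (rule entrance_on_mono[OF eb]; simp)+
    then show "l \<le> k" "pdim X (H 1 1) \<le> l"
      using l0 dim0[of 0 0] Hb[of 0] Hb[of 1] H1[of 1] by simp_all
  qed
  have e: "entrance_on X (\<lambda>u. H u 0) 0 1" "entrance_on X (\<lambda>u. H u 1) 0 1" "entrance_on X (H 1) 0 1" "entrance_on X (H 0) 0 1"
    using entrance_rect_horizontal[OF R] entrance_rect_vertical[OF R] by simp_all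
  have "path_image_arrow (snd p) 0 1 = path_image_arrow (h \<circ> bent) 0 1"
    by (rule path_image_arrow_reparam[OF eb \<phi>]) (use p in simp_all)
  also have "\<dots> = Comp C (path_image_arrow (h \<circ> bent) (1/2) 1) (path_image_arrow (h \<circ> bent) 0 (1/2))"
    by (rule path_image_arrow_Comp[OF eb, symmetric]) simp_all
  also have "path_image_arrow (h \<circ> bent) 0 (1/2) = path_image_arrow (\<lambda>u. H u 0) 0 1"
    by (rule path_image_arrow_reparam[OF e(1) incr_homeo_double(1)]) (use Hb in simp_all)
  also have "path_image_arrow (h \<circ> bent) (1/2) 1 = path_image_arrow (H 1) 0 1"
    by (rule path_image_arrow_reparam[OF e(3) incr_homeo_double(2)]) (use H1 in simp_all)
  also have "Comp C (path_image_arrow (H 1) 0 1) (path_image_arrow (\<lambda>u. H u 0) 0 1) =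
      Comp C (path_image_arrow (\<lambda>u. H u 1) 0 1) (path_image_arrow (H 0) 0 1)"
    by (rule path_image_arrow_square[OF R])
  \<comment> \<open>The collapsed side is a constant path, so the commuting square turns into the
    desired equation of the two remaining sides.\<close>
  also have "path_image_arrow (H 0) 0 1 = Ident C (Dom C (path_image_arrow (\<lambda>u. H u 1) 0 1))"
  proof -
    have "H 0 = (\<lambda>_. h (0, 0))" "H 0 1 = h (0, 0)" unfolding H_def by auto
    moreover have "h (0, 0) \<in> topspace (top_of X)" using entrance_on_in[OF e(4), of 0] unfolding H_def by simp
    ultimately show ?thesis using path_image_arrow_const[of "h (0, 0)" 0 1] path_image_arrow_in(2)[OF e(2)] by simp
  qed
  also have "Comp C (path_image_arrow (\<lambda>u. H u 1) 0 1) (Ident C (Dom C (path_image_arrow (\<lambda>u. H u 1) 0 1))) =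
      path_image_arrow (\<lambda>u. H u 1) 0 1"
    using C_cat path_image_arrow_in(1)[OF e(2)] unfolding is_category_def by simp
  also have "\<dots> = path_image_arrow (snd q) 0 1"
    by (rule path_image_arrow_reparam[OF e(2) \<psi>, symmetric]) (use q in \<open>simp_all add: H_def\<close>)
  finally show ?thesis .
qed

lemma path_image_arrow_change:
  assumes f: "entrance_on X f 0 1" and g: "entrance_on X g 0 1" and ab: "0 \<le> a" "a < b" "b \<le> 1"
    and off: "\<forall>t\<in>{0..1}. t \<le> a \<or> b \<le> t \<longrightarrow> f t = g t" and eq: "path_image_arrow f a b = path_image_arrow g a b"
  shows "path_image_arrow f 0 1 = path_image_arrow g 0 1"
proof -
  have b: "path_image_arrow f 0 b = path_image_arrow g 0 b"
  proof (cases "a = 0")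
    case False
    have "path_image_arrow f 0 a = path_image_arrow g 0 a"
      by (rule path_image_arrow_cong) (use False ab off entrance_on_subset[OF g] in auto)
    moreover have "entrance_on X f 0 b" "entrance_on X g 0 b" using entrance_on_subset[OF f] entrance_on_subset[OF g] ab by simp_all
    ultimately show ?thesis
      using path_image_arrow_Comp[of f 0 b a] path_image_arrow_Comp[of g 0 b a] eq ab False by simp
  qed (use eq in simp)
  show ?thesis
  proof (cases "b = 1")
    case False
    have "path_image_arrow f b 1 = path_image_arrow g b 1"
      by (rule path_image_arrow_cong) (use False ab off entrance_on_subset[OF g] in auto)
    then show ?thesis
      using path_image_arrow_Comp[OF f, of b] path_image_arrow_Comp[OF g, of b] b ab False by simp
  qed (use b in simp)
qed

lemma path_image_arrow_related:
  assumes r: "elementarily_related X p q"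
  shows "path_image_arrow (snd p) 0 1 = path_image_arrow (snd q) 0 1"
proof -
  obtain p' q' \<phi> \<psi> p2 q2 a b where pq': "p' \<in> entrance_paths X" "q' \<in> entrance_paths X"
    and \<phi>: "incr_homeo \<phi> 0 1 0 1" "\<forall>t\<in>{0..1}. snd p' t = snd p (\<phi> t)"
    and \<psi>: "incr_homeo \<psi> 0 1 0 1" "\<forall>t\<in>{0..1}. snd q' t = snd q (\<psi> t)"
    and h: "elementary_homotopy X p2 q2 \<or> elementary_homotopy X q2 p2"
    and ab: "0 \<le> a" "a < b" "b \<le> 1"
    and m1: "\<forall>t\<in>{0..1}. snd p' (affine_to a b t) = snd p2 t"
    and m2: "\<forall>t\<in>{0..1}. snd q' (affine_to a b t) = snd q2 t"
    and off: "\<forall>t\<in>{0..1}. t \<le> a \<or> b \<le> t \<longrightarrow> snd p' t = snd q' t"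
    using r by (elim elementarily_relatedE[OF conical]) (rule that, assumption+)
  note pq = elementarily_related_paths[OF conical r]
  note E = entrance_pathD(3)[OF conical]
  have "path_image_arrow (snd p2) 0 1 = path_image_arrow (snd q2) 0 1"
    using h path_image_arrow_homotopy by metis
  moreover have "path_image_arrow (snd p2) 0 1 = path_image_arrow (snd p') a b"
    by (rule path_image_arrow_reparam[OF entrance_on_subset[OF E[OF pq'(1)] ab(1,3)] incr_homeo_affine[OF ab(2)]])
       (use m1 in simp_all)
  moreover have "path_image_arrow (snd q2) 0 1 = path_image_arrow (snd q') a b"
    by (rule path_image_arrow_reparam[OF entrance_on_subset[OF E[OF pq'(2)] ab(1,3)] incr_homeo_affine[OF ab(2)]])
       (use m2 in simp_all)
  ultimately have "path_image_arrow (snd p') 0 1 = path_image_arrow (snd q') 0 1"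
    by (intro path_image_arrow_change[OF E[OF pq'(1)] E[OF pq'(2)] ab off]) simp
  moreover have "path_image_arrow (snd p') 0 1 = path_image_arrow (snd p) 0 1"
    by (rule path_image_arrow_reparam[OF E \<phi>(1)]) (use pq \<phi>(2) in simp_all)
  moreover have "path_image_arrow (snd q') 0 1 = path_image_arrow (snd q) 0 1"
    by (rule path_image_arrow_reparam[OF E \<psi>(1)]) (use pq \<psi>(2) in simp_all)
  ultimately show ?thesis by simp
qed

section \<open>The functor induced by a cocone\<close>

definition induced_functor :: "('a, 'a spath set, 'p, 'n) fctr" where
  "induced_functor = (point_image, \<lambda>c. the_elem ((\<lambda>p. path_image_arrow (snd p) 0 1) ` c))"

lemma induced_functor_path_class:
  assumes f: "entrance_on X f a b" and ab: "a < b"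
  shows "snd induced_functor (path_class X f a b) = path_image_arrow f a b"
proof -
  obtain P where P: "(P, restrict (f \<circ> affine_to a b) {0..1}) \<in> entrance_paths X"
    "path_class X f a b = path_equiv X `` {(P, restrict (f \<circ> affine_to a b) {0..1})}"
    using f ab by (rule path_class_rep[OF conical])
  let ?p = "(P, restrict (f \<circ> affine_to a b) {0..1})"
  have "path_image_arrow (snd q) 0 1 = path_image_arrow (snd ?p) 0 1" if "q \<in> path_equiv X `` {?p}" for q
  proof -
    have "(elementarily_related X)\<^sup>*\<^sup>* ?p q" using that unfolding path_equiv_def by simp
    then show ?thesis
    proof (induction rule: rtranclp_induct)
      case (step y z)
      show ?case using path_image_arrow_related[OF step(2)] step(3) by (rule trans[OF sym])
    qed (rule refl)
  qed
  then have "the_elem ((\<lambda>p. path_image_arrow (snd p) 0 1) ` (path_equiv X `` {?p})) = path_image_arrow (snd ?p) 0 1"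
    by (intro the_elem_image_const[where f = "\<lambda>p. path_image_arrow (snd p) 0 1"])
       (use path_equiv_refl[OF conical P(1)] in auto)
  also have "\<dots> = path_image_arrow f a b"
    by (rule path_image_arrow_reparam[OF f incr_homeo_affine[OF ab]]) simp_all
  finally show ?thesis unfolding P(2) induced_functor_def by simp
qed

lemma induced_functor: "is_functor (Ent X) C induced_functor"
  unfolding is_functor_def
proof (intro conjI ballI impI)
  show "is_category (Ent X)" "is_category C" by (rule Ent_category[OF conical], rule C_cat)
  fix x assume "x \<in> Ob (Ent X)"
  then have x: "x \<in> topspace (top_of X)" by (simp add: Ent_def)
  have arr: "path_image_arrow (\<lambda>_. x) 0 1 \<in> Ar C" "Dom C (path_image_arrow (\<lambda>_. x) 0 1) = point_image x"
    using path_image_arrow_in[OF entrance_on_const[OF x] zero_less_one] by simp_all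
  then show "fst induced_functor x \<in> Ob C"
    using C_cat unfolding is_category_def induced_functor_def by (metis fst_conv)
  show "snd induced_functor (Ident (Ent X) x) = Ident C (fst induced_functor x)"
    unfolding Ident_Ent[OF conical x zero_less_one] induced_functor_path_class[OF entrance_on_const[OF x] zero_less_one]
      path_image_arrow_const[OF x zero_less_one] by (simp add: induced_functor_def)
next
  fix f assume f: "f \<in> Ar (Ent X)"
  then obtain f' where f': "entrance_on X f' 0 1" "f = path_class X f' 0 1"
    using zero_less_one by (rule Ar_EntE[OF conical])
  have F: "snd induced_functor f = path_image_arrow f' 0 1"
    unfolding f'(2) by (rule induced_functor_path_class[OF f'(1) zero_less_one])
  have pt: "fst induced_functor = point_image" by (simp add: induced_functor_def)
  show "snd induced_functor f \<in> Ar C" "Dom C (snd induced_functor f) = fst induced_functor (Dom (Ent X) f)"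
    "Cod C (snd induced_functor f) = fst induced_functor (Cod (Ent X) f)"
    unfolding F pt using path_image_arrow_in[OF f'(1)] path_class_arrow[OF conical f'(1)] f'(2) by simp_all
  fix g assume g: "g \<in> Ar (Ent X)" and fg: "Cod (Ent X) f = Dom (Ent X) g"
  have lt: "1 < (2::real)" by simp
  obtain g' where g': "entrance_on X g' 1 2" "g = path_class X g' 1 2"
    using g lt by (rule Ar_EntE[OF conical])
  have e: "f' 1 = g' 1" using fg path_class_arrow[OF conical] f' g' by simp
  let ?F = "\<lambda>t. if t \<le> 1 then f' t else g' t"
  have G: "entrance_on X ?F 0 2" by (rule entrance_on_glue[OF f'(1) g'(1)]) (use e in simp_all)
  have f2: "f = path_class X ?F 0 1" unfolding f'(2)
    by (rule path_class_cong[OF conical f'(1), symmetric]) simp_all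
  have g2: "g = path_class X ?F 1 2" unfolding g'(2)
    by (rule path_class_cong[OF conical g'(1), symmetric]) (use e in auto)
  have pieces: "entrance_on X ?F 0 1" "entrance_on X ?F 1 2" using entrance_on_subset[OF G] by simp_all
  show "snd induced_functor (Comp (Ent X) g f) = Comp C (snd induced_functor g) (snd induced_functor f)"
    unfolding f2 g2 using path_class_Comp[OF conical G, of 1] path_image_arrow_Comp[OF G, of 1]
      induced_functor_path_class[OF G] induced_functor_path_class[OF pieces(1)]
      induced_functor_path_class[OF pieces(2)] by simp
qed

lemma induced_functor_cocone:
  assumes U: "U \<in> \<U>"
  shows "functor_eq (Ent (filtered_sub X U)) (functor_comp induced_functor (Ent_map X (\<lambda>x. x))) (G U)"
  unfolding functor_eq_def
proof (intro conjI ballI)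
  fix x assume "x \<in> Ob (Ent (filtered_sub X U))"
  then have "x \<in> U" by (simp add: Ent_def filtered_sub_def)
  then show "fst (functor_comp induced_functor (Ent_map X (\<lambda>x. x))) x = fst (G U) x"
    using point_image_eq[OF U] by (simp add: functor_comp_def induced_functor_def Ent_map_def)
next
  fix f assume "f \<in> Ar (Ent (filtered_sub X U))"
  then obtain f' where f': "entrance_on (filtered_sub X U) f' 0 1" "f = path_class (filtered_sub X U) f' 0 1"
    using zero_less_one by (rule Ar_EntE[OF cover_conical[OF U]])
  have e: "entrance_on X f' 0 1" "f' ` {0..1} \<subseteq> U" using f'(1) unfolding entrance_on_filtered_sub by simp_all
  have "snd (Ent_map X (\<lambda>x. x)) f = path_class X f' 0 1"
    unfolding f'(2) by (rule Ent_map_path_class[OF conical cover_open[OF U] f'(1) zero_less_one])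
  then show "snd (functor_comp induced_functor (Ent_map X (\<lambda>x. x))) f = snd (G U) f"
    using induced_functor_path_class[OF e(1) zero_less_one] path_image_arrow_piece[OF U e(1) zero_less_one e(2)] f'(2)
    by (simp add: functor_comp_def piece_def)
qed

end

subsection \<open>The colimit\<close>

lemma is_functor_comp:
  assumes "is_functor B C F" "is_functor C D G"
  shows "is_functor B D (functor_comp G F)"
  using assms unfolding is_functor_def functor_comp_def by simp

lemma is_functor_id: "is_category C \<Longrightarrow> is_functor C C functor_id"
  unfolding is_functor_def functor_id_def is_category_def by simp

lemma functor_eq_trans: "functor_eq C F G \<Longrightarrow> functor_eq C G H \<Longrightarrow> functor_eq C F H"
  unfolding functor_eq_def by simp

lemma functor_eq_sym: "functor_eq C F G \<Longrightarrow> functor_eq C G F"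
  unfolding functor_eq_def by simp

context
  fixes X :: "'a filtered" and \<U> :: "'a set set"
  assumes conical: "conically_stratified X"
    and cover: "complete_cover (top_of X) (topspace (top_of X)) \<U>"
begin

lemma sub_open:
  assumes "U \<in> \<U>" "V \<in> \<U>" "U \<subseteq> V"
  shows "openin (top_of (filtered_sub X V)) U"
  using cover assms unfolding complete_cover_def filtered_sub_def by (simp add: openin_open_subtopology)

lemma sub_conical: "U \<in> \<U> \<Longrightarrow> conically_stratified (filtered_sub X U)"
  using cover conically_stratified_sub[OF conical] unfolding complete_cover_def by simp

lemma Ent_map_sub_path_class:
  assumes UV: "U \<in> \<U>" "V \<in> \<U>" "U \<subseteq> V" and f: "entrance_on (filtered_sub X U) f a b" "a < b"
  shows "snd (Ent_map (filtered_sub X V) (\<lambda>x. x)) (path_class (filtered_sub X U) f a b) =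
    path_class (filtered_sub X V) f a b"
  using Ent_map_path_class[OF sub_conical[OF UV(2)] sub_open[OF UV], of f a b] f
  unfolding filtered_sub_sub[OF UV(3)] by simp

lemma entrance_on_sub_mono:
  "U \<subseteq> V \<Longrightarrow> entrance_on (filtered_sub X U) f a b \<Longrightarrow> entrance_on (filtered_sub X V) f a b"
  unfolding entrance_on_filtered_sub by blast

lemma Ent_diagram_is_diagram: "is_diagram (Ent_diagram X \<U>)"
proof -
  let ?E = "\<lambda>U. Ent (filtered_sub X U)" and ?M = "\<lambda>V. Ent_map (filtered_sub X V) (\<lambda>x. x)"
  have F: "is_functor (?E U) (?E V) (?M V)" if UV: "U \<in> \<U>" "V \<in> \<U>" "U \<subseteq> V" for U V
    using Ent_map_functor[OF sub_conical[OF UV(2)] sub_open[OF UV]] unfolding filtered_sub_sub[OF UV(3)] .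
  have I: "functor_eq (?E U) (?M U) functor_id" if U: "U \<in> \<U>" for U
    unfolding functor_eq_def
  proof (intro conjI ballI)
    fix f assume "f \<in> Ar (?E U)"
    then obtain f' where f': "entrance_on (filtered_sub X U) f' 0 1" "f = path_class (filtered_sub X U) f' 0 1"
      using zero_less_one by (rule Ar_EntE[OF sub_conical[OF U]])
    show "snd (?M U) f = snd functor_id f"
      unfolding f'(2) Ent_map_sub_path_class[OF U U subset_refl f'(1) zero_less_one] by (simp add: functor_id_def)
  qed (simp add: Ent_map_def functor_id_def)
  have T: "functor_eq (?E U) (functor_comp (?M W) (?M V)) (?M W)"
    if UVW: "U \<in> \<U>" "V \<in> \<U>" "W \<in> \<U>" "U \<subseteq> V" "V \<subseteq> W" for U V W
    unfolding functor_eq_def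
  proof (intro conjI ballI)
    fix f assume "f \<in> Ar (?E U)"
    then obtain f' where f': "entrance_on (filtered_sub X U) f' 0 1" "f = path_class (filtered_sub X U) f' 0 1"
      using zero_less_one by (rule Ar_EntE[OF sub_conical[OF UVW(1)]])
    show "snd (functor_comp (?M W) (?M V)) f = snd (?M W) f"
      unfolding f'(2) functor_comp_def snd_conv comp_apply
        Ent_map_sub_path_class[OF UVW(1,2,4) f'(1) zero_less_one]
        Ent_map_sub_path_class[OF UVW(2,3,5) entrance_on_sub_mono[OF UVW(4) f'(1)] zero_less_one]
        Ent_map_sub_path_class[OF UVW(1,3) order_trans[OF UVW(4,5)] f'(1) zero_less_one] ..
  qed (simp add: functor_comp_def Ent_map_def)
  have C: "is_category (?E U)" if "U \<in> \<U>" for U by (rule Ent_category[OF sub_conical[OF that]])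
  show ?thesis
    unfolding is_diagram_def Ent_diagram_def using C F I T by (simp, meson order_trans)
qed

lemma Ent_cocone: "is_cocone (Ent_diagram X \<U>) (Ent X) (\<lambda>U. Ent_map X (\<lambda>x. x))"
proof -
  let ?E = "\<lambda>U. Ent (filtered_sub X U)" and ?M = "\<lambda>V. Ent_map (filtered_sub X V) (\<lambda>x. x)"
  have op: "openin (top_of X) U" if "U \<in> \<U>" for U using cover that unfolding complete_cover_def by simp
  have F: "is_functor (?E U) (Ent X) (Ent_map X (\<lambda>x. x))" if "U \<in> \<U>" for U
    by (rule Ent_map_functor[OF conical op[OF that]])
  have T: "functor_eq (?E U) (functor_comp (Ent_map X (\<lambda>x. x)) (?M V)) (Ent_map X (\<lambda>x. x))"
    if UV: "U \<in> \<U>" "V \<in> \<U>" "U \<subseteq> V" for U V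
    unfolding functor_eq_def
  proof (intro conjI ballI)
    fix f assume "f \<in> Ar (?E U)"
    then obtain f' where f': "entrance_on (filtered_sub X U) f' 0 1" "f = path_class (filtered_sub X U) f' 0 1"
      using zero_less_one by (rule Ar_EntE[OF sub_conical[OF UV(1)]])
    show "snd (functor_comp (Ent_map X (\<lambda>x. x)) (?M V)) f = snd (Ent_map X (\<lambda>x. x)) f"
      unfolding f'(2) functor_comp_def snd_conv comp_apply
        Ent_map_sub_path_class[OF UV f'(1) zero_less_one]
        Ent_map_path_class[OF conical op[OF UV(1)] f'(1) zero_less_one]
        Ent_map_path_class[OF conical op[OF UV(2)] entrance_on_sub_mono[OF UV(3) f'(1)] zero_less_one] ..
  qed (simp add: functor_comp_def Ent_map_def)
  show ?thesis
    unfolding is_cocone_def Ent_diagram_def using Ent_category[OF conical] F T by simp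
qed

text \<open>Every arrow of \<open>Ent X\<close> is a composite of arrows coming from members of the cover.\<close>

lemma functor_eq_id_Ent:
  assumes D: "is_functor (Ent X) (Ent X) D"
    and DU: "\<And>U. U \<in> \<U> \<Longrightarrow>
      functor_eq (Ent (filtered_sub X U)) (functor_comp D (Ent_map X (\<lambda>x. x))) (Ent_map X (\<lambda>x. x))"
  shows "functor_eq (Ent X) D functor_id"
proof -
  \<comment> \<open>Lifts to \<open>Ent X\<close> itself, along the cocone of inclusions. Their
    derivations are the subdivisions of a path subordinate to the cover, so induction over them is
    induction over such subdivisions, and \<open>lifts_exists\<close> provides one for each
    path.\<close>
  let ?L = "lifts X \<U> (Ent X) (\<lambda>U. Ent_map X (\<lambda>x. x))"
  have op: "openin (top_of X) U" if "U \<in> \<U>" for U using cover that unfolding complete_cover_def by simp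
  have fix_path: "entrance_on X f a b \<and> a < b \<and> snd D (path_class X f a b) = path_class X f a b"
    if "?L f a b m" for f a b m
    using that
  proof (induction rule: lifts.induct)
    case (lifts_piece U a b)
    have "path_class (filtered_sub X U) f a b \<in> Ar (Ent (filtered_sub X U))"
      by (rule path_class_arrow(1)[OF sub_conical[OF lifts_piece(1)] lifts_piece(3,2)])
    then have "snd D (snd (Ent_map X (\<lambda>x. x)) (path_class (filtered_sub X U) f a b)) =
        snd (Ent_map X (\<lambda>x. x)) (path_class (filtered_sub X U) f a b)"
      using DU[OF lifts_piece(1)] unfolding functor_eq_def functor_comp_def by simp
    then show ?case
      using lifts_piece(2,3) unfolding Ent_map_path_class[OF conical op[OF lifts_piece(1)] lifts_piece(3,2)]
        entrance_on_filtered_sub by simp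
  next
    case (lifts_Comp a b m c n)
    then have *: "entrance_on X f a b" "a < b" "snd D (path_class X f a b) = path_class X f a b"
      "entrance_on X f b c" "b < c" "snd D (path_class X f b c) = path_class X f b c" by simp_all
    have f: "entrance_on X f a c" by (rule entrance_on_join[OF *(1,4)]) (use * in simp_all)
    have "snd D (Comp (Ent X) (path_class X f b c) (path_class X f a b)) =
        Comp (Ent X) (snd D (path_class X f b c)) (snd D (path_class X f a b))"
      using D path_class_arrow[OF conical *(1,2)] path_class_arrow[OF conical *(4,5)] unfolding is_functor_def by simp
    then show ?case using f * path_class_Comp[OF conical f *(2,5)] by simp
  qed
  show ?thesis
    unfolding functor_eq_def
  proof (intro conjI ballI)
    fix x assume "x \<in> Ob (Ent X)"
    then have x: "x \<in> topspace (top_of X)" by (simp add: Ent_def)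
    have "\<Union>\<U> = topspace (top_of X)" using cover unfolding complete_cover_def by simp
    then obtain U where U: "U \<in> \<U>" "x \<in> U" using x by blast
    then have "x \<in> Ob (Ent (filtered_sub X U))" using x by (simp add: Ent_def filtered_sub_def)
    then show "fst D x = fst functor_id x"
      using DU[OF U(1)] unfolding functor_eq_def functor_comp_def functor_id_def Ent_map_def by simp
  next
    fix c assume "c \<in> Ar (Ent X)"
    then obtain f where f: "entrance_on X f 0 1" "c = path_class X f 0 1"
      using zero_less_one by (rule Ar_EntE[OF conical])
    obtain m where "?L f 0 1 m"
      using lifts_exists[OF conical cover Ent_cocone f(1) zero_less_one] ..
    then show "snd D c = snd functor_id c" using fix_path unfolding f(2) functor_id_def by simp
  qed
qed

end

theorem theorem5p2:
  fixes X :: "'a filtered" and \<U> :: "'a set set"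
  assumes "conically_stratified X"
    and "complete_cover (top_of X) (topspace (top_of X)) \<U>"
  shows "is_Cat_isomorphism (colim (Ent_diagram X \<U>)) (Ent X)
           (colim_desc (Ent X) (\<lambda>U. Ent_map X (\<lambda>x. x)))"
proof -
  let ?K = "Ent_diagram X \<U>"
  let ?\<iota> = "\<lambda>U :: 'a set. Ent_map X (\<lambda>x. x)"
  let ?F = "colim_desc (Ent X) ?\<iota>"
  have K: "is_diagram ?K" by (rule Ent_diagram_is_diagram[OF assms])
  have coc: "is_cocone ?K (Ent X) ?\<iota>" by (rule Ent_cocone[OF assms])
  have cin: "is_cocone ?K (colim ?K) (colim_in ?K)" by (rule colim_cocone[OF K])
  let ?G = "induced_functor X \<U> (colim ?K) (colim_in ?K)"
  have idx: "Idx ?K = \<U>" and cat: "DCat ?K U = Ent (filtered_sub X U)" for U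
    by (simp_all add: Ent_diagram_def)
  have F: "is_functor (colim ?K) (Ent X) ?F" by (rule colim_universal(1)[OF K coc])
  have FU: "functor_eq (DCat ?K U) (functor_comp ?F (colim_in ?K U)) (?\<iota> U)" if "U \<in> \<U>" for U
    by (rule colim_universal(2)[OF K coc]) (use that idx in simp)
  have G: "is_functor (Ent X) (colim ?K) ?G" by (rule induced_functor[OF assms cin])
  have GU: "functor_eq (DCat ?K U) (functor_comp ?G (?\<iota> U)) (colim_in ?K U)" if "U \<in> \<U>" for U
    unfolding cat by (rule induced_functor_cocone[OF assms cin that])
  have in_functor: "is_functor (DCat ?K U) (colim ?K) (colim_in ?K U)" if "U \<in> \<U>" for U
    using colim_in_functor[OF K] that idx by simp
  have \<iota>_functor: "is_functor (DCat ?K U) (Ent X) (?\<iota> U)" if "U \<in> \<U>" for U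
    using coc that idx unfolding is_cocone_def by simp
  have GF: "functor_eq (DCat ?K U) (functor_comp (functor_comp ?G ?F) (colim_in ?K U)) (colim_in ?K U)" if U: "U \<in> \<U>" for U
    using FU[OF U] GU[OF U] unfolding functor_eq_def functor_comp_def by simp
  have FG: "functor_eq (DCat ?K U) (functor_comp (functor_comp ?F ?G) (?\<iota> U)) (?\<iota> U)" if U: "U \<in> \<U>" for U
    using FU[OF U] GU[OF U] unfolding functor_eq_def functor_comp_def by simp
  \<comment> \<open>The composite and the identity both restrict to the colimit cocone, so
    uniqueness in the universal property, applied to this cocone itself, identifies them.\<close>
  have "functor_eq (colim ?K) (functor_comp ?G ?F) (colim_desc (colim ?K) (colim_in ?K))"
    by (rule colim_universal(3)[OF K cin is_functor_comp[OF F G]]) (use GF idx in simp)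
  moreover have "functor_eq (colim ?K) functor_id (colim_desc (colim ?K) (colim_in ?K))"
    by (rule colim_universal(3)[OF K cin is_functor_id[OF colim_category[OF K]]])
       (simp add: functor_eq_def functor_comp_def functor_id_def)
  ultimately have "functor_eq (colim ?K) (functor_comp ?G ?F) functor_id"
    using functor_eq_trans functor_eq_sym by blast
  \<comment> \<open>\<open>Ent X\<close> is not yet known to have a universal property, so here
    generation by the cover is used instead.\<close>
  moreover have "functor_eq (Ent X) (functor_comp ?F ?G) functor_id"
    by (rule functor_eq_id_Ent[OF assms is_functor_comp[OF G F]]) (use FG cat in simp)
  ultimately show ?thesis unfolding is_Cat_isomorphism_def using F G by blast
qed

end
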